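(* Let $\tau$ be a partition of $n$, let $c\in\mathbb{R}$ be not of the form $r/m$ with $r,m$ coprime integers and $2\le m\le n$, and let $q=e^{2\pi i c}$ be not a root of unity. Then, for a suitable choice of the nonzero real normalization of the invariant Hermitian form on the $\mathcal{H}_n(q)$-module $S^\tau(q)$, $$a_s(M_c(\tau))=s(S^\tau(q)).$$
   Context: Cherednik side. $\mathbb{H}_c$ ($n\ge2$) is the rational Cherednik algebra for $W=S_n$, $\mathfrak h=\mathbb{C}^n$: it is generated by $\mathbb{C}S_n$ and $x_1,\dots,x_n,y_1,\dots,y_n$, where the $x_i$ commute, the $y_i$ commute, $wx_iw^{-1}=x_{w(i)}$, $wy_iw^{-1}=y_{w(i)}$, $y_ix_j-x_jy_i=c\,s_{ij}$ for $i\ne j$, and $y_ix_i-x_iy_i=1-c\sum_{j\neq i}s_{ij}$ ($s_{ij}$ the transposition). For a partition $\tau$ of $n$, viewed as an irreducible representation of $S_n$ ($(n)$ trivial, $(1^n)$ sign), $M_c(\tau)$ is the $\mathbb{H}_c$-module induced from $\tau$ on which all $y_i$ act by $0$; as a vector space it is $\mathbb{C}[x_1,\dots,x_n]\otimes\tau$, graded by polynomial degree. It has a nondegenerate contravariant Hermitian form $\langle\cdot,\cdot\rangle$ ($S_n$-invariant, with $\langle x_iu,v\rangle=\langle u,y_iv\rangle$), unique up to scaling, normalized to be positive definite on $\tau$ in degree $0$. The signature character is $ch_s(M_c(\tau))=\sum_{m\ge0}t^m s_m$, where $s_m$ is the number of positive minus the number of negative eigenvalues of the form on the degree $m$ part.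 It has the form $p(t;c,\tau)/(1-t)^n$ with $p$ a polynomial in $t$, and the asymptotic character is $$a_s(M_c(\tau)):=\big(ch_s(M_c(\tau))(1-t)^n\big)\big|_{t=1}=p(1;c,\tau).$$ Hecke side. $\mathcal{H}_n(q)$ is the $\mathbb{C}$-algebra with generators $T_1,\dots,T_{n-1}$ and relations $T_iT_j=T_jT_i$ for $|i-j|>1$, $T_iT_{i+1}T_i=T_{i+1}T_iT_{i+1}$, $(T_i+1)(T_i-q)=0$. $S^\tau(q)$ is the irreducible (Specht) module indexed by $\tau$, with $(n)$ corresponding to $T_i\mapsto q$. It carries a nondegenerate Hermitian form for which each $T_i$ is unitary, i.e. $(T_iv,v')=(v,T_i^{-1}v')$, unique up to a nonzero real scalar. The signature $s(S^\tau(q))$ is the number of positive minus the number of negative eigenvalues of a Gram matrix of this form; it depends on the normalization only through an overall sign. *)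

theory Defs
  imports
    Complex_Main
    "HOL-Combinatorics.Permutations"
    "HOL-Library.Poly_Mapping"
    "HOL-Library.Function_Algebras"
    "HOL-Computational_Algebra.Polynomial_FPS"
    "Jordan_Normal_Form.Char_Poly"
begin

section \<open>Hermitian forms and signatures\<close>

text \<open>Complex vector spaces are subspaces \<open>V\<close> of an ambient abelian group with a scalar
  multiplication \<open>scale\<close>. Maps and forms are only constrained on \<open>V\<close>.\<close>

definition linear_on_space ::
    "(complex \<Rightarrow> 'v::ab_group_add \<Rightarrow> 'v) \<Rightarrow> 'v set \<Rightarrow> ('v \<Rightarrow> 'v) \<Rightarrow> bool" where
  "linear_on_space scale V f \<longleftrightarrow>
     (\<forall>u\<in>V. f u \<in> V) \<and>
     (\<forall>u\<in>V. \<forall>v\<in>V. f (u + v) = f u + f v) \<and>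
     (\<forall>k. \<forall>u\<in>V. f (scale k u) = scale k (f u))"

definition hermitian_form ::
    "(complex \<Rightarrow> 'v::ab_group_add \<Rightarrow> 'v) \<Rightarrow> 'v set \<Rightarrow> ('v \<Rightarrow> 'v \<Rightarrow> complex) \<Rightarrow> bool" where
  "hermitian_form scale V \<beta> \<longleftrightarrow>
     (\<forall>u\<in>V. \<forall>v\<in>V. \<forall>w\<in>V. \<beta> (u + v) w = \<beta> u w + \<beta> v w) \<and>
     (\<forall>k. \<forall>u\<in>V. \<forall>v\<in>V. \<beta> (scale k u) v = k * \<beta> u v) \<and>
     (\<forall>u\<in>V. \<forall>v\<in>V. \<beta> u v = cnj (\<beta> v u))"

definition nondegenerate :: "'v::zero set \<Rightarrow> ('v \<Rightarrow> 'v \<Rightarrow> complex) \<Rightarrow> bool" where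
  "nondegenerate V \<beta> \<longleftrightarrow> (\<forall>u\<in>V. (\<forall>v\<in>V. \<beta> u v = 0) \<longrightarrow> u = 0)"

definition positive_definite :: "'v::zero set \<Rightarrow> ('v \<Rightarrow> 'v \<Rightarrow> complex) \<Rightarrow> bool" where
  "positive_definite V \<beta> \<longleftrightarrow> (\<forall>u\<in>V. u \<noteq> 0 \<longrightarrow> Re (\<beta> u u) > 0)"

definition gram_matrix :: "('v \<Rightarrow> 'v \<Rightarrow> complex) \<Rightarrow> 'v list \<Rightarrow> complex mat" where
  "gram_matrix \<beta> bs = mat (length bs) (length bs) (\<lambda>(i, j). \<beta> (bs ! i) (bs ! j))"

text \<open>Eigenvalues are counted with multiplicity; those of a Hermitian matrix are real.\<close>

definition matrix_signature :: "complex mat \<Rightarrow> int" where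
  "matrix_signature A =
     int (size {#e \<in># proots (char_poly A). Re e > 0#}) -
     int (size {#e \<in># proots (char_poly A). Re e < 0#})"

definition is_basis :: "(complex \<Rightarrow> 'v::ab_group_add \<Rightarrow> 'v) \<Rightarrow> 'v set \<Rightarrow> 'v list \<Rightarrow> bool" where
  "is_basis scale V bs \<longleftrightarrow>
     distinct bs \<and> \<not> module.dependent scale (set bs) \<and> module.span scale (set bs) = V"

text \<open>By Sylvester's law of inertia the choice of the basis is immaterial.\<close>

definition form_signature ::
    "(complex \<Rightarrow> 'v::ab_group_add \<Rightarrow> 'v) \<Rightarrow> 'v set \<Rightarrow> ('v \<Rightarrow> 'v \<Rightarrow> complex) \<Rightarrow> int" where
  "form_signature scale V \<beta> = matrix_signature (gram_matrix \<beta> (SOME bs. is_basis scale V bs))"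


section \<open>Permutations and partitions\<close>

abbreviation perms :: "nat \<Rightarrow> (nat \<Rightarrow> nat) set" where
  "perms n \<equiv> {w. w permutes {1..n}}"

abbreviation transp :: "nat \<Rightarrow> nat \<Rightarrow> nat \<Rightarrow> nat" where
  "transp \<equiv> Transposition.transpose"

definition perm_length :: "nat \<Rightarrow> (nat \<Rightarrow> nat) \<Rightarrow> nat" where
  "perm_length n w = card {(a, b). 1 \<le> a \<and> a < b \<and> b \<le> n \<and> w b < w a}"

definition reduced_word :: "nat \<Rightarrow> (nat \<Rightarrow> nat) \<Rightarrow> nat list \<Rightarrow> bool" where
  "reduced_word n w is \<longleftrightarrow>
     set is \<subseteq> {1..<n} \<and> length is = perm_length n w \<and>
     foldr (\<lambda>i p. transp i (Suc i) \<circ> p) is id = w"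

definition is_partition :: "nat \<Rightarrow> nat list \<Rightarrow> bool" where
  "is_partition n \<tau> \<longleftrightarrow> sorted_wrt (\<ge>) \<tau> \<and> 0 \<notin> set \<tau> \<and> sum_list \<tau> = n"

definition conj_partition :: "nat list \<Rightarrow> nat list" where
  "conj_partition \<tau> = map (\<lambda>j. length (filter (\<lambda>p. j < p) \<tau>)) [0..<foldr max \<tau> 0]"

definition young_subgroup :: "nat \<Rightarrow> nat list \<Rightarrow> (nat \<Rightarrow> nat) set" where
  "young_subgroup n \<mu> =
     {w \<in> perms n. \<forall>r<length \<mu>.
        w ` {sum_list (take r \<mu>)<..sum_list (take (Suc r) \<mu>)} =
        {sum_list (take r \<mu>)<..sum_list (take (Suc r) \<mu>)}}"

text \<open>Let \<open>t\<close> be the tableau of shape \<open>\<tau>\<close> filled with \<open>1, \<dots>, n\<close> along the rows, and \<open>t'\<close> the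
  one filled along the columns. The following permutation carries each entry of \<open>t\<close> to the entry
  of \<open>t'\<close> in the same box; \<open>(r, j)\<close> is the box in row \<open>r\<close> and column \<open>j\<close>, counted from \<open>0\<close>.\<close>

definition row_to_column :: "nat \<Rightarrow> nat list \<Rightarrow> nat \<Rightarrow> nat" where
  "row_to_column n \<tau> = (THE w. w permutes {1..n} \<and>
     (\<forall>r<length \<tau>. \<forall>j<\<tau> ! r.
        w (sum_list (take r \<tau>) + Suc j) = sum_list (take j (conj_partition \<tau>)) + Suc r))"


section \<open>The Hecke algebra and its Specht modules\<close>

text \<open>An element \<open>\<Sum>\<^sub>w f w T\<^sub>w\<close> of \<open>\<H>\<^sub>n(q)\<close> is represented by its coefficient function \<open>f\<close> in the
  standard basis, vanishing outside of the symmetric group. Products of permutations are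
  compositions, \<open>u v = u \<circ> v\<close>.\<close>

abbreviation hscale :: "complex \<Rightarrow> ((nat \<Rightarrow> nat) \<Rightarrow> complex) \<Rightarrow> (nat \<Rightarrow> nat) \<Rightarrow> complex" where
  "hscale \<equiv> \<lambda>k f w. k * f w"

lemma vector_space_hscale: "vector_space hscale"
  by unfold_locales (auto simp: fun_eq_iff algebra_simps)

definition hecke_space :: "nat \<Rightarrow> ((nat \<Rightarrow> nat) \<Rightarrow> complex) set" where
  "hecke_space n = {f. \<forall>w. w \<notin> perms n \<longrightarrow> f w = 0}"

text \<open>Left multiplication by \<open>T\<^sub>i\<close>: with \<open>s = s\<^sub>i\<close>, one has \<open>T\<^sub>i T\<^sub>v = T\<^bsub>s v\<^esub>\<close> if \<open>s v\<close> is longer than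
  \<open>v\<close>, and \<open>T\<^sub>i T\<^sub>v = q T\<^bsub>s v\<^esub> + (q - 1) T\<^sub>v\<close> otherwise. The defining relations are
  \<open>hecke_relations\<close> below.\<close>

definition hecke_gen ::
    "nat \<Rightarrow> complex \<Rightarrow> nat \<Rightarrow> ((nat \<Rightarrow> nat) \<Rightarrow> complex) \<Rightarrow> (nat \<Rightarrow> nat) \<Rightarrow> complex" where
  "hecke_gen n q i f = (\<lambda>w. let sw = transp i (Suc i) \<circ> w in
     if perm_length n sw < perm_length n w then f sw + (q - 1) * f w else q * f sw)"

lemma perm_length_transp_le:
  assumes w: "w \<in> perms n" and i: "i \<in> {1..<n}"
    and lt: "inv_into UNIV w i < inv_into UNIV w (Suc i)"
  shows "perm_length n (transp i (Suc i) \<circ> w) = Suc (perm_length n w)"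
proof -
  define p r where "p = inv_into UNIV w i" and "r = inv_into UNIV w (Suc i)"
  let ?I = "\<lambda>v. {(a, b). 1 \<le> a \<and> a < b \<and> b \<le> n \<and> v b < (v a :: nat)}"
  have wp: "w permutes {1..n}" using w by simp
  have wi: "w p = i" "w r = Suc i"
    unfolding p_def r_def using permutes_inverses(1)[OF wp] by auto
  have pr: "p < r" using lt unfolding p_def r_def .
  have inj: "w a = w b \<Longrightarrow> a = b" for a b using permutes_inj[OF wp] by (auto dest: injD)
  have rng: "1 \<le> p" "r \<le> n"
    using permutes_in_image[OF permutes_inv[OF wp], of i]
      permutes_in_image[OF permutes_inv[OF wp], of "Suc i"] i unfolding p_def r_def by auto
  have tr: "transp i (Suc i) y < transp i (Suc i) x \<longleftrightarrow>
      (if x = i \<and> y = Suc i then True else if x = Suc i \<and> y = i then False else y < x)" for x y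
    by (auto simp: Transposition.transpose_def)
  have "(a, b) \<in> ?I (transp i (Suc i) \<circ> w) \<longleftrightarrow> (a, b) \<in> insert (p, r) (?I w)" for a b
  proof -
    have eqs: "w a = i \<longleftrightarrow> a = p" "w a = Suc i \<longleftrightarrow> a = r" "w b = i \<longleftrightarrow> b = p" "w b = Suc i \<longleftrightarrow> b = r"
      using wi inj by metis+
    show ?thesis
      unfolding mem_Collect_eq case_prod_conv insert_iff prod.inject o_apply tr eqs
      using rng pr wi by auto
  qed
  then have "?I (transp i (Suc i) \<circ> w) = insert (p, r) (?I w)" by (auto simp only: set_eq_iff split_paired_All)
  moreover have "(p, r) \<notin> ?I w" using wi by auto
  moreover have "finite (?I w)"
    by (rule finite_subset[of _ "{1..n} \<times> {1..n}"]) auto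
  ultimately show ?thesis unfolding perm_length_def by simp
qed

lemma inv_transp_comp:
  assumes w: "w \<in> perms n"
  shows "inv_into UNIV (transp i j \<circ> w) k = inv_into UNIV w (transp i j k)"
proof -
  have "bij w" using w permutes_bij by auto
  then have "inv_into UNIV (transp i j \<circ> w) = inv_into UNIV w \<circ> inv_into UNIV (transp i j)"
    by (simp add: o_inv_distrib)
  then show ?thesis by simp
qed

lemma transp_comp_perms:
  assumes "w \<in> perms n" "i \<in> {1..<n}"
  shows "transp i (Suc i) \<circ> w \<in> perms n"
  using assms by (auto intro!: permutes_compose permutes_swap_id)

lemma perm_length_transp_iff:
  assumes w: "w \<in> perms n" and i: "i \<in> {1..<n}"
  shows "perm_length n (transp i (Suc i) \<circ> w) < perm_length n w \<longleftrightarrow>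
    inv_into UNIV w (Suc i) < inv_into UNIV w i"
proof (cases "inv_into UNIV w i < inv_into UNIV w (Suc i)")
  case True
  then show ?thesis using perm_length_transp_le[OF w i] by simp
next
  case False
  have wp: "w permutes {1..n}" using w by simp
  have "inv_into UNIV w i \<noteq> inv_into UNIV w (Suc i)"
    using permutes_inverses(1)[OF wp] by (metis n_not_Suc_n)
  with False have lt: "inv_into UNIV w (Suc i) < inv_into UNIV w i" by simp
  let ?v = "transp i (Suc i) \<circ> w"
  have "inv_into UNIV ?v i < inv_into UNIV ?v (Suc i)"
    using lt by (simp add: inv_transp_comp[OF w])
  from perm_length_transp_le[OF transp_comp_perms[OF w i] i this]
  have "perm_length n w = Suc (perm_length n ?v)"
    by (simp add: o_assoc)
  with lt show ?thesis by simp
qed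

lemma hecke_gen_apply:
  assumes "w \<in> perms n" "i \<in> {1..<n}"
  shows "hecke_gen n q i f w =
    (if inv_into UNIV w (Suc i) < inv_into UNIV w i
     then f (transp i (Suc i) \<circ> w) + (q - 1) * f w else q * f (transp i (Suc i) \<circ> w))"
  by (simp only: hecke_gen_def Let_def perm_length_transp_iff[OF assms])

lemma hecke_gen_space:
  assumes "f \<in> hecke_space n" "i \<in> {1..<n}"
  shows "hecke_gen n q i f \<in> hecke_space n"
proof -
  have "transp i (Suc i) \<circ> w \<notin> perms n" if "w \<notin> perms n" for w
    using transp_comp_perms[of "transp i (Suc i) \<circ> w" n i] assms(2) that
    by (auto simp: o_assoc)
  then show ?thesis
    using assms(1) unfolding hecke_space_def hecke_gen_def by (auto simp: Let_def)
qed

lemma hecke_ext: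
  assumes "f \<in> hecke_space n" "g \<in> hecke_space n" "\<And>w. w \<in> perms n \<Longrightarrow> f w = g w"
  shows "f = g"
  using assms unfolding hecke_space_def by fastforce

lemma hecke_relations:
  assumes f: "f \<in> hecke_space n"
  shows
    "\<lbrakk>i \<in> {1..<n}; j \<in> {1..<n}; Suc i < j\<rbrakk> \<Longrightarrow>
       hecke_gen n q i (hecke_gen n q j f) = hecke_gen n q j (hecke_gen n q i f)"
    "\<lbrakk>i \<in> {1..<n}; Suc i \<in> {1..<n}\<rbrakk> \<Longrightarrow>
       hecke_gen n q i (hecke_gen n q (Suc i) (hecke_gen n q i f)) =
       hecke_gen n q (Suc i) (hecke_gen n q i (hecke_gen n q (Suc i) f))"
    "i \<in> {1..<n} \<Longrightarrow>
       hecke_gen n q i (hecke_gen n q i f) = hscale (q - 1) (hecke_gen n q i f) + hscale q f"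
proof -
  { assume i: "i \<in> {1..<n}" and j: "j \<in> {1..<n}" and ij: "Suc i < j"
    show "hecke_gen n q i (hecke_gen n q j f) = hecke_gen n q j (hecke_gen n q i f)"
    proof (rule hecke_ext)
      fix w assume w: "w \<in> perms n"
      have "transp i (Suc i) \<circ> (transp j (Suc j) \<circ> w) = transp j (Suc j) \<circ> (transp i (Suc i) \<circ> w)"
        using ij by (auto simp: fun_eq_iff Transposition.transpose_def)
      moreover have "transp i (Suc i) j = j" "transp i (Suc i) (Suc j) = Suc j"
        "transp j (Suc j) i = i" "transp j (Suc j) (Suc i) = Suc i"
        using ij by (auto simp: Transposition.transpose_def)
      ultimately show "hecke_gen n q i (hecke_gen n q j f) w = hecke_gen n q j (hecke_gen n q i f) w"
        using transp_comp_perms[OF w i] transp_comp_perms[OF w j]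
        by (simp only: hecke_gen_apply[OF _ i] hecke_gen_apply[OF _ j] w inv_transp_comp[OF w])
          (auto simp: algebra_simps)
    qed (intro hecke_gen_space f i j)+
  }
  { assume i: "i \<in> {1..<n}" and j: "Suc i \<in> {1..<n}"
    let ?j = "Suc i"
    show "hecke_gen n q i (hecke_gen n q ?j (hecke_gen n q i f)) =
       hecke_gen n q ?j (hecke_gen n q i (hecke_gen n q ?j f))"
    proof (rule hecke_ext)
      fix w assume w: "w \<in> perms n"
      let ?s = "transp i (Suc i)" and ?t = "transp ?j (Suc ?j)"
      have br: "?s \<circ> (?t \<circ> (?s \<circ> w)) = ?t \<circ> (?s \<circ> (?t \<circ> w))"
        by (auto simp: fun_eq_iff Transposition.transpose_def)
      have ss: "?s \<circ> (?s \<circ> v) = v" "?t \<circ> (?t \<circ> v) = v" for v by (auto simp: fun_eq_iff)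
      have v: "?s i = Suc i" "?s (Suc i) = i" "?s (Suc (Suc i)) = Suc (Suc i)"
        "?t i = i" "?t (Suc i) = Suc (Suc i)" "?t (Suc (Suc i)) = Suc i"
        by (auto simp: Transposition.transpose_def)
      have ws: "?s \<circ> w \<in> perms n" and wt: "?t \<circ> w \<in> perms n"
        using transp_comp_perms[OF w] i j by blast+
      have wst: "?s \<circ> (?t \<circ> w) \<in> perms n" and wts: "?t \<circ> (?s \<circ> w) \<in> perms n"
        using transp_comp_perms[OF ws j] transp_comp_perms[OF wt i] by blast+
      have wp: "w permutes {1..n}" using w by simp
      have inj: "inv_into UNIV w a = inv_into UNIV w b \<longleftrightarrow> a = b" for a b
        using permutes_inverses(1)[OF wp] by metis
      have ne: "inv_into UNIV w i \<noteq> inv_into UNIV w (Suc i)"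
        "inv_into UNIV w i \<noteq> inv_into UNIV w (Suc (Suc i))"
        "inv_into UNIV w (Suc i) \<noteq> inv_into UNIV w (Suc (Suc i))"
        by (simp_all add: inj)
      show "hecke_gen n q i (hecke_gen n q ?j (hecke_gen n q i f)) w =
         hecke_gen n q ?j (hecke_gen n q i (hecke_gen n q ?j f)) w"
        using ne
        apply (simp only: hecke_gen_apply[OF _ i] hecke_gen_apply[OF _ j] w ws wt wst wts
            inv_transp_comp[OF w] inv_transp_comp[OF ws] inv_transp_comp[OF wt]
            inv_transp_comp[OF wst] inv_transp_comp[OF wts] v ss br)
        apply (auto simp: algebra_simps)
        done
    qed (intro hecke_gen_space f i j)+
  }
  { assume i: "i \<in> {1..<n}"
    show "hecke_gen n q i (hecke_gen n q i f) = hscale (q - 1) (hecke_gen n q i f) + hscale q f"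
    proof (rule hecke_ext)
      show "hscale (q - 1) (hecke_gen n q i f) + hscale q f \<in> hecke_space n"
        using hecke_gen_space[OF f i, of q] f by (auto simp: hecke_space_def)
      fix w assume w: "w \<in> perms n"
      have wp: "w permutes {1..n}" using w by simp
      have "inv_into UNIV w i \<noteq> inv_into UNIV w (Suc i)"
        using permutes_inverses(1)[OF wp] by (metis n_not_Suc_n)
      then show "hecke_gen n q i (hecke_gen n q i f) w =
          (hscale (q - 1) (hecke_gen n q i f) + hscale q f) w"
        using transp_comp_perms[OF w i]
        apply (simp only: plus_fun_apply hecke_gen_apply[OF _ i] w inv_transp_comp[OF w])
        apply (auto simp: o_assoc algebra_simps)
        done
    qed (intro hecke_gen_space f i)+
  }
qed

text \<open>Left multiplication by \<open>T\<^sub>w\<close>; by Matsumoto's theorem the reduced word is immaterial.\<close>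

definition hecke_T ::
    "nat \<Rightarrow> complex \<Rightarrow> (nat \<Rightarrow> nat) \<Rightarrow> ((nat \<Rightarrow> nat) \<Rightarrow> complex) \<Rightarrow> (nat \<Rightarrow> nat) \<Rightarrow> complex" where
  "hecke_T n q w = foldr (hecke_gen n q) (SOME is. reduced_word n w is)"

text \<open>The Specht module of Dipper and James, as a left ideal. In the usual notation it is
  generated by \<open>y\<^bsub>\<tau>'\<^esub> T\<^sub>w x\<^sub>\<tau>\<close>, where \<open>w = row_to_column n \<tau>\<close>, \<open>x\<^sub>\<mu>\<close> is the sum of the \<open>T\<^sub>u\<close> and
  \<open>y\<^sub>\<mu>\<close> the sum of the \<open>(-q)\<^bsup>-\<ell>(u)\<^esup> T\<^sub>u\<close> over the Young subgroup of \<open>\<mu>\<close>. Thus \<open>(n)\<close> is the character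
  \<open>T\<^sub>i \<mapsto> q\<close> and \<open>(1, \<dots>, 1)\<close> is \<open>T\<^sub>i \<mapsto> -1\<close>. For \<open>q = 1\<close> the algebra is the group algebra of the
  symmetric group, and this is its classical Specht module.\<close>

definition specht_generator :: "nat \<Rightarrow> complex \<Rightarrow> nat list \<Rightarrow> (nat \<Rightarrow> nat) \<Rightarrow> complex" where
  "specht_generator n q \<tau> =
     (let x = (\<lambda>u. if u \<in> young_subgroup n \<tau> then 1 else 0) in
      \<Sum>u\<in>young_subgroup n (conj_partition \<tau>).
        hscale ((- inverse q) ^ perm_length n u)
          (hecke_T n q u (hecke_T n q (row_to_column n \<tau>) x)))"

definition specht :: "nat \<Rightarrow> complex \<Rightarrow> nat list \<Rightarrow> ((nat \<Rightarrow> nat) \<Rightarrow> complex) set" where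
  "specht n q \<tau> =
     (\<lambda>V. module.subspace hscale V \<and> (\<forall>i\<in>{1..<n}. \<forall>v\<in>V. hecke_gen n q i v \<in> V))
       hull {specht_generator n q \<tau>}"

definition hecke_form ::
    "nat \<Rightarrow> complex \<Rightarrow> nat list \<Rightarrow>
     (((nat \<Rightarrow> nat) \<Rightarrow> complex) \<Rightarrow> ((nat \<Rightarrow> nat) \<Rightarrow> complex) \<Rightarrow> complex) \<Rightarrow> bool" where
  "hecke_form n q \<tau> \<gamma> \<longleftrightarrow>
     hermitian_form hscale (specht n q \<tau>) \<gamma> \<and>
     nondegenerate (specht n q \<tau>) \<gamma> \<and>
     (\<forall>i\<in>{1..<n}. \<forall>v\<in>specht n q \<tau>. \<forall>v'\<in>specht n q \<tau>.
        \<gamma> (hecke_gen n q i v) v' = \<gamma> v (inv_into (specht n q \<tau>) (hecke_gen n q i) v'))"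


section \<open>The rational Cherednik algebra and its standard modules\<close>

text \<open>A module over the rational Cherednik algebra of the symmetric group, given as a vector space
  with actions \<open>W\<close>, \<open>X\<close>, \<open>Y\<close> of the generators satisfying the defining relations.\<close>

definition cherednik_module ::
    "nat \<Rightarrow> real \<Rightarrow> (complex \<Rightarrow> 'v::ab_group_add \<Rightarrow> 'v) \<Rightarrow> 'v set \<Rightarrow>
     ((nat \<Rightarrow> nat) \<Rightarrow> 'v \<Rightarrow> 'v) \<Rightarrow> (nat \<Rightarrow> 'v \<Rightarrow> 'v) \<Rightarrow> (nat \<Rightarrow> 'v \<Rightarrow> 'v) \<Rightarrow> bool" where
  "cherednik_module n c scale V W X Y \<longleftrightarrow>
     module.subspace scale V \<and>
     (\<forall>w\<in>perms n. linear_on_space scale V (W w)) \<and>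
     (\<forall>i\<in>{1..n}. linear_on_space scale V (X i) \<and> linear_on_space scale V (Y i)) \<and>
     (\<forall>v\<in>V.
        W id v = v \<and>
        (\<forall>u\<in>perms n. \<forall>w\<in>perms n. W (u \<circ> w) v = W u (W w v)) \<and>
        (\<forall>i\<in>{1..n}. \<forall>j\<in>{1..n}. X i (X j v) = X j (X i v)) \<and>
        (\<forall>i\<in>{1..n}. \<forall>j\<in>{1..n}. Y i (Y j v) = Y j (Y i v)) \<and>
        (\<forall>w\<in>perms n. \<forall>i\<in>{1..n}. W w (X i v) = X (w i) (W w v)) \<and>
        (\<forall>w\<in>perms n. \<forall>i\<in>{1..n}. W w (Y i v) = Y (w i) (W w v)) \<and>
        (\<forall>i\<in>{1..n}. \<forall>j\<in>{1..n}. i \<noteq> j \<longrightarrow>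
           Y i (X j v) - X j (Y i v) = scale (of_real c) (W (transp i j) v)) \<and>
        (\<forall>i\<in>{1..n}.
           Y i (X i v) - X i (Y i v) =
           v - scale (of_real c) (\<Sum>j\<in>{1..n} - {i}. W (transp i j) v)))"

text \<open>Polynomials in the variables \<open>x\<^sub>0, x\<^sub>1, \<dots>\<close> (finitely many of them in each polynomial).
  With \<open>\<tau>\<close> realised inside the group algebra, an element of \<open>\<complex>[x\<^sub>1, \<dots>, x\<^sub>n] \<otimes> \<tau>\<close> is a family
  \<open>F\<close> of polynomials indexed by permutations, representing \<open>\<Sum>\<^sub>w F w \<otimes> w\<close>.\<close>

type_synonym cpoly = "(nat \<Rightarrow>\<^sub>0 nat) \<Rightarrow>\<^sub>0 complex"

abbreviation mscale :: "complex \<Rightarrow> ((nat \<Rightarrow> nat) \<Rightarrow> cpoly) \<Rightarrow> (nat \<Rightarrow> nat) \<Rightarrow> cpoly" where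
  "mscale \<equiv> \<lambda>k F w. Poly_Mapping.single 0 k * F w"

lemma vector_space_mscale: "vector_space mscale"
proof unfold_locales
  fix a b :: complex and F :: "(nat \<Rightarrow> nat) \<Rightarrow> cpoly"
  show "mscale a (mscale b F) = mscale (a * b) F"
    by (simp add: fun_eq_iff mult.assoc[symmetric] mult_single)
qed (auto simp: fun_eq_iff algebra_simps single_add)

definition standard_space :: "nat \<Rightarrow> nat list \<Rightarrow> ((nat \<Rightarrow> nat) \<Rightarrow> cpoly) set" where
  "standard_space n \<tau> =
     {F. (\<forall>w. \<forall>m\<in>Poly_Mapping.keys (F w). Poly_Mapping.keys m \<subseteq> {1..n}) \<and>
         (\<forall>m. (\<lambda>w. Poly_Mapping.lookup (F w) m) \<in> specht n 1 \<tau>)}"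

definition standard_degree :: "nat \<Rightarrow> nat list \<Rightarrow> nat \<Rightarrow> ((nat \<Rightarrow> nat) \<Rightarrow> cpoly) set" where
  "standard_degree n \<tau> d =
     {F \<in> standard_space n \<tau>.
        \<forall>w. \<forall>m\<in>Poly_Mapping.keys (F w). (\<Sum>i\<in>{1..n}. Poly_Mapping.lookup m i) = d}"

definition standard_x :: "nat \<Rightarrow> ((nat \<Rightarrow> nat) \<Rightarrow> cpoly) \<Rightarrow> (nat \<Rightarrow> nat) \<Rightarrow> cpoly" where
  "standard_x i F = (\<lambda>w. Poly_Mapping.single (Poly_Mapping.single i 1) 1 * F w)"

text \<open>The automorphism \<open>x\<^sub>i \<mapsto> x\<^bsub>u i\<^esub>\<close>: the coefficient of \<open>\<Prod>\<^sub>k x\<^sub>k\<^bsup>b k\<^esup>\<close> in the image of \<open>f\<close> is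
  that of \<open>\<Prod>\<^sub>i x\<^sub>i\<^bsup>b (u i)\<^esup>\<close> in \<open>f\<close>.\<close>

definition permute_vars :: "(nat \<Rightarrow> nat) \<Rightarrow> cpoly \<Rightarrow> cpoly" where
  "permute_vars u f = Poly_Mapping.map_key (Poly_Mapping.map_key u) f"

definition standard_w ::
    "(nat \<Rightarrow> nat) \<Rightarrow> ((nat \<Rightarrow> nat) \<Rightarrow> cpoly) \<Rightarrow> (nat \<Rightarrow> nat) \<Rightarrow> cpoly" where
  "standard_w u F = (\<lambda>w. permute_vars u (F (inv_into UNIV u \<circ> w)))"

text \<open>\<open>M\<^sub>c(\<tau>)\<close> is the only module structure on \<open>\<complex>[x\<^sub>1, \<dots>, x\<^sub>n] \<otimes> \<tau>\<close> with \<open>standard_w\<close> and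
  \<open>standard_x\<close> as actions of the permutations and of the \<open>x\<^sub>i\<close>, and with all \<open>y\<^sub>i\<close> vanishing on \<open>\<tau>\<close>:
  the relations allow to move the \<open>y\<^sub>i\<close> past the \<open>x\<^sub>j\<close>, so they determine the \<open>y\<^sub>i\<close> (which are the
  Dunkl operators). The canonical map to it from the module induced from \<open>\<tau>\<close> is bijective.\<close>

definition is_standard_y ::
    "nat \<Rightarrow> real \<Rightarrow> nat list \<Rightarrow>
     (nat \<Rightarrow> ((nat \<Rightarrow> nat) \<Rightarrow> cpoly) \<Rightarrow> (nat \<Rightarrow> nat) \<Rightarrow> cpoly) \<Rightarrow> bool" where
  "is_standard_y n c \<tau> Y \<longleftrightarrow>
     cherednik_module n c mscale (standard_space n \<tau>) standard_w standard_x Y \<and>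
     (\<forall>i\<in>{1..n}. \<forall>v\<in>standard_degree n \<tau> 0. Y i v = 0)"

definition standard_y ::
    "nat \<Rightarrow> real \<Rightarrow> nat list \<Rightarrow> nat \<Rightarrow> ((nat \<Rightarrow> nat) \<Rightarrow> cpoly) \<Rightarrow> (nat \<Rightarrow> nat) \<Rightarrow> cpoly" where
  "standard_y n c \<tau> = (SOME Y. is_standard_y n c \<tau> Y)"

definition contravariant_form ::
    "nat \<Rightarrow> real \<Rightarrow> nat list \<Rightarrow>
     (((nat \<Rightarrow> nat) \<Rightarrow> cpoly) \<Rightarrow> ((nat \<Rightarrow> nat) \<Rightarrow> cpoly) \<Rightarrow> complex) \<Rightarrow> bool" where
  "contravariant_form n c \<tau> \<beta> \<longleftrightarrow>
     hermitian_form mscale (standard_space n \<tau>) \<beta> \<and>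
     nondegenerate (standard_space n \<tau>) \<beta> \<and>
     (\<forall>w\<in>perms n. \<forall>u\<in>standard_space n \<tau>. \<forall>v\<in>standard_space n \<tau>.
        \<beta> (standard_w w u) (standard_w w v) = \<beta> u v) \<and>
     (\<forall>i\<in>{1..n}. \<forall>u\<in>standard_space n \<tau>. \<forall>v\<in>standard_space n \<tau>.
        \<beta> (standard_x i u) v = \<beta> u (standard_y n c \<tau> i v)) \<and>
     positive_definite (standard_degree n \<tau> 0) \<beta>"

text \<open>The form is unique up to a positive factor, which does not affect signatures.\<close>

definition standard_form ::
    "nat \<Rightarrow> real \<Rightarrow> nat list \<Rightarrow> ((nat \<Rightarrow> nat) \<Rightarrow> cpoly) \<Rightarrow> ((nat \<Rightarrow> nat) \<Rightarrow> cpoly) \<Rightarrow> complex" where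
  "standard_form n c \<tau> = (SOME \<beta>. contravariant_form n c \<tau> \<beta>)"

definition signature_character :: "nat \<Rightarrow> real \<Rightarrow> nat list \<Rightarrow> int fps" where
  "signature_character n c \<tau> =
     Abs_fps (\<lambda>m. form_signature mscale (standard_degree n \<tau> m) (standard_form n c \<tau>))"

definition asymptotic_character :: "nat \<Rightarrow> real \<Rightarrow> nat list \<Rightarrow> int" where
  "asymptotic_character n c \<tau> =
     poly (THE p. fps_of_poly p = signature_character n c \<tau> * (1 - fps_X) ^ n) 1"

end

theory Submission
  imports
    Defs
    "Jordan_Normal_Form.Schur_Decomposition"
begin

text \<open>Since \<open>c\<close> is irrational, \<open>M\<^sub>c(\<tau>)\<close> has an orthogonal basis of joint eigenvectors of Cherednik's
  operators \<open>z\<^sub>i = x\<^sub>i y\<^sub>i + 1 - c \<Sum>\<^bsub>j<i\<^esub> s\<^sub>i\<^sub>j\<close>, indexed by an exponent vector in \<open>\<nat>\<^sup>n\<close> and a standard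
  tableau, the latter recorded by its content sequence. It is produced from Young's basis of
  \<open>\<tau>\<close> by intertwining operators whose norm factors are explicit, and the sign of the norm of a basis
  vector depends only on the exponents truncated at a large bound. Hence the signature series is
  \<open>p(t)/(1 - t)\<^sup>n\<close>, and \<open>p(1)\<close> is the sum over the tableaux of the signs for large exponents. In
  Young's seminormal basis of \<open>S\<^sup>\<tau>(q)\<close> the invariant form is diagonal, and the ratios of its
  entries are quotients of the numbers \<open>sin(\<pi>cd)\<close>. The two families of signs agree because
  \<open>\<Prod>\<^bsub>m \<le> K\<^esub> (m - x)(m + x)\<close> has the sign of \<open>sin(\<pi>x)/x\<close> for large \<open>K\<close>.

  That the Specht module, a left ideal, is isomorphic to the seminormal module follows from the
  faithfulness of the sum of all seminormal modules: the product of the symmetrizer and the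
  antisymmetrizer that generates the ideal annihilates all of them but the one of shape \<open>\<tau>\<close>,
  where it has rank one.\<close>


section \<open>Words of boxes and their contents\<close>

text \<open>Because q is not a root of unity, c is irrational. This one fact separates the weights,
  keeps every norm factor away from 0 and makes all quantum integers [d] with d nonzero invertible.
  Dimensions enter only through one comparison: an orthogonal family with nonzero norms against a
  spanning set of the same size.

  The locale \<open>quantum\<close> admits q = 1 besides generic q, since Young's basis is needed
  twice, for \<tau> inside the standard module and for the Hecke module.

  Passing an entry of level m + 1 by one of level 0, with content difference d, multiplies the norm
  by a number with the sign of (m+1-c(d+1))(m+1-c(d-1)). The products over m are truncated Gamma
  factors; taken alone they have no counterpart for the Hecke algebra. Only the quotient of the
  factors for d and -d does, as the reflection formula turns it into a quotient of sines. Hence the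
  Hecke form is built from the Cherednik signs, completed by suitable absolute values, and its
  invariance becomes a condition on adjacent swaps alone.\<close>

definition part_fun :: "(nat \<Rightarrow> nat) \<Rightarrow> bool" where
  "part_fun \<nu> \<longleftrightarrow> (\<forall>r. \<nu> (Suc r) \<le> \<nu> r)"

definition addable :: "(nat \<Rightarrow> nat) \<Rightarrow> nat \<Rightarrow> bool" where
  "addable \<nu> r \<longleftrightarrow> r = 0 \<or> \<nu> r < \<nu> (r - 1)"

definition add_box :: "(nat \<Rightarrow> nat) \<Rightarrow> nat \<Rightarrow> nat \<Rightarrow> nat" where
  "add_box \<nu> r = \<nu>(r := Suc (\<nu> r))"

text \<open>Letter k of a word is the row of the box added at step k, so the words that start at the
  empty shape are the standard tableaux. The running shape \<open>\<nu>\<close> is an argument so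
  that claims about neighbouring letters reduce by induction to the first letters.\<close>

primrec yam_from :: "(nat \<Rightarrow> nat) \<Rightarrow> nat list \<Rightarrow> bool" where
  "yam_from \<nu> [] = True"
| "yam_from \<nu> (x # w) = (addable \<nu> x \<and> yam_from (add_box \<nu> x) w)"

primrec contents_from :: "(nat \<Rightarrow> nat) \<Rightarrow> nat list \<Rightarrow> int list" where
  "contents_from \<nu> [] = []"
| "contents_from \<nu> (x # w) = (int (\<nu> x) - int x) # contents_from (add_box \<nu> x) w"

abbreviation "yam \<equiv> yam_from (\<lambda>_. 0)"
abbreviation "contents \<equiv> contents_from (\<lambda>_. 0)"

definition swap_at :: "nat \<Rightarrow> 'a list \<Rightarrow> 'a list" where
  "swap_at k xs = xs[k := xs ! Suc k, Suc k := xs ! k]"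

lemma length_swap_at [simp]: "length (swap_at k xs) = length xs"
  by (simp add: swap_at_def)

lemma swap_at_0: "swap_at 0 (x # y # v) = y # x # v"
  by (simp add: swap_at_def)

lemma swap_at_Suc: "swap_at (Suc k) (x # v) = x # swap_at k v"
  by (simp add: swap_at_def)

lemma nth_swap_at:
  "\<lbrakk>Suc k < length xs; i < length xs\<rbrakk> \<Longrightarrow>
   swap_at k xs ! i = (if i = k then xs ! Suc k else if i = Suc k then xs ! k else xs ! i)"
  by (auto simp: swap_at_def nth_list_update)

lemma swap_at_swap_at: "Suc k < length xs \<Longrightarrow> swap_at k (swap_at k xs) = xs"
  by (rule nth_equalityI) (auto simp: nth_swap_at)

lemma mset_swap_at: "Suc k < length xs \<Longrightarrow> mset (swap_at k xs) = mset xs"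
  unfolding swap_at_def using mset_swap[of "Suc k" xs k] by simp

lemma count_list_eq_count_mset: "count_list xs x = count (mset xs) x"
  by (induction xs) auto

lemma count_list_swap_at: "Suc k < length xs \<Longrightarrow> count_list (swap_at k xs) = count_list xs"
  by (rule ext) (simp add: count_list_eq_count_mset mset_swap_at)

lemma length_contents_from [simp]: "length (contents_from \<nu> w) = length w"
  by (induction w arbitrary: \<nu>) auto

lemma part_fun_add_box: "part_fun \<nu> \<Longrightarrow> addable \<nu> r \<Longrightarrow> part_fun (add_box \<nu> r)"
  unfolding part_fun_def addable_def add_box_def by (auto simp: Suc_le_eq le_SucI)

lemma part_fun_0 [simp]: "part_fun (\<lambda>_. 0)"
  by (simp add: part_fun_def)

lemma part_fun_antimono: "part_fun \<nu> \<Longrightarrow> r \<le> s \<Longrightarrow> \<nu> s \<le> \<nu> r"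
  unfolding part_fun_def by (metis lift_Suc_antimono_le)

lemma yam_from_append:
  "yam_from \<nu> (u @ v) \<longleftrightarrow> yam_from \<nu> u \<and> yam_from (\<lambda>r. \<nu> r + count_list u r) v"
proof (induction u arbitrary: \<nu>)
  case (Cons x u)
  have "(\<lambda>r. add_box \<nu> x r + count_list u r) = (\<lambda>r. \<nu> r + count_list (x # u) r)"
    by (auto simp: add_box_def)
  then show ?case using Cons by simp
qed simp

lemma yam_snoc: "yam (w @ [r]) \<longleftrightarrow> yam w \<and> addable (count_list w) r"
  by (simp add: yam_from_append)

lemma yam_from_part_fun:
  "part_fun \<nu> \<Longrightarrow> yam_from \<nu> w \<Longrightarrow> part_fun (\<lambda>r. \<nu> r + count_list w r)"
proof (induction w arbitrary: \<nu>)
  case (Cons x u)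
  have "(\<lambda>r. add_box \<nu> x r + count_list u r) = (\<lambda>r. \<nu> r + count_list (x # u) r)"
    by (auto simp: add_box_def)
  then show ?case using Cons part_fun_add_box[of \<nu> x] by (metis yam_from.simps(2))
qed simp

lemma yam_part_fun: "yam w \<Longrightarrow> part_fun (count_list w)"
  using yam_from_part_fun[of "\<lambda>_. 0" w] by simp

lemma content_strict:
  assumes "part_fun \<nu>" "r < s"
  shows "int (\<nu> s) - int s < int (\<nu> r) - int r"
  using part_fun_antimono[OF assms(1), of r s] assms(2) by simp

lemma add_box_commute: "add_box (add_box \<nu> x) y = add_box (add_box \<nu> y) x"
  by (auto simp: add_box_def fun_eq_iff)

text \<open>Either the second box relies on the first, and is then its right or lower neighbour, or
  both boxes are corners of one shape. Corners in different rows can be added in either order, and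
  the strict drop between their rows makes the contents differ by at least 2.\<close>

lemma two_boxes:
  assumes p: "part_fun \<nu>" and x: "addable \<nu> x" and y: "addable (add_box \<nu> x) y"
  defines "d \<equiv> (int (add_box \<nu> x y) - int y) - (int (\<nu> x) - int x)"
  shows "x = y \<and> d = 1 \<or> x < y \<and> d = -1 \<or>
    x \<noteq> y \<and> \<bar>d\<bar> \<ge> 2 \<and> addable \<nu> y \<and> addable (add_box \<nu> y) x \<and> add_box \<nu> x y = \<nu> y \<and> add_box \<nu> y x = \<nu> x"
proof (cases "x = y")
  case True
  then show ?thesis by (simp add: d_def add_box_def)
next
  case ne: False
  have d: "d = (int (\<nu> y) - int y) - (int (\<nu> x) - int x)"
    using ne by (simp add: d_def add_box_def)
  show ?thesis
  proof (cases "addable \<nu> y")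
    case True
    have ax: "addable (add_box \<nu> y) x"
      using x ne by (auto simp: addable_def add_box_def)
    have "\<bar>d\<bar> \<ge> 2"
    proof (cases "x < y")
      case True
      have "\<nu> y < \<nu> (y - 1)" "\<nu> (y - 1) \<le> \<nu> x"
        using \<open>addable \<nu> y\<close> True part_fun_antimono[OF p, of x "y - 1"] by (auto simp: addable_def)
      then show ?thesis using True d by simp
    next
      case False
      then have "y < x" using ne by simp
      then have "\<nu> x < \<nu> (x - 1)" "\<nu> (x - 1) \<le> \<nu> y"
        using x part_fun_antimono[OF p, of y "x - 1"] by (auto simp: addable_def)
      then show ?thesis using \<open>y < x\<close> d by simp
    qed
    then show ?thesis using ax True ne by (auto simp: add_box_def)
  next
    case False
    with y ne have "y \<noteq> 0" "y - 1 = x" "\<nu> y = \<nu> x"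
      using p part_fun_antimono[OF p, of "y - 1" y]
      by (auto simp: addable_def add_box_def split: if_splits)
    then show ?thesis using d by auto
  qed
qed

text \<open>The next box on a diagonal requires both the right and the lower neighbour of the
  previous one, so at least two other boxes are added in between.\<close>

lemma three_boxes:
  assumes p: "part_fun \<nu>" and x: "addable \<nu> x" and y: "addable (add_box \<nu> x) y"
    and z: "addable (add_box (add_box \<nu> x) y) z"
  shows "int (add_box (add_box \<nu> x) y z) - int z \<noteq> int (\<nu> x) - int x"
proof -
  consider "z = x" | "z < x" | "z = Suc x" | "z > Suc x" by linarith
  then show ?thesis
  proof cases
    case 2
    then show ?thesis using content_strict[OF p 2] by (auto simp: add_box_def)
  next
    case 4
    then show ?thesis using part_fun_antimono[OF p, of x z] by (auto simp: add_box_def)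
  next
    case 3
    then show ?thesis using z part_fun_antimono[OF p, of x z]
      by (cases "y = x"; cases "y = z") (auto simp: add_box_def addable_def)
  qed (auto simp: add_box_def)
qed

definition axial :: "int list \<Rightarrow> nat \<Rightarrow> int" where
  "axial c k = c ! Suc k - c ! k"

lemma yam_from_swap:
  assumes "part_fun \<nu>" "yam_from \<nu> w" "Suc k < length w"
  shows "w ! k = w ! Suc k \<and> axial (contents_from \<nu> w) k = 1 \<or>
    w ! k < w ! Suc k \<and> axial (contents_from \<nu> w) k = -1 \<or>
    w ! k \<noteq> w ! Suc k \<and> \<bar>axial (contents_from \<nu> w) k\<bar> \<ge> 2 \<and> yam_from \<nu> (swap_at k w) \<and>
    contents_from \<nu> (swap_at k w) = swap_at k (contents_from \<nu> w)"
  using assms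
proof (induction k arbitrary: w \<nu>)
  case 0
  then obtain x y v where w: "w = x # y # v" by (cases w; cases "tl w") auto
  show ?case
    using two_boxes[of \<nu> x y] 0 unfolding w
    by (auto simp: swap_at_0 axial_def add_box_commute[of \<nu> x y])
next
  case (Suc k)
  then obtain x v where w: "w = x # v" by (cases w) auto
  show ?case using Suc.IH[of "add_box \<nu> x" v] Suc.prems part_fun_add_box[of \<nu> x] unfolding w
    by (auto simp: swap_at_Suc axial_def)
qed

lemma yam_from_third:
  assumes "part_fun \<nu>" "yam_from \<nu> w" "Suc (Suc k) < length w"
  shows "contents_from \<nu> w ! Suc (Suc k) \<noteq> contents_from \<nu> w ! k"
  using assms
proof (induction k arbitrary: w \<nu>)
  case 0
  then obtain x y z v where w: "w = x # y # z # v" by (cases w; cases "tl w"; cases "tl (tl w)") auto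
  show ?case using three_boxes[of \<nu> x y z] 0 unfolding w by auto
next
  case (Suc k)
  then obtain x v where w: "w = x # v" by (cases w) auto
  show ?case using Suc.IH[of "add_box \<nu> x" v] Suc.prems part_fun_add_box[of \<nu> x] unfolding w
    by auto
qed

text \<open>The first free boxes of distinct rows have distinct contents, so each letter can be read
  off from its content. This lets content sequences stand for tableaux from here on.\<close>

lemma contents_from_inj:
  assumes "part_fun \<nu>" "yam_from \<nu> w" "yam_from \<nu> w'" "contents_from \<nu> w = contents_from \<nu> w'"
  shows "w = w'"
  using assms
proof (induction w arbitrary: w' \<nu>)
  case Nil
  then have "length w' = 0" by (metis length_contents_from contents_from.simps(1) list.size(3))
  then show ?case by simp
next
  case (Cons x w)
  then obtain y v where w': "w' = y # v" by (cases w') auto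
  have "x = y"
    using content_strict[OF Cons.prems(1), of x y] content_strict[OF Cons.prems(1), of y x]
      Cons.prems(4) unfolding w' by (auto dest: linorder_neqE_nat)
  then show ?case using Cons.IH[of "add_box \<nu> x" v] Cons.prems part_fun_add_box[of \<nu> x]
    unfolding w' by auto
qed

section \<open>Counting pairs of standard tableaux of one shape\<close>

definition yam_words :: "nat \<Rightarrow> nat list set" where
  "yam_words n = {w. length w = n \<and> yam w}"

definition shape_words :: "nat \<Rightarrow> (nat \<Rightarrow> nat) \<Rightarrow> nat list set" where
  "shape_words n \<nu> = {w \<in> yam_words n. count_list w = \<nu>}"

lemma finite_addable: "finite {r. addable (count_list w) r}"
proof (rule finite_subset)
  show "{r. addable (count_list w) r} \<subseteq> insert 0 (Suc ` set w)"
  proof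
    fix r assume r: "r \<in> {r. addable (count_list w) r}"
    show "r \<in> insert 0 (Suc ` set w)"
    proof (cases r)
      case (Suc r')
      then have "count_list w r' \<noteq> 0" using r by (auto simp: addable_def)
      then have "r' \<in> set w" by (simp add: count_list_0_iff)
      then show ?thesis using Suc by simp
    qed simp
  qed
qed simp

lemma yam_words_Suc:
  "yam_words (Suc n) = (\<lambda>(w, r). w @ [r]) ` (SIGMA w : yam_words n. {r. addable (count_list w) r})"
proof -
  have "v \<in> yam_words (Suc n) \<longleftrightarrow> (\<exists>w r. v = w @ [r] \<and> w \<in> yam_words n \<and> addable (count_list w) r)" for v
    by (cases v rule: rev_cases) (auto simp: yam_words_def yam_snoc)
  then show ?thesis by auto
qed

lemma finite_yam_words: "finite (yam_words n)"
proof (induction n)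
  case 0
  have "yam_words 0 = {[]}" by (auto simp: yam_words_def)
  then show ?case by simp
next
  case (Suc n)
  then show ?case unfolding yam_words_Suc using finite_addable by blast
qed

lemma finite_shape_words: "finite (shape_words n \<nu>)"
  unfolding shape_words_def using finite_yam_words by simp

definition removable :: "(nat \<Rightarrow> nat) \<Rightarrow> nat \<Rightarrow> bool" where
  "removable \<nu> r \<longleftrightarrow> \<nu> (Suc r) < \<nu> r"

definition remove_box :: "(nat \<Rightarrow> nat) \<Rightarrow> nat \<Rightarrow> nat \<Rightarrow> nat" where
  "remove_box \<nu> r = \<nu>(r := \<nu> r - 1)"

lemma count_list_snoc: "count_list (w @ [r]) = add_box (count_list w) r"
  by (auto simp: fun_eq_iff add_box_def)

lemma shape_words_Suc:
  assumes "part_fun \<nu>"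
  shows "shape_words (Suc n) \<nu> =
    (\<lambda>(r, w). w @ [r]) ` (SIGMA r : {r. removable \<nu> r}. shape_words n (remove_box \<nu> r))"
proof -
  have "v \<in> shape_words (Suc n) \<nu> \<longleftrightarrow>
    (\<exists>w r. v = w @ [r] \<and> removable \<nu> r \<and> w \<in> shape_words n (remove_box \<nu> r))" for v
  proof (cases v rule: rev_cases)
    case (snoc w r)
    have "addable (count_list w) r \<and> yam w \<and> add_box (count_list w) r = \<nu> \<longleftrightarrow>
      removable \<nu> r \<and> yam w \<and> count_list w = remove_box \<nu> r"
    proof
      assume a: "addable (count_list w) r \<and> yam w \<and> add_box (count_list w) r = \<nu>"
      then have "part_fun (count_list w)" using yam_part_fun by blast
      then have "count_list w (Suc r) \<le> count_list w r" by (simp add: part_fun_def)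
      then show "removable \<nu> r \<and> yam w \<and> count_list w = remove_box \<nu> r"
        using a by (auto simp: removable_def remove_box_def add_box_def)
    next
      assume a: "removable \<nu> r \<and> yam w \<and> count_list w = remove_box \<nu> r"
      then have "\<nu> r > 0" by (simp add: removable_def)
      moreover have "r \<noteq> 0 \<Longrightarrow> \<nu> r \<le> \<nu> (r - 1)"
        using assms part_fun_antimono[of \<nu> "r - 1" r] by simp
      ultimately show "addable (count_list w) r \<and> yam w \<and> add_box (count_list w) r = \<nu>"
        using a by (cases r) (auto simp: addable_def remove_box_def add_box_def)
    qed
    then show ?thesis unfolding snoc shape_words_def yam_words_def
      by (auto simp: yam_snoc count_list_snoc)
  qed (auto simp: shape_words_def yam_words_def)
  then show ?thesis by auto
qed

lemma removable_iff_addable: "removable \<nu> r \<longleftrightarrow> addable \<nu> (Suc r)"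
  by (simp add: removable_def addable_def)

lemma finite_addable_imp_removable: "finite {r. addable \<nu> r} \<Longrightarrow> finite {r. removable \<nu> r}"
  unfolding removable_iff_addable using finite_vimageI[of "{r. addable \<nu> r}" Suc] by (simp add: vimage_def)

text \<open>Each removable corner has the addable corner in the row below as its partner, and only
  the addable one in row 0 is left over.\<close>

lemma card_addable:
  assumes "finite {r. addable \<nu> r}"
  shows "card {r. addable \<nu> r} = Suc (card {r. removable \<nu> r})"
proof -
  have "addable \<nu> r \<longleftrightarrow> r \<in> insert 0 (Suc ` {r. removable \<nu> r})" for r
    unfolding removable_iff_addable by (cases r) (auto simp: addable_def)
  then have "{r. addable \<nu> r} = insert 0 (Suc ` {r. removable \<nu> r})" by auto
  then show ?thesis using finite_addable_imp_removable[OF assms]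
    by (simp add: card_image)
qed

lemma card_shape_words_Suc:
  assumes "part_fun \<nu>" "finite {r. addable \<nu> r}"
  shows "card (shape_words (Suc n) \<nu>) = (\<Sum>r | removable \<nu> r. card (shape_words n (remove_box \<nu> r)))"
proof -
  have "inj_on (\<lambda>(r, w). w @ [r]) X" for X :: "(nat \<times> nat list) set"
    by (auto simp: inj_on_def)
  then show ?thesis unfolding shape_words_Suc[OF assms(1)]
    using finite_addable_imp_removable[OF assms(2)] finite_shape_words
    by (simp add: card_image card_SigmaI)
qed

lemma part_fun_remove_box:
  assumes "part_fun \<nu>" "removable \<nu> r"
  shows "part_fun (remove_box \<nu> r)"
  unfolding part_fun_def
proof
  fix s
  show "remove_box \<nu> r (Suc s) \<le> remove_box \<nu> r s"
    using assms le_trans[of "\<nu> (Suc s) - 1" "\<nu> (Suc s)" "\<nu> s"]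
    unfolding part_fun_def removable_def remove_box_def by auto
qed

lemma finite_addable_remove_box:
  assumes "finite {r. addable \<nu> r}"
  shows "finite {r. addable (remove_box \<nu> s) r}"
  by (rule finite_subset[OF _ finite_insert[THEN iffD2, OF assms], of _ s])
    (auto simp: addable_def remove_box_def split: if_splits)

lemma finite_addable_add_box:
  assumes "finite {r. addable \<nu> r}"
  shows "finite {r. addable (add_box \<nu> s) r}"
  by (rule finite_subset[OF _ finite_insert[THEN iffD2, OF assms], of _ "Suc s"])
    (auto simp: addable_def add_box_def split: if_splits)

text \<open>Adding a box and removing one from another row commute. Together with
  \<open>card_addable\<close> this is the relation DU - UD = 1 of the up and down operators on
  Young's lattice.\<close>

lemma add_remove_exchange:
  assumes "part_fun \<nu>"
  shows "(addable \<nu> r \<and> removable (add_box \<nu> r) s \<and> s \<noteq> r) \<longleftrightarrow>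
    (removable \<nu> s \<and> addable (remove_box \<nu> s) r \<and> s \<noteq> r)"
proof -
  have "\<nu> (Suc r) \<le> \<nu> r" "\<nu> (Suc s) \<le> \<nu> s" using assms by (auto simp: part_fun_def)
  then show ?thesis
    by (auto simp: addable_def removable_def add_box_def remove_box_def)
qed

lemma add_remove_commute: "s \<noteq> r \<Longrightarrow> remove_box (add_box \<nu> r) s = add_box (remove_box \<nu> s) r"
  by (auto simp: remove_box_def add_box_def fun_eq_iff)

lemma removable_add_box: "part_fun \<nu> \<Longrightarrow> addable \<nu> r \<Longrightarrow> removable (add_box \<nu> r) r"
  by (auto simp: removable_def add_box_def part_fun_def less_Suc_eq_le)

lemma addable_remove_box: "part_fun \<nu> \<Longrightarrow> removable \<nu> s \<Longrightarrow> addable (remove_box \<nu> s) s"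
  using part_fun_antimono[of \<nu> "s - 1" s]
  by (auto simp: removable_def remove_box_def addable_def)

text \<open>Deleting the last box of the larger tableaux leads back to \<open>\<nu>\<close>, once
  for each addable corner, or to a shape in which a box of \<open>\<nu>\<close> was moved to another
  row. The exchange turns the second kind into the induction hypothesis for the shapes below
  \<open>\<nu>\<close>, and the one surplus addable corner makes up the step from n to n +
  1.\<close>

lemma sum_card_add_box:
  assumes "part_fun \<nu>" "finite {r. addable \<nu> r}"
    "\<exists>N. (\<forall>r\<ge>N. \<nu> r = 0) \<and> (\<Sum>r<N. \<nu> r) = n"
  shows "(\<Sum>r | addable \<nu> r. card (shape_words (Suc n) (add_box \<nu> r))) = Suc n * card (shape_words n \<nu>)"
  using assms
proof (induction n arbitrary: \<nu>)
  case 0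
  then have l: "\<nu> = (\<lambda>_. 0)" by (auto simp: fun_eq_iff) (metis lessThan_iff not_le)
  have a: "{r. addable \<nu> r} = {0}" unfolding l by (auto simp: addable_def)
  have "shape_words (Suc 0) (add_box \<nu> 0) = {[0]}"
    unfolding l by (auto simp: shape_words_def yam_words_def length_Suc_conv addable_def add_box_def)
  moreover have "shape_words 0 \<nu> = {[]}"
    unfolding l by (auto simp: shape_words_def yam_words_def)
  ultimately show ?case by (simp add: a)
next
  case (Suc n)
  define A R F where "A = {r. addable \<nu> r}" and "R = {r. removable \<nu> r}"
    and "F = (\<lambda>\<mu>. card (shape_words (Suc n) \<mu>))"
  have fA: "finite A" and fR: "finite R"
    using Suc.prems finite_addable_imp_removable unfolding A_def R_def by auto
  obtain N where N: "\<forall>r\<ge>N. \<nu> r = 0" "(\<Sum>r<N. \<nu> r) = Suc n" using Suc.prems by blast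
  have IH: "(\<Sum>r | addable (remove_box \<nu> s) r. F (add_box (remove_box \<nu> s) r)) =
      Suc n * card (shape_words n (remove_box \<nu> s))" if s: "s \<in> R" for s
    unfolding F_def
  proof (rule Suc.IH)
    have ls: "\<nu> s > 0" using s by (auto simp: R_def removable_def)
    then have "s < N" using N by (metis not_gr_zero not_le)
    have "(\<Sum>r<N. \<nu> r) = (\<Sum>r<N. remove_box \<nu> s r) + 1"
      using \<open>s < N\<close> ls by (simp add: sum.remove[of "{..<N}" s] remove_box_def)
    then have "(\<forall>r\<ge>N. remove_box \<nu> s r = 0) \<and> (\<Sum>r<N. remove_box \<nu> s r) = n"
      using N by (auto simp: remove_box_def)
    then show "\<exists>N. (\<forall>r\<ge>N. remove_box \<nu> s r = 0) \<and> (\<Sum>r<N. remove_box \<nu> s r) = n" by blast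
  qed (use Suc.prems s in \<open>auto simp: R_def part_fun_remove_box finite_addable_remove_box\<close>)
  have "(\<Sum>r\<in>A. card (shape_words (Suc (Suc n)) (add_box \<nu> r))) =
    (\<Sum>r\<in>A. \<Sum>s | removable (add_box \<nu> r) s. F (remove_box (add_box \<nu> r) s))"
    unfolding F_def A_def
    by (intro sum.cong refl card_shape_words_Suc part_fun_add_box finite_addable_add_box)
       (use Suc.prems in auto)
  also have "\<dots> = (\<Sum>r\<in>A. F \<nu> + (\<Sum>s | removable (add_box \<nu> r) s \<and> s \<noteq> r. F (remove_box (add_box \<nu> r) s)))"
  proof (intro sum.cong refl)
    fix r assume r: "r \<in> A"
    have "{s. removable (add_box \<nu> r) s} - {r} = {s. removable (add_box \<nu> r) s \<and> s \<noteq> r}" by auto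
    moreover have "remove_box (add_box \<nu> r) r = \<nu>" by (auto simp: remove_box_def add_box_def)
    moreover have "finite {s. removable (add_box \<nu> r) s}"
      using Suc.prems by (intro finite_addable_imp_removable finite_addable_add_box)
    ultimately show "(\<Sum>s | removable (add_box \<nu> r) s. F (remove_box (add_box \<nu> r) s)) =
       F \<nu> + (\<Sum>s | removable (add_box \<nu> r) s \<and> s \<noteq> r. F (remove_box (add_box \<nu> r) s))"
      using removable_add_box[OF Suc.prems(1), of r] r sum.remove[of "{s. removable (add_box \<nu> r) s}" r
        "\<lambda>s. F (remove_box (add_box \<nu> r) s)"]
      by (simp add: A_def)
  qed
  also have "\<dots> = card A * F \<nu> + (\<Sum>r\<in>A. \<Sum>s | removable (add_box \<nu> r) s \<and> s \<noteq> r. F (remove_box (add_box \<nu> r) s))"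
    by (simp add: sum.distrib)
  finally have 1: "(\<Sum>r\<in>A. card (shape_words (Suc (Suc n)) (add_box \<nu> r))) =
    card A * F \<nu> + (\<Sum>r\<in>A. \<Sum>s | removable (add_box \<nu> r) s \<and> s \<noteq> r. F (remove_box (add_box \<nu> r) s))" .
  have 2: "(\<Sum>r\<in>A. \<Sum>s | removable (add_box \<nu> r) s \<and> s \<noteq> r. F (remove_box (add_box \<nu> r) s)) =
    (\<Sum>s\<in>R. \<Sum>r | addable (remove_box \<nu> s) r \<and> s \<noteq> r. F (add_box (remove_box \<nu> s) r))"
  proof -
    have "(\<Sum>r\<in>A. \<Sum>s | removable (add_box \<nu> r) s \<and> s \<noteq> r. F (remove_box (add_box \<nu> r) s)) =
      (\<Sum>(r, s)\<in>(SIGMA r : A. {s. removable (add_box \<nu> r) s \<and> s \<noteq> r}). F (remove_box (add_box \<nu> r) s))"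
    proof (intro sum.Sigma fA ballI)
      fix r
      show "finite {s. removable (add_box \<nu> r) s \<and> s \<noteq> r}"
        using finite_addable_imp_removable[OF finite_addable_add_box[OF Suc.prems(2)], of r] by simp
    qed
    also have "\<dots> = (\<Sum>(s, r)\<in>(SIGMA s : R. {r. addable (remove_box \<nu> s) r \<and> s \<noteq> r}). F (add_box (remove_box \<nu> s) r))"
      by (rule sum.reindex_bij_witness[of _ "\<lambda>(s, r). (r, s)" "\<lambda>(r, s). (s, r)"])
        (use add_remove_exchange[OF Suc.prems(1)] in \<open>auto simp: A_def R_def add_remove_commute\<close>)
    also have "\<dots> = (\<Sum>s\<in>R. \<Sum>r | addable (remove_box \<nu> s) r \<and> s \<noteq> r. F (add_box (remove_box \<nu> s) r))"
    proof (intro sum.Sigma[symmetric] fR ballI)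
      fix s
      show "finite {r. addable (remove_box \<nu> s) r \<and> s \<noteq> r}"
        using finite_addable_remove_box[OF Suc.prems(2), of s] by simp
    qed
    finally show ?thesis .
  qed
  have 3: "(\<Sum>s\<in>R. \<Sum>r | addable (remove_box \<nu> s) r \<and> s \<noteq> r. F (add_box (remove_box \<nu> s) r)) + card R * F \<nu> =
     (\<Sum>s\<in>R. Suc n * card (shape_words n (remove_box \<nu> s)))"
  proof -
    have "(\<Sum>r | addable (remove_box \<nu> s) r \<and> s \<noteq> r. F (add_box (remove_box \<nu> s) r)) + F \<nu> =
      Suc n * card (shape_words n (remove_box \<nu> s))" if s: "s \<in> R" for s
    proof -
      have "{r. addable (remove_box \<nu> s) r} - {s} = {r. addable (remove_box \<nu> s) r \<and> s \<noteq> r}" by auto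
      moreover have "add_box (remove_box \<nu> s) s = \<nu>"
        using s by (auto simp: R_def removable_def remove_box_def add_box_def)
      moreover have "finite {r. addable (remove_box \<nu> s) r}"
        using Suc.prems by (intro finite_addable_remove_box)
      ultimately show ?thesis
        using addable_remove_box[OF Suc.prems(1), of s] s sum.remove[of "{r. addable (remove_box \<nu> s) r}" s
          "\<lambda>r. F (add_box (remove_box \<nu> s) r)"] IH[OF s] by (simp add: R_def)
    qed
    then have "(\<Sum>s\<in>R. (\<Sum>r | addable (remove_box \<nu> s) r \<and> s \<noteq> r. F (add_box (remove_box \<nu> s) r)) + F \<nu>) =
       (\<Sum>s\<in>R. Suc n * card (shape_words n (remove_box \<nu> s)))"
      by (rule sum.cong[OF refl])
    then show ?thesis by (simp only: sum.distrib sum_constant of_nat_id)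
  qed
  have 4: "(\<Sum>s\<in>R. Suc n * card (shape_words n (remove_box \<nu> s))) = Suc n * F \<nu>"
    unfolding F_def card_shape_words_Suc[OF Suc.prems(1,2)] R_def sum_distrib_left ..
  have 5: "card A = Suc (card R)" unfolding A_def R_def by (rule card_addable[OF Suc.prems(2)])
  have 6: "F \<nu> = card (shape_words (Suc n) \<nu>)" by (simp add: F_def)
  show ?case using 1 2 3 4 5 unfolding A_def[symmetric] 6 by simp
qed

text \<open>Growing the first tableau by a box and summing the number of second tableaux over the
  enlarged shapes multiplies the count by n + 1. That the squares of the numbers of tableaux add up
  to n! is the dimension count behind \<open>rep_faithful\<close>.\<close>

lemma card_same_shape:
  "card (SIGMA w : yam_words n. shape_words n (count_list w)) = fact n"
proof (induction n)
  case 0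
  have "yam_words 0 = {[]}" by (auto simp: yam_words_def)
  moreover have "shape_words 0 (count_list []) = {[]}" by (auto simp: shape_words_def yam_words_def)
  ultimately show ?case by simp
next
  case (Suc n)
  let ?f = "\<lambda>w. card (shape_words n (count_list w))"
  have inj: "inj_on (\<lambda>(w, r). w @ [r]) X" for X :: "(nat list \<times> nat) set"
    by (auto simp: inj_on_def)
  have "card (SIGMA w : yam_words (Suc n). shape_words (Suc n) (count_list w)) =
      (\<Sum>w\<in>yam_words (Suc n). card (shape_words (Suc n) (count_list w)))"
    by (simp add: card_SigmaI finite_yam_words finite_shape_words)
  also have "\<dots> = (\<Sum>(w, r)\<in>(SIGMA w : yam_words n. {r. addable (count_list w) r}).
      card (shape_words (Suc n) (count_list (w @ [r]))))"
    unfolding yam_words_Suc by (subst sum.reindex[OF inj]) (simp add: case_prod_unfold o_def)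
  also have "\<dots> = (\<Sum>w\<in>yam_words n. \<Sum>r | addable (count_list w) r.
      card (shape_words (Suc n) (add_box (count_list w) r)))"
    by (subst sum.Sigma) (simp_all add: finite_yam_words finite_addable count_list_snoc)
  also have "\<dots> = (\<Sum>w\<in>yam_words n. Suc n * ?f w)"
  proof (intro sum.cong refl sum_card_add_box finite_addable)
    fix w assume w: "w \<in> yam_words n"
    then show "part_fun (count_list w)" by (auto simp: yam_words_def yam_part_fun)
    obtain N where N: "set w \<subseteq> {..<N}"
      by (metis List.finite_set finite_nat_iff_bounded)
    have "(\<Sum>r<N. count_list w r) = n"
      using sum_count_set[OF N] w by (simp add: yam_words_def)
    moreover have "\<forall>r\<ge>N. count_list w r = 0" using N by (auto simp: count_list_0_iff)
    ultimately show "\<exists>N. (\<forall>r\<ge>N. count_list w r = 0) \<and> (\<Sum>r<N. count_list w r) = n" by blast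
  qed
  also have "\<dots> = Suc n * card (SIGMA w : yam_words n. shape_words n (count_list w))"
    by (simp add: card_SigmaI finite_yam_words finite_shape_words sum_distrib_left)
  finally show ?case using Suc by simp
qed

text \<open>The sum of the letters with weights n - i drops at each swap of a descent, so the
  sorting stops. The predicate \<open>P\<close> carries an invariant along, and \<open>K\<close>
  confines the swaps to positions inside blocks.\<close>

lemma bubble_sort:
  fixes w :: "nat list"
  assumes "P w" and "\<And>w. P w \<Longrightarrow> length w = n" and "K \<subseteq> {k. Suc k < n}"
    and step: "\<And>w k. \<lbrakk>P w; k \<in> K; w ! Suc k < w ! k\<rbrakk> \<Longrightarrow> P (swap_at k w)"
  shows "\<exists>w'. P w' \<and> (\<forall>k\<in>K. w' ! k \<le> w' ! Suc k)"
  using assms(1)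
proof (induction "\<Sum>i<n. (n - i) * w ! i" arbitrary: w rule: less_induct)
  case less
  show ?case
  proof (cases "\<forall>k\<in>K. w ! k \<le> w ! Suc k")
    case False
    then obtain k where k: "k \<in> K" "w ! Suc k < w ! k" by (auto simp: not_le)
    then have kn: "Suc k < n" and len: "length w = n" using assms less.prems by auto
    let ?g = "\<lambda>w. \<Sum>i\<in>{..<n} - {k, Suc k}. (n - i) * w ! i"
    have split: "(\<Sum>i<n. (n - i) * v ! i) = (n - k) * v ! k + (n - Suc k) * v ! Suc k + ?g v" for v :: "nat list"
    proof -
      have "{..<n} = insert k (insert (Suc k) ({..<n} - {k, Suc k}))" using kn by auto
      then have "(\<Sum>i<n. (n - i) * v ! i) = (\<Sum>i\<in>insert k (insert (Suc k) ({..<n} - {k, Suc k})). (n - i) * v ! i)"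
        by simp
      then show ?thesis by simp
    qed
    have "?g (swap_at k w) = ?g w"
      using kn len by (intro sum.cong) (auto simp: nth_swap_at)
    moreover obtain m where "n - k = Suc m" "n - Suc k = m" using kn by (metis Suc_diff_Suc Suc_lessD)
    ultimately have "(\<Sum>i<n. (n - i) * swap_at k w ! i) < (\<Sum>i<n. (n - i) * w ! i)"
      unfolding split using kn len k(2) by (simp add: nth_swap_at)
    from less.hyps[OF this step[OF less.prems k]] show ?thesis .
  qed (use less.prems in blast)
qed

lemma bubble_sort_down:
  fixes w :: "nat list"
  assumes "P w" and "\<And>w. P w \<Longrightarrow> length w = n" and "K \<subseteq> {k. Suc k < n}"
    and step: "\<And>w k. \<lbrakk>P w; k \<in> K; w ! k < w ! Suc k\<rbrakk> \<Longrightarrow> P (swap_at k w)"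
  shows "\<exists>w'. P w' \<and> (\<forall>k\<in>K. w' ! Suc k \<le> w' ! k)"
  using assms(1)
proof (induction "\<Sum>i<n. i * w ! i" arbitrary: w rule: less_induct)
  case less
  show ?case
  proof (cases "\<forall>k\<in>K. w ! Suc k \<le> w ! k")
    case False
    then obtain k where k: "k \<in> K" "w ! k < w ! Suc k" by (auto simp: not_le)
    then have kn: "Suc k < n" and len: "length w = n" using assms less.prems by auto
    let ?g = "\<lambda>w. \<Sum>i\<in>{..<n} - {k, Suc k}. i * w ! i"
    have split: "(\<Sum>i<n. i * v ! i) = k * v ! k + Suc k * v ! Suc k + ?g v" for v :: "nat list"
    proof -
      have "{..<n} = insert k (insert (Suc k) ({..<n} - {k, Suc k}))" using kn by auto
      then have "(\<Sum>i<n. i * v ! i) = (\<Sum>i\<in>insert k (insert (Suc k) ({..<n} - {k, Suc k})). i * v ! i)"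
        by simp
      then show ?thesis by simp
    qed
    have "?g (swap_at k w) = ?g w"
      using kn len by (intro sum.cong) (auto simp: nth_swap_at)
    then have "(\<Sum>i<n. i * swap_at k w ! i) < (\<Sum>i<n. i * w ! i)"
      unfolding split using kn len k(2) by (simp add: nth_swap_at)
    from less.hyps[OF this step[OF less.prems k]] show ?thesis .
  qed (use less.prems in blast)
qed


section \<open>Seminormal modules\<close>

text \<open>The value at q = 1 is the limit of the quotient, so that one treatment serves both the
  symmetric group and the Hecke algebra.\<close>

definition qint :: "complex \<Rightarrow> int \<Rightarrow> complex" where
  "qint q d = (if q = 1 then of_int d else (q powi d - 1) / (q - 1))"

lemma qint_0 [simp]: "qint q 0 = 0" and qint_1 [simp]: "qint q 1 = 1"
  by (auto simp: qint_def)

lemma qint_add: "q \<noteq> 0 \<Longrightarrow> qint q (a + b) = qint q a + q powi a * qint q b"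
  by (auto simp: qint_def power_int_add add_divide_distrib[symmetric] algebra_simps)

lemma qint_neg: "q \<noteq> 0 \<Longrightarrow> qint q (- d) = - (q powi (- d)) * qint q d"
  by (auto simp: qint_def power_int_minus field_simps)

lemma powi_qint: "q \<noteq> 0 \<Longrightarrow> q powi d = 1 + (q - 1) * qint q d"
  by (auto simp: qint_def)

locale quantum =
  fixes q :: complex
  assumes q0: "q \<noteq> 0" and qint_nz: "\<And>d. d \<noteq> 0 \<Longrightarrow> qint q d \<noteq> 0"
begin

text \<open>The diagonal entry of Young's seminormal matrices at axial distance d. At d = 1 and d =
  -1 it becomes the eigenvalue q or -1 of a basis vector fixed up to a scalar.\<close>

definition dcoef :: "int \<Rightarrow> complex" where
  "dcoef d = q powi d / qint q d"

text \<open>The off-diagonal entry. The quadratic relation prescribes only the product of the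
  entries for d and -d; this unsymmetric factorization avoids square roots. At d = 1 the quotient
  would not vanish, and the cut-off keeps words that are not tableaux out of the module.\<close>

definition ocoef :: "int \<Rightarrow> complex" where
  "ocoef d = (if \<bar>d\<bar> \<ge> 2 then qint q (d + 1) / qint q d else 0)"

lemma dcoef_neg: "d \<noteq> 0 \<Longrightarrow> dcoef (- d) = q - 1 - dcoef d"
  using qint_nz[of d] qint_nz[of "-d"] q0
  by (simp add: dcoef_def qint_neg power_int_minus field_simps powi_qint)

lemma dcoef_1 [simp]: "dcoef 1 = q" and dcoef_neg_1 [simp]: "dcoef (-1) = -1"
  using dcoef_neg[of 1] by (auto simp: dcoef_def)

lemma qint_Suc: "qint q (d + 1) = 1 + q * qint q d"
  using qint_add[OF q0, of 1 d] by (simp add: add.commute)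

lemma ocoef_alt: "\<bar>d\<bar> \<ge> 2 \<Longrightarrow> ocoef d = q - dcoef (- d)"
proof -
  assume d: "\<bar>d\<bar> \<ge> 2"
  then have "qint q d \<noteq> 0" "d \<noteq> 0" using qint_nz by auto
  then have "ocoef d = 1 / qint q d + q" "dcoef d = 1 / qint q d + (q - 1)"
    using d unfolding ocoef_def dcoef_def qint_Suc powi_qint[OF q0] by (simp_all add: add_divide_distrib)
  then show ?thesis using dcoef_neg[OF \<open>d \<noteq> 0\<close>] by simp
qed

lemma ocoef_nz: "\<bar>d\<bar> \<ge> 2 \<Longrightarrow> ocoef d \<noteq> 0"
  using qint_nz[of d] qint_nz[of "d + 1"] by (auto simp: ocoef_def)

lemma ocoef_ocoef: "d \<noteq> 0 \<Longrightarrow> ocoef d * ocoef (- d) = q + dcoef d * dcoef (- d)"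
proof -
  assume d: "d \<noteq> 0"
  show ?thesis
  proof (cases "\<bar>d\<bar> \<ge> 2")
    case True
    then have "ocoef d = 1 + dcoef d" "ocoef (- d) = q - dcoef d"
      using ocoef_alt[of d] ocoef_alt[of "-d"] dcoef_neg[OF d] by simp_all
    then show ?thesis unfolding dcoef_neg[OF d] by (simp only:) (simp add: algebra_simps)
  next
    case False
    then have "d = 1 \<or> d = -1" using d by auto
    then show ?thesis by (auto simp: ocoef_def)
  qed
qed

text \<open>This is the addition theorem of quantum integers, rewritten for the diagonal entries in
  the form that the braid relation asks for.\<close>

lemma dcoef_add:
  assumes "a \<noteq> 0" "b \<noteq> 0" "a + b \<noteq> 0"
  shows "dcoef a * dcoef b = dcoef (a + b) * (dcoef a + dcoef b - (q - 1))"
proof -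
  define A B x y where "A = q powi a" "B = q powi b" "x = qint q a" "y = qint q b"
  have nz: "x \<noteq> 0" "y \<noteq> 0" "qint q (a + b) \<noteq> 0" using assms qint_nz by (auto simp: A_B_x_y_def)
  have e: "qint q (a + b) = x + A * y" "q powi (a + b) = A * B"
    using qint_add[OF q0] q0 by (auto simp: A_B_x_y_def power_int_add)
  have AB: "A = 1 + (q - 1) * x" "B = 1 + (q - 1) * y" by (auto simp: A_B_x_y_def powi_qint[OF q0])
  have "A / x * (B / y) = A * B / (x + A * y) * (A / x + B / y - (q - 1))"
  proof -
    have "A / x + B / y - (q - 1) = (x + A * y) / (x * y)"
      using nz by (simp add: field_simps AB)
    then show ?thesis using nz e by simp
  qed
  then show ?thesis unfolding dcoef_def e by (simp add: A_B_x_y_def)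
qed

text \<open>The operator acts on coefficient functions, so the matrix entry that leads from
  \<open>c\<close> to its swap is \<open>ocoef (- axial c k)\<close>. Positions start at 0:
  \<open>top k\<close> represents the generator with index k + 1.\<close>

definition top :: "nat \<Rightarrow> (int list \<Rightarrow> complex) \<Rightarrow> int list \<Rightarrow> complex" where
  "top k u = (\<lambda>c. dcoef (axial c k) * u c + ocoef (axial c k) * u (swap_at k c))"

end

text \<open>The index sets of seminormal bases.\<close>

definition swap_closed :: "nat \<Rightarrow> int list set \<Rightarrow> bool" where
  "swap_closed n C \<longleftrightarrow> finite C \<and> (\<forall>c\<in>C. length c = n \<and>
     (\<forall>k. Suc k < n \<longrightarrow> axial c k \<noteq> 0 \<and> (\<bar>axial c k\<bar> \<ge> 2 \<longrightarrow> swap_at k c \<in> C)) \<and>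
     (\<forall>k. Suc (Suc k) < n \<longrightarrow> c ! Suc (Suc k) \<noteq> c ! k) \<and> (0 < n \<longrightarrow> c ! 0 = 0))"

definition supported :: "'a set \<Rightarrow> ('a \<Rightarrow> complex) set" where
  "supported C = {u. \<forall>c. c \<notin> C \<longrightarrow> u c = 0}"

lemma axial_swap_at: "Suc k < length c \<Longrightarrow> axial (swap_at k c) k = - axial c k"
  by (simp add: axial_def nth_swap_at)

lemma contents_first: "yam w \<Longrightarrow> w \<noteq> [] \<Longrightarrow> contents w ! 0 = 0"
  by (cases w) (auto simp: addable_def)

lemma swap_closed_contents:
  assumes "\<And>w. w \<in> W \<Longrightarrow> w \<in> yam_words n"
    and "\<And>w k. \<lbrakk>w \<in> W; Suc k < n; swap_at k w \<in> yam_words n\<rbrakk> \<Longrightarrow> swap_at k w \<in> W"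
  shows "swap_closed n (contents ` W)"
  unfolding swap_closed_def
proof (intro conjI ballI)
  show "finite (contents ` W)"
    using assms(1) finite_yam_words finite_subset by (metis finite_imageI subsetI)
  fix c assume "c \<in> contents ` W"
  then obtain w where w: "w \<in> W" "c = contents w" by blast
  then have y: "yam w" "length w = n" using assms(1) by (auto simp: yam_words_def)
  show "length c = n" using w y by simp
  show "\<forall>k. Suc k < n \<longrightarrow> axial c k \<noteq> 0 \<and> (\<bar>axial c k\<bar> \<ge> 2 \<longrightarrow> swap_at k c \<in> contents ` W)"
  proof (intro allI impI)
    fix k assume k: "Suc k < n"
    show "axial c k \<noteq> 0 \<and> (\<bar>axial c k\<bar> \<ge> 2 \<longrightarrow> swap_at k c \<in> contents ` W)"
      using yam_from_swap[OF part_fun_0 y(1), of k] k y(2) w assms(2)[OF w(1) k]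
      by (auto simp: yam_words_def intro!: image_eqI[of _ _ "swap_at k w"])
  qed
  show "\<forall>k. Suc (Suc k) < n \<longrightarrow> c ! Suc (Suc k) \<noteq> c ! k"
    using yam_from_third[OF part_fun_0 y(1)] y(2) w(2) by simp
  show "0 < n \<longrightarrow> c ! 0 = 0" using contents_first[OF y(1)] y(2) w(2) by auto
qed

lemma swap_closed_yam: "swap_closed n (contents ` yam_words n)"
  by (rule swap_closed_contents) auto

lemma swap_closed_shape: "swap_closed n (contents ` shape_words n \<nu>)"
  by (rule swap_closed_contents)
    (auto simp: shape_words_def yam_words_def count_list_swap_at)

context quantum
begin

lemma top_supported:
  assumes C: "swap_closed n C" and k: "Suc k < n" and u: "u \<in> supported C"
  shows "top k u \<in> supported C"
  unfolding supported_def
proof (intro CollectI allI impI)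
  fix c assume c: "c \<notin> C"
  show "top k u c = 0"
  proof (cases "swap_at k c \<in> C \<and> \<bar>axial c k\<bar> \<ge> 2")
    case True
    then have "length c = n" using C unfolding swap_closed_def by (metis length_swap_at)
    then have "\<bar>axial (swap_at k c) k\<bar> \<ge> 2" using True k by (simp add: axial_swap_at)
    then have "swap_at k (swap_at k c) \<in> C" using True C k unfolding swap_closed_def by blast
    then show ?thesis using c k \<open>length c = n\<close> by (simp add: swap_at_swap_at)
  next
    case False
    then show ?thesis using c u by (auto simp: top_def supported_def ocoef_def)
  qed
qed

lemma supported_eqI:
  assumes "u \<in> supported C" "v \<in> supported C" "\<And>c. c \<in> C \<Longrightarrow> u c = v c"
  shows "u = v"
  using assms by (auto simp: supported_def fun_eq_iff) metis

lemma supported_lin: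
  "u \<in> supported C \<Longrightarrow> v \<in> supported C \<Longrightarrow> (\<lambda>c. u c + v c) \<in> supported C"
  "u \<in> supported C \<Longrightarrow> (\<lambda>c. (f c :: complex) * u c) \<in> supported C"
  by (auto simp: supported_def)

lemma top_quad:
  assumes C: "swap_closed n C" and k: "Suc k < n" and u: "u \<in> supported C"
  shows "top k (top k u) = (\<lambda>c. (q - 1) * top k u c + q * u c)"
proof (rule supported_eqI[of _ C])
  fix c assume c: "c \<in> C"
  define d where "d = axial c k"
  have l: "length c = n" and d: "d \<noteq> 0" using c C k by (auto simp: swap_closed_def d_def)
  have n: "axial (swap_at k c) k = - d" "swap_at k (swap_at k c) = c"
    using l k by (auto simp: d_def axial_swap_at swap_at_swap_at)
  have "top k (top k u) c = dcoef d * (dcoef d * u c + ocoef d * u (swap_at k c)) +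
     ocoef d * (dcoef (- d) * u (swap_at k c) + ocoef (- d) * u c)"
    by (simp add: top_def n d_def)
  also have "\<dots> = (dcoef d * dcoef d + ocoef d * ocoef (- d)) * u c +
      (dcoef d + dcoef (- d)) * ocoef d * u (swap_at k c)" by (simp add: algebra_simps)
  also have "\<dots> = (q - 1) * top k u c + q * u c"
    unfolding ocoef_ocoef[OF d] dcoef_neg[OF d] by (simp add: top_def d_def algebra_simps)
  finally show "top k (top k u) c = (q - 1) * top k u c + q * u c" .
qed (intro top_supported[OF C k] supported_lin u)+

lemma top_comm:
  assumes C: "swap_closed n C" and j: "Suc j < n" and kj: "Suc k < j" and u: "u \<in> supported C"
  shows "top k (top j u) = top j (top k u)"
proof (rule supported_eqI[of _ C])
  fix c assume c: "c \<in> C"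
  have l: "length c = n" using c C by (auto simp: swap_closed_def)
  have "axial (swap_at k c) j = axial c j" "axial (swap_at j c) k = axial c k"
    "swap_at k (swap_at j c) = swap_at j (swap_at k c)"
    using l j kj by (auto simp: axial_def nth_swap_at intro!: nth_equalityI)
  then show "top k (top j u) c = top j (top k u) c" by (simp add: top_def algebra_simps)
qed (use j kj in \<open>auto intro!: top_supported[OF C] u\<close>)

lemma top_braid:
  assumes C: "swap_closed n C" and k: "Suc (Suc k) < n" and u: "u \<in> supported C"
  shows "top k (top (Suc k) (top k u)) = top (Suc k) (top k (top (Suc k) u))"
proof (rule supported_eqI[of _ C])
  fix c assume c: "c \<in> C"
  let ?j = "Suc k" let ?s = "swap_at k" and ?t = "swap_at (Suc k)"
  define a b where "a = axial c k" and "b = axial c ?j"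
  have l: "length c = n" and a: "a \<noteq> 0" and b: "b \<noteq> 0" and ab: "a + b \<noteq> 0"
    using c C k by (auto simp: swap_closed_def a_def b_def axial_def)
  note nn = nth_swap_at[of k] nth_swap_at[of "Suc k"]
  have ax: "axial (?s c) k = - a" "axial (?t c) ?j = - b" "axial (?s c) ?j = a + b" "axial (?t c) k = a + b"
    "axial (?t (?s c)) k = b" "axial (?s (?t c)) ?j = a"
    using l k by (auto simp: a_def b_def axial_def nn)
  have sw: "?s (?s c) = c" "?t (?t c) = c" "?s (?s (?t c)) = ?t c" "?t (?t (?s c)) = ?s c"
    using l k by (auto simp: swap_at_swap_at)
  have br: "?s (?t (?s c)) = ?t (?s (?t c))"
    using l k by (auto simp: nn intro!: nth_equalityI)
  have L: "top k (top ?j (top k u)) c =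
    dcoef a * (dcoef b * (dcoef a * u c + ocoef a * u (?s c)) + ocoef b * (dcoef (a + b) * u (?t c) + ocoef (a + b) * u (?s (?t c))))
    + ocoef a * (dcoef (a + b) * (dcoef (- a) * u (?s c) + ocoef (- a) * u c) + ocoef (a + b) * (dcoef b * u (?t (?s c)) + ocoef b * u (?s (?t (?s c)))))"
    by (simp add: top_def ax sw a_def[symmetric] b_def[symmetric])
  have R: "top ?j (top k (top ?j u)) c =
    dcoef b * (dcoef a * (dcoef b * u c + ocoef b * u (?t c)) + ocoef a * (dcoef (a + b) * u (?s c) + ocoef (a + b) * u (?t (?s c))))
    + ocoef b * (dcoef (a + b) * (dcoef (- b) * u (?t c) + ocoef (- b) * u c) + ocoef (a + b) * (dcoef a * u (?s (?t c)) + ocoef a * u (?t (?s (?t c)))))"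
    by (simp add: top_def ax sw a_def[symmetric] b_def[symmetric])
  have 0: "dcoef a * dcoef b = dcoef (a + b) * (dcoef a + dcoef b - (q - 1))"
    by (rule dcoef_add[OF a b ab])
  have 1: "dcoef a * dcoef b + dcoef (a + b) * dcoef (- a) = dcoef b * dcoef (a + b)"
    and 2: "dcoef a * dcoef b + dcoef (a + b) * dcoef (- b) = dcoef a * dcoef (a + b)"
    unfolding 0 dcoef_neg[OF a] dcoef_neg[OF b] by (simp_all add: algebra_simps)
  have "dcoef a * (dcoef a * dcoef b) + dcoef (a + b) * (ocoef a * ocoef (- a)) =
    dcoef b * (dcoef a * dcoef b) + dcoef (a + b) * (ocoef b * ocoef (- b))"
    unfolding 0 ocoef_ocoef[OF a] ocoef_ocoef[OF b] dcoef_neg[OF a] dcoef_neg[OF b]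
    by (simp add: algebra_simps)
  then have 3: "dcoef a * (dcoef a * dcoef b) + dcoef (a + b) * (ocoef a * ocoef (- a)) -
    dcoef b * (dcoef a * dcoef b) - dcoef (a + b) * (ocoef b * ocoef (- b)) = 0" by simp
  \<comment> \<open>Among the six sequences in the orbit of \<open>c\<close> under the two swaps,
    three have visibly equal coefficients on both sides. The three brackets belong to
    \<open>c\<close> itself and to its two single swaps.\<close>
  have "top k (top ?j (top k u)) c - top ?j (top k (top ?j u)) c =
    (dcoef a * (dcoef a * dcoef b) + dcoef (a + b) * (ocoef a * ocoef (- a)) -
      dcoef b * (dcoef a * dcoef b) - dcoef (a + b) * (ocoef b * ocoef (- b))) * u c
    + ocoef a * u (?s c) * (dcoef a * dcoef b + dcoef (a + b) * dcoef (- a) - dcoef b * dcoef (a + b))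
    - ocoef b * u (?t c) * (dcoef a * dcoef b + dcoef (a + b) * dcoef (- b) - dcoef a * dcoef (a + b))"
    unfolding L R br by (simp add: algebra_simps)
  also have "\<dots> = 0" unfolding 1 2 3 by simp
  finally show "top k (top ?j (top k u)) c = top ?j (top k (top ?j u)) c" by simp
qed (use k in \<open>auto intro!: top_supported[OF C] u\<close>)

text \<open>The Jucys--Murphy elements, by the recursion \<open>q L\<^sub>k\<^sub>+\<^sub>1 = T\<^sub>k L\<^sub>k T\<^sub>k + T\<^sub>k\<close>.\<close>

primrec jm :: "nat \<Rightarrow> (int list \<Rightarrow> complex) \<Rightarrow> int list \<Rightarrow> complex" where
  "jm 0 u = (\<lambda>_. 0)"
| "jm (Suc k) u = (\<lambda>c. (top k (jm k (top k u)) c + top k u c) / q)"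

lemma jm_eigen:
  assumes C: "swap_closed n C" and k: "k < n" and u: "u \<in> supported C"
  shows "jm k u = (\<lambda>c. qint q (c ! k) * u c)"
  using k u
proof (induction k arbitrary: u)
  case 0
  have "qint q (c ! 0) * u c = 0" for c
    using C 0 by (cases "c \<in> C") (simp_all add: swap_closed_def supported_def)
  then show ?case by (simp only: jm.simps)
next
  case (Suc k)
  have tu: "top k u \<in> supported C" by (rule top_supported[OF C Suc.prems])
  have IH: "jm k (top k u) = (\<lambda>c. qint q (c ! k) * top k u c)" using Suc.IH[OF _ tu] Suc.prems by simp
  have "jm (Suc k) u c = qint q (c ! Suc k) * u c" if c: "c \<in> C" for c
  proof -
    define d x y where "d = axial c k" and "x = c ! k" and "y = c ! Suc k"
    have l: "length c = n" and d: "d \<noteq> 0" using c C Suc.prems by (auto simp: swap_closed_def d_def)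
    have n: "axial (swap_at k c) k = - d" "swap_at k (swap_at k c) = c" "swap_at k c ! k = y"
      using l Suc.prems by (auto simp: d_def y_def axial_swap_at swap_at_swap_at nth_swap_at)
    \<comment> \<open>This identity removes the off-diagonal term and at the same time reduces the
      diagonal one to \<open>q * qint q y\<close>. It rests on writing the difference of the two
      quantum contents as \<open>q powi x * qint q d\<close>.\<close>
    have key: "dcoef d * qint q x + qint q y * (q - 1 - dcoef d) + 1 = 0"
    proof -
      have "qint q y - qint q x = q powi x * qint q d"
        using qint_add[OF q0, of x d] by (simp add: d_def x_def y_def axial_def)
      moreover have "(q - 1) * qint q y + 1 = q powi x * q powi d"
        using powi_qint[OF q0, of y] q0 by (simp add: d_def x_def y_def axial_def power_int_diff)
      moreover have "dcoef d * (q powi x * qint q d) = q powi x * q powi d"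
        using qint_nz[OF d] by (simp add: dcoef_def)
      moreover have "dcoef d * qint q x + qint q y * (q - 1 - dcoef d) + 1 =
          ((q - 1) * qint q y + 1) - dcoef d * (qint q y - qint q x)" by (simp add: algebra_simps)
      ultimately show ?thesis by (simp only: diff_self)
    qed
    have "q * jm (Suc k) u c = dcoef d * (qint q x * (dcoef d * u c + ocoef d * u (swap_at k c))) +
        ocoef d * (qint q y * (dcoef (- d) * u (swap_at k c) + ocoef (- d) * u c)) +
        dcoef d * u c + ocoef d * u (swap_at k c)"
      using q0 by (simp add: IH, simp add: top_def n d_def[symmetric] x_def)
    also have "\<dots> = (dcoef d * (dcoef d * qint q x + 1) + qint q y * (ocoef d * ocoef (- d))) * u c +
       ocoef d * u (swap_at k c) * (dcoef d * qint q x + qint q y * dcoef (- d) + 1)"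
      by (simp add: algebra_simps)
    also have "\<dots> = (q * qint q y + dcoef d * (dcoef d * qint q x + qint q y * (q - 1 - dcoef d) + 1)) * u c +
       ocoef d * u (swap_at k c) * (dcoef d * qint q x + qint q y * (q - 1 - dcoef d) + 1)"
      unfolding ocoef_ocoef[OF d] dcoef_neg[OF d] by (simp add: algebra_simps)
    also have "\<dots> = q * qint q y * u c" unfolding key by simp
    finally show ?thesis using q0 by (simp add: y_def)
  qed
  moreover have "jm (Suc k) u \<in> supported C"
  proof -
    have "top k (jm k (top k u)) \<in> supported C"
      unfolding IH by (rule top_supported[OF C Suc.prems(1) supported_lin(2)[OF tu]])
    then show ?thesis using tu by (auto simp: supported_def)
  qed
  ultimately show ?case using supported_lin(2)[OF Suc.prems(2)] by (intro supported_eqI[of _ C]) auto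
qed

lemma qint_inj: "qint q a = qint q b \<Longrightarrow> a = b"
  using qint_add[OF q0, of b "a - b"] qint_nz[of "a - b"] q0 by auto

end

text \<open>Multiplication by \<open>m k - m k p1\<close> deletes \<open>p1\<close> from the support
  and keeps \<open>p0\<close> as soon as \<open>m k\<close> separates the two, so induction on the
  size of the support isolates \<open>p0\<close>. The index type is arbitrary because the lemma
  serves matrices, with pairs as indices, as well as vectors.\<close>

lemma interpolation:
  fixes U :: "('p \<Rightarrow> complex) set" and m :: "'k \<Rightarrow> 'p \<Rightarrow> complex"
  assumes add: "\<And>u v. u \<in> U \<Longrightarrow> v \<in> U \<Longrightarrow> (\<lambda>p. u p + v p) \<in> U"
    and scale: "\<And>u a. u \<in> U \<Longrightarrow> (\<lambda>p. a * u p) \<in> U"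
    and mult: "\<And>u k. u \<in> U \<Longrightarrow> k \<in> K \<Longrightarrow> (\<lambda>p. m k p * u p) \<in> U"
    and u: "u \<in> U" and fin: "finite {p. u p \<noteq> 0}" and p0: "u p0 \<noteq> 0"
    and sep: "\<And>p p'. \<lbrakk>u p \<noteq> 0; u p' \<noteq> 0; p \<noteq> p'\<rbrakk> \<Longrightarrow> \<exists>k\<in>K. m k p \<noteq> m k p'"
  shows "(\<lambda>p. if p = p0 then 1 else 0) \<in> U"
  using u fin p0 sep
proof (induction "card {p. u p \<noteq> 0}" arbitrary: u rule: less_induct)
  case less
  show ?case
  proof (cases "\<exists>p1. p1 \<noteq> p0 \<and> u p1 \<noteq> 0")
    case False
    then have "(\<lambda>p. if p = p0 then 1 else 0) = (\<lambda>p. (1 / u p0) * u p)"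
      using less.prems(3) by (auto simp: fun_eq_iff)
    then show ?thesis using scale[OF less.prems(1)] by (simp only:)
  next
    case True
    then obtain p1 where p1: "p1 \<noteq> p0" "u p1 \<noteq> 0" by blast
    then obtain k where k: "k \<in> K" "m k p0 \<noteq> m k p1" using less.prems by metis
    define v where "v = (\<lambda>p. m k p * u p + (- m k p1) * u p)"
    have vU: "v \<in> U" unfolding v_def by (intro add mult scale less.prems k)
    have v: "v p = (m k p - m k p1) * u p" for p by (simp add: v_def algebra_simps)
    have "{p. v p \<noteq> 0} \<subset> {p. u p \<noteq> 0}" using p1 by (auto simp: v)
    then have "card {p. v p \<noteq> 0} < card {p. u p \<noteq> 0}" "finite {p. v p \<noteq> 0}"
      using less.prems(2) by (auto intro: psubset_card_mono finite_subset)
    then show ?thesis using less.hyps[of v] vU k less.prems(3,4) by (simp add: v)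
  qed
qed

lemma sorted_word_unique:
  fixes v w :: "nat list"
  assumes "\<And>k. Suc k < n \<Longrightarrow> v ! k \<le> v ! Suc k" "\<And>k. Suc k < n \<Longrightarrow> w ! k \<le> w ! Suc k"
    and "length v = n" "length w = n" "count_list v = count_list w"
  shows "v = w"
proof -
  have "sorted v" "sorted w" using assms by (auto simp: sorted_iff_nth_Suc)
  moreover have "mset v = mset w"
    using assms(5) by (simp add: multiset_eq_iff count_list_eq_count_mset[symmetric])
  ultimately show ?thesis by (metis properties_for_sort)
qed

lemma swap_descent:
  assumes "w \<in> shape_words n \<nu>" "Suc k < n" "w ! Suc k < w ! k"
  shows "swap_at k w \<in> shape_words n \<nu>" "\<bar>axial (contents w) k\<bar> \<ge> 2"
    "contents (swap_at k w) = swap_at k (contents w)"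
  using yam_from_swap[OF part_fun_0, of w k] assms
  by (auto simp: shape_words_def yam_words_def count_list_swap_at)

text \<open>Swapping descents never leaves the shape and ends at the unique weakly increasing word,
  the tableau filled row by row. So any two tableaux of the shape are joined through it.\<close>

lemma shape_connected:
  assumes step: "\<And>w k. \<lbrakk>w \<in> shape_words n \<nu>; Suc k < n; w ! Suc k < w ! k\<rbrakk> \<Longrightarrow> w \<in> D \<longleftrightarrow> swap_at k w \<in> D"
    and v: "v \<in> shape_words n \<nu>" and w: "w \<in> shape_words n \<nu>"
  shows "v \<in> D \<longleftrightarrow> w \<in> D"
proof -
  have ex: "\<exists>w'. (w' \<in> shape_words n \<nu> \<and> (w \<in> D \<longleftrightarrow> w' \<in> D)) \<and> (\<forall>k\<in>{k. Suc k < n}. w' ! k \<le> w' ! Suc k)"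
    if "w \<in> shape_words n \<nu>" for w
    by (rule bubble_sort) (use that step swap_descent in \<open>auto simp: shape_words_def yam_words_def\<close>)
  obtain v' where v': "v' \<in> shape_words n \<nu>" "v \<in> D \<longleftrightarrow> v' \<in> D" "\<And>k. Suc k < n \<Longrightarrow> v' ! k \<le> v' ! Suc k"
    using ex[OF v] by auto
  obtain w' where w': "w' \<in> shape_words n \<nu>" "w \<in> D \<longleftrightarrow> w' \<in> D" "\<And>k. Suc k < n \<Longrightarrow> w' ! k \<le> w' ! Suc k"
    using ex[OF w] by auto
  have "v' = w'"
    using v'(1) w'(1) by (intro sorted_word_unique[of n] v'(3) w'(3)) (auto simp: shape_words_def yam_words_def)
  then show ?thesis using v' w' by simp
qed


section \<open>Representations of the Hecke algebra\<close>

definition descent :: "(nat \<Rightarrow> nat) \<Rightarrow> nat \<Rightarrow> bool" where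
  "descent w i \<longleftrightarrow> inv_into UNIV w (Suc i) < inv_into UNIV w i"

abbreviation simple_mult :: "nat \<Rightarrow> (nat \<Rightarrow> nat) \<Rightarrow> nat \<Rightarrow> nat" where
  "simple_mult i w \<equiv> transp i (Suc i) \<circ> w"

abbreviation word_perm :: "nat list \<Rightarrow> nat \<Rightarrow> nat" where
  "word_perm is \<equiv> foldr (\<lambda>i p. transp i (Suc i) \<circ> p) is id"

lemma simple_mult_twice [simp]: "simple_mult i (simple_mult i w) = w"
  by (auto simp: fun_eq_iff)

lemma descent_simple_mult:
  assumes "w \<in> perms n"
  shows "descent (simple_mult i w) j \<longleftrightarrow>
    inv_into UNIV w (transp i (Suc i) (Suc j)) < inv_into UNIV w (transp i (Suc i) j)"
  by (simp add: descent_def inv_transp_comp[OF assms])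

lemma inv_neq: "w \<in> perms n \<Longrightarrow> i \<noteq> j \<Longrightarrow> inv_into UNIV w i \<noteq> inv_into UNIV w j"
  using permutes_inverses(1)[of w] by (metis mem_Collect_eq)

lemma not_descent_iff:
  "w \<in> perms n \<Longrightarrow> \<not> descent w i \<longleftrightarrow> inv_into UNIV w i < inv_into UNIV w (Suc i)"
  using inv_neq[of w n i "Suc i"] by (auto simp: descent_def)

lemma perm_length_ascent:
  "\<lbrakk>w \<in> perms n; i \<in> {1..<n}; \<not> descent w i\<rbrakk> \<Longrightarrow> perm_length n (simple_mult i w) = Suc (perm_length n w)"
  using perm_length_transp_le not_descent_iff by blast

lemma descent_simple_mult_self:
  "w \<in> perms n \<Longrightarrow> descent (simple_mult i w) i \<longleftrightarrow> \<not> descent w i"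
  using not_descent_iff[of w n i] by (simp add: descent_simple_mult)

lemma perm_length_descent:
  assumes "w \<in> perms n" "i \<in> {1..<n}" "descent w i"
  shows "perm_length n w = Suc (perm_length n (simple_mult i w))"
  using perm_length_ascent[OF transp_comp_perms[OF assms(1,2)] assms(2)] assms
  by (simp add: descent_simple_mult_self)

lemma word_perm_Cons: "word_perm (i # is) = simple_mult i (word_perm is)"
  by (simp only: foldr.simps o_apply)

lemma word_perm_perms: "set is \<subseteq> {1..<n} \<Longrightarrow> word_perm is \<in> perms n"
proof (induction "is")
  case (Cons i "is")
  then show ?case using transp_comp_perms[of "word_perm is" n i]
    unfolding word_perm_Cons by (simp only: list.set insert_subset simp_thms)
qed (simp add: permutes_id)

lemma perm_length_word_perm: "set is \<subseteq> {1..<n} \<Longrightarrow> perm_length n (word_perm is) \<le> length is"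
proof (induction "is")
  case Nil
  have "{(a, b). 1 \<le> a \<and> a < b \<and> b \<le> n \<and> id b < id a} = {}" by auto
  then show ?case unfolding perm_length_def foldr.simps by (simp only: id_apply card.empty le0)
next
  case (Cons i "is")
  have w: "word_perm is \<in> perms n" using Cons.prems by (intro word_perm_perms) auto
  have "perm_length n (simple_mult i (word_perm is)) \<le> Suc (perm_length n (word_perm is))"
    using perm_length_ascent[OF w, of i] perm_length_descent[OF w, of i] Cons.prems by fastforce
  moreover have "perm_length n (word_perm is) \<le> length is" using Cons.prems by (intro Cons.IH) simp
  ultimately have "perm_length n (simple_mult i (word_perm is)) \<le> Suc (length is)" by linarith
  then show ?case unfolding word_perm_Cons list.size(4) by (simp only: add_0_right add_Suc_right One_nat_def)
qed

lemma reduced_word_perms: "reduced_word n w is \<Longrightarrow> w \<in> perms n"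
  unfolding reduced_word_def using word_perm_perms by blast

lemma reduced_word_Cons:
  assumes "reduced_word n w (i # is)"
  shows "i \<in> {1..<n}" "descent w i" "reduced_word n (simple_mult i w) is"
proof -
  have i: "i \<in> {1..<n}" "set is \<subseteq> {1..<n}" using assms by (auto simp: reduced_word_def)
  have w: "w \<in> perms n" using reduced_word_perms[OF assms] .
  have e: "simple_mult i w = word_perm is"
    using assms by (auto simp: reduced_word_def)
  have len: "Suc (length is) = perm_length n w" using assms by (auto simp: reduced_word_def)
  have "perm_length n (simple_mult i w) \<le> length is"
    unfolding e by (rule perm_length_word_perm[OF i(2)])
  then have d: "descent w i" using perm_length_ascent[OF w i(1)] len by fastforce
  then show "i \<in> {1..<n}" "descent w i" "reduced_word n (simple_mult i w) is"
    using perm_length_descent[OF w i(1) d] len e i by (auto simp: reduced_word_def)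
qed

lemma reduced_word_ConsI:
  assumes "w \<in> perms n" "i \<in> {1..<n}" "descent w i" "reduced_word n (simple_mult i w) is"
  shows "reduced_word n w (i # is)"
proof -
  have "word_perm is = simple_mult i w" using assms(4) by (simp add: reduced_word_def)
  then have "word_perm (i # is) = w" by (simp only: foldr.simps o_apply simple_mult_twice)
  then show ?thesis using assms perm_length_descent[OF assms(1-3)] unfolding reduced_word_def by simp
qed

lemma no_descent_id:
  assumes "w \<in> perms n" "\<And>i. i \<in> {1..<n} \<Longrightarrow> \<not> descent w i"
  shows "w = id"
proof -
  let ?v = "inv_into UNIV w"
  have wp: "w permutes {1..n}" using assms by simp
  have vp: "?v permutes {1..n}" using permutes_inv[OF wp] .
  have step: "?v i < ?v (Suc i)" if "i \<in> {1..<n}" for i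
    using assms not_descent_iff that by blast
  have up: "i \<le> ?v i" if "i \<in> {1..n}" for i
    using that
  proof (induction i)
    case (Suc i)
    show ?case
    proof (cases "i = 0")
      case True
      then show ?thesis using Suc.prems permutes_in_image[OF vp, of 1] by auto
    next
      case False
      then show ?thesis using Suc step[of i] by auto
    qed
  qed simp
  have down: "?v (n - k) \<le> n - k" if "k < n" for k
    using that
  proof (induction k)
    case 0
    then show ?case using permutes_in_image[OF vp, of n] by auto
  next
    case (Suc k)
    then have "Suc (n - Suc k) = n - k" "n - Suc k \<in> {1..<n}" by auto
    then show ?case using step[of "n - Suc k"] Suc by simp
  qed
  have "?v i = i" for i
  proof (cases "i \<in> {1..n}")
    case True
    then show ?thesis using up[of i] down[of "n - i"] by auto
  qed (use permutes_not_in[OF vp] in auto)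
  then have "?v = id" by auto
  then show ?thesis using permutes_inv_inv[OF wp] by (metis inv_id)
qed

lemma perm_length_id [simp]: "perm_length n id = 0"
  using perm_length_word_perm[of "[]" n] by simp

lemma reduced_word_exists: "w \<in> perms n \<Longrightarrow> \<exists>is. reduced_word n w is"
proof (induction "perm_length n w" arbitrary: w rule: less_induct)
  case less
  show ?case
  proof (cases "\<exists>i\<in>{1..<n}. descent w i")
    case True
    then obtain i where i: "i \<in> {1..<n}" "descent w i" by blast
    have "\<exists>is. reduced_word n (simple_mult i w) is"
      using less.hyps[of "simple_mult i w"] perm_length_descent[OF less.prems i]
        transp_comp_perms[OF less.prems i(1)] by simp
    then show ?thesis using reduced_word_ConsI[OF less.prems i] by blast
  next
    case False
    then have "w = id" using no_descent_id[OF less.prems] by blast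
    then have "reduced_word n w []" by (simp add: reduced_word_def)
    then show ?thesis by blast
  qed
qed

lemma reduced_word_some: "w \<in> perms n \<Longrightarrow> reduced_word n w (SOME is. reduced_word n w is)"
  using someI_ex[OF reduced_word_exists] .

text \<open>Exactly the relations that connect the reduced words of one permutation, required on the
  carrier \<open>A\<close> alone. For the seminormal modules this carrier is the space of functions
  supported on the index set.\<close>

locale braid_action =
  fixes n :: nat and A :: "'a set" and \<Theta> :: "nat \<Rightarrow> 'a \<Rightarrow> 'a"
  assumes closed: "\<And>i x. i \<in> {1..<n} \<Longrightarrow> x \<in> A \<Longrightarrow> \<Theta> i x \<in> A"
    and comm: "\<And>i j x. \<lbrakk>i \<in> {1..<n}; j \<in> {1..<n}; Suc i < j; x \<in> A\<rbrakk> \<Longrightarrow> \<Theta> i (\<Theta> j x) = \<Theta> j (\<Theta> i x)"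
    and braid: "\<And>i x. \<lbrakk>i \<in> {1..<n}; Suc i \<in> {1..<n}; x \<in> A\<rbrakk> \<Longrightarrow>
      \<Theta> i (\<Theta> (Suc i) (\<Theta> i x)) = \<Theta> (Suc i) (\<Theta> i (\<Theta> (Suc i) x))"
begin

lemma foldr_closed: "set is \<subseteq> {1..<n} \<Longrightarrow> x \<in> A \<Longrightarrow> foldr \<Theta> is x \<in> A"
  by (induction "is") (auto intro!: closed)

text \<open>If both i and j are descents, then the longest element of the subgroup generated by the
  two simple transpositions is a left factor of \<open>w\<close>. Its two reduced words, continued
  by a common word \<open>ks\<close>, begin with i and with j, and the commutation or braid relation
  identifies them.\<close>

lemma matsumoto_step:
  assumes w: "w \<in> perms n" and i: "i \<in> {1..<n}" "descent w i" and j: "j \<in> {1..<n}" "descent w j"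
    and ij: "i < j"
  shows "\<exists>ks ls. reduced_word n (simple_mult i w) ks \<and> reduced_word n (simple_mult j w) ls \<and>
    (\<forall>x\<in>A. \<Theta> i (foldr \<Theta> ks x) = \<Theta> j (foldr \<Theta> ls x))"
proof (cases "Suc i < j")
  case True
  have vi: "simple_mult i w \<in> perms n" and vj: "simple_mult j w \<in> perms n"
    using w i j transp_comp_perms by blast+
  have c: "simple_mult j (simple_mult i w) = simple_mult i (simple_mult j w)"
    using True by (auto simp: fun_eq_iff Transposition.transpose_def)
  have d: "descent (simple_mult i w) j" "descent (simple_mult j w) i"
    using True i j unfolding descent_simple_mult[OF w]
    by (auto simp: descent_def Transposition.transpose_def)
  obtain ks where ks: "reduced_word n (simple_mult j (simple_mult i w)) ks"
    using reduced_word_exists transp_comp_perms[OF vi j(1)] by blast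
  have "reduced_word n (simple_mult i w) (j # ks)" "reduced_word n (simple_mult j w) (i # ks)"
    using reduced_word_ConsI[OF vi j(1) d(1) ks] reduced_word_ConsI[OF vj i(1) d(2)] ks c by auto
  moreover have "set ks \<subseteq> {1..<n}" using ks by (simp add: reduced_word_def)
  ultimately show ?thesis using comm[OF i(1) j(1) True] foldr_closed
    by (intro exI[of _ "j # ks"] exI[of _ "i # ks"]) auto
next
  case False
  then have ji: "j = Suc i" using ij by simp
  let ?s = "simple_mult i" and ?t = "simple_mult (Suc i)"
  have j1: "Suc i \<in> {1..<n}" using j ji by simp
  have p: "?s w \<in> perms n" "?t w \<in> perms n" using w i(1) j1 transp_comp_perms by blast+
  then have p2: "?t (?s w) \<in> perms n" "?s (?t w) \<in> perms n" using i(1) j1 transp_comp_perms by blast+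
  then have p3: "?s (?t (?s w)) \<in> perms n" using i(1) transp_comp_perms by blast
  have c: "?s (?t (?s w)) = ?t (?s (?t w))"
    by (auto simp: fun_eq_iff Transposition.transpose_def)
  have lt: "inv_into UNIV w (Suc (Suc i)) < inv_into UNIV w (Suc i)" "inv_into UNIV w (Suc i) < inv_into UNIV w i"
    using i j ji by (auto simp: descent_def)
  have d: "descent (?s w) (Suc i)" "descent (?t (?s w)) i" "descent (?t w) i" "descent (?s (?t w)) (Suc i)"
    using lt by (auto simp: descent_simple_mult[OF p(1)] descent_simple_mult[OF p(2)] descent_simple_mult[OF w]
      inv_transp_comp[OF w] Transposition.transpose_def)
  obtain ks where ks: "reduced_word n (?s (?t (?s w))) ks"
    using reduced_word_exists p3 by blast
  have "reduced_word n (?s w) (Suc i # i # ks)"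
    using reduced_word_ConsI[OF p(1) j1 d(1) reduced_word_ConsI[OF p2(1) i(1) d(2) ks]] .
  moreover have "reduced_word n (?t w) (i # Suc i # ks)"
    using reduced_word_ConsI[OF p(2) i(1) d(3) reduced_word_ConsI[OF p2(2) j1 d(4)]] ks c by simp
  moreover have "set ks \<subseteq> {1..<n}" using ks by (simp add: reduced_word_def)
  ultimately show ?thesis using braid[OF i(1) j1] foldr_closed unfolding ji
    by (intro exI[of _ "Suc i # i # ks"] exI[of _ "i # Suc i # ks"]) auto
qed

text \<open>Two reduced words with different first letters are each compared with one of the words
  from \<open>matsumoto_step\<close>. They share a first letter with it, so the induction applies to
  the rest.\<close>

lemma matsumoto:
  assumes "reduced_word n w is" "reduced_word n w js" "x \<in> A"
  shows "foldr \<Theta> is x = foldr \<Theta> js x"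
  using assms(1,2)
proof (induction "length is" arbitrary: w "is" js rule: less_induct)
  case less
  have len: "length is = length js" using less.prems by (simp add: reduced_word_def)
  have w: "w \<in> perms n" using less.prems reduced_word_perms by blast
  show ?case
  proof (cases "is")
    case (Cons i is')
    then obtain j js' where js: "js = j # js'" using len by (cases js) auto
    note I = reduced_word_Cons[OF less.prems(1)[unfolded Cons]]
      and J = reduced_word_Cons[OF less.prems(2)[unfolded js]]
    have IH: "foldr \<Theta> is' x = foldr \<Theta> ks x" if "reduced_word n (simple_mult i w) ks" for ks
      using less.hyps[OF _ I(3) that] Cons by simp
    have JH: "foldr \<Theta> js' x = foldr \<Theta> ks x" if "reduced_word n (simple_mult j w) ks" for ks
      using less.hyps[OF _ J(3) that] js len Cons by simp
    consider "i = j" | "i < j" | "j < i" by linarith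
    then show ?thesis
    proof cases
      case 1
      then show ?thesis using IH J(3) Cons js by simp
    next
      case 2
      then show ?thesis using matsumoto_step[OF w I(1,2) J(1,2) 2] IH JH Cons js assms(3) by auto
    next
      case 3
      then show ?thesis using matsumoto_step[OF w J(1,2) I(1,2) 3] IH JH Cons js assms(3) by auto
    qed
  qed (use len in auto)
qed

definition act :: "(nat \<Rightarrow> nat) \<Rightarrow> 'a \<Rightarrow> 'a" where
  "act w = foldr \<Theta> (SOME is. reduced_word n w is)"

lemma act_closed: "w \<in> perms n \<Longrightarrow> x \<in> A \<Longrightarrow> act w x \<in> A"
  unfolding act_def using reduced_word_some[of w n] foldr_closed
  unfolding reduced_word_def[of n w "SOME is. reduced_word n w is"] by blast

lemma act_descent:
  assumes "w \<in> perms n" "i \<in> {1..<n}" "descent w i" "x \<in> A"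
  shows "act w x = \<Theta> i (act (simple_mult i w) x)"
proof -
  have v: "simple_mult i w \<in> perms n" using transp_comp_perms assms by blast
  have "foldr \<Theta> (SOME is. reduced_word n w is) x = foldr \<Theta> (i # (SOME is. reduced_word n (simple_mult i w) is)) x"
    by (rule matsumoto[OF reduced_word_some[OF assms(1)]
      reduced_word_ConsI[OF assms(1-3) reduced_word_some[OF v]] assms(4)])
  then show ?thesis by (simp add: act_def)
qed

lemma act_ascent:
  assumes "w \<in> perms n" "i \<in> {1..<n}" "\<not> descent w i" "x \<in> A"
  shows "act (simple_mult i w) x = \<Theta> i (act w x)"
  using act_descent[OF transp_comp_perms[OF assms(1,2)] assms(2) _ assms(4)] assms
  by (simp add: descent_simple_mult_self)

lemma act_id: "x \<in> A \<Longrightarrow> act id x = x"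
  unfolding act_def using reduced_word_some[of id n]
  unfolding reduced_word_def[of n id "SOME is. reduced_word n id is"] by (simp add: permutes_id)

end

section \<open>The Hecke algebra acting on seminormal modules\<close>

lemma finite_perms: "finite (perms n)"
  by (simp add: finite_permutations)

lemma hecke_gen_apply_descent:
  assumes "w \<in> perms n" "i \<in> {1..<n}"
  shows "hecke_gen n q i f w =
    (if descent w i then f (simple_mult i w) + (q - 1) * f w else q * f (simple_mult i w))"
  using hecke_gen_apply[OF assms] by (simp add: descent_def)

context quantum
begin

lemma braid_action_top:
  "swap_closed n C \<Longrightarrow> braid_action n (supported C) (\<lambda>i. top (i - 1))"
proof
  assume C: "swap_closed n C"
  show "top (i - 1) x \<in> supported C" if "i \<in> {1..<n}" "x \<in> supported C" for i x
    using top_supported[OF C, of "i - 1"] that by auto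
  show "top (i - 1) (top (j - 1) x) = top (j - 1) (top (i - 1) x)"
    if "i \<in> {1..<n}" "j \<in> {1..<n}" "Suc i < j" "x \<in> supported C" for i j x
    using top_comm[OF C, of "j - 1" "i - 1" x] that by auto
  show "top (i - 1) (top (Suc i - 1) (top (i - 1) x)) = top (Suc i - 1) (top (i - 1) (top (Suc i - 1) x))"
    if "i \<in> {1..<n}" "Suc i \<in> {1..<n}" "x \<in> supported C" for i x
    using top_braid[OF C, of "i - 1" x] that by (cases i) auto
qed

abbreviation tact :: "nat \<Rightarrow> (nat \<Rightarrow> nat) \<Rightarrow> (int list \<Rightarrow> complex) \<Rightarrow> int list \<Rightarrow> complex" where
  "tact n \<equiv> braid_action.act n (\<lambda>i. top (i - 1))"

definition rep :: "nat \<Rightarrow> ((nat \<Rightarrow> nat) \<Rightarrow> complex) \<Rightarrow> (int list \<Rightarrow> complex) \<Rightarrow> int list \<Rightarrow> complex" where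
  "rep n f u = (\<lambda>c. \<Sum>w\<in>perms n. f w * tact n w u c)"

lemma top_sum: "top k (\<lambda>c. \<Sum>w\<in>S. f w * X w c) = (\<lambda>c. \<Sum>w\<in>S. f w * top k (X w) c)"
  by (simp add: top_def fun_eq_iff sum_distrib_left sum.distrib algebra_simps)

lemma rep_supported:
  assumes C: "swap_closed n C" and u: "u \<in> supported C"
  shows "rep n f u \<in> supported C"
  using braid_action.act_closed[OF braid_action_top[OF C] _ u]
  by (auto simp: rep_def supported_def)

text \<open>Left multiplication by the simple transposition pairs the permutations that have the
  descent \<open>i\<close> with those that lack it. On each pair the two sides agree, where the
  longer element calls for the quadratic relation.\<close>

lemma rep_gen:
  assumes C: "swap_closed n C" and u: "u \<in> supported C" and i: "i \<in> {1..<n}"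
  shows "rep n (hecke_gen n q i f) u = top (i - 1) (rep n f u)"
proof
  fix c
  interpret braid_action n "supported C" "\<lambda>i. top (i - 1)" by (rule braid_action_top[OF C])
  let ?s = "simple_mult i" and ?h = "\<lambda>w. tact n w u"
  define D E where "D = {w \<in> perms n. descent w i}" and "E = {w \<in> perms n. \<not> descent w i}"
  have fin: "finite D" "finite E" using finite_perms[of n] by (auto simp: D_def E_def)
  have P: "perms n = D \<union> E" "D \<inter> E = {}" by (auto simp: D_def E_def)
  have hD: "?h w = top (i - 1) (?h (?s w))" if "w \<in> D" for w
    using act_descent[of w i u] that u i by (auto simp: D_def)
  have hE: "?h (?s w) = top (i - 1) (?h w)" if "w \<in> E" for w
    using act_ascent[of w i u] that u i by (auto simp: E_def)
  have DE: "?s w \<in> E" if "w \<in> D" for w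
    using that transp_comp_perms[of w n i] i descent_simple_mult_self[of w n i] by (auto simp: D_def E_def)
  have ED: "?s w \<in> D" if "w \<in> E" for w
    using that transp_comp_perms[of w n i] i descent_simple_mult_self[of w n i] by (auto simp: D_def E_def)
  have re: "(\<Sum>w\<in>D. g (?s w) w) = (\<Sum>w\<in>E. g w (?s w))" for g :: "(nat \<Rightarrow> nat) \<Rightarrow> (nat \<Rightarrow> nat) \<Rightarrow> complex"
    by (rule sum.reindex_bij_witness[of _ ?s ?s]) (auto intro: DE ED)
  have tD: "top (i - 1) (?h w) c = (q - 1) * ?h w c + q * ?h (?s w) c" if "w \<in> D" for w
  proof -
    have "?h (?s w) \<in> supported C" using DE[OF that] u act_closed by (auto simp: E_def)
    from top_quad[OF C _ this, of "i - 1"] show ?thesis using hD[OF that] i by auto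
  qed
  have "rep n (hecke_gen n q i f) u c =
      (\<Sum>w\<in>D. (f (?s w) + (q - 1) * f w) * ?h w c) + (\<Sum>w\<in>E. q * f (?s w) * ?h w c)"
    unfolding rep_def P(1) sum.union_disjoint[OF fin P(2)]
    by (intro arg_cong2[of _ _ _ _ "(+)"] sum.cong refl)
      (auto simp: D_def E_def hecke_gen_apply_descent[OF _ i])
  also have "\<dots> = (\<Sum>w\<in>D. f (?s w) * ?h w c) + (\<Sum>w\<in>D. (q - 1) * f w * ?h w c) + (\<Sum>w\<in>E. q * f (?s w) * ?h w c)"
    by (simp add: distrib_right sum.distrib)
  also have "(\<Sum>w\<in>E. q * f (?s w) * ?h w c) = (\<Sum>w\<in>D. q * f w * ?h (?s w) c)"
    using re[of "\<lambda>v w. q * f w * ?h v c"] by simp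
  also have "(\<Sum>w\<in>D. f (?s w) * ?h w c) = (\<Sum>w\<in>E. f w * ?h (?s w) c)"
    using re[of "\<lambda>v w. f v * ?h w c"] by simp
  also have "(\<Sum>w\<in>E. f w * ?h (?s w) c) + (\<Sum>w\<in>D. (q - 1) * f w * ?h w c) + (\<Sum>w\<in>D. q * f w * ?h (?s w) c) =
     (\<Sum>w\<in>E. f w * top (i - 1) (?h w) c) + (\<Sum>w\<in>D. f w * top (i - 1) (?h w) c)"
  proof -
    have "(\<Sum>w\<in>D. f w * top (i - 1) (?h w) c) = (\<Sum>w\<in>D. (q - 1) * f w * ?h w c) + (\<Sum>w\<in>D. q * f w * ?h (?s w) c)"
      unfolding sum.distrib[symmetric] by (intro sum.cong refl) (simp only: tD, simp add: algebra_simps)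
    moreover have "(\<Sum>w\<in>E. f w * ?h (?s w) c) = (\<Sum>w\<in>E. f w * top (i - 1) (?h w) c)"
      by (intro sum.cong refl) (simp only: hE)
    ultimately show ?thesis by simp
  qed
  also have "\<dots> = top (i - 1) (rep n f u) c"
    unfolding rep_def top_sum unfolding P(1) sum.union_disjoint[OF fin P(2)] by simp
  finally show "rep n (hecke_gen n q i f) u c = top (i - 1) (rep n f u) c" .
qed

definition hdelta :: "(nat \<Rightarrow> nat) \<Rightarrow> (nat \<Rightarrow> nat) \<Rightarrow> complex" where
  "hdelta w = (\<lambda>v. if v = w then 1 else 0)"

lemma rep_id:
  assumes C: "swap_closed n C" and u: "u \<in> supported C"
  shows "rep n (hdelta id) u = u"
proof -
  have "rep n (hdelta id) u = tact n id u"
    unfolding rep_def hdelta_def using finite_perms[of n] permutes_id[of "{1..n}"]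
    by (simp add: if_distrib[of "\<lambda>x. x * _"] sum.delta' cong: if_cong) 
  then show ?thesis using braid_action.act_id[OF braid_action_top[OF C] u] by simp
qed

lemma rep_lin:
  "rep n (f + g) u = (\<lambda>c. rep n f u c + rep n g u c)"
  "rep n (\<lambda>w. a * f w) u = (\<lambda>c. a * rep n f u c)"
  by (simp_all add: rep_def fun_eq_iff sum.distrib sum_distrib_left algebra_simps)

end

interpretation hv: vector_space hscale by (rule vector_space_hscale)

abbreviation delta :: "'a \<Rightarrow> 'a \<Rightarrow> complex" where
  "delta a \<equiv> \<lambda>p. if p = a then 1 else 0"

text \<open>Preimages of the unit functions are linearly independent. Since there are at least as
  many of them as elements in the spanning set \<open>B\<close>, they already span \<open>H\<close>,
  and on their span the map visibly has no kernel.\<close>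

lemma injective_by_dimension:
  fixes \<Psi> :: "((nat \<Rightarrow> nat) \<Rightarrow> complex) \<Rightarrow> 'p \<Rightarrow> complex"
  assumes add: "\<And>f g p. \<Psi> (f + g) p = \<Psi> f p + \<Psi> g p" and sc: "\<And>a f p. \<Psi> (hscale a f) p = a * \<Psi> f p"
    and B: "finite B" "H \<subseteq> hv.span B" "card B \<le> card P" and P: "finite P"
    and surj: "\<And>p. p \<in> P \<Longrightarrow> \<exists>g\<in>H. \<Psi> g = delta p"
    and f: "f \<in> H" "\<And>p. \<Psi> f p = 0"
  shows "f = 0"
proof -
  obtain g where g: "\<And>p. p \<in> P \<Longrightarrow> g p \<in> H" "\<And>p. p \<in> P \<Longrightarrow> \<Psi> (g p) = delta p"
    using surj by metis
  have z: "(0 :: (nat \<Rightarrow> nat) \<Rightarrow> complex) = (\<lambda>_. 0)" by (rule ext) simp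
  have zero': "\<Psi> (\<lambda>_. 0) p = 0" for p using sc[of 0 "\<lambda>_. 0" p] by simp
  then have zero: "\<Psi> 0 p = 0" for p unfolding z .
  have sum: "\<Psi> (\<Sum>x\<in>S. hscale (a x) x) p = (\<Sum>x\<in>S. a x * \<Psi> x p)" if "finite S" for S a p
    using that by (induction S rule: finite_induct) (auto simp: zero zero' add sc simp del: plus_fun_apply)
  have inj: "inj_on g P"
  proof
    fix p p' assume "p \<in> P" "p' \<in> P" "g p = g p'"
    then have "delta p p = delta p' p" using g(2) by metis
    then show "p = p'" by (simp split: if_splits)
  qed
  have key: "(\<Sum>x\<in>g ` P. a x * \<Psi> x p) = a (g p)" if p: "p \<in> P" for a p
  proof -
    have "(\<Sum>x\<in>g ` P. a x * \<Psi> x p) = (\<Sum>p'\<in>P. a (g p') * \<Psi> (g p') p)"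
      by (simp add: sum.reindex[OF inj])
    also have "\<dots> = (\<Sum>p'\<in>P. if p' = p then a (g p') else 0)"
      by (intro sum.cong) (auto simp: g(2))
    finally show ?thesis using p P by simp
  qed
  have ind: "hv.independent (g ` P)"
  proof (rule hv.independent_if_scalars_zero)
    fix a x assume s: "(\<Sum>x\<in>g ` P. hscale (a x) x) = 0" and "x \<in> g ` P"
    then obtain p where p: "p \<in> P" "x = g p" by blast
    have "\<Psi> (\<Sum>x\<in>g ` P. hscale (a x) x) p = a x"
      using key[OF p(1)] P p(2) by (simp only: sum finite_imageI)
    then show "a x = 0" by (simp only: s zero)
  qed (use P in simp)
  have "f \<in> hv.span (g ` P)"
  proof (rule ccontr)
    assume nf: "f \<notin> hv.span (g ` P)"
    then have "f \<notin> g ` P" using hv.span_base by blast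
    moreover have "hv.independent (insert f (g ` P))" using hv.independent_insertI[OF nf ind] .
    moreover have "insert f (g ` P) \<subseteq> hv.span B" using f(1) g(1) B(2) by blast
    ultimately have "card (insert f (g ` P)) \<le> card B" using hv.independent_span_bound[OF B(1)] by blast
    then show False using \<open>f \<notin> g ` P\<close> P B(3) by (simp add: card_image[OF inj])
  qed
  then obtain a where a: "f = (\<Sum>x\<in>g ` P. hscale (a x) x)"
    using hv.span_finite[of "g ` P"] P by auto
  have "a (g p) = 0" if "p \<in> P" for p
    using f(2)[of p] key[OF that] P unfolding a by (simp only: sum finite_imageI)
  then have "hscale (a x) x = 0" if "x \<in> g ` P" for x using that by (auto simp: fun_eq_iff)
  then show ?thesis unfolding a by (rule sum.neutral[OF ballI])
qed

lemma sum_apply: "(\<Sum>x\<in>S. f x) y = (\<Sum>x\<in>S. f x y)"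
  for f :: "'x \<Rightarrow> 'y \<Rightarrow> 'z::comm_monoid_add"
  by (induction S rule: infinite_finite_induct) auto

lemma hecke_space_span: "hecke_space n \<subseteq> hv.span (delta ` perms n)"
proof
  fix f assume f: "f \<in> hecke_space n"
  have "f = (\<Sum>w\<in>perms n. hscale (f w) (delta w))"
  proof
    fix v
    have "(\<Sum>w\<in>perms n. hscale (f w) (delta w)) v = (\<Sum>w\<in>perms n. if w = v then f w else 0)"
      by (auto simp: sum_apply intro!: sum.cong)
    also have "\<dots> = f v" using f finite_perms[of n] by (auto simp: hecke_space_def)
    finally show "f v = (\<Sum>w\<in>perms n. hscale (f w) (delta w)) v" by simp
  qed
  also have "\<dots> \<in> hv.span (delta ` perms n)"
    by (intro hv.span_sum hv.span_scale hv.span_base) auto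
  finally show "f \<in> hv.span (delta ` perms n)" .
qed

context quantum
begin

lemma top_lin:
  "top k (\<lambda>c. u c + v c) = (\<lambda>c. top k u c + top k v c)"
  "top k (\<lambda>c. a * u c) = (\<lambda>c. a * top k u c)"
  by (simp_all add: top_def fun_eq_iff algebra_simps)

lemma top_delta:
  assumes "Suc k < length c" "axial c k \<noteq> 0"
  shows "top k (delta c) = (\<lambda>c'. dcoef (axial c k) * delta c c' + ocoef (- axial c k) * delta (swap_at k c) c')"
proof
  fix c'
  have "swap_at k c ! k \<noteq> c ! k" using assms by (simp add: nth_swap_at axial_def)
  then have "swap_at k c \<noteq> c" by auto
  moreover have "swap_at k c' = c \<longleftrightarrow> c' = swap_at k c"
    using assms(1) swap_at_swap_at[of k c'] swap_at_swap_at[of k c] by auto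
  ultimately show "top k (delta c) c' = dcoef (axial c k) * delta c c' + ocoef (- axial c k) * delta (swap_at k c) c'"
    using assms(1) by (auto simp: top_def axial_swap_at)
qed

text \<open>Applying \<open>top k\<close> to a unit vector and subtracting the diagonal part leaves
  a nonzero multiple of the swapped unit vector. The second index is a spectator: it numbers matrix
  columns in \<open>rep_faithful\<close> and is trivial in \<open>submodule_all\<close>.\<close>

lemma delta_swap:
  fixes U :: "(int list \<times> 'b \<Rightarrow> complex) set"
  assumes add: "\<And>u v. u \<in> U \<Longrightarrow> v \<in> U \<Longrightarrow> (\<lambda>p. u p + v p) \<in> U"
    and scale: "\<And>u a. u \<in> U \<Longrightarrow> (\<lambda>p. a * u p) \<in> U"
    and top: "\<And>u k. u \<in> U \<Longrightarrow> Suc k < n \<Longrightarrow> (\<lambda>(c, t). top k (\<lambda>c. u (c, t)) c) \<in> U"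
    and w: "w \<in> shape_words n \<nu>" and k: "Suc k < n" "\<bar>axial (contents w) k\<bar> \<ge> 2"
    and d: "delta (contents w, t) \<in> U"
  shows "delta (swap_at k (contents w), t) \<in> U"
proof -
  let ?c = "contents w" and ?d = "axial (contents w) k"
  have l: "length ?c = n" using w by (simp add: shape_words_def yam_words_def)
  have "(\<lambda>(c, t'). top k (\<lambda>c. delta (?c, t) (c, t')) c) =
      (\<lambda>p. dcoef ?d * delta (?c, t) p + ocoef (- ?d) * delta (swap_at k ?c, t) p)"
  proof
    fix p :: "int list \<times> 'b"
    obtain c t' where p: "p = (c, t')" by fastforce
    show "(\<lambda>(c, t'). top k (\<lambda>c. delta (?c, t) (c, t')) c) p =
      dcoef ?d * delta (?c, t) p + ocoef (- ?d) * delta (swap_at k ?c, t) p"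
    proof (cases "t' = t")
      case True
      then show ?thesis using fun_cong[OF top_delta[of k ?c], of c] k l by (auto simp: p)
    qed (simp add: p top_def)
  qed
  then have "(\<lambda>p. dcoef ?d * delta (?c, t) p + ocoef (- ?d) * delta (swap_at k ?c, t) p) \<in> U"
    using top[OF d k(1)] by simp
  from scale[OF add[OF this scale[OF d, of "- dcoef ?d"]], of "1 / ocoef (- ?d)"]
  show ?thesis using ocoef_nz[of "- ?d"] k(2) by (simp add: algebra_simps)
qed

lemma delta_connected:
  fixes U :: "(int list \<times> 'b \<Rightarrow> complex) set"
  assumes add: "\<And>u v. u \<in> U \<Longrightarrow> v \<in> U \<Longrightarrow> (\<lambda>p. u p + v p) \<in> U"
    and scale: "\<And>u a. u \<in> U \<Longrightarrow> (\<lambda>p. a * u p) \<in> U"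
    and top: "\<And>u k. u \<in> U \<Longrightarrow> Suc k < n \<Longrightarrow> (\<lambda>(c, t). top k (\<lambda>c. u (c, t)) c) \<in> U"
    and v: "v \<in> shape_words n \<nu>" and w: "w \<in> shape_words n \<nu>"
    and d: "delta (contents v, t) \<in> U"
  shows "delta (contents w, t) \<in> U"
proof -
  have "v \<in> {w. delta (contents w, t) \<in> U} \<longleftrightarrow> w \<in> {w. delta (contents w, t) \<in> U}"
  proof (rule shape_connected[OF _ v w])
    fix w k assume w: "w \<in> shape_words n \<nu>" "Suc k < n" "w ! Suc k < w ! k"
    note s = swap_descent[OF w]
    have l: "length w = n" using w by (simp add: shape_words_def yam_words_def)
    have b: "\<bar>axial (contents (swap_at k w)) k\<bar> \<ge> 2"
      unfolding s(3) using s(2) w(2) l by (simp add: axial_swap_at)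
    have "swap_at k (swap_at k (contents w)) = contents w" using w(2) l by (simp add: swap_at_swap_at)
    then show "w \<in> {w. delta (contents w, t) \<in> U} \<longleftrightarrow> swap_at k w \<in> {w. delta (contents w, t) \<in> U}"
      using delta_swap[OF add scale top w(1,2) s(2), of t]
        delta_swap[OF add scale top s(1) w(2) b, of t]
      unfolding s(3) mem_Collect_eq by metis
  qed
  then show ?thesis using d by simp
qed

abbreviation "all_contents n \<equiv> contents ` yam_words n"

text \<open>The image of the algebra in the seminormal modules contains a basis of matrix units, whose
  number is the dimension of the algebra.\<close>

lemma rep_faithful:
  assumes f: "f \<in> hecke_space n" and z: "\<And>T. T \<in> all_contents n \<Longrightarrow> rep n f (delta T) = (\<lambda>_. 0)"
  shows "f = 0"
proof -
  let ?Y = "all_contents n"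
  define \<Psi> :: "((nat \<Rightarrow> nat) \<Rightarrow> complex) \<Rightarrow> int list \<times> int list \<Rightarrow> complex" where
    "\<Psi> = (\<lambda>g (c, T). if T \<in> ?Y then rep n g (delta T) c else 0)"
  define U where "U = \<Psi> ` hecke_space n"
  \<comment> \<open>The swaps reach only tableaux of the same shape, so these are the positions of
    the matrix units to be found; there are n! of them.\<close>
  define P where "P = (\<lambda>(v, w). (contents w, contents v)) ` (SIGMA w : yam_words n. shape_words n (count_list w))"
  have C: "swap_closed n ?Y" by (rule swap_closed_yam)
  have dY: "delta T \<in> supported ?Y" if "T \<in> ?Y" for T using that by (auto simp: supported_def)
  have add: "\<Psi> (f + g) p = \<Psi> f p + \<Psi> g p" for f g p
    by (auto simp: \<Psi>_def rep_lin split: prod.splits)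
  have sc: "\<Psi> (hscale a f) p = a * \<Psi> f p" for a f p
    by (auto simp: \<Psi>_def rep_lin split: prod.splits)
  have Uadd: "(\<lambda>p. u p + v p) \<in> U" if uv: "u \<in> U" "v \<in> U" for u v
  proof -
    obtain g h where "u = \<Psi> g" "v = \<Psi> h" "g \<in> hecke_space n" "h \<in> hecke_space n" using uv by (auto simp: U_def)
    then show ?thesis unfolding U_def
      by (intro image_eqI[of _ _ "g + h"]) (auto simp: add hecke_space_def simp del: plus_fun_apply, auto)
  qed
  have Uscale: "(\<lambda>p. a * u p) \<in> U" if u: "u \<in> U" for a u
  proof -
    obtain g where "u = \<Psi> g" "g \<in> hecke_space n" using u by (auto simp: U_def)
    then show ?thesis unfolding U_def
      by (intro image_eqI[of _ _ "hscale a g"]) (auto simp: sc hecke_space_def)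
  qed
  have Utop: "(\<lambda>(c, t). top k (\<lambda>c. u (c, t)) c) \<in> U" if u: "u \<in> U" "Suc k < n" for u k
  proof -
    obtain g where g: "u = \<Psi> g" "g \<in> hecke_space n" using u by (auto simp: U_def)
    have "\<Psi> (hecke_gen n q (Suc k) g) = (\<lambda>(c, t). top k (\<lambda>c. u (c, t)) c)"
      using rep_gen[OF C dY, of _ "Suc k"] u(2) by (auto simp: \<Psi>_def g(1) fun_eq_iff top_def)
    then show ?thesis using hecke_gen_space[OF g(2), of "Suc k" q] u(2) unfolding U_def by (metis atLeastLessThan_iff image_eqI le_add1 plus_1_eq_Suc)
  qed
  have Ujm: "(\<lambda>(c, t). jm k (\<lambda>c. u (c, t)) c) \<in> U" if "u \<in> U" "k < n" for u k
    using that
  proof (induction k arbitrary: u)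
    case 0
    then show ?case using Uscale[of u 0] by (simp add: case_prod_unfold)
  next
    case (Suc k)
    have t: "(\<lambda>(c, t). top k (\<lambda>c. u (c, t)) c) \<in> U" using Utop Suc.prems by simp
    have "(\<lambda>(c, t). jm k (top k (\<lambda>c. u (c, t))) c) \<in> U" using Suc.IH[OF t] Suc.prems by simp
    from Utop[OF this Suc.prems(2)]
    have "(\<lambda>(c, t). top k (jm k (top k (\<lambda>c. u (c, t)))) c) \<in> U" by simp
    from Uscale[OF Uadd[OF this t], of "1 / q"] show ?case by (simp add: case_prod_unfold)
  qed
  have Umult: "(\<lambda>p. qint q (fst p ! k) * u p) \<in> U" if u: "u \<in> U" "k \<in> {..<n}" for u k
  proof -
    obtain g where g: "u = \<Psi> g" using u by (auto simp: U_def)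
    have "(\<lambda>c. u (c, t)) \<in> supported ?Y" for t
      using rep_supported[OF C dY] by (auto simp: g \<Psi>_def supported_def)
    then have "(\<lambda>(c, t). jm k (\<lambda>c. u (c, t)) c) = (\<lambda>p. qint q (fst p ! k) * u p)"
      using jm_eigen[OF C, of k] u(2) by (auto simp: fun_eq_iff)
    then show ?thesis using Ujm[OF u(1), of k] u(2) by (simp only: lessThan_iff)
  qed
  have u0: "\<Psi> (hdelta id) = (\<lambda>(c, t). if c = t \<and> t \<in> ?Y then 1 else 0)"
    using rep_id[OF C dY] by (auto simp: \<Psi>_def fun_eq_iff)
  have hd: "hdelta id \<in> hecke_space n" by (auto simp: hecke_space_def hdelta_def permutes_id)
  \<comment> \<open>The unit of the algebra acts as the identity matrix, and the eigenvalues of the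
    Jucys--Murphy elements tell its diagonal entries apart.\<close>
  have diag: "delta (T, T) \<in> U" if T: "T \<in> ?Y" for T
  proof (rule interpolation[where m = "\<lambda>k p. qint q (fst p ! k)" and K = "{..<n}" and u = "\<Psi> (hdelta id)"])
    show "\<Psi> (hdelta id) \<in> U" using hd by (simp add: U_def)
    show "finite {p. \<Psi> (hdelta id) p \<noteq> 0}"
      by (rule finite_subset[of _ "(\<lambda>t. (t, t)) ` ?Y"]) (auto simp: u0 finite_yam_words split: if_splits)
    show "\<Psi> (hdelta id) (T, T) \<noteq> 0" using T by (simp add: u0)
    fix p p' assume "\<Psi> (hdelta id) p \<noteq> 0" "\<Psi> (hdelta id) p' \<noteq> 0" "p \<noteq> p'"
    then obtain s t where st: "p = (s, s)" "p' = (t, t)" "s \<in> ?Y" "t \<in> ?Y" "s \<noteq> t"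
      by (auto simp: u0 split: prod.splits if_splits)
    then have "length s = n" "length t = n" by (auto simp: yam_words_def)
    then obtain k where "k < n" "s ! k \<noteq> t ! k" using st(5) nth_equalityI by metis
    then show "\<exists>k\<in>{..<n}. qint q (fst p ! k) \<noteq> qint q (fst p' ! k)" using st qint_inj by auto
  qed (use Uadd Uscale Umult in auto)
  have surj: "\<exists>g\<in>hecke_space n. \<Psi> g = delta p" if "p \<in> P" for p
  proof -
    obtain v w where vw: "p = (contents w, contents v)" "v \<in> yam_words n" "w \<in> shape_words n (count_list v)"
      using \<open>p \<in> P\<close> by (auto simp: P_def)
    have "v \<in> shape_words n (count_list v)" using vw(2) by (simp add: shape_words_def)
    then have "delta p \<in> U"
      unfolding vw(1) using vw(2,3) delta_connected[OF Uadd Uscale Utop _ vw(3) diag] by blast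
    then show ?thesis by (auto simp: U_def)
  qed
  have "card (delta ` perms n :: ((nat \<Rightarrow> nat) \<Rightarrow> complex) set) \<le> card (perms n)"
    by (rule card_image_le[OF finite_perms])
  also have "card (perms n) = fact n" using card_permutations[of "{1..n}" n] by simp
  also have "fact n = card P"
  proof -
    have "inj_on (\<lambda>(v, w). (contents w, contents v)) (SIGMA w : yam_words n. shape_words n (count_list w))"
      using contents_from_inj[OF part_fun_0] by (auto simp: inj_on_def shape_words_def yam_words_def)
    then show ?thesis unfolding P_def card_same_shape[symmetric] by (simp add: card_image)
  qed
  finally have card: "card (delta ` perms n :: ((nat \<Rightarrow> nat) \<Rightarrow> complex) set) \<le> card P" .
  show ?thesis
  proof (rule injective_by_dimension[OF add sc _ hecke_space_span card _ surj f])
    show "finite P" unfolding P_def by (intro finite_imageI finite_SigmaI finite_yam_words finite_shape_words)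
    show "\<Psi> f p = 0" for p using z by (auto simp: \<Psi>_def split: prod.splits)
  qed (use finite_perms in auto)
qed

end


section \<open>Specht modules\<close>

definition part_shape :: "nat list \<Rightarrow> nat \<Rightarrow> nat" where
  "part_shape \<tau> r = (if r < length \<tau> then \<tau> ! r else 0)"

text \<open>Positions, counted from 0, whose successor lies in the same block. The generator with
  index k + 1 then belongs to the parabolic subalgebra of \<open>\<mu>\<close>.\<close>

definition block_pos :: "nat list \<Rightarrow> nat set" where
  "block_pos \<mu> = {k. \<exists>j<length \<mu>. sum_list (take j \<mu>) \<le> k \<and> Suc k < sum_list (take (Suc j) \<mu>)}"

lemma sum_list_take_Suc: "j < length \<mu> \<Longrightarrow> sum_list (take (Suc j) \<mu>) = sum_list (take j \<mu>) + (\<mu> ! j :: nat)"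
  by (simp add: take_Suc_conv_app_nth)

lemma sum_list_take_mono: "i \<le> j \<Longrightarrow> sum_list (take i \<mu>) \<le> sum_list (take j (\<mu> :: nat list))"
  by (metis le_add_diff_inverse le_add1 sum_list_append take_add)

lemma sum_list_take_le: "sum_list (take j \<mu>) \<le> sum_list (\<mu> :: nat list)"
  by (metis append_take_drop_id le_add1 sum_list_append)

lemma block_pos_less: "k \<in> block_pos \<mu> \<Longrightarrow> Suc k < sum_list \<mu>"
  unfolding block_pos_def using sum_list_take_le order_less_le_trans by blast

lemma block_append:
  assumes "length w = sum_list \<mu>" "j < length \<mu>"
  defines "b \<equiv> take (\<mu> ! j) (drop (sum_list (take j \<mu>)) w)"
  shows "take (sum_list (take (Suc j) \<mu>)) w = take (sum_list (take j \<mu>)) w @ b"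
    "length b = \<mu> ! j" "\<And>i. i < \<mu> ! j \<Longrightarrow> b ! i = w ! (sum_list (take j \<mu>) + i)"
proof -
  have "sum_list (take j \<mu>) + \<mu> ! j \<le> length w"
    using sum_list_take_le[of "Suc j" \<mu>] assms by (simp add: sum_list_take_Suc)
  then show "take (sum_list (take (Suc j) \<mu>)) w = take (sum_list (take j \<mu>)) w @ b"
    "length b = \<mu> ! j" "\<And>i. i < \<mu> ! j \<Longrightarrow> b ! i = w ! (sum_list (take j \<mu>) + i)"
    using assms(2) by (auto simp: b_def sum_list_take_Suc take_add)
qed

lemma block_strict:
  assumes "length w = sum_list \<mu>" "j < length \<mu>" "\<And>k. k \<in> block_pos \<mu> \<Longrightarrow> w ! k < (w ! Suc k :: nat)"
  shows "sorted_wrt (<) (take (\<mu> ! j) (drop (sum_list (take j \<mu>)) w))"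
proof (subst sorted_wrt_iff_nth_Suc_transp)
  let ?p = "sum_list (take j \<mu>)"
  have "w ! (?p + i) < w ! Suc (?p + i)" if "Suc i < \<mu> ! j" for i
    using that assms(2) by (intro assms(3)) (auto simp: sum_list_take_Suc block_pos_def)
  then show "\<forall>i. Suc i < length (take (\<mu> ! j) (drop ?p w)) \<longrightarrow>
    take (\<mu> ! j) (drop ?p w) ! i < take (\<mu> ! j) (drop ?p w) ! Suc i"
    using block_append[OF assms(1,2)] by auto
qed simp

text \<open>A block with strictly increasing rows is a vertical strip and meets each row at most
  once.\<close>

lemma vertical_count:
  assumes len: "length w = sum_list \<mu>" and inc: "\<And>k. k \<in> block_pos \<mu> \<Longrightarrow> w ! k < (w ! Suc k :: nat)"
    and j: "j \<le> length \<mu>"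
  shows "count_list (take (sum_list (take j \<mu>)) w) r \<le> j"
  using j
proof (induction j)
  case (Suc j)
  let ?b = "take (\<mu> ! j) (drop (sum_list (take j \<mu>)) w)"
  have "distinct ?b"
    using block_strict[OF len _ inc, of j] Suc.prems strict_sorted_iff by (auto simp: strict_sorted_iff)
  then have "count_list ?b r \<le> 1" by (simp add: distinct_count_atmost_1 count_list_eq_count_mset)
  then show ?case using Suc block_append(1)[OF len, of j] by simp
qed simp

text \<open>The first letter of a block can exceed the rows used so far by at most one, because its
  box must be addable; the later letters of the block are no larger. So each block opens at most one
  new row.\<close>

lemma horizontal_less:
  assumes y: "yam w" and len: "length w = sum_list \<mu>"
    and dec: "\<And>k. k \<in> block_pos \<mu> \<Longrightarrow> w ! Suc k \<le> w ! k"
    and j: "j \<le> length \<mu>"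
  shows "x \<in> set (take (sum_list (take j \<mu>)) w) \<Longrightarrow> x < j"
  using j
proof (induction j arbitrary: x)
  case (Suc j)
  let ?p = "sum_list (take j \<mu>)"
  let ?b = "take (\<mu> ! j) (drop ?p w)"
  have jl: "j < length \<mu>" using Suc.prems by simp
  note ba = block_append[OF len jl]
  show ?case
  proof (cases "x \<in> set (take ?p w)")
    case True
    then show ?thesis using Suc.IH[of x] Suc.prems by simp
  next
    case False
    then have "x \<in> set ?b" using Suc.prems(1) unfolding ba(1) by simp
    then obtain i where i: "i < \<mu> ! j" "x = ?b ! i" using ba(2) by (metis in_set_conv_nth)
    have mono: "?b ! i \<le> ?b ! 0" if "i < \<mu> ! j" for i
      using that
    proof (induction i)
      case (Suc i)
      have "?p + i \<in> block_pos \<mu>" using Suc.prems jl by (auto simp: block_pos_def sum_list_take_Suc)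
      from dec[OF this] have "?b ! Suc i \<le> ?b ! i" using Suc.prems ba(3) by simp
      then show ?case using Suc by simp
    qed simp
    have "yam (take ?p w @ drop ?p w)" using y by simp
    then have "yam_from (count_list (take ?p w)) (drop ?p w)" unfolding yam_from_append by simp
    moreover have "drop ?p w = ?b ! 0 # tl (drop ?p w)"
      using i ba(2) by (cases "drop ?p w") auto
    ultimately have "addable (count_list (take ?p w)) (?b ! 0)"
      by (metis yam_from.simps(2))
    then have "?b ! 0 = 0 \<or> count_list (take ?p w) (?b ! 0 - 1) \<noteq> 0" by (auto simp: addable_def)
    then have "?b ! 0 \<le> j" using Suc.IH[of "?b ! 0 - 1"] jl by (auto simp: count_list_0_iff)
    then show ?thesis using mono[OF i(1)] i(2) by simp
  qed
qed simp

lemma sum_count_list: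
  fixes w :: "nat list"
  assumes "set w \<subseteq> {..<N}"
  shows "(\<Sum>r<N. count_list w r) = length w"
  using sum_count_set[OF assms finite_lessThan] .

text \<open>The sum of \<open>min (a r) k\<close> counts the boxes in the first k columns, so the
  two families of inequalities express dominance in opposite directions. Row by row: the partial row
  sums give \<open>b s \<le> a s\<close>, and truncation at \<open>b s\<close>, which does not
  affect the rows of \<open>b\<close> from s on, shows that \<open>a s\<close> is no longer.\<close>

lemma dominance_antisym:
  fixes a b :: "nat \<Rightarrow> nat"
  assumes "\<And>r. r \<ge> N \<Longrightarrow> a r = 0" "\<And>r. r \<ge> N \<Longrightarrow> b r = 0"
    and tot: "(\<Sum>r<N. a r) = (\<Sum>r<N. b r)"
    and A: "\<And>k. (\<Sum>r<N. min (b r) k) \<le> (\<Sum>r<N. min (a r) k)"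
    and B: "\<And>k. k \<le> N \<Longrightarrow> (\<Sum>r<k. b r) \<le> (\<Sum>r<k. a r)"
    and anti: "\<And>r s. r \<le> s \<Longrightarrow> b s \<le> b r"
  shows "a = b"
proof
  fix s
  show "a s = b s"
  proof (induction s rule: less_induct)
    case (less s)
    show ?case
    proof (cases "s < N")
      case True
      have eq: "(\<Sum>r<s. f (a r)) = (\<Sum>r<s. f (b r))" for f :: "nat \<Rightarrow> nat" using less by simp
      have "b s \<le> a s" using B[of "Suc s"] True eq[of "\<lambda>x. x"] by simp
      have split: "(\<Sum>r<N. f r) = (\<Sum>r<s. f r) + (\<Sum>r\<in>{s..<N}. f r)" for f :: "nat \<Rightarrow> nat"
        using True by (metis atLeast0LessThan less_imp_le_nat sum.atLeastLessThan_concat zero_le)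
      have "(\<Sum>r\<in>{s..<N}. b r) = (\<Sum>r\<in>{s..<N}. min (b r) (b s))"
        using anti by (intro sum.cong) auto
      also have "\<dots> \<le> (\<Sum>r\<in>{s..<N}. min (a r) (b s))"
        using A[of "b s"] eq[of "\<lambda>x. min x (b s)"] unfolding split[of "\<lambda>r. min (b r) (b s)"] split[of "\<lambda>r. min (a r) (b s)"] by simp
      finally have 1: "(\<Sum>r\<in>{s..<N}. a r) \<le> (\<Sum>r\<in>{s..<N}. min (a r) (b s))"
        using tot eq[of "\<lambda>x. x"] unfolding split[of a] split[of b] by simp
      have "min (a s) (b s) \<ge> a s"
      proof (rule ccontr)
        assume "\<not> a s \<le> min (a s) (b s)"
        then have "(\<Sum>r\<in>{s..<N}. min (a r) (b s)) < (\<Sum>r\<in>{s..<N}. a r)"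
          using True by (intro sum_strict_mono_ex1) (auto intro!: bexI[of _ s])
        then show False using 1 by simp
      qed
      then show ?thesis using \<open>b s \<le> a s\<close> by simp
    qed (use assms in auto)
  qed
qed

lemma part_shape_anti: "is_partition n \<tau> \<Longrightarrow> r \<le> s \<Longrightarrow> part_shape \<tau> s \<le> part_shape \<tau> r"
  by (cases "r = s") (auto simp: part_shape_def is_partition_def sorted_wrt_iff_nth_less)

lemma sum_part_shape: "(\<Sum>r<k. part_shape \<tau> r) = sum_list (take k \<tau>)"
proof (induction k)
  case (Suc k)
  then show ?case by (cases "k < length \<tau>") (auto simp: part_shape_def sum_list_take_Suc)
qed simp

lemma sum_part_shape_all: "length \<tau> \<le> N \<Longrightarrow> (\<Sum>r<N. part_shape \<tau> r) = sum_list \<tau>"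
  by (simp add: sum_part_shape)

lemma length_partition: "is_partition n \<tau> \<Longrightarrow> length \<tau> \<le> n"
proof -
  have "0 \<notin> set \<tau> \<Longrightarrow> length \<tau> \<le> sum_list \<tau>" for \<tau> :: "nat list" by (induction \<tau>) auto
  then show "is_partition n \<tau> \<Longrightarrow> length \<tau> \<le> n" by (auto simp: is_partition_def)
qed

lemma le_foldr_max: "(p :: nat) \<in> set \<tau> \<Longrightarrow> p \<le> foldr max \<tau> 0"
  by (induction \<tau>) auto

lemma length_conj: "length (conj_partition \<tau>) = foldr max \<tau> 0"
  by (simp add: conj_partition_def)

lemma nth_conj: "j < foldr max \<tau> 0 \<Longrightarrow> conj_partition \<tau> ! j = length (filter (\<lambda>p. j < p) \<tau>)"
  by (simp add: conj_partition_def)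

lemma sum_list_min: "(\<Sum>j<k. length (filter (\<lambda>p. j < p) \<tau>)) = (\<Sum>p\<leftarrow>\<tau>. min p k)"
proof (induction \<tau>)
  case (Cons p \<tau>)
  have "(\<Sum>j<k. if j < p then 1 else 0 :: nat) = card ({..<k} \<inter> {..<p})"
    by (simp add: sum.If_cases lessThan_def)
  also have "{..<k} \<inter> {..<p} = {..<min p k}" by auto
  finally have "(\<Sum>j<k. if j < p then 1 else 0 :: nat) = min p k" by simp
  moreover have "(\<Sum>j<k. length (filter (\<lambda>p. j < p) (p # \<tau>))) =
      (\<Sum>j<k. (if j < p then 1 else 0) + length (filter (\<lambda>p. j < p) \<tau>))"
    by (intro sum.cong) auto
  ultimately show ?case using Cons by (simp add: sum.distrib)
qed simp

lemma sum_list_take_conj: "sum_list (take k (conj_partition \<tau>)) = (\<Sum>p\<leftarrow>\<tau>. min p k)"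
proof -
  let ?m = "foldr max \<tau> 0"
  have "sum_list (take k (conj_partition \<tau>)) = (\<Sum>j<min k ?m. length (filter (\<lambda>p. j < p) \<tau>))"
    unfolding conj_partition_def take_map
    by (cases "k \<le> ?m") (simp_all add: interv_sum_list_conv_sum_set_nat atLeast0LessThan min_def)
  also have "\<dots> = (\<Sum>p\<leftarrow>\<tau>. min p (min k ?m))" by (rule sum_list_min)
  also have "\<dots> = (\<Sum>p\<leftarrow>\<tau>. min p k)"
    by (intro arg_cong[of _ _ sum_list] map_cong) (auto simp: min_def dest!: le_foldr_max)
  finally show ?thesis .
qed

lemma sum_list_part_shape: "length \<tau> \<le> N \<Longrightarrow> f 0 = (0::nat) \<Longrightarrow> (\<Sum>p\<leftarrow>\<tau>. f p) = (\<Sum>r<N. f (part_shape \<tau> r))"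
proof -
  assume N: "length \<tau> \<le> N" and f: "f 0 = 0"
  have "(\<Sum>p\<leftarrow>\<tau>. f p) = (\<Sum>r<length \<tau>. f (part_shape \<tau> r))"
    by (simp add: sum_list_sum_nth atLeast0LessThan part_shape_def)
  also have "\<dots> = (\<Sum>r<N. f (part_shape \<tau> r))"
    using N f by (intro sum.mono_neutral_left) (auto simp: part_shape_def)
  finally show ?thesis .
qed

lemma sum_list_take_conj': "length \<tau> \<le> N \<Longrightarrow> sum_list (take k (conj_partition \<tau>)) = (\<Sum>r<N. min (part_shape \<tau> r) k)"
  unfolding sum_list_take_conj by (rule sum_list_part_shape) auto

lemma sum_list_conj: "sum_list (conj_partition \<tau>) = sum_list \<tau>"
proof -
  have "sum_list (conj_partition \<tau>) = sum_list (take (foldr max \<tau> 0) (conj_partition \<tau>))" by (simp add: length_conj)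
  also have "\<dots> = (\<Sum>p\<leftarrow>\<tau>. p)" unfolding sum_list_take_conj
    by (intro arg_cong[of _ _ sum_list] map_cong) (auto dest!: le_foldr_max)
  finally show ?thesis by simp
qed

lemma set_yam_word: "w \<in> yam_words n \<Longrightarrow> set w \<subseteq> {..<n}"
proof (induction n arbitrary: w)
  case (Suc n)
  then obtain v r where v: "w = v @ [r]" "v \<in> yam_words n" "addable (count_list v) r"
    unfolding yam_words_Suc by auto
  have IH: "set v \<subseteq> {..<n}" using Suc.IH v by blast
  have "r = 0 \<or> r - 1 \<in> set v" using v(3) by (auto simp: addable_def count_list_0_iff[symmetric])
  then show ?case using IH v(1) by fastforce
qed (simp add: yam_words_def)

text \<open>Filling \<open>\<nu>\<close> by vertical strips as long as the columns of
  \<open>\<tau>\<close> bounds its column sums from below, and filling it by horizontal strips as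
  long as the rows of \<open>\<tau>\<close> bounds its row sums from below. This is the
  combinatorial reason why the Specht generator is visible in one shape only.\<close>

lemma strips_shape:
  assumes \<tau>: "is_partition n \<tau>"
    and v: "v \<in> shape_words n \<nu>" "\<And>k. k \<in> block_pos (conj_partition \<tau>) \<Longrightarrow> v ! k < v ! Suc k"
    and w: "w \<in> shape_words n \<nu>" "\<And>k. k \<in> block_pos \<tau> \<Longrightarrow> w ! Suc k \<le> w ! k"
  shows "\<nu> = part_shape \<tau>"
proof (rule dominance_antisym[of n])
  let ?c = "conj_partition \<tau>"
  have sn: "sum_list \<tau> = n" "sum_list ?c = n" using \<tau> by (auto simp: is_partition_def sum_list_conj)
  have lt: "length \<tau> \<le> n" using length_partition[OF \<tau>] .
  have v': "length v = n" "yam v" "count_list v = \<nu>" "set v \<subseteq> {..<n}"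
    and w': "length w = n" "yam w" "count_list w = \<nu>" "set w \<subseteq> {..<n}"
    using v(1) w(1) set_yam_word[of v n] set_yam_word[of w n] by (auto simp: shape_words_def yam_words_def)
  show "\<nu> r = 0" if "n \<le> r" for r
    using that v'(4) unfolding v'(3)[symmetric] by (auto simp: count_list_0_iff)
  show "part_shape \<tau> r = 0" if "n \<le> r" for r using that lt by (simp add: part_shape_def)
  have nu: "(\<Sum>r<n. \<nu> r) = n" using sum_count_list[OF v'(4)] v' by simp
  show "(\<Sum>r<n. \<nu> r) = (\<Sum>r<n. part_shape \<tau> r)"
    unfolding nu using sum_part_shape_all[OF lt] sn by simp
  show "part_shape \<tau> s \<le> part_shape \<tau> r" if "r \<le> s" for r s using part_shape_anti[OF \<tau> that] .
  show "(\<Sum>r<n. min (part_shape \<tau> r) k) \<le> (\<Sum>r<n. min (\<nu> r) k)" for k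
  proof -
    define k' where "k' = min k (length ?c)"
    have le: "sum_list (take k' ?c) \<le> n" using sum_list_take_le[of k' ?c] sn by simp
    have cnt: "count_list (take (sum_list (take k' ?c)) v) r \<le> min (\<nu> r) k" for r
    proof -
      have "count_list (take (sum_list (take k' ?c)) v) r \<le> k'"
        by (rule vertical_count) (use v' sn v(2) in \<open>auto simp: k'_def\<close>)
      moreover have "count_list (take (sum_list (take k' ?c)) v) r \<le> count_list v r"
        by (metis append_take_drop_id count_list_append le_add1)
      ultimately show ?thesis using v'(3) by (simp add: k'_def)
    qed
    have "(\<Sum>r<n. min (part_shape \<tau> r) k) = sum_list (take k ?c)"
      by (rule sum_list_take_conj'[OF lt, symmetric])
    also have "\<dots> = sum_list (take k' ?c)" by (cases "k \<le> length ?c") (simp_all add: k'_def)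
    also have "\<dots> = length (take (sum_list (take k' ?c)) v)" using le v' by simp
    also have "\<dots> = (\<Sum>r<n. count_list (take (sum_list (take k' ?c)) v) r)"
      using v'(4) set_take_subset[of _ v] by (intro sum_count_list[symmetric]) blast
    also have "\<dots> \<le> (\<Sum>r<n. min (\<nu> r) k)" by (rule sum_mono[OF cnt])
    finally show ?thesis .
  qed
  show "(\<Sum>r<k. part_shape \<tau> r) \<le> (\<Sum>r<k. \<nu> r)" if "k \<le> n" for k
  proof -
    define k' where "k' = min k (length \<tau>)"
    have le: "sum_list (take k' \<tau>) \<le> n" using sum_list_take_le[of k' \<tau>] sn by simp
    have sub: "set (take (sum_list (take k' \<tau>)) w) \<subseteq> {..<k}"
    proof
      fix x assume "x \<in> set (take (sum_list (take k' \<tau>)) w)"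
      then have "x < k'"
        by (rule horizontal_less[OF w'(2) _ w(2), rotated -1]) (use w' sn in \<open>auto simp: k'_def\<close>)
      then show "x \<in> {..<k}" by (simp add: k'_def)
    qed
    have "(\<Sum>r<k. part_shape \<tau> r) = sum_list (take k' \<tau>)"
      unfolding sum_part_shape by (cases "k \<le> length \<tau>") (simp_all add: k'_def)
    also have "\<dots> = length (take (sum_list (take k' \<tau>)) w)" using le w' by simp
    also have "\<dots> = (\<Sum>r<k. count_list (take (sum_list (take k' \<tau>)) w) r)"
      by (rule sum_count_list[symmetric, OF sub])
    also have "\<dots> \<le> (\<Sum>r<k. \<nu> r)"
      unfolding w'(3)[symmetric] by (intro sum_mono) (metis append_take_drop_id count_list_append le_add1)
    finally show ?thesis .
  qed
qed

text \<open>For the shape of \<open>\<tau>\<close> itself the bounds on the initial segments add up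
  to their lengths, so they are equalities. The contents of each block are then known as multisets,
  and a strictly increasing block is determined by its multiset. This uniqueness becomes rank one in
  \<open>generator_rank_one\<close>.\<close>

lemma vertical_unique:
  assumes \<tau>: "is_partition n \<tau>"
    and v: "v \<in> shape_words n (part_shape \<tau>)" "\<And>k. k \<in> block_pos (conj_partition \<tau>) \<Longrightarrow> v ! k < v ! Suc k"
    and w: "w \<in> shape_words n (part_shape \<tau>)" "\<And>k. k \<in> block_pos (conj_partition \<tau>) \<Longrightarrow> w ! k < w ! Suc k"
  shows "v = w"
proof -
  let ?c = "conj_partition \<tau>"
  let ?S = "\<lambda>j. sum_list (take j ?c)"
  have sn: "sum_list ?c = n" using \<tau> by (auto simp: is_partition_def sum_list_conj)
  have lt: "length \<tau> \<le> n" using length_partition[OF \<tau>] .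
  have cnt: "count_list (take (?S j) v) r = min (part_shape \<tau> r) j"
    if v: "v \<in> shape_words n (part_shape \<tau>)" "\<And>k. k \<in> block_pos ?c \<Longrightarrow> v ! k < v ! Suc k"
      and j: "j \<le> length ?c" and "r < n" for v j r
  proof -
    have v': "length v = n" "yam v" "count_list v = part_shape \<tau>" "set v \<subseteq> {..<n}"
      using v(1) set_yam_word[of v n] by (auto simp: shape_words_def yam_words_def)
    have le: "count_list (take (?S j) v) r \<le> min (part_shape \<tau> r) j" for r
    proof -
      have "count_list (take (?S j) v) r \<le> j"
        by (rule vertical_count) (use v' sn v(2) j in auto)
      moreover have "count_list (take (?S j) v) r \<le> count_list v r"
        by (metis append_take_drop_id count_list_append le_add1)
      ultimately show ?thesis using v'(3) by simp
    qed
    have "(\<Sum>r<n. count_list (take (?S j) v) r) = length (take (?S j) v)"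
      using v'(4) set_take_subset[of _ v] by (intro sum_count_list) blast
    also have "\<dots> = (\<Sum>r<n. min (part_shape \<tau> r) j)"
      using sum_list_take_le[of j ?c] sn v' by (simp add: sum_list_take_conj'[OF lt])
    finally have eq: "(\<Sum>r<n. count_list (take (?S j) v) r) = (\<Sum>r<n. min (part_shape \<tau> r) j)" .
    show ?thesis
    proof (rule ccontr)
      assume "count_list (take (?S j) v) r \<noteq> min (part_shape \<tau> r) j"
      then have "count_list (take (?S j) v) r < min (part_shape \<tau> r) j" using le[of r] by linarith
      then have "(\<Sum>r<n. count_list (take (?S j) v) r) < (\<Sum>r<n. min (part_shape \<tau> r) j)"
        using le \<open>r < n\<close> by (intro sum_strict_mono_ex1) auto
      then show False using eq by simp
    qed
  qed
  have l: "length v = sum_list ?c" "length w = sum_list ?c" using v w sn by (auto simp: shape_words_def yam_words_def)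
  have "take (?S j) v = take (?S j) w" if "j \<le> length ?c" for j
    using that
  proof (induction j)
    case (Suc j)
    let ?b = "\<lambda>w. take (?c ! j) (drop (?S j) w)"
    have j: "j < length ?c" using Suc.prems by simp
    note bv = block_append(1)[OF l(1) j] and bw = block_append(1)[OF l(2) j]
    have IH: "take (?S j) v = take (?S j) w" using Suc by simp
    have sub: "set v \<subseteq> {..<n}" "set w \<subseteq> {..<n}" using v w set_yam_word by (auto simp: shape_words_def)
    have "count_list (?b v) r = count_list (?b w) r" for r
    proof (cases "r < n")
      case True
      have "count_list (take (?S (Suc j)) v) r = count_list (take (?S (Suc j)) w) r"
        using cnt[OF v Suc.prems True] cnt[OF w Suc.prems True] by simp
      then show ?thesis unfolding bv bw IH by simp
    next
      case False
      then have "r \<notin> set (?b v)" "r \<notin> set (?b w)"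
        using sub by (meson in_set_dropD in_set_takeD lessThan_iff subsetD)+
      then show ?thesis by (metis count_list_0_iff)
    qed
    then have "mset (?b v) = mset (?b w)" by (simp add: multiset_eq_iff count_list_eq_count_mset)
    moreover have "sorted (?b v)" "sorted (?b w)"
      using block_strict[OF l(1) j v(2)] block_strict[OF l(2) j w(2)] strict_sorted_imp_sorted by blast+
    ultimately have "?b v = ?b w" by (metis properties_for_sort)
    then show ?case unfolding bv bw IH by simp
  qed simp
  from this[of "length ?c"] show ?thesis using l by simp
qed

section \<open>Young subgroups and their symmetrizers\<close>

definition block :: "nat list \<Rightarrow> nat \<Rightarrow> nat set" where
  "block \<mu> r = {sum_list (take r \<mu>)<..sum_list (take (Suc r) \<mu>)}"

lemma young_subgroup_iff:
  "w \<in> young_subgroup n \<mu> \<longleftrightarrow> w \<in> perms n \<and> (\<forall>r<length \<mu>. w ` block \<mu> r = block \<mu> r)"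
  by (simp add: young_subgroup_def block_def)

lemma block_less:
  assumes "a \<in> block \<mu> r" "b \<in> block \<mu> s" "r < s"
  shows "a < b"
proof -
  have "sum_list (take (Suc r) \<mu>) \<le> sum_list (take s \<mu>)" using assms(3) by (intro sum_list_take_mono) simp
  then show ?thesis using assms by (auto simp: block_def)
qed

lemma block_unique: "a \<in> block \<mu> r \<Longrightarrow> a \<in> block \<mu> s \<Longrightarrow> r = s"
  using block_less[of a \<mu> r a s] block_less[of a \<mu> s a r] by (auto intro: linorder_cases)

lemma block_cover:
  assumes "a \<in> {1..sum_list \<mu>}"
  shows "\<exists>r<length \<mu>. a \<in> block \<mu> r"
proof -
  have "\<exists>r<k. a \<in> block \<mu> r" if "a \<le> sum_list (take k \<mu>)" "a \<ge> 1" "k \<le> length \<mu>" for k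
    using that
  proof (induction k)
    case (Suc k)
    then show ?case by (cases "a \<le> sum_list (take k \<mu>)") (auto simp: block_def less_Suc_eq)
  qed auto
  from this[of "length \<mu>"] show ?thesis using assms by auto
qed

lemma block_pos_block:
  assumes "k \<in> block_pos \<mu>"
  obtains j where "j < length \<mu>" "Suc k \<in> block \<mu> j" "Suc (Suc k) \<in> block \<mu> j"
  using assms by (force simp: block_pos_def block_def)

lemma block_block_pos:
  "\<lbrakk>j < length \<mu>; Suc k \<in> block \<mu> j; Suc (Suc k) \<in> block \<mu> j\<rbrakk> \<Longrightarrow> k \<in> block_pos \<mu>"
  by (auto simp: block_pos_def block_def)

lemma young_apply: "\<lbrakk>v \<in> young_subgroup n \<mu>; r < length \<mu>; a \<in> block \<mu> r\<rbrakk> \<Longrightarrow> v a \<in> block \<mu> r"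
  unfolding young_subgroup_iff by blast

lemma young_inv_apply:
  assumes v: "v \<in> young_subgroup n \<mu>" "r < length \<mu>" "a \<in> block \<mu> r"
  shows "inv_into UNIV v a \<in> block \<mu> r"
proof -
  have "v permutes {1..n}" using v(1) by (simp add: young_subgroup_iff)
  then have "inj v" using permutes_inj by blast
  obtain b where b: "b \<in> block \<mu> r" "a = v b" using v unfolding young_subgroup_iff by blast
  then show ?thesis using \<open>inj v\<close> by simp
qed

lemma young_id: "id \<in> young_subgroup n \<mu>"
  by (simp add: young_subgroup_iff permutes_id)

lemma young_simple_mult:
  assumes k: "k \<in> block_pos \<mu>" and n: "sum_list \<mu> = n"
  shows "simple_mult (Suc k) u \<in> young_subgroup n \<mu> \<longleftrightarrow> u \<in> young_subgroup n \<mu>"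
proof -
  have i: "Suc k \<in> {1..<n}" using block_pos_less[OF k] n by auto
  obtain j where j: "j < length \<mu>" "Suc k \<in> block \<mu> j" "Suc (Suc k) \<in> block \<mu> j"
    using block_pos_block[OF k] .
  have inv: "transp (Suc k) (Suc (Suc k)) ` block \<mu> r = block \<mu> r" if "r < length \<mu>" for r
  proof (cases "r = j")
    case True
    then show ?thesis using j by (simp add: transpose_image_eq)
  next
    case False
    then have "Suc k \<notin> block \<mu> r" "Suc (Suc k) \<notin> block \<mu> r" using j block_unique by blast+
    then show ?thesis by (simp add: transpose_image_eq)
  qed
  have "simple_mult (Suc k) u \<in> young_subgroup n \<mu>" if "u \<in> young_subgroup n \<mu>" for u
  proof -
    have "(simple_mult (Suc k) u) ` block \<mu> r = block \<mu> r" if r: "r < length \<mu>" for r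
    proof -
      have "u ` block \<mu> r = block \<mu> r" using \<open>u \<in> young_subgroup n \<mu>\<close> r by (simp add: young_subgroup_iff)
      then show ?thesis using inv[OF r] by (simp only: image_comp[symmetric])
    qed
    then show ?thesis using that transp_comp_perms[of u n "Suc k"] i unfolding young_subgroup_iff by blast
  qed
  from this[of u] this[of "simple_mult (Suc k) u"] show ?thesis by (auto simp del: o_apply)
qed

definition row_sym :: "nat \<Rightarrow> nat list \<Rightarrow> (nat \<Rightarrow> nat) \<Rightarrow> complex" where
  "row_sym n \<mu> = (\<lambda>u. if u \<in> young_subgroup n \<mu> then 1 else 0)"

definition col_sym :: "nat \<Rightarrow> complex \<Rightarrow> nat list \<Rightarrow> (nat \<Rightarrow> nat) \<Rightarrow> complex" where
  "col_sym n q \<mu> = (\<lambda>u. if u \<in> young_subgroup n \<mu> then (- inverse q) ^ perm_length n u else 0)"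

lemma sym_space: "row_sym n \<mu> \<in> hecke_space n" "col_sym n q \<mu> \<in> hecke_space n"
  by (auto simp: hecke_space_def row_sym_def col_sym_def young_subgroup_iff)

lemma hecke_gen_row_sym:
  assumes k: "k \<in> block_pos \<mu>" and n: "sum_list \<mu> = n"
  shows "hecke_gen n q (Suc k) (row_sym n \<mu>) = (\<lambda>w. q * row_sym n \<mu> w)"
proof (rule hecke_ext[of _ n])
  have i: "Suc k \<in> {1..<n}" using block_pos_less[OF k] n by auto
  show "hecke_gen n q (Suc k) (row_sym n \<mu>) \<in> hecke_space n" by (rule hecke_gen_space[OF sym_space(1) i])
  show "(\<lambda>w. q * row_sym n \<mu> w) \<in> hecke_space n" using sym_space(1)[of n \<mu>] by (auto simp: hecke_space_def)
  show "hecke_gen n q (Suc k) (row_sym n \<mu>) w = q * row_sym n \<mu> w" if w: "w \<in> perms n" for w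
    using young_simple_mult[OF k n, of w] by (simp add: hecke_gen_apply_descent[OF w i] row_sym_def algebra_simps)
qed

lemma hecke_gen_col_sym:
  assumes k: "k \<in> block_pos \<mu>" and n: "sum_list \<mu> = n" and q: "q \<noteq> 0"
  shows "hecke_gen n q (Suc k) (col_sym n q \<mu>) = (\<lambda>w. - col_sym n q \<mu> w)"
proof (rule hecke_ext[of _ n])
  have i: "Suc k \<in> {1..<n}" using block_pos_less[OF k] n by auto
  show "hecke_gen n q (Suc k) (col_sym n q \<mu>) \<in> hecke_space n" by (rule hecke_gen_space[OF sym_space(2) i])
  show "(\<lambda>w. - col_sym n q \<mu> w) \<in> hecke_space n" using sym_space(2)[of n q \<mu>] by (auto simp: hecke_space_def)
  show "hecke_gen n q (Suc k) (col_sym n q \<mu>) w = - col_sym n q \<mu> w" if w: "w \<in> perms n" for w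
  proof (cases "descent w (Suc k)")
    case True
    then show ?thesis using young_simple_mult[OF k n, of w] perm_length_descent[OF w i True] q
      by (simp add: hecke_gen_apply_descent[OF w i] col_sym_def field_simps)
  next
    case False
    then show ?thesis using young_simple_mult[OF k n, of w] perm_length_ascent[OF w i False] q
      by (simp add: hecke_gen_apply_descent[OF w i] col_sym_def)
  qed
qed

lemma specht_generator_alt:
  "specht_generator n q \<tau> = (\<Sum>u\<in>young_subgroup n (conj_partition \<tau>).
     hscale ((- inverse q) ^ perm_length n u)
       (hecke_T n q u (hecke_T n q (row_to_column n \<tau>) (row_sym n \<tau>))))"
  by (simp add: specht_generator_def row_sym_def Let_def)

lemma finite_young: "finite (young_subgroup n \<mu>)"
  by (rule finite_subset[OF _ finite_perms[of n]]) (auto simp: young_subgroup_iff)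

lemma foldr_hecke_gen_space: "set is \<subseteq> {1..<n} \<Longrightarrow> f \<in> hecke_space n \<Longrightarrow> foldr (hecke_gen n q) is f \<in> hecke_space n"
  by (induction "is") (auto intro!: hecke_gen_space)

lemma hecke_T_space:
  assumes "w \<in> perms n" "f \<in> hecke_space n"
  shows "hecke_T n q w f \<in> hecke_space n"
proof -
  have "set (SOME is. reduced_word n w is) \<subseteq> {1..<n}"
    using reduced_word_some[OF assms(1)] unfolding reduced_word_def[of n w "SOME is. reduced_word n w is"] by blast
  then show ?thesis unfolding hecke_T_def using foldr_hecke_gen_space assms by blast
qed

section \<open>The Specht generator in the seminormal modules\<close>

context quantum
begin

lemma rep_hecke_T:
  assumes C: "swap_closed n C" and v: "v \<in> supported C" and u: "u \<in> perms n"
  shows "rep n (hecke_T n q u f) v = tact n u (rep n f v)"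
proof -
  have "rep n (foldr (hecke_gen n q) is f) v = foldr (\<lambda>i. top (i - 1)) is (rep n f v)"
    if "set is \<subseteq> {1..<n}" for "is"
    using that
  proof (induction "is")
    case (Cons i "is")
    then show ?case using rep_gen[OF C v, of i] by simp
  qed simp
  moreover have "set (SOME is. reduced_word n u is) \<subseteq> {1..<n}"
    using reduced_word_some[OF u] unfolding reduced_word_def[of n u "SOME is. reduced_word n u is"] by blast
  ultimately show ?thesis
    unfolding hecke_T_def braid_action.act_def[OF braid_action_top[OF C]] by blast
qed

lemma rep_sum: "rep n (\<Sum>u\<in>S. X u) v = (\<lambda>c. \<Sum>u\<in>S. rep n (X u) v c)"
proof -
  have "rep n (\<Sum>u\<in>S. X u) v c = (\<Sum>w\<in>perms n. \<Sum>u\<in>S. X u w * tact n w v c)" for c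
    by (simp add: rep_def sum_apply sum_distrib_right)
  also have "\<dots> c = (\<Sum>u\<in>S. rep n (X u) v c)" for c
    unfolding rep_def by (rule sum.swap)
  finally show ?thesis by (rule ext)
qed

lemma rep_generator:
  assumes C: "swap_closed n C" and v: "v \<in> supported C" and w: "row_to_column n \<tau> \<in> perms n"
  shows "rep n (specht_generator n q \<tau>) v =
    rep n (col_sym n q (conj_partition \<tau>)) (tact n (row_to_column n \<tau>) (rep n (row_sym n \<tau>) v))"
proof
  fix c
  let ?z = "tact n (row_to_column n \<tau>) (rep n (row_sym n \<tau>) v)" and ?Y = "young_subgroup n (conj_partition \<tau>)"
  have Y: "u \<in> perms n" if "u \<in> ?Y" for u using that by (simp add: young_subgroup_iff)
  have "rep n (specht_generator n q \<tau>) v c = (\<Sum>u\<in>?Y. (- inverse q) ^ perm_length n u * tact n u ?z c)"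
    unfolding specht_generator_alt rep_sum
    by (intro sum.cong refl) (simp add: rep_lin rep_hecke_T[OF C v Y] rep_hecke_T[OF C v w])
  also have "\<dots> = rep n (col_sym n q (conj_partition \<tau>)) ?z c"
    unfolding rep_def col_sym_def
    by (rule sum.mono_neutral_cong_left) (use finite_perms Y in auto)
  finally show "rep n (specht_generator n q \<tau>) v c = rep n (col_sym n q (conj_partition \<tau>)) ?z c" .
qed

lemma generator_antisym:
  assumes C: "swap_closed n C" and v: "v \<in> supported C" and w: "row_to_column n \<tau> \<in> perms n"
    and \<tau>: "is_partition n \<tau>" and k: "k \<in> block_pos (conj_partition \<tau>)"
  shows "top k (rep n (specht_generator n q \<tau>) v) = (\<lambda>c. - rep n (specht_generator n q \<tau>) v c)"
proof -
  let ?c = "conj_partition \<tau>"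
  have sn: "sum_list ?c = n" using \<tau> by (auto simp: is_partition_def sum_list_conj)
  let ?z = "tact n (row_to_column n \<tau>) (rep n (row_sym n \<tau>) v)"
  have z: "?z \<in> supported C"
    by (intro braid_action.act_closed[OF braid_action_top[OF C]] rep_supported[OF C] v w)
  have "top k (rep n (col_sym n q ?c) ?z) = rep n (hecke_gen n q (Suc k) (col_sym n q ?c)) ?z"
    using rep_gen[OF C z, of "Suc k"] block_pos_less[OF k] sn by auto
  also have "\<dots> = (\<lambda>c. - rep n (col_sym n q ?c) ?z c)"
    unfolding hecke_gen_col_sym[OF k sn q0] using rep_lin(2)[of n "-1" "col_sym n q ?c"] by simp
  finally show ?thesis unfolding rep_generator[OF C v w] .
qed

lemma row_sym_sym:
  assumes C: "swap_closed n C" and v: "v \<in> supported C"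
    and \<tau>: "is_partition n \<tau>" and k: "k \<in> block_pos \<tau>"
  shows "top k (rep n (row_sym n \<tau>) v) = (\<lambda>c. q * rep n (row_sym n \<tau>) v c)"
proof -
  have sn: "sum_list \<tau> = n" using \<tau> by (auto simp: is_partition_def)
  have "top k (rep n (row_sym n \<tau>) v) = rep n (hecke_gen n q (Suc k) (row_sym n \<tau>)) v"
    using rep_gen[OF C v, of "Suc k"] block_pos_less[OF k] sn by auto
  then show ?thesis unfolding hecke_gen_row_sym[OF k sn] rep_lin(2) .
qed

lemma generator_row_sym:
  assumes C: "swap_closed n C" and v: "v \<in> supported C" and w: "row_to_column n \<tau> \<in> perms n"
    and nz: "rep n (specht_generator n q \<tau>) v c \<noteq> 0"
  shows "\<exists>c. rep n (row_sym n \<tau>) v c \<noteq> 0"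
proof (rule ccontr)
  assume "\<not> ?thesis"
  then have 0: "rep n (row_sym n \<tau>) v = (\<lambda>_. 0)" by auto
  have t0: "top k (\<lambda>_. 0) = (\<lambda>_. 0)" for k by (simp add: top_def)
  have f0: "foldr (\<lambda>i. top (i - 1)) is (\<lambda>_. 0) = (\<lambda>_. 0)" for "is" by (induction "is") (simp_all add: t0)
  have a0: "tact n w (\<lambda>_. 0) = (\<lambda>_. 0)" for w
    unfolding braid_action.act_def[OF braid_action_top[OF C]] by (rule f0)
  show False using nz unfolding rep_generator[OF C v w] 0 a0 unfolding rep_def a0 by simp
qed

lemma shape_word_swap:
  assumes "w \<in> shape_words n \<nu>" "Suc k < n"
  shows "w ! k = w ! Suc k \<and> axial (contents w) k = 1 \<or>
    w ! k < w ! Suc k \<and> axial (contents w) k = -1 \<or>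
    w ! k \<noteq> w ! Suc k \<and> \<bar>axial (contents w) k\<bar> \<ge> 2 \<and> swap_at k w \<in> shape_words n \<nu> \<and>
    contents (swap_at k w) = swap_at k (contents w)"
  using yam_from_swap[OF part_fun_0, of w k] assms
  by (auto simp: shape_words_def yam_words_def count_list_swap_at)

text \<open>In the chosen normalization the off-diagonal entry is one plus the diagonal entry, so
  the coefficients of an eigenvector for -1 merely change sign under a swap. At axial distance 1 the
  operator acts by q, and 1 + q = [2] is nonzero.\<close>

lemma antisym_swap:
  assumes "top k u = (\<lambda>c. - u c)"
  shows "axial c k = 1 \<Longrightarrow> u c = 0" "\<bar>axial c k\<bar> \<ge> 2 \<Longrightarrow> u (swap_at k c) = - u c"
proof -
  have e: "dcoef (axial c k) * u c + ocoef (axial c k) * u (swap_at k c) = - u c"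
    using fun_cong[OF assms, of c] by (simp add: top_def)
  have "1 + q \<noteq> 0" using qint_nz[of 2] qint_Suc[of 1] by simp
  then show "u c = 0" if "axial c k = 1"
  proof -
    have "q * u c = - u c" using e that by (simp add: ocoef_def)
    then have "(1 + q) * u c = 0" by (simp add: distrib_right)
    then show ?thesis using \<open>1 + q \<noteq> 0\<close> by simp
  qed
  show "u (swap_at k c) = - u c" if a: "\<bar>axial c k\<bar> \<ge> 2"
  proof -
    have "ocoef (axial c k) = 1 + dcoef (axial c k)"
      using ocoef_alt[OF a] dcoef_neg[of "axial c k"] a by auto
    then have "ocoef (axial c k) * (u (swap_at k c) + u c) = 0" using e by (simp add: algebra_simps)
    then show ?thesis using ocoef_nz[OF a] by (simp add: eq_neg_iff_add_eq_0)
  qed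
qed

lemma sym_swap:
  assumes "top k u = (\<lambda>c. q * u c)"
  shows "axial c k = -1 \<Longrightarrow> u c = 0" "\<bar>axial c k\<bar> \<ge> 2 \<Longrightarrow> u c \<noteq> 0 \<Longrightarrow> u (swap_at k c) \<noteq> 0"
proof -
  have e: "dcoef (axial c k) * u c + ocoef (axial c k) * u (swap_at k c) = q * u c"
    using fun_cong[OF assms, of c] by (simp add: top_def)
  have nz: "1 + q \<noteq> 0" using qint_nz[of 2] qint_Suc[of 1] by simp
  show "u c = 0" if "axial c k = -1"
  proof -
    have "- u c = q * u c" using e that by (simp add: ocoef_def)
    then have "(1 + q) * u c = 0" unfolding distrib_right by (metis add.right_inverse mult_1)
    then show ?thesis using nz by simp
  qed
  show "u (swap_at k c) \<noteq> 0" if a: "\<bar>axial c k\<bar> \<ge> 2" and "u c \<noteq> 0"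
  proof -
    have "ocoef (- axial c k) = q - dcoef (axial c k)"
      using ocoef_alt[of "- axial c k"] a by auto
    then have "ocoef (axial c k) * u (swap_at k c) = ocoef (- axial c k) * u c"
      using arg_cong[OF e, of "\<lambda>x. x - dcoef (axial c k) * u c"]
      by (simp only: add_diff_cancel_left' left_diff_distrib)
    then show ?thesis using ocoef_nz[of "- axial c k"] a \<open>u c \<noteq> 0\<close> by auto
  qed
qed

text \<open>Sorting inside the blocks moves along nonzero coefficients. In the sorted word equal
  neighbours cannot occur, since the coefficient vanishes there, so the increase is strict.\<close>

lemma antisym_vertical:
  assumes u: "\<And>k. k \<in> K \<Longrightarrow> top k u = (\<lambda>c. - u c)" and K: "K \<subseteq> {k. Suc k < n}"
    and w: "w \<in> shape_words n \<nu>" "u (contents w) \<noteq> 0"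
  shows "\<exists>v\<in>shape_words n \<nu>. u (contents v) \<noteq> 0 \<and> (\<forall>k\<in>K. v ! k < v ! Suc k)"
proof -
  have "\<exists>v. (v \<in> shape_words n \<nu> \<and> u (contents v) \<noteq> 0) \<and> (\<forall>k\<in>K. v ! k \<le> v ! Suc k)"
  proof (rule bubble_sort[OF _ _ K])
    fix w k assume a: "w \<in> shape_words n \<nu> \<and> u (contents w) \<noteq> 0" "k \<in> K" "w ! Suc k < w ! k"
    show "swap_at k w \<in> shape_words n \<nu> \<and> u (contents (swap_at k w)) \<noteq> 0"
      using swap_descent[of w n \<nu> k] a K antisym_swap(2)[OF u[OF a(2)], of "contents w"] by auto
  qed (use w in \<open>auto simp: shape_words_def yam_words_def\<close>)
  then obtain v where v: "v \<in> shape_words n \<nu>" "u (contents v) \<noteq> 0" "\<And>k. k \<in> K \<Longrightarrow> v ! k \<le> v ! Suc k" by blast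
  have "v ! k < v ! Suc k" if k: "k \<in> K" for k
    using shape_word_swap[OF v(1), of k] v(2) v(3)[OF k] K k antisym_swap(1)[OF u[OF k], of "contents v"]
    by (metis le_neq_implies_less mem_Collect_eq subsetD)
  then show ?thesis using v by blast
qed

lemma sym_horizontal:
  assumes u: "\<And>k. k \<in> K \<Longrightarrow> top k u = (\<lambda>c. q * u c)" and K: "K \<subseteq> {k. Suc k < n}"
    and w: "w \<in> shape_words n \<nu>" "u (contents w) \<noteq> 0"
  shows "\<exists>v\<in>shape_words n \<nu>. \<forall>k\<in>K. v ! Suc k \<le> v ! k"
proof -
  have "\<exists>v. (v \<in> shape_words n \<nu> \<and> u (contents v) \<noteq> 0) \<and> (\<forall>k\<in>K. v ! Suc k \<le> v ! k)"
  proof (rule bubble_sort_down[OF _ _ K])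
    fix w k assume a: "w \<in> shape_words n \<nu> \<and> u (contents w) \<noteq> 0" "k \<in> K" "w ! k < w ! Suc k"
    show "swap_at k w \<in> shape_words n \<nu> \<and> u (contents (swap_at k w)) \<noteq> 0"
      using shape_word_swap[of w n \<nu> k] a subsetD[OF K a(2)] sym_swap[OF u[OF a(2)], of "contents w"] by auto
  qed (use w in \<open>auto simp: shape_words_def yam_words_def\<close>)
  then show ?thesis by blast
qed

abbreviation shape_contents :: "nat \<Rightarrow> (nat \<Rightarrow> nat) \<Rightarrow> int list set" where
  "shape_contents n \<nu> \<equiv> contents ` shape_words n \<nu>"

text \<open>A nonzero value of the generator yields a tableau made of vertical strips, from the
  antisymmetrizer on the left. Its right factor cannot vanish on the vector either, which yields a
  tableau of the same shape made of horizontal strips.\<close>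

lemma generator_other_shape:
  assumes \<tau>: "is_partition n \<tau>" and w: "row_to_column n \<tau> \<in> perms n" and v: "v \<in> supported (shape_contents n \<nu>)"
    and nz: "rep n (specht_generator n q \<tau>) v \<noteq> (\<lambda>_. 0)"
  shows "\<nu> = part_shape \<tau>"
proof -
  note C = swap_closed_shape[of n \<nu>]
  have sn: "sum_list \<tau> = n" "sum_list (conj_partition \<tau>) = n" using \<tau> by (auto simp: is_partition_def sum_list_conj)
  obtain c where c: "rep n (specht_generator n q \<tau>) v c \<noteq> 0" using nz by auto
  then obtain a where a: "a \<in> shape_words n \<nu>" "c = contents a"
    using rep_supported[OF C v] by (auto simp: supported_def)
  obtain c' where c': "rep n (row_sym n \<tau>) v c' \<noteq> 0" using generator_row_sym[OF C v w c] by blast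
  then obtain b where b: "b \<in> shape_words n \<nu>" "c' = contents b"
    using rep_supported[OF C v] by (auto simp: supported_def)
  have sub: "block_pos (conj_partition \<tau>) \<subseteq> {k. Suc k < n}" "block_pos \<tau> \<subseteq> {k. Suc k < n}"
    using block_pos_less[of _ \<tau>] block_pos_less[of _ "conj_partition \<tau>"] sn by auto
  obtain a' where a': "a' \<in> shape_words n \<nu>" "\<And>k. k \<in> block_pos (conj_partition \<tau>) \<Longrightarrow> a' ! k < a' ! Suc k"
    using antisym_vertical[OF generator_antisym[OF C v w \<tau>] sub(1) a(1)] c a(2) by blast
  obtain b' where b': "b' \<in> shape_words n \<nu>" "\<And>k. k \<in> block_pos \<tau> \<Longrightarrow> b' ! Suc k \<le> b' ! k"
    using sym_horizontal[OF row_sym_sym[OF C v \<tau>] sub(2) b(1)] c' b(2) by blast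
  show ?thesis by (rule strips_shape[OF \<tau> a' b'])
qed

text \<open>An antisymmetric vector is determined by its coefficient at the single tableau of
  \<open>vertical_unique\<close>. Subtracting the right multiple makes this coefficient vanish, and
  then everything vanishes.\<close>

lemma generator_rank_one:
  assumes \<tau>: "is_partition n \<tau>" and w: "row_to_column n \<tau> \<in> perms n"
    and v: "v \<in> supported (shape_contents n (part_shape \<tau>))" and v0: "v0 \<in> supported (shape_contents n (part_shape \<tau>))"
    and nz: "rep n (specht_generator n q \<tau>) v0 \<noteq> (\<lambda>_. 0)"
  shows "\<exists>a. rep n (specht_generator n q \<tau>) v = (\<lambda>c. a * rep n (specht_generator n q \<tau>) v0 c)"
proof -
  note C = swap_closed_shape[of n "part_shape \<tau>"]
  let ?e = "rep n (specht_generator n q \<tau>)" and ?K = "block_pos (conj_partition \<tau>)"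
  have sub: "?K \<subseteq> {k. Suc k < n}" using block_pos_less[of _ "conj_partition \<tau>"] \<tau> by (auto simp: is_partition_def sum_list_conj)
  obtain b where b: "b \<in> shape_words n (part_shape \<tau>)" "?e v0 (contents b) \<noteq> 0" "\<And>k. k \<in> ?K \<Longrightarrow> b ! k < b ! Suc k"
  proof -
    obtain c where c: "?e v0 c \<noteq> 0" using nz by auto
    then obtain a where "a \<in> shape_words n (part_shape \<tau>)" "c = contents a"
      using rep_supported[OF C v0] by (auto simp: supported_def)
    then show ?thesis using antisym_vertical[OF generator_antisym[OF C v0 w \<tau>] sub] c that by blast
  qed
  define a where "a = ?e v (contents b) / ?e v0 (contents b)"
  define u where "u = (\<lambda>c. ?e v c + (- a) * ?e v0 c)"
  have us: "u \<in> supported (shape_contents n (part_shape \<tau>))"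
    unfolding u_def by (intro supported_lin rep_supported[OF C] v v0)
  have anti: "top k u = (\<lambda>c. - u c)" if "k \<in> ?K" for k
    unfolding u_def top_lin generator_antisym[OF C v w \<tau> that] generator_antisym[OF C v0 w \<tau> that]
    by (simp add: algebra_simps)
  have "u c = 0" for c
  proof (rule ccontr)
    assume nz: "u c \<noteq> 0"
    then obtain d where "d \<in> shape_words n (part_shape \<tau>)" "c = contents d"
      using us by (auto simp: supported_def)
    then obtain d' where d': "d' \<in> shape_words n (part_shape \<tau>)" "u (contents d') \<noteq> 0" "\<And>k. k \<in> ?K \<Longrightarrow> d' ! k < d' ! Suc k"
      using antisym_vertical[OF anti sub] nz by blast
    have "d' = b" by (rule vertical_unique[OF \<tau> d'(1,3) b(1,3)])
    then show False using d'(2) b(2) by (simp add: u_def a_def)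
  qed
  then show ?thesis by (intro exI[of _ a]) (auto simp: u_def fun_eq_iff)
qed

end

section \<open>The Specht generator is nonzero\<close>

definition increasing_on_blocks :: "nat list \<Rightarrow> (nat \<Rightarrow> nat) \<Rightarrow> bool" where
  "increasing_on_blocks \<mu> w \<longleftrightarrow> (\<forall>r<length \<mu>. \<forall>a\<in>block \<mu> r. \<forall>b\<in>block \<mu> r. a < b \<longrightarrow> w a < w b)"

lemma inv_comp_perms:
  "w \<in> perms n \<Longrightarrow> v \<in> perms n \<Longrightarrow> inv_into UNIV (w \<circ> v) a = inv_into UNIV v (inv_into UNIV w a)"
  using o_inv_distrib[of w v] permutes_bij[of w "{1..n}"] permutes_bij[of v "{1..n}"] by auto

lemma perm_inverses:
  assumes "w \<in> perms n"
  shows "w (inv_into UNIV w a) = a" "inv_into UNIV w (w a) = a"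
  using permutes_inverses[of w "{1..n}"] assms by auto

lemma young_perms: "v \<in> young_subgroup n \<mu> \<Longrightarrow> v \<in> perms n"
  by (simp add: young_subgroup_iff)

text \<open>A permutation that increases on the blocks is the shortest element of its coset by the
  Young subgroup. Lengths therefore add up, \<open>T_w T_v = T_(wv)\<close>, and the symmetrizer
  turns into the indicator function of the coset. Removing the first letter of a reduced word
  preserves this minimality.\<close>

lemma hecke_word_row_sym:
  assumes n: "sum_list \<mu> = n" and r: "reduced_word n w is" and inc: "increasing_on_blocks \<mu> w"
  shows "foldr (hecke_gen n q) is (row_sym n \<mu>) = (\<lambda>z. if \<exists>v\<in>young_subgroup n \<mu>. z = w \<circ> v then 1 else 0)"
  using r inc
proof (induction "is" arbitrary: w)
  case Nil
  then have "w = id" by (auto simp: reduced_word_def)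
  then show ?case by (simp add: row_sym_def)
next
  case (Cons i "is")
  let ?w = "simple_mult i w" and ?Y = "young_subgroup n \<mu>"
  note R = reduced_word_Cons[OF Cons.prems(1)]
  have w: "w \<in> perms n" using reduced_word_perms[OF Cons.prems(1)] .
  have w': "?w \<in> perms n" by (rule transp_comp_perms[OF w R(1)])
  define p p' where "p = inv_into UNIV w (Suc i)" and "p' = inv_into UNIV w i"
  have pp: "p < p'" using R(2) by (simp add: descent_def p_def p'_def)
  have wp: "w p = Suc i" "w p' = i" using perm_inverses[OF w] by (auto simp: p_def p'_def)
  have inv': "inv_into UNIV ?w i = p" "inv_into UNIV ?w (Suc i) = p'"
    by (simp_all add: inv_transp_comp[OF w] p_def p'_def)
  have rng: "p \<in> {1..n}" "p' \<in> {1..n}"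
    using permutes_in_image[of w "{1..n}"] w wp R(1) by (metis One_nat_def Suc_leI atLeastAtMost_iff atLeastLessThan_iff le_SucI less_imp_le_nat mem_Collect_eq)+
  obtain r where r: "r < length \<mu>" "p \<in> block \<mu> r" using block_cover[of p \<mu>] rng n by auto
  obtain r' where r': "r' < length \<mu>" "p' \<in> block \<mu> r'" using block_cover[of p' \<mu>] rng n by auto
  have "r \<noteq> r'"
  proof
    assume "r = r'"
    then have "w p < w p'" using Cons.prems(2) r r' pp unfolding increasing_on_blocks_def by blast
    then show False using wp by simp
  qed
  then have rr: "r < r'" using block_less[OF r'(2) r(2)] pp by (metis linorder_neqE_nat not_less_iff_gr_or_eq)
  have "increasing_on_blocks \<mu> ?w"
    unfolding increasing_on_blocks_def
  proof (intro allI impI ballI)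
    fix s a b assume s: "s < length \<mu>" and ab: "a \<in> block \<mu> s" "b \<in> block \<mu> s" "a < b"
    have "w a < w b" using Cons.prems(2) s ab unfolding increasing_on_blocks_def by blast
    moreover have "\<not> (w a = i \<and> w b = Suc i)"
    proof
      assume "w a = i \<and> w b = Suc i"
      then have "a = p'" "b = p" using perm_inverses(2)[OF w] unfolding p_def p'_def by metis+
      then show False using pp ab(3) by simp
    qed
    ultimately show "?w a < ?w b" by (auto simp: Transposition.transpose_def)
  qed
  from Cons.IH[OF R(3) this]
  have IH: "foldr (hecke_gen n q) is (row_sym n \<mu>) = (\<lambda>z. if \<exists>v\<in>?Y. z = ?w \<circ> v then 1 else 0)" (is "_ = ?f") .
  have lt: "inv_into UNIV v p < inv_into UNIV v p'" if "v \<in> ?Y" for v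
    using block_less[OF young_inv_apply[OF that r] young_inv_apply[OF that r'] rr] .
  show ?case
  proof (rule hecke_ext[of _ n])
    show "foldr (hecke_gen n q) (i # is) (row_sym n \<mu>) \<in> hecke_space n"
      using R(1,3) sym_space by (intro foldr_hecke_gen_space) (auto simp: reduced_word_def)
    have "w \<circ> v \<in> perms n" if "v \<in> ?Y" for v using w young_perms[OF that] by (auto intro: permutes_compose)
    then show "(\<lambda>z. if \<exists>v\<in>?Y. z = w \<circ> v then 1 else 0) \<in> hecke_space n" by (auto simp: hecke_space_def)
    fix z assume z: "z \<in> perms n"
    have ww: "simple_mult i (?w \<circ> v) = w \<circ> v" "simple_mult i (w \<circ> v) = ?w \<circ> v" for v
      by (auto simp: fun_eq_iff)
    have coset: "(\<exists>v\<in>?Y. simple_mult i z = ?w \<circ> v) \<longleftrightarrow> (\<exists>v\<in>?Y. z = w \<circ> v)"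
      by (metis ww simple_mult_twice)
    have "hecke_gen n q i ?f z = (if \<exists>v\<in>?Y. z = w \<circ> v then 1 else 0)"
    proof (cases "\<exists>v\<in>?Y. z = w \<circ> v")
      case True
      then obtain v where v: "v \<in> ?Y" "z = w \<circ> v" by blast
      have d: "descent z i"
        unfolding descent_def v(2) inv_comp_perms[OF w young_perms[OF v(1)]]
        using lt[OF v(1)] by (simp add: p_def p'_def)
      have "\<not> (\<exists>v\<in>?Y. z = ?w \<circ> v)"
      proof
        assume "\<exists>v\<in>?Y. z = ?w \<circ> v"
        then obtain u where u: "u \<in> ?Y" "z = ?w \<circ> u" by blast
        have "inv_into UNIV z i = inv_into UNIV u p" "inv_into UNIV z (Suc i) = inv_into UNIV u p'"
          unfolding u(2) inv_comp_perms[OF w' young_perms[OF u(1)]] inv' by auto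
        then show False using d lt[OF u(1)] by (simp add: descent_def)
      qed
      then show ?thesis using True d coset by (simp add: hecke_gen_apply_descent[OF z R(1)])
    next
      case False
      show ?thesis
      proof (cases "\<exists>v\<in>?Y. z = ?w \<circ> v")
        case True
        then obtain v where v: "v \<in> ?Y" "z = ?w \<circ> v" by blast
        have "\<not> descent z i"
          unfolding descent_def v(2) inv_comp_perms[OF w' young_perms[OF v(1)]] inv'
          using lt[OF v(1)] by simp
        then show ?thesis using False coset by (simp add: hecke_gen_apply_descent[OF z R(1)])
      next
        case F2: False
        then show ?thesis using False coset by (simp add: hecke_gen_apply_descent[OF z R(1)])
      qed
    qed
    then show "foldr (hecke_gen n q) (i # is) (row_sym n \<mu>) z = (if \<exists>v\<in>?Y. z = w \<circ> v then 1 else 0)"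
      by (simp add: IH)
  qed
qed

text \<open>Here \<open>w\<close> is shortest in its coset on the other side, so on the coefficients
  at \<open>u' \<circ> w\<close> the generators of the Young subgroup act as they do on the
  coefficient at \<open>u'\<close>. The start is the unit function at \<open>id\<close>, and
  applying \<open>T_u\<close> to it gives the unit function at \<open>u\<close>.\<close>

lemma hecke_word_coset:
  assumes n: "sum_list \<mu> = n" and w: "w \<in> perms n" and inc: "increasing_on_blocks \<mu> (inv_into UNIV w)"
    and f: "\<And>u. u \<in> young_subgroup n \<mu> \<Longrightarrow> f (u \<circ> w) = (if u = id then 1 else 0)"
    and u: "u \<in> young_subgroup n \<mu>" and r: "reduced_word n u is"
  shows "u' \<in> young_subgroup n \<mu> \<Longrightarrow> foldr (hecke_gen n q) is f (u' \<circ> w) = (if u' = u then 1 else 0)"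
  using u r
proof (induction "is" arbitrary: u u')
  case Nil
  then have "u = id" by (auto simp: reduced_word_def)
  moreover have "foldr (hecke_gen n q) [] f = f" by simp
  ultimately show ?case using f[OF Nil.prems(1)] by (simp only:)
next
  case (Cons i "is")
  let ?Y = "young_subgroup n \<mu>" and ?u = "simple_mult i u"
  note R = reduced_word_Cons[OF Cons.prems(3)]
  have up: "u \<in> perms n" "u' \<in> perms n" using Cons.prems young_perms by blast+
  obtain k where k: "i = Suc k" using R(1) by (cases i) auto
  have "i \<in> {1..n}" "Suc i \<in> {1..n}" using R(1) by auto
  obtain r where r: "r < length \<mu>" "i \<in> block \<mu> r" using block_cover[of i \<mu>] \<open>i \<in> {1..n}\<close> n by auto
  obtain r' where r': "r' < length \<mu>" "Suc i \<in> block \<mu> r'" using block_cover[of "Suc i" \<mu>] \<open>Suc i \<in> {1..n}\<close> n by auto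
  have "r = r'"
  proof (rule ccontr)
    assume "r \<noteq> r'"
    then have "r < r'" using block_less[OF r'(2) r(2)] by (metis Suc_lessD less_irrefl linorder_neqE_nat)
    from block_less[OF young_inv_apply[OF Cons.prems(2) r] young_inv_apply[OF Cons.prems(2) r'] this]
    show False using R(2) by (simp add: descent_def)
  qed
  then have kb: "k \<in> block_pos \<mu>" using block_block_pos[of r \<mu> k] r r' k by simp
  have Y: "simple_mult i v \<in> ?Y \<longleftrightarrow> v \<in> ?Y" for v using young_simple_mult[OF kb n] k by simp
  have IH: "foldr (hecke_gen n q) is f (v \<circ> w) = (if v = ?u then 1 else 0)" if "v \<in> ?Y" for v
    by (rule Cons.IH[OF that _ R(3)]) (use Y Cons.prems in blast)
  have z: "u' \<circ> w \<in> perms n" using up w by (auto intro: permutes_compose)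
  have sz: "simple_mult i (u' \<circ> w) = simple_mult i u' \<circ> w" by (simp add: o_assoc)
  have d: "descent (u' \<circ> w) i \<longleftrightarrow> descent u' i"
  proof -
    have b: "inv_into UNIV u' i \<in> block \<mu> r" "inv_into UNIV u' (Suc i) \<in> block \<mu> r"
      using young_inv_apply[OF Cons.prems(1)] r r' \<open>r = r'\<close> by auto
    show ?thesis
      unfolding descent_def inv_comp_perms[OF up(2) w]
      using inc b r(1) unfolding increasing_on_blocks_def by (metis not_less_iff_gr_or_eq)
  qed
  have uu: "simple_mult i u' = ?u \<longleftrightarrow> u' = u" by (metis simple_mult_twice)
  have nd: "\<not> descent ?u i" using R(2) by (simp add: descent_simple_mult_self[OF up(1)])
  have "hecke_gen n q i (foldr (hecke_gen n q) is f) (u' \<circ> w) = (if u' = u then 1 else 0)"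
    unfolding hecke_gen_apply_descent[OF z R(1)] d sz
    using IH[of "simple_mult i u'"] IH[of u'] Y Cons.prems(1) uu nd R(2) by auto
  moreover have "foldr (hecke_gen n q) (i # is) f = hecke_gen n q i (foldr (hecke_gen n q) is f)" by simp
  ultimately show ?case by (simp only:)
qed

definition boxes :: "nat list \<Rightarrow> (nat \<times> nat) set" where
  "boxes \<mu> = {(r, j). r < length \<mu> \<and> j < \<mu> ! r}"

definition box_index :: "nat list \<Rightarrow> nat \<times> nat \<Rightarrow> nat" where
  "box_index \<mu> = (\<lambda>(r, j). sum_list (take r \<mu>) + Suc j)"

lemma box_index_block: "(r, j) \<in> boxes \<mu> \<Longrightarrow> box_index \<mu> (r, j) \<in> block \<mu> r"
  by (auto simp: boxes_def box_index_def block_def sum_list_take_Suc)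

lemma block_box_index:
  assumes "r < length \<mu>" "a \<in> block \<mu> r"
  obtains j where "(r, j) \<in> boxes \<mu>" "a = box_index \<mu> (r, j)"
proof
  show "(r, a - Suc (sum_list (take r \<mu>))) \<in> boxes \<mu>" "a = box_index \<mu> (r, a - Suc (sum_list (take r \<mu>)))"
    using assms by (auto simp: boxes_def box_index_def block_def sum_list_take_Suc)
qed

lemma bij_betw_box_index: "bij_betw (box_index \<mu>) (boxes \<mu>) {1..sum_list \<mu>}"
  unfolding bij_betw_def
proof
  show "inj_on (box_index \<mu>) (boxes \<mu>)"
  proof
    fix x y assume xy: "x \<in> boxes \<mu>" "y \<in> boxes \<mu>" "box_index \<mu> x = box_index \<mu> y"
    obtain r j s k where e: "x = (r, j)" "y = (s, k)" by fastforce
    have "r = s" using box_index_block[of r j \<mu>] box_index_block[of s k \<mu>] xy e block_unique by metis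
    then show "x = y" using xy e by (simp add: box_index_def)
  qed
  show "box_index \<mu> ` boxes \<mu> = {1..sum_list \<mu>}"
  proof
    show "box_index \<mu> ` boxes \<mu> \<subseteq> {1..sum_list \<mu>}"
    proof
      fix a assume "a \<in> box_index \<mu> ` boxes \<mu>"
      then obtain r j where "r < length \<mu>" "a \<in> block \<mu> r"
        using box_index_block by (force simp: boxes_def)
      then show "a \<in> {1..sum_list \<mu>}" using sum_list_take_le[of "Suc r" \<mu>] by (auto simp: block_def)
    qed
    show "{1..sum_list \<mu>} \<subseteq> box_index \<mu> ` boxes \<mu>"
      using block_cover block_box_index by (metis image_eqI subsetI)
  qed
qed

lemma down_closed_lessThan:
  fixes A :: "nat set"
  assumes fin: "finite A" and down: "\<And>a b. a \<le> b \<Longrightarrow> b \<in> A \<Longrightarrow> a \<in> A"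
  shows "A = {..<card A}"
proof (cases "A = {}")
  case False
  define m where "m = Max A"
  have "m \<in> A" unfolding m_def using Max_in[OF fin False] .
  have "x \<in> A \<longleftrightarrow> x \<le> m" for x using down[of x m] \<open>m \<in> A\<close> Max_ge[OF fin, of x] by (auto simp: m_def)
  then have A: "A = {..m}" by auto
  show ?thesis unfolding A by (simp add: lessThan_Suc_atMost)
qed simp

lemma conj_boxes:
  assumes "is_partition n \<tau>"
  shows "(j, r) \<in> boxes (conj_partition \<tau>) \<longleftrightarrow> (r, j) \<in> boxes \<tau>"
proof -
  have s: "\<tau> ! b \<le> \<tau> ! a" if "a \<le> b" "b < length \<tau>" for a b
    using assms that by (cases "a = b") (auto simp: is_partition_def sorted_wrt_iff_nth_less)
  have "{i. i < length \<tau> \<and> j < \<tau> ! i} = {..<length (filter (\<lambda>p. j < p) \<tau>)}"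
  proof -
    let ?A = "{i. i < length \<tau> \<and> j < \<tau> ! i}"
    have fin: "finite ?A" by simp
    have down: "a \<in> ?A" if "a \<le> b" "b \<in> ?A" for a b using that s[of a b] by auto
    have "?A = {..<card ?A}" by (rule down_closed_lessThan[OF fin down])
    then show ?thesis by (simp only: length_filter_conv_card)
  qed
  then have "r < length (filter (\<lambda>p. j < p) \<tau>) \<longleftrightarrow> r < length \<tau> \<and> j < \<tau> ! r" by auto
  moreover have "j < foldr max \<tau> 0" if "r < length \<tau>" "j < \<tau> ! r"
    using le_foldr_max[of "\<tau> ! r" \<tau>] that by simp
  ultimately show ?thesis by (auto simp: boxes_def length_conj nth_conj)
qed

text \<open>The numberings of the boxes along rows and along columns are bijections onto the same
  interval. One composed with the inverse of the other is the permutation sought, and it is the only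
  one since every number is the index of a box.\<close>

lemma row_to_column_ex:
  assumes \<tau>: "is_partition n \<tau>"
  shows "row_to_column n \<tau> permutes {1..n}"
    "\<And>r j. (r, j) \<in> boxes \<tau> \<Longrightarrow> row_to_column n \<tau> (box_index \<tau> (r, j)) = box_index (conj_partition \<tau>) (j, r)"
proof -
  let ?c = "conj_partition \<tau>"
  have sn: "sum_list \<tau> = n" "sum_list ?c = n" using \<tau> by (auto simp: is_partition_def sum_list_conj)
  have b1: "bij_betw (box_index \<tau>) (boxes \<tau>) {1..n}" and b2: "bij_betw (box_index ?c) (boxes ?c) {1..n}"
    using bij_betw_box_index[of \<tau>] bij_betw_box_index[of ?c] sn by auto
  have b3: "bij_betw prod.swap (boxes \<tau>) (boxes ?c)"
  proof -
    have "(a, b) \<in> prod.swap ` boxes \<tau> \<longleftrightarrow> (a, b) \<in> boxes ?c" for a b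
      unfolding conj_boxes[OF \<tau>] by (force simp: image_iff)
    then show ?thesis unfolding bij_betw_def by auto
  qed
  define g where "g = box_index ?c \<circ> prod.swap \<circ> inv_into (boxes \<tau>) (box_index \<tau>)"
  define w where "w = (\<lambda>a. if a \<in> {1..n} then g a else a)"
  have "bij_betw g {1..n} {1..n}"
    unfolding g_def by (intro bij_betw_trans[OF bij_betw_inv_into[OF b1]] bij_betw_trans[OF b3 b2])
  moreover have "bij_betw w {1..n} {1..n} = bij_betw g {1..n} {1..n}"
    by (intro bij_betw_cong) (simp add: w_def)
  ultimately have "bij_betw w {1..n} {1..n}" by simp
  then have wp: "w permutes {1..n}" by (rule bij_imp_permutes) (auto simp: w_def)
  have wb: "w (box_index \<tau> (r, j)) = box_index ?c (j, r)" if "(r, j) \<in> boxes \<tau>" for r j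
  proof -
    have "box_index \<tau> (r, j) \<in> {1..n}" using b1 that by (auto simp: bij_betw_def)
    moreover have "inv_into (boxes \<tau>) (box_index \<tau>) (box_index \<tau> (r, j)) = (r, j)"
      using b1 that by (simp add: bij_betw_def inv_into_f_f)
    ultimately show ?thesis by (simp add: w_def g_def)
  qed
  let ?P = "\<lambda>w. w permutes {1..n} \<and> (\<forall>r<length \<tau>. \<forall>j<\<tau> ! r.
        w (sum_list (take r \<tau>) + Suc j) = sum_list (take j ?c) + Suc r)"
  have Pb: "?P v \<longleftrightarrow> v permutes {1..n} \<and> (\<forall>r j. (r, j) \<in> boxes \<tau> \<longrightarrow> v (box_index \<tau> (r, j)) = box_index ?c (j, r))" for v
    by (auto simp: boxes_def box_index_def)
  have "row_to_column n \<tau> = w"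
    unfolding row_to_column_def
  proof (rule the_equality)
    show "?P w" unfolding Pb using wp wb by blast
    fix v assume "?P v"
    then have v: "v permutes {1..n}" "\<And>r j. (r, j) \<in> boxes \<tau> \<Longrightarrow> v (box_index \<tau> (r, j)) = box_index ?c (j, r)"
      unfolding Pb by auto
    show "v = w"
    proof
      fix a
      show "v a = w a"
      proof (cases "a \<in> {1..n}")
        case True
        then have "a \<in> box_index \<tau> ` boxes \<tau>" using b1 by (simp add: bij_betw_imp_surj_on)
        then obtain r j where "(r, j) \<in> boxes \<tau>" "a = box_index \<tau> (r, j)" by (metis imageE surj_pair)
        then show ?thesis using v(2) wb by simp
      qed (use v(1) wp permutes_not_in in metis)
    qed
  qed
  then show "row_to_column n \<tau> permutes {1..n}"
    "\<And>r j. (r, j) \<in> boxes \<tau> \<Longrightarrow> row_to_column n \<tau> (box_index \<tau> (r, j)) = box_index (conj_partition \<tau>) (j, r)"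
    using wp wb by simp_all
qed

lemma specht_generator_space:
  assumes "is_partition n \<tau>"
  shows "specht_generator n q \<tau> \<in> hecke_space n"
proof -
  have "hv.subspace (hecke_space n)"
    unfolding hv.subspace_def by (auto simp: hecke_space_def)
  moreover have "row_to_column n \<tau> \<in> perms n" using row_to_column_ex[OF assms] by simp
  ultimately show ?thesis
    unfolding specht_generator_alt
    by (intro hv.subspace_sum hv.subspace_scale hecke_T_space sym_space) (auto simp: young_subgroup_iff)
qed

text \<open>Only the identity of the column group contributes to this coefficient. If u fixes the
  columns and \<open>u \<circ> w = w \<circ> v\<close> with v fixing the rows, then u keeps both the
  column and the row of every box, hence every box.\<close>

lemma specht_generator_nonzero:
  assumes \<tau>: "is_partition n \<tau>"
  shows "specht_generator n q \<tau> (row_to_column n \<tau>) = 1"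
proof -
  let ?c = "conj_partition \<tau>" and ?w = "row_to_column n \<tau>"
  have sn: "sum_list \<tau> = n" "sum_list ?c = n" using \<tau> by (auto simp: is_partition_def sum_list_conj)
  note wb = row_to_column_ex(2)[OF \<tau>]
  have w: "?w \<in> perms n" using row_to_column_ex(1)[OF \<tau>] by simp
  have row: "\<exists>j. (r, j) \<in> boxes \<tau> \<and> a = box_index \<tau> (r, j)" if "r < length \<tau>" "a \<in> block \<tau> r" for r a
    using block_box_index[OF that] by blast
  have inc1: "increasing_on_blocks \<tau> ?w"
    unfolding increasing_on_blocks_def
  proof (intro allI impI ballI)
    fix r a b assume r: "r < length \<tau>" and ab: "a \<in> block \<tau> r" "b \<in> block \<tau> r" "a < b"
    obtain j k where j: "(r, j) \<in> boxes \<tau>" "a = box_index \<tau> (r, j)" and k: "(r, k) \<in> boxes \<tau>" "b = box_index \<tau> (r, k)"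
      using row r ab by metis
    have "j < k" using ab(3) j k by (simp add: box_index_def)
    moreover have "?w a \<in> block ?c j" "?w b \<in> block ?c k"
      using j k conj_boxes[OF \<tau>] by (simp_all add: wb box_index_block)
    ultimately show "?w a < ?w b" using block_less by blast
  qed
  have inc2: "increasing_on_blocks ?c (inv_into UNIV ?w)"
    unfolding increasing_on_blocks_def
  proof (intro allI impI ballI)
    fix j a b assume j: "j < length ?c" and ab: "a \<in> block ?c j" "b \<in> block ?c j" "a < b"
    obtain r where r: "(j, r) \<in> boxes ?c" "a = box_index ?c (j, r)" using block_box_index[OF j ab(1)] .
    obtain s where s: "(j, s) \<in> boxes ?c" "b = box_index ?c (j, s)" using block_box_index[OF j ab(2)] .
    have rs: "r < s" using ab(3) r s by (simp add: box_index_def)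
    have "(r, j) \<in> boxes \<tau>" "(s, j) \<in> boxes \<tau>" using r s conj_boxes[OF \<tau>] by auto
    moreover have "inv_into UNIV ?w a = box_index \<tau> (r, j)" "inv_into UNIV ?w b = box_index \<tau> (s, j)"
      using calculation wb r s perm_inverses(2)[OF w] by metis+
    ultimately show "inv_into UNIV ?w a < inv_into UNIV ?w b"
      using block_less[OF box_index_block box_index_block rs] by simp
  qed
  let ?f = "hecke_T n q ?w (row_sym n \<tau>)"
  have f: "?f = (\<lambda>z. if \<exists>v\<in>young_subgroup n \<tau>. z = ?w \<circ> v then 1 else 0)"
    unfolding hecke_T_def by (rule hecke_word_row_sym[OF sn(1) reduced_word_some[OF w] inc1])
  have fu: "?f (u \<circ> ?w) = (if u = id then 1 else 0)" if u: "u \<in> young_subgroup n ?c" for u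
  proof (cases "u = id")
    case True
    then show ?thesis using young_id[of n \<tau>] by (auto simp: f intro!: bexI[of _ id])
  next
    case False
    have "\<not> (\<exists>v\<in>young_subgroup n \<tau>. u \<circ> ?w = ?w \<circ> v)"
    proof
      assume "\<exists>v\<in>young_subgroup n \<tau>. u \<circ> ?w = ?w \<circ> v"
      then obtain v where v: "v \<in> young_subgroup n \<tau>" "u \<circ> ?w = ?w \<circ> v" by blast
      have "u b = b" for b
      proof (cases "b \<in> {1..n}")
        case True
        then obtain j where j: "j < length ?c" "b \<in> block ?c j" using block_cover[of b ?c] sn by auto
        then obtain r where r: "(j, r) \<in> boxes ?c" "b = box_index ?c (j, r)" using block_box_index by metis
        then have rj: "(r, j) \<in> boxes \<tau>" using conj_boxes[OF \<tau>] by blast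
        then have "?w (box_index \<tau> (r, j)) = b" using wb r by simp
        then have ub: "u b = ?w (v (box_index \<tau> (r, j)))" using fun_cong[OF v(2)] by (metis comp_apply)
        have "v (box_index \<tau> (r, j)) \<in> block \<tau> r"
          using young_apply[OF v(1) _ box_index_block[OF rj]] rj by (auto simp: boxes_def)
        then obtain k where k: "(r, k) \<in> boxes \<tau>" "v (box_index \<tau> (r, j)) = box_index \<tau> (r, k)"
          using row rj by (metis (mono_tags, lifting) boxes_def case_prodD mem_Collect_eq)
        then have "u b = box_index ?c (k, r)" using ub wb by simp
        moreover have "(k, r) \<in> boxes ?c" using k conj_boxes[OF \<tau>] by blast
        ultimately have "u b \<in> block ?c k" using box_index_block by metis
        moreover have "u b \<in> block ?c j" using young_apply[OF u j] .
        ultimately have "k = j" using block_unique by blast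
        then show ?thesis using \<open>u b = box_index ?c (k, r)\<close> r by simp
      qed (use u permutes_not_in[of u "{1..n}" b] in \<open>simp add: young_subgroup_iff\<close>)
      then show False using False by auto
    qed
    then show ?thesis using False by (auto simp: f)
  qed
  have coset: "hecke_T n q u ?f ?w = (if u = id then 1 else 0)" if u: "u \<in> young_subgroup n ?c" for u
    using hecke_word_coset[OF sn(2) w inc2 fu u reduced_word_some[OF young_perms[OF u]] young_id]
    unfolding hecke_T_def by (simp only: id_o eq_commute[of id u])
  have "specht_generator n q \<tau> ?w = (\<Sum>u\<in>young_subgroup n ?c. (- inverse q) ^ perm_length n u * hecke_T n q u ?f ?w)"
    unfolding specht_generator_alt sum_apply ..
  also have "\<dots> = (\<Sum>u\<in>young_subgroup n ?c. if u = id then 1 else 0)"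
    by (intro sum.cong refl) (simp add: coset)
  also have "\<dots> = 1" using young_id[of n ?c] finite_young by simp
  finally show ?thesis .
qed

lemma specht_closed:
  "specht_generator n q \<tau> \<in> specht n q \<tau>"
  "hv.subspace (specht n q \<tau>)"
  "\<And>i v. i \<in> {1..<n} \<Longrightarrow> v \<in> specht n q \<tau> \<Longrightarrow> hecke_gen n q i v \<in> specht n q \<tau>"
proof -
  let ?S = "\<lambda>V. hv.subspace V \<and> (\<forall>i\<in>{1..<n}. \<forall>v\<in>V. hecke_gen n q i v \<in> V)"
  have "?S (?S hull {specht_generator n q \<tau>})"
    by (rule hull_in) (auto simp: hv.subspace_def)
  then show "hv.subspace (specht n q \<tau>)"
    "\<And>i v. i \<in> {1..<n} \<Longrightarrow> v \<in> specht n q \<tau> \<Longrightarrow> hecke_gen n q i v \<in> specht n q \<tau>"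
    unfolding specht_def by blast+
  show "specht_generator n q \<tau> \<in> specht n q \<tau>"
    unfolding specht_def using hull_subset[of "{specht_generator n q \<tau>}" ?S] by simp
qed

lemma specht_minimal:
  assumes "specht_generator n q \<tau> \<in> V" "hv.subspace V"
    "\<And>i v. i \<in> {1..<n} \<Longrightarrow> v \<in> V \<Longrightarrow> hecke_gen n q i v \<in> V"
  shows "specht n q \<tau> \<subseteq> V"
  unfolding specht_def using assms by (intro hull_minimal) auto

lemma specht_space:
  assumes "is_partition n \<tau>"
  shows "specht n q \<tau> \<subseteq> hecke_space n"
  by (rule specht_minimal)
    (use specht_generator_space[OF assms] hecke_gen_space in \<open>auto simp: hv.subspace_def hecke_space_def\<close>)

context quantum
begin

lemma delta_supported: "c \<in> C \<Longrightarrow> delta c \<in> supported C"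
  by (auto simp: supported_def)

text \<open>Irreducibility: the Jucys--Murphy elements isolate one basis vector occurring in a
  nonzero vector, and from there the swaps reach all the others.\<close>

lemma submodule_all:
  assumes sub: "U \<subseteq> supported (shape_contents n \<nu>)"
    and add: "\<And>u v. u \<in> U \<Longrightarrow> v \<in> U \<Longrightarrow> (\<lambda>p. u p + v p) \<in> U"
    and scale: "\<And>u a. u \<in> U \<Longrightarrow> (\<lambda>p. a * u p) \<in> U"
    and top: "\<And>u k. u \<in> U \<Longrightarrow> Suc k < n \<Longrightarrow> top k u \<in> U"
    and u0: "u0 \<in> U" "u0 \<noteq> (\<lambda>_. 0)"
  shows "U = supported (shape_contents n \<nu>)"
proof -
  let ?C = "shape_contents n \<nu>"
  note C = swap_closed_shape[of n \<nu>]
  have jm: "jm k u \<in> U" if "u \<in> U" "k < n" for u k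
    using that
  proof (induction k arbitrary: u)
    case 0
    then show ?case using scale[of u 0] by simp
  next
    case (Suc k)
    have "top k (jm k (top k u)) \<in> U" using top Suc by simp
    from scale[OF add[OF this top[OF Suc.prems]], of "1 / q"] show ?case by simp
  qed
  obtain c where c: "u0 c \<noteq> 0" using u0 by auto
  have len: "length c = n" if "u0 c \<noteq> 0" for c
    using sub u0 that by (force simp: supported_def shape_words_def yam_words_def)
  have "delta c \<in> U"
  proof (rule interpolation[where m = "\<lambda>k p. qint q (p ! k)" and K = "{..<n}" and u = u0])
    show "(\<lambda>p. qint q (p ! k) * u p) \<in> U" if "u \<in> U" "k \<in> {..<n}" for u k
      using jm[of u k] jm_eigen[OF C, of k u] sub that by auto
    show "finite {p. u0 p \<noteq> 0}"
      by (rule finite_subset[of _ ?C]) (use sub u0 finite_shape_words in \<open>auto simp: supported_def\<close>)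
    fix p p' assume "u0 p \<noteq> 0" "u0 p' \<noteq> 0" "p \<noteq> p'"
    then obtain k where "k < n" "p ! k \<noteq> p' ! k" using len nth_equalityI by metis
    then show "\<exists>k\<in>{..<n}. qint q (p ! k) \<noteq> qint q (p' ! k)" using qint_inj by auto
  qed (use add scale u0 c in auto)
  obtain w where w: "w \<in> shape_words n \<nu>" "c = contents w" using c sub u0 by (auto simp: supported_def)
  have all: "delta d \<in> U" if d: "d \<in> ?C" for d
  proof -
    define U' where "U' = {F :: int list \<times> unit \<Rightarrow> complex. (\<lambda>c. F (c, ())) \<in> U}"
    have iff: "delta (d, ()) \<in> U' \<longleftrightarrow> delta d \<in> U" for d by (simp add: U'_def)
    obtain v where "v \<in> shape_words n \<nu>" "d = contents v" using d by blast
    then show ?thesis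
      using delta_connected[of U' n w \<nu> v "()"] add scale top w \<open>delta c \<in> U\<close> iff
      by (simp add: U'_def)
  qed
  have "u \<in> U" if u: "u \<in> supported ?C" for u
  proof -
    have "(\<lambda>p. \<Sum>d\<in>S. u d * delta d p) \<in> U" if "finite S" "S \<subseteq> ?C" for S
      using that
    proof (induction S rule: finite_induct)
      case empty
      then show ?case using scale[OF u0(1), of 0] by simp
    next
      case (insert d S)
      then show ?case using add[OF scale[OF all[of d], of "u d"]] by simp
    qed
    from this[of ?C] have "(\<lambda>p. \<Sum>d\<in>?C. u d * delta d p) \<in> U" using finite_shape_words by auto
    moreover have "(\<lambda>p. \<Sum>d\<in>?C. u d * delta d p) = u"
    proof
      fix p
      have "(\<Sum>d\<in>?C. u d * delta d p) = (\<Sum>d\<in>?C. if p = d then u d else 0)" by (intro sum.cong) auto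
      also have "\<dots> = u p" using u finite_shape_words by (auto simp: supported_def)
      finally show "(\<Sum>d\<in>?C. u d * delta d p) = u p" .
    qed
    ultimately show ?thesis by simp
  qed
  then show ?thesis using sub by blast
qed

text \<open>The isomorphism evaluates the ideal at a basis vector \<open>v0\<close> that the
  generator does not kill. By rank one, an element of the ideal that kills \<open>v0\<close> kills
  all basis vectors of all shapes, so it is 0 by \<open>rep_faithful\<close>. The image is a nonzero
  submodule, hence everything.\<close>

theorem specht_seminormal:
  assumes \<tau>: "is_partition n \<tau>"
  defines "C \<equiv> shape_contents n (part_shape \<tau>)"
  obtains R :: "((nat \<Rightarrow> nat) \<Rightarrow> complex) \<Rightarrow> int list \<Rightarrow> complex" where
    "\<And>f g. R (f + g) = (\<lambda>c. R f c + R g c)"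
    "\<And>a f. R (hscale a f) = (\<lambda>c. a * R f c)"
    "\<And>i f. \<lbrakk>f \<in> specht n q \<tau>; i \<in> {1..<n}\<rbrakk> \<Longrightarrow> R (hecke_gen n q i f) = top (i - 1) (R f)"
    "bij_betw R (specht n q \<tau>) (supported C)"
proof -
  let ?e = "specht_generator n q \<tau>" and ?V = "specht n q \<tau>"
  have w: "row_to_column n \<tau> \<in> perms n" using row_to_column_ex(1)[OF \<tau>] by simp
  note CC = swap_closed_shape[of n "part_shape \<tau>", folded C_def]
  have "?e \<noteq> 0" using specht_generator_nonzero[OF \<tau>, of q] by auto
  then obtain T where T: "T \<in> all_contents n" "rep n ?e (delta T) \<noteq> (\<lambda>_. 0)"
    using rep_faithful[OF specht_generator_space[OF \<tau>]] by blast
  have shape: "\<exists>\<nu>. T \<in> shape_contents n \<nu>" if "T \<in> all_contents n" for T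
    using that by (auto simp: shape_words_def)
  obtain \<nu> where "T \<in> shape_contents n \<nu>" using shape[OF T(1)] by blast
  then have TC: "T \<in> C"
    using generator_other_shape[OF \<tau> w delta_supported T(2)] by (simp add: C_def)
  define v0 where "v0 = delta T"
  have v0: "v0 \<in> supported C" "rep n ?e v0 \<noteq> (\<lambda>_. 0)" using TC T delta_supported by (auto simp: v0_def)
  define R where "R = (\<lambda>f. rep n f v0)"
  have gen: "R (hecke_gen n q i f) = top (i - 1) (R f)" if "i \<in> {1..<n}" for i f
    unfolding R_def by (rule rep_gen[OF CC v0(1) that])
  have inj0: "f = 0" if f: "f \<in> ?V" "R f = (\<lambda>_. 0)" for f
  proof (rule rep_faithful)
    show "f \<in> hecke_space n" using f specht_space[OF \<tau>] by blast
    fix S assume "S \<in> all_contents n"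
    then obtain \<nu> where S: "S \<in> shape_contents n \<nu>" using shape by blast
    note CS = swap_closed_shape[of n \<nu>] and dS = delta_supported[OF S]
    have "\<exists>a. rep n ?e (delta S) = (\<lambda>c. a * rep n ?e v0 c)"
    proof (cases "\<nu> = part_shape \<tau>")
      case True
      then show ?thesis using generator_rank_one[OF \<tau> w _ _ v0(2)] dS v0(1) by (simp add: C_def)
    next
      case False
      then have "rep n ?e (delta S) = (\<lambda>_. 0)" using generator_other_shape[OF \<tau> w dS] by blast
      then show ?thesis by (intro exI[of _ 0]) simp
    qed
    then obtain a where a: "rep n ?e (delta S) = (\<lambda>c. a * rep n ?e v0 c)" by blast
    \<comment> \<open>Proportionality at the generator passes to the whole left ideal, with the same
      factor, because it is preserved by multiplication from the left.\<close>
    have "?V \<subseteq> {f. rep n f (delta S) = (\<lambda>c. a * rep n f v0 c)}"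
    proof (rule specht_minimal)
      show "?e \<in> {f. rep n f (delta S) = (\<lambda>c. a * rep n f v0 c)}" using a by simp
      show "hv.subspace {f. rep n f (delta S) = (\<lambda>c. a * rep n f v0 c)}"
        unfolding hv.subspace_def
        by (auto simp: rep_lin fun_eq_iff algebra_simps) (simp add: rep_def)
      show "hecke_gen n q i f \<in> {f. rep n f (delta S) = (\<lambda>c. a * rep n f v0 c)}"
        if "i \<in> {1..<n}" "f \<in> {f. rep n f (delta S) = (\<lambda>c. a * rep n f v0 c)}" for i f
        using that by (simp add: rep_gen[OF CS dS that(1)] rep_gen[OF CC v0(1) that(1)] top_lin)
    qed
    then show "rep n f (delta S) = (\<lambda>_. 0)" using f by (auto simp: R_def)
  qed
  have "R ` ?V = supported C"
    unfolding C_def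
  proof (rule submodule_all)
    show "R ` ?V \<subseteq> supported (shape_contents n (part_shape \<tau>))"
      using rep_supported[OF CC v0(1)] by (auto simp: R_def C_def)
    show "(\<lambda>p. u p + v p) \<in> R ` ?V" if uv: "u \<in> R ` ?V" "v \<in> R ` ?V" for u v
    proof -
      obtain f g where "u = R f" "v = R g" "f \<in> ?V" "g \<in> ?V" using uv by blast
      then show ?thesis using hv.subspace_add[OF specht_closed(2)]
        by (intro image_eqI[of _ _ "f + g"]) (auto simp: R_def rep_lin)
    qed
    show "(\<lambda>p. a * u p) \<in> R ` ?V" if u: "u \<in> R ` ?V" for u a
    proof -
      obtain f where "u = R f" "f \<in> ?V" using u by blast
      then show ?thesis using hv.subspace_scale[OF specht_closed(2)]
        by (intro image_eqI[of _ _ "hscale a f"]) (auto simp: R_def rep_lin)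
    qed
    show "top k u \<in> R ` ?V" if u: "u \<in> R ` ?V" "Suc k < n" for u k
    proof -
      obtain f where "u = R f" "f \<in> ?V" using u by blast
      then show ?thesis using specht_closed(3)[of "Suc k" n f q \<tau>] gen[of "Suc k" f] u(2)
        by (intro image_eqI[of _ _ "hecke_gen n q (Suc k) f"]) auto
    qed
    show "R ?e \<in> R ` ?V" using specht_closed(1) by blast
    show "R ?e \<noteq> (\<lambda>_. 0)" using v0(2) by (simp add: R_def)
  qed
  moreover have "inj_on R ?V"
  proof
    fix f g assume fg: "f \<in> ?V" "g \<in> ?V" "R f = R g"
    have fgV: "f - g \<in> ?V" using hv.subspace_diff[OF specht_closed(2)] fg by blast
    have "f + hscale (-1) g = f - g" by (simp add: fun_eq_iff)
    moreover have "R (f + hscale (-1) g) = (\<lambda>_. 0)" unfolding R_def rep_lin using fg(3) by (simp add: R_def)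
    ultimately have "R (f - g) = (\<lambda>_. 0)" by (simp only:)
    then have "f - g = 0" by (rule inj0[OF fgV])
    then show "f = g" by simp
  qed
  ultimately have "bij_betw R ?V (supported C)" by (simp add: bij_betw_def)
  then show ?thesis using that[of R] gen by (simp add: R_def rep_lin)
qed

end


section \<open>Signatures of Hermitian forms\<close>

definition adj :: "complex mat \<Rightarrow> complex mat" where
  "adj A = mat (dim_col A) (dim_row A) (\<lambda>(i, j). cnj (A $$ (j, i)))"

lemma adj_carrier [simp]: "A \<in> carrier_mat n m \<Longrightarrow> adj A \<in> carrier_mat m n"
  by (simp add: adj_def)

lemma index_adj [simp]: "A \<in> carrier_mat n m \<Longrightarrow> i < m \<Longrightarrow> j < n \<Longrightarrow> adj A $$ (i, j) = cnj (A $$ (j, i))"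
  by (simp add: adj_def)

lemma index_mult_sum:
  assumes "A \<in> carrier_mat n m" "B \<in> carrier_mat m k" "i < n" "j < k"
  shows "(A * B) $$ (i, j) = (\<Sum>l<m. A $$ (i, l) * B $$ (l, j))"
  using assms by (auto simp: scalar_prod_def atLeast0LessThan)

lemma mult_square_carrier: "A \<in> carrier_mat n n \<Longrightarrow> B \<in> carrier_mat n n \<Longrightarrow> A * B \<in> carrier_mat n n"
  by simp

lemma adj_mult:
  assumes "A \<in> carrier_mat n m" "B \<in> carrier_mat m k"
  shows "adj (A * B) = adj B * adj A"
proof (rule eq_matI)
  have AB: "A * B \<in> carrier_mat n k" using assms by simp
  fix i j assume "i < dim_row (adj B * adj A)" "j < dim_col (adj B * adj A)"
  then have ij: "i < k" "j < n" using assms by (auto simp: adj_def)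
  then show "adj (A * B) $$ (i, j) = (adj B * adj A) $$ (i, j)"
    using assms index_adj[OF AB] index_adj[OF assms(1)] index_adj[OF assms(2)]
      index_mult_sum[OF adj_carrier[OF assms(2)] adj_carrier[OF assms(1)]] index_mult_sum[OF assms]
    by (simp add: mult.commute)
qed (use assms in \<open>auto simp: adj_def\<close>)

lemma adj_adj: "adj (adj A) = A"
  by (rule eq_matI) (simp_all add: adj_def)

lemma adj_one [simp]: "adj (1\<^sub>m n) = 1\<^sub>m n"
  by (rule eq_matI) (auto simp: adj_def)

lemma adj_eqI:
  assumes A: "A \<in> carrier_mat n n" and h: "\<And>i j. i < n \<Longrightarrow> j < n \<Longrightarrow> A $$ (i, j) = cnj (A $$ (j, i))"
  shows "adj A = A"
proof (rule eq_matI)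
  fix i j assume "i < dim_row A" "j < dim_col A"
  then have "i < n" "j < n" using A by auto
  then show "adj A $$ (i, j) = A $$ (i, j)" using index_adj[OF A] h[of i j] by simp
qed (use A in \<open>auto simp: adj_def\<close>)

text \<open>Gram--Schmidt, started at \<open>v\<close>, leaves \<open>v\<close> unchanged. Dividing
  the resulting orthogonal columns by their norms gives a unitary matrix whose first column is a
  multiple of \<open>v\<close>.\<close>

lemma unitary_completion:
  assumes v: "v \<in> carrier_vec n" "v \<noteq> 0\<^sub>v n"
  shows "\<exists>W a. W \<in> carrier_mat n n \<and> adj W * W = 1\<^sub>m n \<and> a \<noteq> 0 \<and> col W 0 = a \<cdot>\<^sub>v v"
proof -
  interpret cof_vec_space n "TYPE(complex)" .
  have n0: "n \<noteq> 0"
  proof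
    assume "n = 0"
    then have "v = 0\<^sub>v n" using v(1) by (intro eq_vecI) auto
    then show False using v(2) by simp
  qed
  define b where "b = basis_completion v"
  have b: "span (set b) = carrier_vec n" "distinct b" "\<not> lin_dep (set b)" "set b \<subseteq> carrier_vec n" "hd b = v" "length b = n"
    using basis_completion[OF v, folded b_def] by auto
  then obtain vs where bv: "b = v # vs" using n0 by (cases b) auto
  define ws where "ws = gram_schmidt n b"
  have ws: "set ws \<subseteq> carrier_vec n" "corthogonal ws" "length ws = n"
    using gram_schmidt_result[OF b(4,2,3) refl, folded ws_def] b(6) by auto
  have hd: "hd ws = v" using gram_schmidt_hd[OF v(1), of vs, folded bv] by (simp add: ws_def)
  then have ws0: "ws ! 0 = v" using ws(3) n0 by (metis hd_conv_nth list.size(3))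
  have wsi: "ws ! i \<in> carrier_vec n" if "i < n" for i using ws that by auto
  define r where "r = (\<lambda>i. Re (ws ! i \<bullet>c ws ! i))"
  have sp: "ws ! i \<bullet>c ws ! i = complex_of_real (r i)" "r i > 0" if "i < n" for i
  proof -
    have "ws ! i \<bullet>c ws ! i \<noteq> 0" using corthogonalD[OF ws(2), of i i] that ws(3) by simp
    moreover have "ws ! i \<bullet>c ws ! i = complex_of_real (\<Sum>k<n. (cmod (ws ! i $ k))\<^sup>2)"
      using wsi[OF that] by (simp add: scalar_prod_def atLeast0LessThan complex_norm_square[symmetric] del: of_real_power)
    moreover have "(\<Sum>k<n. (cmod (ws ! i $ k))\<^sup>2) \<ge> 0" by (intro sum_nonneg) simp
    ultimately have "ws ! i \<bullet>c ws ! i = complex_of_real (\<Sum>k<n. (cmod (ws ! i $ k))\<^sup>2)"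
      "(\<Sum>k<n. (cmod (ws ! i $ k))\<^sup>2) > 0" by (auto simp del: of_real_sum simp: less_le)
    then show "ws ! i \<bullet>c ws ! i = complex_of_real (r i)" "r i > 0" unfolding r_def by (simp_all del: of_real_sum)
  qed
  define W where "W = mat n n (\<lambda>(i, j). ws ! j $ i / complex_of_real (sqrt (r j)))"
  have W: "W \<in> carrier_mat n n" by (simp add: W_def)
  have "adj W * W = 1\<^sub>m n"
  proof (rule eq_matI)
    fix i j assume "i < dim_row (1\<^sub>m n)" "j < dim_col (1\<^sub>m n)"
    then have ij: "i < n" "j < n" by auto
    have "(adj W * W) $$ (i, j) = (\<Sum>k<n. cnj (W $$ (k, i)) * W $$ (k, j))"
      using ij index_mult_sum[OF adj_carrier[OF W] W] index_adj[OF W] by simp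
    also have "\<dots> = (ws ! j \<bullet>c ws ! i) / (complex_of_real (sqrt (r i)) * complex_of_real (sqrt (r j)))"
      using ij wsi[OF ij(1)] wsi[OF ij(2)]
      by (simp add: W_def scalar_prod_def sum_divide_distrib atLeast0LessThan mult.commute)
    also have "\<dots> = 1\<^sub>m n $$ (i, j)"
    proof (cases "i = j")
      case True
      have "complex_of_real (sqrt (r i)) * complex_of_real (sqrt (r i)) = complex_of_real (r i)"
        using sp(2)[OF ij(1)] by (simp add: of_real_mult[symmetric] del: of_real_mult)
      then show ?thesis using True sp[OF ij(1)] ij by simp
    next
      case False
      then show ?thesis using corthogonalD[OF ws(2), of j i] ij ws(3) by simp
    qed
    finally show "(adj W * W) $$ (i, j) = 1\<^sub>m n $$ (i, j)" .
  qed (use W in \<open>auto simp: adj_def\<close>)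
  moreover have "col W 0 = (1 / complex_of_real (sqrt (r 0))) \<cdot>\<^sub>v v"
    using n0 v(1) by (intro eq_vecI) (auto simp: W_def ws0)
  moreover have "1 / complex_of_real (sqrt (r 0)) \<noteq> 0" using sp(2)[of 0] n0 by simp
  ultimately show ?thesis using W by blast
qed

definition diag_list :: "complex list \<Rightarrow> complex mat" where
  "diag_list es = mat (length es) (length es) (\<lambda>(i, j). if i = j then es ! i else 0)"

text \<open>A unitary matrix with an eigenvector as first column clears the first column, and by
  Hermitian symmetry the first row too; the remaining block is handled by induction. The
  factorization of the characteristic polynomial is carried along because
  \<open>matrix_signature\<close> counts its roots.\<close>

lemma hermitian_diagonalization:
  assumes "A \<in> carrier_mat n n" "adj A = A"
  shows "\<exists>P es. P \<in> carrier_mat n n \<and> length es = n \<and> char_poly A = (\<Prod>e\<leftarrow>es. [:- e, 1:]) \<and>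
    adj P * P = 1\<^sub>m n \<and> adj P * A * P = diag_list es"
  using assms
proof (induction n arbitrary: A)
  case 0
  have "char_poly A = 1"
    using degree_monic_char_poly[OF 0(1)] by (metis coeff_pCons_0 degree_eq_zeroE one_pCons)
  then show ?case using 0 by (intro exI[of _ "1\<^sub>m 0"] exI[of _ "[]"]) (auto simp: diag_list_def)
next
  case (Suc m)
  let ?n = "Suc m"
  note A = Suc.prems(1)
  have "degree (char_poly A) \<noteq> 0" using degree_monic_char_poly[OF A] by simp
  then obtain e where "poly (char_poly A) e = 0"
    using fundamental_theorem_of_algebra[of "char_poly A"] constant_degree[of "char_poly A"] by auto
  then obtain v where "eigenvector A v e"
    using eigenvalue_root_char_poly[OF A] by (auto simp: eigenvalue_def)
  then have v: "v \<in> carrier_vec ?n" "v \<noteq> 0\<^sub>v ?n" "A *\<^sub>v v = e \<cdot>\<^sub>v v"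
    using A by (auto simp: eigenvector_def)
  obtain W a where W: "W \<in> carrier_mat ?n ?n" "adj W * W = 1\<^sub>m ?n" and col: "col W 0 = a \<cdot>\<^sub>v v" "a \<noteq> 0"
    using unitary_completion[OF v(1,2)] by blast
  have WW: "W * adj W = 1\<^sub>m ?n"
    using mat_mult_left_right_inverse[OF adj_carrier[OF W(1)] W(1) W(2)] .
  define A' where "A' = adj W * A * W"
  note sq = mult_square_carrier[of _ ?n] adj_carrier[of _ ?n ?n]
    and ass = assoc_mult_mat[of _ ?n ?n _ ?n _ ?n]
  have A': "A' \<in> carrier_mat ?n ?n" unfolding A'_def by (intro sq A W)
  have hA': "adj A' = A'"
    unfolding A'_def using A W Suc.prems(2)
    by (simp add: adj_mult[of _ ?n ?n _ ?n] adj_adj ass sq)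
  have herm: "A' $$ (i, j) = cnj (A' $$ (j, i))" if "i < ?n" "j < ?n" for i j
    using index_adj[OF A' that] hA' by simp
  have c0: "A' $$ (i, 0) = (if i = 0 then e else 0)" if i: "i < ?n" for i
  proof -
    have "col A' 0 = adj W *\<^sub>v (A *\<^sub>v col W 0)"
    proof -
      have "col A' 0 = (adj W * A) *\<^sub>v col W 0"
        unfolding A'_def by (rule col_mult2[of _ ?n ?n _ ?n]) (auto intro!: sq A W(1))
      then show ?thesis using A W assoc_mult_mat_vec[OF sq(2)[OF W(1)] A, of "col W 0"] by (metis carrier_matD(1) col_dim)
    qed
    also have "A *\<^sub>v col W 0 = e \<cdot>\<^sub>v col W 0"
      unfolding col using A v by (simp add: mult_mat_vec[of _ ?n ?n] smult_smult_assoc mult.commute)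
    also have "adj W *\<^sub>v (e \<cdot>\<^sub>v col W 0) = e \<cdot>\<^sub>v (adj W *\<^sub>v col W 0)"
      by (rule mult_mat_vec[OF sq(2)[OF W(1)]]) (use W(1) in \<open>auto intro: carrier_vecI\<close>)
    also have "adj W *\<^sub>v col W 0 = col (adj W * W) 0"
      by (rule col_mult2[of _ ?n ?n _ ?n, symmetric]) (use W(1) sq in auto)
    finally have "col A' 0 = e \<cdot>\<^sub>v col (1\<^sub>m ?n) 0" unfolding W(2) .
    from arg_cong[OF this, of "\<lambda>v. v $ i"] show ?thesis using i A' by simp
  qed
  have r0: "A' $$ (0, i) = (if i = 0 then e else 0)" if i: "i < ?n" for i
  proof (cases "i = 0")
    case False
    then show ?thesis using herm[of 0 i] c0[OF i] i by simp
  qed (use c0[of 0] in simp)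
  define B where "B = mat m m (\<lambda>(i, j). A' $$ (Suc i, Suc j))"
  have B: "B \<in> carrier_mat m m" by (simp add: B_def)
  have hB: "adj B = B"
  proof (rule adj_eqI[OF B])
    fix i j assume "i < m" "j < m"
    then show "B $$ (i, j) = cnj (B $$ (j, i))" using herm[of "Suc i" "Suc j"] by (simp add: B_def)
  qed
  have A'B: "A' = four_block_mat (mat 1 1 (\<lambda>_. e)) (0\<^sub>m 1 m) (0\<^sub>m m 1) B"
  proof (rule eq_matI)
    fix i j assume "i < dim_row (four_block_mat (mat 1 1 (\<lambda>_. e)) (0\<^sub>m 1 m) (0\<^sub>m m 1) B)"
      "j < dim_col (four_block_mat (mat 1 1 (\<lambda>_. e)) (0\<^sub>m 1 m) (0\<^sub>m m 1) B)"
    then have "i < ?n" "j < ?n" using B by auto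
    then show "A' $$ (i, j) = four_block_mat (mat 1 1 (\<lambda>_. e)) (0\<^sub>m 1 m) (0\<^sub>m m 1) B $$ (i, j)"
      using B c0[of i] r0[of j] by (cases i; cases j) (simp_all add: B_def)
  qed (use A' B in auto)
  obtain P es where P: "P \<in> carrier_mat m m" "length es = m" "char_poly B = (\<Prod>e\<leftarrow>es. [:- e, 1:])"
    "adj P * P = 1\<^sub>m m" "adj P * B * P = diag_list es"
    using Suc.IH[OF B hB] by blast
  define Q where "Q = four_block_mat (1\<^sub>m 1) (0\<^sub>m 1 m) (0\<^sub>m m 1) P"
  have Q: "Q \<in> carrier_mat ?n ?n" using P by (auto simp: Q_def)
  have aQ: "adj Q = four_block_mat (1\<^sub>m 1) (0\<^sub>m 1 m) (0\<^sub>m m 1) (adj P)"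
    using P(1) by (intro eq_matI) (auto simp: Q_def adj_def)
  have aP: "adj P \<in> carrier_mat m m" using P(1) by simp
  have aPB: "adj P * B \<in> carrier_mat m m" "adj P * B * P \<in> carrier_mat m m"
    by (intro mult_square_carrier aP B P(1))+
  note z = right_mult_zero_mat[OF aP] left_mult_zero_mat[OF P(1)] left_mult_zero_mat[OF B]
    right_mult_zero_mat[OF aPB(1)] left_add_zero_mat[OF aPB(1)] left_add_zero_mat[OF aPB(2)]
  have QQ: "adj Q * Q = 1\<^sub>m ?n"
  proof -
    have "adj Q * Q = four_block_mat (1\<^sub>m 1) (0\<^sub>m 1 m) (0\<^sub>m m 1) (adj P * P)"
      unfolding aQ unfolding Q_def
      by (subst mult_four_block_mat[OF _ _ _ aP _ _ _ P(1)]) (auto simp: z P(4))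
    also have "\<dots> = 1\<^sub>m ?n" unfolding P(4) by (intro eq_matI) auto
    finally show ?thesis .
  qed
  have QAQ: "adj Q * A' * Q = diag_list (e # es)"
  proof -
    have 1: "adj Q * A' = four_block_mat (mat 1 1 (\<lambda>_. e)) (0\<^sub>m 1 m) (0\<^sub>m m 1) (adj P * B)"
      unfolding aQ A'B
      by (subst mult_four_block_mat[OF _ _ _ aP _ _ _ B]) (auto simp: z)
    have "adj Q * A' * Q = four_block_mat (mat 1 1 (\<lambda>_. e)) (0\<^sub>m 1 m) (0\<^sub>m m 1) (adj P * B * P)"
      unfolding 1 unfolding Q_def
      by (subst mult_four_block_mat[OF _ _ _ aPB(1) _ _ _ P(1)]) (auto simp: z)
    also have "\<dots> = diag_list (e # es)" unfolding P(5)
    proof (rule eq_matI)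
      fix i j assume "i < dim_row (diag_list (e # es))" "j < dim_col (diag_list (e # es))"
      then have "i < ?n" "j < ?n" using P(2) by (auto simp: diag_list_def)
      then show "four_block_mat (mat 1 1 (\<lambda>_. e)) (0\<^sub>m 1 m) (0\<^sub>m m 1) (diag_list es) $$ (i, j) = diag_list (e # es) $$ (i, j)"
        by (cases i; cases j) (simp_all add: diag_list_def P(2))
    qed (auto simp: diag_list_def P(2))
    finally show ?thesis .
  qed
  have "similar_mat A' A"
    unfolding similar_mat_def similar_mat_wit_def A'_def
    using A W WW by (intro exI[of _ "adj W"] exI[of _ W]) (auto simp: Let_def adj_def)
  then have "char_poly A = char_poly A'" using char_poly_similar by metis
  also have "\<dots> = char_poly (mat 1 1 (\<lambda>_. e)) * char_poly B"
    unfolding A'B by (rule char_poly_four_block_zeros_col[OF _ _ B]) auto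
  also have "char_poly (mat 1 1 (\<lambda>_. e)) = [:- e, 1:]"
    by (simp add: char_poly_defs det_def sign_def)
  finally have cp: "char_poly A = (\<Prod>e\<leftarrow>e # es. [:- e, 1:])" using P(3) by simp
  have WQ: "adj (W * Q) = adj Q * adj W" by (rule adj_mult[OF W(1) Q])
  have c: "adj W * X \<in> carrier_mat ?n ?n" "W * X \<in> carrier_mat ?n ?n" "X * Q \<in> carrier_mat ?n ?n"
    if "X \<in> carrier_mat ?n ?n" for X using that W(1) Q by (auto intro!: sq)
  have "adj W * (W * Q) = Q"
    using ass[OF sq(2)[OF W(1)] W(1) Q] W(2) Q by simp
  then have 1: "adj (W * Q) * (W * Q) = 1\<^sub>m ?n"
    unfolding WQ using ass[OF sq(2)[OF Q] sq(2)[OF W(1)] c(2)[OF Q]] QQ by simp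
  have "adj (W * Q) * A * (W * Q) = adj Q * (adj W * A) * (W * Q)"
    unfolding WQ using ass[OF sq(2)[OF Q] sq(2)[OF W(1)] A] by simp
  also have "\<dots> = adj Q * (adj W * A * (W * Q))"
    by (rule ass[OF sq(2)[OF Q] c(1)[OF A] c(2)[OF Q]])
  also have "adj W * A * (W * Q) = A' * Q"
    unfolding A'_def by (rule ass[OF c(1)[OF A] W(1) Q, symmetric])
  also have "adj Q * (A' * Q) = adj Q * A' * Q" by (rule ass[OF sq(2)[OF Q] A' Q, symmetric])
  finally have 2: "adj (W * Q) * A * (W * Q) = diag_list (e # es)" using QAQ by simp
  show ?case using 1 2 cp W(1) Q P(2) by (intro exI[of _ "W * Q"] exI[of _ "e # es"]) auto
qed

lemma proots_prod_linear: "proots (\<Prod>e\<leftarrow>es. [:- e, 1:]) = mset (es :: complex list)"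
proof (induction es)
  case (Cons e es)
  have "(\<Prod>e\<leftarrow>es. [:- e, 1:]) \<noteq> 0" by (auto simp: prod_list_zero_iff)
  then have "proots ([:- e, 1:] * (\<Prod>e\<leftarrow>es. [:- e, 1:])) = proots [:- e, 1:] + proots (\<Prod>e\<leftarrow>es. [:- e, 1:])"
    by (intro proots_mult) auto
  then show ?case using Cons by (simp del: mult_pCons_left)
qed simp

lemma size_filter_mset_list: "size {#x \<in># mset es. P x#} = card {k. k < length es \<and> P (es ! k)}"
  by (metis length_filter_conv_card mset_filter size_mset)

lemma matrix_signature_list:
  assumes "char_poly A = (\<Prod>e\<leftarrow>es. [:- e, 1:])"
  shows "matrix_signature A =
    int (card {k. k < length es \<and> Re (es ! k) > 0}) - int (card {k. k < length es \<and> Re (es ! k) < 0})"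
  unfolding matrix_signature_def assms proots_prod_linear size_filter_mset_list ..

section \<open>Sylvester's law and signatures from orthogonal families\<close>

lemma hermitian_formD:
  assumes "hermitian_form scale V \<beta>"
  shows "u \<in> V \<Longrightarrow> v \<in> V \<Longrightarrow> w \<in> V \<Longrightarrow> \<beta> (u + v) w = \<beta> u w + \<beta> v w"
    "u \<in> V \<Longrightarrow> v \<in> V \<Longrightarrow> \<beta> (scale k u) v = k * \<beta> u v"
    "u \<in> V \<Longrightarrow> v \<in> V \<Longrightarrow> \<beta> u v = cnj (\<beta> v u)"
  using assms unfolding hermitian_form_def by blast+

locale hermitian_space = vector_space scale for scale :: "complex \<Rightarrow> 'v::ab_group_add \<Rightarrow> 'v" +
  fixes V :: "'v set" and \<beta> :: "'v \<Rightarrow> 'v \<Rightarrow> complex"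
  assumes sub: "subspace V" and herm: "hermitian_form scale V \<beta>"
begin

lemmas add_left = hermitian_formD(1)[OF herm] and scale_left = hermitian_formD(2)[OF herm]
  and conj_sym = hermitian_formD(3)[OF herm]

lemma add_right: "u \<in> V \<Longrightarrow> v \<in> V \<Longrightarrow> w \<in> V \<Longrightarrow> \<beta> w (u + v) = \<beta> w u + \<beta> w v"
  using conj_sym[of w "u + v"] conj_sym[of w u] conj_sym[of w v] add_left[of u v w] subspace_add[OF sub] by simp

lemma scale_right: "u \<in> V \<Longrightarrow> w \<in> V \<Longrightarrow> \<beta> w (scale k u) = cnj k * \<beta> w u"
  using conj_sym[of w "scale k u"] conj_sym[of w u] scale_left[of u w k] subspace_scale[OF sub] by simp

lemma zero_left: "w \<in> V \<Longrightarrow> \<beta> 0 w = 0"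
  using scale_left[of 0 w 0] subspace_0[OF sub] by simp

lemma zero_right: "w \<in> V \<Longrightarrow> \<beta> w 0 = 0"
  using scale_right[of 0 w 0] subspace_0[OF sub] by simp

lemma lin_sum_mem: "(\<And>i. i \<in> I \<Longrightarrow> x i \<in> V) \<Longrightarrow> (\<Sum>i\<in>I. scale (a i) (x i)) \<in> V"
  by (intro subspace_sum[OF sub] subspace_scale[OF sub])

lemma sum_left:
  assumes "finite I" "\<And>i. i \<in> I \<Longrightarrow> x i \<in> V" "w \<in> V"
  shows "\<beta> (\<Sum>i\<in>I. scale (a i) (x i)) w = (\<Sum>i\<in>I. a i * \<beta> (x i) w)"
  using assms(1,2)
proof (induction I rule: finite_induct)
  case (insert i I)
  then show ?case using lin_sum_mem[of I x a] assms(3) by (simp add: add_left scale_left subspace_scale[OF sub])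
qed (simp add: zero_left assms(3))

lemma sum_right:
  assumes "finite I" "\<And>i. i \<in> I \<Longrightarrow> x i \<in> V" "w \<in> V"
  shows "\<beta> w (\<Sum>i\<in>I. scale (a i) (x i)) = (\<Sum>i\<in>I. cnj (a i) * \<beta> w (x i))"
  using assms(1,2)
proof (induction I rule: finite_induct)
  case (insert i I)
  then show ?case using lin_sum_mem[of I x a] assms(3) by (simp add: add_right scale_right subspace_scale[OF sub])
qed (simp add: zero_right assms(3))

lemma form_real: "u \<in> V \<Longrightarrow> \<beta> u u = of_real (Re (\<beta> u u))"
  using conj_sym[of u u] by (metis Reals_cnj_iff of_real_Re)

definition orth :: "'i set \<Rightarrow> ('i \<Rightarrow> 'v) \<Rightarrow> bool" where
  "orth I x \<longleftrightarrow> finite I \<and> (\<forall>i\<in>I. x i \<in> V) \<and> (\<forall>i\<in>I. \<forall>j\<in>I. i \<noteq> j \<longrightarrow> \<beta> (x i) (x j) = 0)"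

lemma orth_norm:
  assumes "orth I x"
  shows "\<beta> (\<Sum>i\<in>I. scale (a i) (x i)) (\<Sum>i\<in>I. scale (a i) (x i)) =
    of_real (\<Sum>i\<in>I. (cmod (a i))\<^sup>2 * Re (\<beta> (x i) (x i)))"
proof -
  have x: "finite I" "\<And>i. i \<in> I \<Longrightarrow> x i \<in> V" "\<And>i j. i \<in> I \<Longrightarrow> j \<in> I \<Longrightarrow> i \<noteq> j \<Longrightarrow> \<beta> (x i) (x j) = 0"
    using assms by (auto simp: orth_def)
  have "\<beta> (\<Sum>i\<in>I. scale (a i) (x i)) (\<Sum>i\<in>I. scale (a i) (x i)) = (\<Sum>i\<in>I. a i * (\<Sum>j\<in>I. cnj (a j) * \<beta> (x i) (x j)))"
  proof -
    have "\<beta> (\<Sum>i\<in>I. scale (a i) (x i)) (\<Sum>i\<in>I. scale (a i) (x i)) =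
        (\<Sum>i\<in>I. a i * \<beta> (x i) (\<Sum>i\<in>I. scale (a i) (x i)))"
      by (rule sum_left[OF x(1,2) lin_sum_mem[OF x(2)]])
    also have "\<dots> = (\<Sum>i\<in>I. a i * (\<Sum>j\<in>I. cnj (a j) * \<beta> (x i) (x j)))"
      by (intro sum.cong refl arg_cong2[of _ _ _ _ "(*)"] sum_right[OF x(1,2)] x(2))
    finally show ?thesis .
  qed
  also have "\<dots> = (\<Sum>i\<in>I. a i * (cnj (a i) * \<beta> (x i) (x i)))"
  proof (intro sum.cong refl)
    fix i assume i: "i \<in> I"
    have "(\<Sum>j\<in>I. cnj (a j) * \<beta> (x i) (x j)) = (\<Sum>j\<in>I. if j = i then cnj (a i) * \<beta> (x i) (x i) else 0)"
      using x i by (intro sum.cong) auto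
    then show "a i * (\<Sum>j\<in>I. cnj (a j) * \<beta> (x i) (x j)) = a i * (cnj (a i) * \<beta> (x i) (x i))" using x(1) i by simp
  qed
  also have "\<dots> = (\<Sum>i\<in>I. of_real ((cmod (a i))\<^sup>2 * Re (\<beta> (x i) (x i))))"
    using x by (intro sum.cong refl) (simp add: mult.assoc[symmetric] complex_norm_square[symmetric] form_real[symmetric])
  finally show ?thesis by simp
qed

text \<open>The span of a positive orthogonal family meets the span of a negative one only in 0,
  since the norm of a common vector is both nonnegative and nonpositive. So the two families
  together are independent.\<close>

lemma pos_neg_card:
  assumes x: "orth I x" "\<And>i. i \<in> I \<Longrightarrow> Re (\<beta> (x i) (x i)) > 0"
    and y: "orth J y" "\<And>j. j \<in> J \<Longrightarrow> Re (\<beta> (y j) (y j)) < 0"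
    and T: "finite T" "V \<subseteq> span T"
  shows "card I + card J \<le> card T"
proof -
  have inj: "inj_on z K" if z: "orth K z" "\<And>i. i \<in> K \<Longrightarrow> Re (\<beta> (z i) (z i)) \<noteq> 0" for z :: "'k \<Rightarrow> 'v" and K
  proof
    fix i j assume ij: "i \<in> K" "j \<in> K" "z i = z j"
    show "i = j"
    proof (rule ccontr)
      assume "i \<noteq> j"
      then have "\<beta> (z i) (z j) = 0" using z(1) ij(1,2) unfolding orth_def by metis
      then show False using z(2)[OF ij(1)] ij(3) by simp
    qed
  qed
  have ix: "inj_on x I" using inj[OF x(1)] x(2) by fastforce
  have iy: "inj_on y J" using inj[OF y(1)] y(2) by fastforce
  have fin: "finite I" "finite J" and mem: "x ` I \<subseteq> V" "y ` J \<subseteq> V" using x y by (auto simp: orth_def)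
  have disj: "x ` I \<inter> y ` J = {}"
  proof (rule ccontr)
    assume "x ` I \<inter> y ` J \<noteq> {}"
    then obtain i j where "i \<in> I" "j \<in> J" "x i = y j" by auto
    then show False using x(2)[of i] y(2)[of j] by simp
  qed
  have "independent (x ` I \<union> y ` J)"
  proof (rule independent_if_scalars_zero)
    fix f z assume s: "(\<Sum>z\<in>x ` I \<union> y ` J. scale (f z) z) = 0" and z: "z \<in> x ` I \<union> y ` J"
    define u v where "u = (\<Sum>i\<in>I. scale (f (x i)) (x i))" and "v = (\<Sum>j\<in>J. scale (- f (y j)) (y j))"
    have "(\<Sum>z\<in>x ` I \<union> y ` J. scale (f z) z) = u - v"
      using fin disj by (simp add: sum.union_disjoint sum.reindex[OF ix] sum.reindex[OF iy] u_def v_def sum_negf)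
    then have uv: "u = v" using s by simp
    have "complex_of_real (\<Sum>i\<in>I. (cmod (f (x i)))\<^sup>2 * Re (\<beta> (x i) (x i))) =
        of_real (\<Sum>j\<in>J. (cmod (- f (y j)))\<^sup>2 * Re (\<beta> (y j) (y j)))"
      using orth_norm[OF x(1), of "\<lambda>i. f (x i)"] orth_norm[OF y(1), of "\<lambda>j. - f (y j)"] uv
      unfolding u_def v_def by metis
    then have eq: "(\<Sum>i\<in>I. (cmod (f (x i)))\<^sup>2 * Re (\<beta> (x i) (x i))) =
        (\<Sum>j\<in>J. (cmod (f (y j)))\<^sup>2 * Re (\<beta> (y j) (y j)))" by (simp only: of_real_eq_iff norm_minus_cancel)
    have p: "(\<Sum>i\<in>I. (cmod (f (x i)))\<^sup>2 * Re (\<beta> (x i) (x i))) \<ge> 0"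
      using x(2) by (intro sum_nonneg) (simp add: less_imp_le)
    have m: "(\<Sum>j\<in>J. (cmod (f (y j)))\<^sup>2 * Re (\<beta> (y j) (y j))) \<le> 0"
      using y(2) by (intro sum_nonpos) (simp add: less_imp_le mult_nonneg_nonpos)
    have "\<forall>i\<in>I. (cmod (f (x i)))\<^sup>2 * Re (\<beta> (x i) (x i)) = 0"
      using x(2) fin p m eq by (intro sum_nonneg_eq_0_iff[THEN iffD1]) (auto simp: less_imp_le)
    moreover have "\<forall>j\<in>J. - ((cmod (f (y j)))\<^sup>2 * Re (\<beta> (y j) (y j))) = 0"
      using y(2) fin p m eq
      by (intro sum_nonneg_eq_0_iff[THEN iffD1]) (auto simp: less_imp_le sum_negf mult_nonneg_nonpos)
    ultimately show "f z = 0" using z x(2) y(2) by fastforce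
  qed (use fin in auto)
  moreover have "x ` I \<union> y ` J \<subseteq> span T" using mem T by blast
  ultimately have "card (x ` I \<union> y ` J) \<le> card T" using independent_span_bound[OF T(1)] by blast
  then show ?thesis using fin disj by (simp add: card_Un_disjoint card_image ix iy)
qed

lemma orth_independent:
  assumes y: "orth I y" "\<And>i. i \<in> I \<Longrightarrow> Re (\<beta> (y i) (y i)) \<noteq> 0"
  shows "independent (y ` I)" "inj_on y I"
proof -
  show inj: "inj_on y I"
  proof
    fix i j assume ij: "i \<in> I" "j \<in> I" "y i = y j"
    show "i = j"
    proof (rule ccontr)
      assume "i \<noteq> j"
      then have "\<beta> (y i) (y j) = 0" using y(1) ij(1,2) unfolding orth_def by metis
      then show False using y(2)[OF ij(1)] ij(3) by simp
    qed
  qed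
  have fin: "finite I" and mem: "\<And>i. i \<in> I \<Longrightarrow> y i \<in> V" using y by (auto simp: orth_def)
  show "independent (y ` I)"
  proof (rule independent_if_scalars_zero)
    fix f z assume s: "(\<Sum>z\<in>y ` I. scale (f z) z) = 0" and "z \<in> y ` I"
    then obtain i where i: "i \<in> I" "z = y i" by blast
    have "0 = \<beta> (\<Sum>j\<in>I. scale (f (y j)) (y j)) (y i)"
      using s mem[OF i(1)] by (simp add: sum.reindex[OF inj] zero_left)
    also have "\<dots> = (\<Sum>j\<in>I. f (y j) * \<beta> (y j) (y i))" using fin mem i by (simp add: sum_left)
    also have "\<dots> = (\<Sum>j\<in>I. if j = i then f z * \<beta> (y i) (y i) else 0)"
      using y(1) i by (intro sum.cong) (auto simp: orth_def)
    also have "\<dots> = f z * \<beta> (y i) (y i)" using fin i by simp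
    finally have "f z * \<beta> (y i) (y i) = 0" by simp
    moreover have "\<beta> (y i) (y i) \<noteq> 0" using y(2)[OF i(1)] by auto
    ultimately show "f z = 0" by simp
  qed (use fin in simp)
qed

lemma orth_span:
  assumes y: "orth I y" "\<And>i. i \<in> I \<Longrightarrow> Re (\<beta> (y i) (y i)) \<noteq> 0"
    and T: "finite T" "V \<subseteq> span T" "card T \<le> card I"
  shows "V \<subseteq> span (y ` I)"
proof
  fix v assume v: "v \<in> V"
  show "v \<in> span (y ` I)"
  proof (rule ccontr)
    assume n: "v \<notin> span (y ` I)"
    have "independent (insert v (y ` I))" using independent_insertI[OF n orth_independent(1)[OF y]] .
    moreover have "insert v (y ` I) \<subseteq> span T" using v T y(1) by (auto simp: orth_def)
    ultimately have "card (insert v (y ` I)) \<le> card T" using independent_span_bound[OF T(1)] by blast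
    moreover have "v \<notin> y ` I" using n span_base by blast
    ultimately show False using y(1) T(3) by (simp add: card_image[OF orth_independent(2)[OF y]] orth_def)
  qed
qed

lemma orth_nondegenerate:
  assumes y: "orth I y" "\<And>i. i \<in> I \<Longrightarrow> Re (\<beta> (y i) (y i)) \<noteq> 0" and V: "v \<in> span (y ` I)" "\<And>i. i \<in> I \<Longrightarrow> \<beta> v (y i) = 0"
  shows "v = 0"
proof -
  note inj = orth_independent(2)[OF y]
  have fin: "finite I" and mem: "\<And>i. i \<in> I \<Longrightarrow> y i \<in> V" using y by (auto simp: orth_def)
  obtain f where f: "v = (\<Sum>z\<in>y ` I. scale (f z) z)" using V(1) span_finite[of "y ` I"] fin by auto
  have "f (y i) = 0" if i: "i \<in> I" for i
  proof -
    have "0 = \<beta> (\<Sum>j\<in>I. scale (f (y j)) (y j)) (y i)"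
      using V(2)[OF i] by (simp add: f sum.reindex[OF inj])
    also have "\<dots> = (\<Sum>j\<in>I. f (y j) * \<beta> (y j) (y i))" using fin mem i by (simp add: sum_left)
    also have "\<dots> = (\<Sum>j\<in>I. if j = i then f (y i) * \<beta> (y i) (y i) else 0)"
      using y(1) i by (intro sum.cong) (auto simp: orth_def)
    also have "\<dots> = f (y i) * \<beta> (y i) (y i)" using fin i by simp
    finally have "f (y i) * \<beta> (y i) (y i) = 0" by simp
    moreover have "\<beta> (y i) (y i) \<noteq> 0" using y(2)[OF i] by auto
    ultimately show ?thesis by simp
  qed
  then show ?thesis unfolding f by (intro sum.neutral) auto
qed

text \<open>The signature is defined by an arbitrarily chosen basis. Diagonalizing its Gram matrix
  gives a second orthogonal family, with the eigenvalues as norms. Applying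
  \<open>pos_neg_card\<close> crosswise, positives of one family against negatives of the other,
  forces the counts to coincide.\<close>

theorem form_signature_orth:
  assumes y: "orth I y" "\<And>i. i \<in> I \<Longrightarrow> Re (\<beta> (y i) (y i)) \<noteq> 0"
    and T: "finite T" "V \<subseteq> span T" "card T \<le> card I"
  shows "form_signature scale V \<beta> =
    int (card {i \<in> I. Re (\<beta> (y i) (y i)) > 0}) - int (card {i \<in> I. Re (\<beta> (y i) (y i)) < 0})"
proof -
  note inj = orth_independent(2)[OF y] and ind = orth_independent(1)[OF y]
  have fin: "finite I" and mem: "\<And>i. i \<in> I \<Longrightarrow> y i \<in> V" using y by (auto simp: orth_def)
  have spy: "V \<subseteq> span (y ` I)" using orth_span[OF y T] .
  obtain ys where ys: "distinct ys" "set ys = y ` I" using finite_distinct_list[of "y ` I"] fin by auto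
  have "is_basis scale V ys"
    unfolding is_basis_def using ys ind spy mem span_minimal[OF _ sub, of "y ` I"] by auto
  then have b: "is_basis scale V (SOME bs. is_basis scale V bs)" by (rule someI)
  define bs where "bs = (SOME bs. is_basis scale V bs)"
  define N where "N = length bs"
  have bs: "distinct bs" "independent (set bs)" "span (set bs) = V"
    using b by (auto simp: is_basis_def bs_def)
  have bV: "bs ! i \<in> V" if "i < N" for i using bs(3) span_base that by (auto simp: N_def)
  have cardN: "card I = N"
  proof -
    have "card (y ` I) \<le> card (set bs)"
      using independent_span_bound[OF _ ind, of "set bs"] mem bs(3) by auto
    moreover have "card (set bs) \<le> card (y ` I)"
      using independent_span_bound[OF _ bs(2), of "y ` I"] fin spy bs(3) span_base by blast
    ultimately show ?thesis using bs(1) by (simp add: card_image[OF inj] distinct_card N_def)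
  qed
  define G where "G = gram_matrix \<beta> bs"
  have G: "G \<in> carrier_mat N N" by (simp add: G_def gram_matrix_def N_def)
  have Gij: "G $$ (i, j) = \<beta> (bs ! i) (bs ! j)" if "i < N" "j < N" for i j
    using that by (simp add: G_def gram_matrix_def N_def)
  have "adj G = G" by (rule adj_eqI[OF G]) (simp add: Gij bV conj_sym[symmetric])
  then obtain P es where P: "P \<in> carrier_mat N N" "length es = N" "char_poly G = (\<Prod>e\<leftarrow>es. [:- e, 1:])"
    "adj P * G * P = diag_list es"
    using hermitian_diagonalization[OF G] by blast
  \<comment> \<open>The conjugate is required because the form is linear in its first argument; the
    Gram matrix of the vectors \<open>x k\<close> is then \<open>adj P * G * P\<close>.\<close>
  define x where "x = (\<lambda>k. \<Sum>i<N. scale (cnj (P $$ (i, k))) (bs ! i))"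
  have xV: "x k \<in> V" for k unfolding x_def by (rule lin_sum_mem) (simp add: bV)
  have xx: "\<beta> (x k) (x l) = (if k = l then es ! k else 0)" if kl: "k < N" "l < N" for k l
  proof -
    have "\<beta> (x k) (x l) = (\<Sum>i<N. cnj (P $$ (i, k)) * (\<Sum>j<N. P $$ (j, l) * G $$ (i, j)))"
    proof -
      have "\<beta> (x k) (x l) = (\<Sum>i<N. cnj (P $$ (i, k)) * \<beta> (bs ! i) (x l))"
        unfolding fun_cong[OF x_def, of k] by (rule sum_left) (use bV xV in auto)
      also have "\<dots> = (\<Sum>i<N. cnj (P $$ (i, k)) * (\<Sum>j<N. P $$ (j, l) * G $$ (i, j)))"
      proof (intro sum.cong refl)
        fix i assume i: "i \<in> {..<N}"
        have "\<beta> (bs ! i) (x l) = (\<Sum>j<N. cnj (cnj (P $$ (j, l))) * \<beta> (bs ! i) (bs ! j))"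
          unfolding fun_cong[OF x_def, of l] by (rule sum_right) (use bV i in auto)
        then show "cnj (P $$ (i, k)) * \<beta> (bs ! i) (x l) = cnj (P $$ (i, k)) * (\<Sum>j<N. P $$ (j, l) * G $$ (i, j))"
          using i by (simp add: Gij)
      qed
      finally show ?thesis .
    qed
    also have "\<dots> = (adj P * (G * P)) $$ (k, l)"
      using kl index_mult_sum[OF adj_carrier[OF P(1)] mult_square_carrier[OF G P(1)]] index_mult_sum[OF G P(1)]
        index_adj[OF P(1)] by (simp add: mult.commute)
    also have "adj P * (G * P) = diag_list es"
      using P G by (simp add: assoc_mult_mat[of _ N N _ N _ N, symmetric])
    finally show ?thesis using kl P(2) by (simp add: diag_list_def)
  qed
  \<comment> \<open>An eigenvector for 0 would give a nonzero vector orthogonal to the whole basis,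
    hence to all \<open>y i\<close>, which span the space and have nonzero norms.\<close>
  have nz: "es ! k \<noteq> 0" if k: "k < N" for k
  proof
    assume "es ! k = 0"
    then have "0 \<in> set es" using k P(2) by (metis nth_mem)
    then have "poly (char_poly G) 0 = 0" unfolding P(3) by (auto simp: poly_prod_list prod_list_zero_iff)
    then have "eigenvalue G 0" using eigenvalue_root_char_poly[OF G] by simp
    then obtain v where v: "v \<in> carrier_vec N" "v \<noteq> 0\<^sub>v N" "G *\<^sub>v v = 0 \<cdot>\<^sub>v v"
      using G by (auto simp: eigenvalue_def eigenvector_def)
    define z where "z = (\<Sum>i<N. scale (cnj (v $ i)) (bs ! i))"
    have zV: "z \<in> V" unfolding z_def by (rule lin_sum_mem) (simp add: bV)
    have bz: "\<beta> (bs ! i) z = 0" if i: "i < N" for i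
    proof -
      have "\<beta> (bs ! i) z = (\<Sum>j<N. cnj (cnj (v $ j)) * \<beta> (bs ! i) (bs ! j))"
        unfolding z_def by (rule sum_right) (use bV i in auto)
      also have "\<dots> = (G *\<^sub>v v) $ i"
        using i v(1) G by (simp add: scalar_prod_def atLeast0LessThan Gij mult.commute)
      finally show ?thesis using i v by simp
    qed
    have "z = 0"
    proof (rule orth_nondegenerate[OF y])
      show "z \<in> span (y ` I)" using zV spy by blast
      fix i assume i: "i \<in> I"
      have "y i \<in> span (set bs)" using mem[OF i] bs(3) by simp
      then obtain f where "y i = (\<Sum>b\<in>set bs. scale (f b) b)" using span_finite[of "set bs"] by auto
      then have "\<beta> z (y i) = (\<Sum>b\<in>set bs. cnj (f b) * \<beta> z b)"
        using sum_right[of "set bs" "\<lambda>b. b" z f] zV bs(3) span_base by auto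
      also have "\<dots> = 0"
      proof (intro sum.neutral ballI)
        fix b assume "b \<in> set bs"
        then obtain i where "i < N" "b = bs ! i" by (auto simp: in_set_conv_nth N_def)
        then show "cnj (f b) * \<beta> z b = 0" using bz[of i] conj_sym[OF zV bV[of i]] by simp
      qed
      finally show "\<beta> z (y i) = 0" .
    qed
    moreover have "(\<Sum>i<N. scale (cnj (v $ i)) (bs ! i)) = (\<Sum>b\<in>set bs. scale (cnj (v $ (inv_into {..<N} ((!) bs) b))) b)"
    proof -
      have inj: "inj_on ((!) bs) {..<N}" using bs(1) by (auto simp: inj_on_def nth_eq_iff_index_eq N_def)
      have "set bs = (!) bs ` {..<N}" by (auto simp: N_def in_set_conv_nth)
      then show ?thesis by (simp add: sum.reindex[OF inj] inv_into_f_f[OF inj])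
    qed
    ultimately have s: "(\<Sum>b\<in>set bs. scale (cnj (v $ (inv_into {..<N} ((!) bs) b))) b) = 0" by (simp add: z_def)
    have "v $ i = 0" if i: "i < N" for i
    proof -
      have inj: "inj_on ((!) bs) {..<N}" using bs(1) by (auto simp: inj_on_def nth_eq_iff_index_eq N_def)
      have "cnj (v $ (inv_into {..<N} ((!) bs) (bs ! i))) = 0"
        using bs(2) s i unfolding dependent_finite[OF finite_set] by (metis N_def nth_mem)
      then show ?thesis using inv_into_f_f[OF inj, of i] i by simp
    qed
    then have "v = 0\<^sub>v N" using v(1) by (intro eq_vecI) auto
    then show False using v(2) by simp
  qed
  have re: "Re (es ! k) \<noteq> 0" if "k < N" for k
    using nz[OF that] xx[OF that that] form_real[OF xV[of k]] by (metis of_real_0)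
  let ?Ip = "{i \<in> I. Re (\<beta> (y i) (y i)) > 0}" and ?Im = "{i \<in> I. Re (\<beta> (y i) (y i)) < 0}"
  let ?Jp = "{k. k < N \<and> Re (es ! k) > 0}" and ?Jm = "{k. k < N \<and> Re (es ! k) < 0}"
  have ox: "orth {k. k < N \<and> Q k} x" for Q using xV xx by (auto simp: orth_def)
  have oy: "orth {i \<in> I. Q i} y" for Q using y(1) by (auto simp: orth_def)
  have Tb: "finite (set bs)" "V \<subseteq> span (set bs)" "card (set bs) = N" using bs by (auto simp: distinct_card N_def)
  have 1: "card ?Jp + card ?Im \<le> N"
    using pos_neg_card[OF ox[of "\<lambda>k. Re (es ! k) > 0"] _ oy[of "\<lambda>i. Re (\<beta> (y i) (y i)) < 0"] _ Tb(1,2)] Tb(3)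
    by (simp add: xx)
  have 2: "card ?Ip + card ?Jm \<le> N"
    using pos_neg_card[OF oy[of "\<lambda>i. Re (\<beta> (y i) (y i)) > 0"] _ ox[of "\<lambda>k. Re (es ! k) < 0"] _ Tb(1,2)] Tb(3)
    by (simp add: xx)
  have "?Ip \<union> ?Im = I" "?Ip \<inter> ?Im = {}" using y(2) by (auto simp: neq_iff)
  then have 3: "card ?Ip + card ?Im = N" using fin cardN card_Un_disjoint[of ?Ip ?Im] by simp
  have "?Jp \<union> ?Jm = {..<N}" "?Jp \<inter> ?Jm = {}" using re by (auto simp: neq_iff)
  then have 4: "card ?Jp + card ?Jm = N" using card_Un_disjoint[of ?Jp ?Jm] by simp
  have "form_signature scale V \<beta> = int (card ?Jp) - int (card ?Jm)"
    unfolding form_signature_def bs_def[symmetric] G_def[symmetric] matrix_signature_list[OF P(3)] P(2) ..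
  then show ?thesis using 1 2 3 4 by linarith
qed

end


section \<open>Dunkl operators\<close>

abbreviation Lk :: "('a \<Rightarrow>\<^sub>0 'b::zero) \<Rightarrow> 'a \<Rightarrow> 'b" where "Lk \<equiv> Poly_Mapping.lookup"
definition unit_exp :: "nat \<Rightarrow> nat \<Rightarrow>\<^sub>0 nat" where "unit_exp i = Poly_Mapping.single i 1"
definition var :: "nat \<Rightarrow> cpoly" where "var i = Poly_Mapping.single (unit_exp i) 1"
abbreviation const :: "complex \<Rightarrow> cpoly" where "const a \<equiv> Poly_Mapping.single 0 a"

lemma lookup_unit_exp [simp]: "Lk (unit_exp i) j = (if j = i then 1 else 0)"
  by (simp add: unit_exp_def lookup_single when_def eq_commute)

lemma var_mult_single: "var i * Poly_Mapping.single m a = Poly_Mapping.single (unit_exp i + m) a"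
  by (simp add: var_def mult_single)

lemma standard_x_var: "standard_x i F = (\<lambda>w. var i * F w)"
  by (simp add: standard_x_def var_def unit_exp_def)

lemma poly_mapping_update_add:
  "a \<notin> Poly_Mapping.keys f \<Longrightarrow> Poly_Mapping.update a b f = Poly_Mapping.single a b + (f :: _ \<Rightarrow>\<^sub>0 'b::comm_monoid_add)"
  by (rule poly_mapping_eqI) (auto simp: lookup_update lookup_add lookup_single when_def in_keys_iff)

text \<open>The operators below are governed by their commutation rules with multiplication by one
  variable, and this induction follows those rules.\<close>

lemma cpoly_induct [case_names const var add]:
  fixes f :: cpoly
  assumes c: "\<And>a. P (const a)" and v: "\<And>i f. P f \<Longrightarrow> P (var i * f)" and a: "\<And>f g. P f \<Longrightarrow> P g \<Longrightarrow> P (f + g)"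
  shows "P f"
proof -
  have s: "P (Poly_Mapping.single m b)" for m b
  proof (induction m rule: update_induct)
    case const
    show ?case by (rule c)
  next
    case (update m i k)
    have "P (Poly_Mapping.single (Poly_Mapping.single i k + m) b)"
    proof (induction k)
      case (Suc k)
      have "Poly_Mapping.single i (Suc k) + m = unit_exp i + (Poly_Mapping.single i k + m)"
        by (simp add: unit_exp_def single_add[symmetric] add.assoc[symmetric])
      then show ?case using v[OF Suc, of i] by (simp only: var_mult_single)
    qed (use update in simp)
    then show ?case using update by (simp add: poly_mapping_update_add)
  qed
  show ?thesis
  proof (induction f rule: update_induct)
    case const
    show ?case using c[of 0] by simp
  next
    case (update f m b)
    then show ?case using a[OF s] by (simp add: poly_mapping_update_add)
  qed
qed

lemma lookup_const_mult: "Lk (const a * f) m = a * Lk f m"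
proof (induction f rule: update_induct)
  case (update f k b)
  then show ?case
    by (auto simp: poly_mapping_update_add distrib_left lookup_add mult_single lookup_single when_def)
qed simp

lemma add_unit_exp_eq:
  "unit_exp i + a = m \<longleftrightarrow> Lk m i > 0 \<and> a = m - unit_exp i"
proof
  assume "unit_exp i + a = m"
  then show "Lk m i > 0 \<and> a = m - unit_exp i" by (auto simp: lookup_add)
next
  assume "Lk m i > 0 \<and> a = m - unit_exp i"
  then show "unit_exp i + a = m"
    by (intro poly_mapping_eqI) (auto simp: lookup_add lookup_minus lookup_single when_def)
qed

lemma lookup_var_mult: "Lk (var i * f) m = (if Lk m i > 0 then Lk f (m - unit_exp i) else 0)"
proof (induction f rule: update_induct)
  case (update f k b)
  then show ?case using add_unit_exp_eq[of i k m]
    by (auto simp: poly_mapping_update_add distrib_left lookup_add var_mult_single lookup_single when_def)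
qed simp

lemma lookup_map_key: "inj f \<Longrightarrow> Lk (Poly_Mapping.map_key f p) k = Lk p (f k)"
  by (simp add: map_key.rep_eq)

lemma inj_map_key: "bij u \<Longrightarrow> inj (Poly_Mapping.map_key u :: ('a \<Rightarrow>\<^sub>0 'c::zero) \<Rightarrow> 'b \<Rightarrow>\<^sub>0 'c)"
proof
  fix a b :: "'a \<Rightarrow>\<^sub>0 'c" assume u: "bij u" and e: "Poly_Mapping.map_key u a = Poly_Mapping.map_key u b"
  show "a = b"
  proof (rule poly_mapping_eqI)
    fix k
    obtain j where "k = u j" using u by (metis bij_pointE)
    then show "Lk a k = Lk b k" using arg_cong[OF e, of "\<lambda>p. Lk p j"] u by (simp add: lookup_map_key bij_is_inj)
  qed
qed

lemma lookup_permute_vars: "bij u \<Longrightarrow> Lk (permute_vars u f) m = Lk f (Poly_Mapping.map_key u m)"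
  by (simp add: permute_vars_def lookup_map_key inj_map_key)

lemma permute_vars_add: "bij u \<Longrightarrow> permute_vars u (f + g) = permute_vars u f + permute_vars u g"
  by (rule poly_mapping_eqI) (simp add: lookup_permute_vars lookup_add)

lemma permute_vars_zero: "bij u \<Longrightarrow> permute_vars u 0 = 0"
  by (rule poly_mapping_eqI) (simp add: lookup_permute_vars)

lemma permute_vars_diff: "bij u \<Longrightarrow> permute_vars u (f - g) = permute_vars u f - permute_vars u g"
  by (rule poly_mapping_eqI) (simp add: lookup_permute_vars lookup_minus)

lemma map_key_eq_0: "bij u \<Longrightarrow> Poly_Mapping.map_key u m = (0 :: _ \<Rightarrow>\<^sub>0 nat) \<longleftrightarrow> m = 0"
  using inj_map_key[of u] by (metis bij_is_inj injD map_key_zero)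

lemma permute_vars_const: "bij u \<Longrightarrow> permute_vars u (const a) = const a"
  by (rule poly_mapping_eqI) (simp add: lookup_permute_vars lookup_single map_key_eq_0 eq_commute[of 0])

lemma permute_vars_const_mult: "bij u \<Longrightarrow> permute_vars u (const a * f) = const a * permute_vars u f"
  by (rule poly_mapping_eqI) (simp add: lookup_permute_vars lookup_const_mult)

lemma permute_vars_var_mult: "bij u \<Longrightarrow> permute_vars u (var i * f) = var (u i) * permute_vars u f"
proof (rule poly_mapping_eqI)
  fix m assume u: "bij u"
  have "Poly_Mapping.map_key u (m - unit_exp (u i)) = Poly_Mapping.map_key u m - unit_exp i"
    using u by (intro poly_mapping_eqI)
      (auto simp: lookup_map_key bij_is_inj lookup_minus lookup_single when_def bij_def inj_eq)
  then show "Lk (permute_vars u (var i * f)) m = Lk (var (u i) * permute_vars u f) m"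
    using u by (simp add: lookup_permute_vars lookup_var_mult lookup_map_key bij_is_inj)
qed

lemma permute_vars_comp: "bij u \<Longrightarrow> bij v \<Longrightarrow> permute_vars u (permute_vars v f) = permute_vars (u \<circ> v) f"
  by (rule poly_mapping_eqI) (simp add: lookup_permute_vars bij_comp map_key_compose bij_is_inj)

lemma permute_vars_id: "permute_vars id f = f"
proof (rule poly_mapping_eqI)
  fix m :: "nat \<Rightarrow>\<^sub>0 nat"
  have "Poly_Mapping.map_key id m = m"
    by (rule poly_mapping_eqI) (simp add: lookup_map_key[OF inj_on_id])
  then show "Lk (permute_vars id f) m = Lk f m" by (simp only: lookup_permute_vars[OF bij_id])
qed

lemma bij_transp: "bij (transp i j)" by simp

definition part_deriv :: "nat \<Rightarrow> cpoly \<Rightarrow> cpoly" where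
  "part_deriv i f = Poly_Mapping.map_key (\<lambda>m. m + unit_exp i) (Poly_Mapping.mapp (\<lambda>m a. of_nat (Lk m i) * a) f)"

lemma lookup_part_deriv: "Lk (part_deriv i f) m = of_nat (Lk m i + 1) * Lk f (m + unit_exp i)"
proof -
  have "inj (\<lambda>m. m + unit_exp i)" by (simp add: inj_on_def)
  then show ?thesis
    by (simp add: part_deriv_def lookup_map_key lookup_mapp lookup_add when_def in_keys_iff)
qed

lemma part_deriv_add: "part_deriv i (f + g) = part_deriv i f + part_deriv i g"
  by (rule poly_mapping_eqI) (simp add: lookup_part_deriv lookup_add algebra_simps)

lemma part_deriv_const: "part_deriv i (const a) = 0"
proof (rule poly_mapping_eqI)
  fix m
  have "Lk (m + unit_exp i) i \<noteq> Lk 0 i" by (simp add: lookup_add)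
  then have "m + unit_exp i \<noteq> 0" by metis
  then have "Lk (const a) (m + unit_exp i) = 0" by (simp add: lookup_single_not_eq)
  then show "Lk (part_deriv i (const a)) m = Lk 0 m" by (simp add: lookup_part_deriv)
qed

lemma part_deriv_const_mult: "part_deriv i (const a * f) = const a * part_deriv i f"
  by (rule poly_mapping_eqI) (simp add: lookup_part_deriv lookup_const_mult)

lemma part_deriv_var_mult: "part_deriv i (var k * f) = var k * part_deriv i f + (if k = i then f else 0)"
proof (rule poly_mapping_eqI)
  fix m
  show "Lk (part_deriv i (var k * f)) m = Lk (var k * part_deriv i f + (if k = i then f else 0)) m"
  proof (cases "k = i")
    case True
    have e: "Lk m i > 0 \<Longrightarrow> m - unit_exp i + unit_exp i = m"
      by (intro poly_mapping_eqI) (auto simp: lookup_add lookup_minus lookup_single when_def)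
    show ?thesis using True
      by (cases "Lk m i") (simp_all add: lookup_part_deriv lookup_var_mult lookup_add lookup_minus e distrib_right)
  next
    case False
    have "m + unit_exp i - unit_exp k = m - unit_exp k + unit_exp i"
      using False by (intro poly_mapping_eqI) (auto simp: lookup_add lookup_minus lookup_single when_def)
    then show ?thesis using False
      by (auto simp: lookup_part_deriv lookup_var_mult lookup_add lookup_minus lookup_single)
  qed
qed

lemma part_deriv_permute: "bij u \<Longrightarrow> part_deriv (u i) (permute_vars u f) = permute_vars u (part_deriv i f)"
  by (induction f rule: cpoly_induct)
    (auto simp: permute_vars_const part_deriv_const permute_vars_zero permute_vars_var_mult
      part_deriv_var_mult permute_vars_add part_deriv_add bij_def inj_eq)

abbreviation swap_vars :: "nat \<Rightarrow> nat \<Rightarrow> cpoly \<Rightarrow> cpoly" where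
  "swap_vars i j \<equiv> permute_vars (transp i j)"

definition div_diff :: "nat \<Rightarrow> nat \<Rightarrow> cpoly \<Rightarrow> cpoly" where
  "div_diff i j f = (THE g. (var i - var j) * g = f - swap_vars i j f)"

lemma var_diff_nonzero: "i \<noteq> j \<Longrightarrow> var i - var j \<noteq> 0"
proof
  assume "i \<noteq> j" "var i - var j = 0"
  then have "Lk (var i) (unit_exp i) = Lk (var j) (unit_exp i)" by simp
  moreover have "Lk (unit_exp j) i \<noteq> Lk (unit_exp i) i" using \<open>i \<noteq> j\<close> by simp
  then have "unit_exp j \<noteq> unit_exp i" by metis
  ultimately show False by (simp add: var_def lookup_single)
qed

text \<open>The quotient is assembled along the induction by the twisted product rule that reappears
  in \<open>div_diff_var_mult\<close>. Its uniqueness comes from the absence of zero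
  divisors.\<close>

lemma div_diff_ex: "\<exists>g. (var i - var j) * g = f - swap_vars i j f"
proof (induction f rule: cpoly_induct)
  case (const a)
  then show ?case by (intro exI[of _ 0]) (simp add: permute_vars_const)
next
  case (var k f)
  then obtain g where g: "(var i - var j) * g = f - swap_vars i j f" by blast
  let ?s = "swap_vars i j f"
  have "(var i - var j) * (var k * g + (if k = i then ?s else if k = j then - ?s else 0)) =
     var k * (f - ?s) + (if k = i then (var i - var j) * ?s else if k = j then - ((var i - var j) * ?s) else 0)"
    unfolding g[symmetric] by (simp add: algebra_simps)
  also have "\<dots> = var k * f - swap_vars i j (var k * f)"
    unfolding permute_vars_var_mult[OF bij_transp] by (auto simp: Transposition.transpose_def algebra_simps)
  finally show ?case by blast
next
  case (add f g)
  then obtain a b where "(var i - var j) * a = f - swap_vars i j f" "(var i - var j) * b = g - swap_vars i j g" by blast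
  then show ?case by (intro exI[of _ "a + b"]) (simp add: distrib_left permute_vars_add)
qed

lemma div_diff_unique:
  assumes "i \<noteq> j" "(var i - var j) * g = f - swap_vars i j f"
  shows "div_diff i j f = g"
  unfolding div_diff_def
proof (rule the_equality)
  fix h assume "(var i - var j) * h = f - swap_vars i j f"
  then have "(var i - var j) * h = (var i - var j) * g" using assms by simp
  then show "h = g" using var_diff_nonzero[OF assms(1)] by simp
qed (rule assms)

lemma div_diff_eq: "i \<noteq> j \<Longrightarrow> (var i - var j) * div_diff i j f = f - swap_vars i j f"
  using div_diff_ex[of i j f] div_diff_unique by metis

lemma div_diff_add: "i \<noteq> j \<Longrightarrow> div_diff i j (f + g) = div_diff i j f + div_diff i j g"
  by (rule div_diff_unique) (simp_all add: distrib_left div_diff_eq permute_vars_add)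

lemma div_diff_const: "i \<noteq> j \<Longrightarrow> div_diff i j (const a) = 0"
  by (rule div_diff_unique) (simp_all add: permute_vars_const)

lemma div_diff_const_mult: "i \<noteq> j \<Longrightarrow> div_diff i j (const a * f) = const a * div_diff i j f"
proof (rule div_diff_unique)
  assume "i \<noteq> j"
  then show "(var i - var j) * (const a * div_diff i j f) = const a * f - swap_vars i j (const a * f)"
    unfolding mult.left_commute[of _ "const a"] by (simp add: div_diff_eq permute_vars_const_mult right_diff_distrib)
qed

lemma div_diff_var_mult:
  assumes "i \<noteq> j"
  shows "div_diff i j (var k * f) = var k * div_diff i j f +
    (if k = i then swap_vars i j f else if k = j then - swap_vars i j f else 0)"
proof (rule div_diff_unique[OF assms])
  let ?s = "swap_vars i j f" and ?g = "div_diff i j f"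
  have "(var i - var j) * (var k * ?g + (if k = i then ?s else if k = j then - ?s else 0)) =
     var k * (f - ?s) + (if k = i then (var i - var j) * ?s else if k = j then - ((var i - var j) * ?s) else 0)"
    unfolding div_diff_eq[OF assms, symmetric] by (simp add: algebra_simps)
  also have "\<dots> = var k * f - swap_vars i j (var k * f)"
    unfolding permute_vars_var_mult[OF bij_transp] by (auto simp: Transposition.transpose_def algebra_simps)
  finally show "(var i - var j) * (var k * ?g + (if k = i then ?s else if k = j then - ?s else 0)) =
     var k * f - swap_vars i j (var k * f)" .
qed

lemma comp_transp: "bij u \<Longrightarrow> u \<circ> transp i j = transp (u i) (u j) \<circ> u"
  by (auto simp: fun_eq_iff Transposition.transpose_def bij_def inj_eq)

lemma div_diff_permute:
  assumes "bij u" "i \<noteq> j"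
  shows "div_diff (u i) (u j) (permute_vars u f) = permute_vars u (div_diff i j f)"
proof (rule div_diff_unique)
  show "u i \<noteq> u j" using assms by (simp add: bij_def inj_eq)
  have "(var (u i) - var (u j)) * permute_vars u (div_diff i j f) = permute_vars u ((var i - var j) * div_diff i j f)"
    using assms by (simp add: left_diff_distrib permute_vars_diff permute_vars_var_mult)
  also have "\<dots> = permute_vars u f - swap_vars (u i) (u j) (permute_vars u f)"
    using assms by (simp add: div_diff_eq permute_vars_diff permute_vars_comp comp_transp)
  finally show "(var (u i) - var (u j)) * permute_vars u (div_diff i j f) = permute_vars u f - swap_vars (u i) (u j) (permute_vars u f)" .
qed

text \<open>Polynomials with coefficients in a representation of the symmetric group by left
  translations of functions.\<close>

locale left_translation_module =
  fixes n :: nat and V :: "((nat \<Rightarrow> nat) \<Rightarrow> complex) set"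
  assumes V_sub: "hv.subspace V" and V_space: "V \<subseteq> hecke_space n"
    and V_trans: "\<And>u v. u \<in> perms n \<Longrightarrow> v \<in> V \<Longrightarrow> (\<lambda>w. v (inv_into UNIV u \<circ> w)) \<in> V"
begin

definition emb :: "((nat \<Rightarrow> nat) \<Rightarrow> complex) \<Rightarrow> (nat \<Rightarrow> nat) \<Rightarrow> cpoly" where
  "emb v = (\<lambda>w. const (v w))"

definition poly_space :: "((nat \<Rightarrow> nat) \<Rightarrow> cpoly) set" where
  "poly_space = {F. (\<forall>w. \<forall>m\<in>Poly_Mapping.keys (F w). Poly_Mapping.keys m \<subseteq> {1..n}) \<and>
     (\<forall>m. (\<lambda>w. Lk (F w) m) \<in> V)}"

lemma emb_space: "v \<in> V \<Longrightarrow> emb v \<in> poly_space"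
proof -
  assume v: "v \<in> V"
  have "(\<lambda>w. Lk (const (v w)) m) = (if m = 0 then v else 0)" for m
    by (auto simp: lookup_single fun_eq_iff)
  then show ?thesis using v hv.subspace_0[OF V_sub] by (auto simp: poly_space_def emb_def)
qed

lemma poly_space_add: "F \<in> poly_space \<Longrightarrow> G \<in> poly_space \<Longrightarrow> F + G \<in> poly_space"
proof -
  assume F: "F \<in> poly_space" and G: "G \<in> poly_space"
  have "(\<lambda>w. Lk (F w + G w) m) \<in> V" for m
    using hv.subspace_add[OF V_sub, of "\<lambda>w. Lk (F w) m" "\<lambda>w. Lk (G w) m"] F G
    by (simp add: poly_space_def lookup_add plus_fun_def)
  moreover have "Poly_Mapping.keys m \<subseteq> {1..n}" if "m \<in> Poly_Mapping.keys (F w + G w)" for m w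
    using F G that keys_add[of "F w" "G w"] unfolding poly_space_def by blast
  ultimately show ?thesis by (simp add: poly_space_def)
qed

lemma poly_space_scale: "F \<in> poly_space \<Longrightarrow> mscale a F \<in> poly_space"
proof -
  assume F: "F \<in> poly_space"
  have "(\<lambda>w. Lk (const a * F w) m) \<in> V" for m
    using hv.subspace_scale[OF V_sub, of "\<lambda>w. Lk (F w) m" a] F by (simp add: poly_space_def lookup_const_mult)
  moreover have "Poly_Mapping.keys m \<subseteq> {1..n}" if "m \<in> Poly_Mapping.keys (const a * F w)" for m w
  proof -
    have "m \<in> Poly_Mapping.keys (F w)" using that by (auto simp: in_keys_iff lookup_const_mult)
    then show ?thesis using F by (simp add: poly_space_def)
  qed
  ultimately show ?thesis by (simp add: poly_space_def)
qed

lemma poly_space_x: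
  assumes i: "i \<in> {1..n}" and F: "F \<in> poly_space"
  shows "standard_x i F \<in> poly_space"
proof -
  have "(\<lambda>w. Lk (var i * F w) m) \<in> V" for m
    using F hv.subspace_0[OF V_sub]
    by (cases "Lk m i > 0") (auto simp: poly_space_def lookup_var_mult zero_fun_def)
  moreover have "Poly_Mapping.keys m \<subseteq> {1..n}" if m: "m \<in> Poly_Mapping.keys (var i * F w)" for m w
  proof -
    have "Lk m i > 0" "m - unit_exp i \<in> Poly_Mapping.keys (F w)"
      using m by (auto simp: in_keys_iff lookup_var_mult split: if_splits)
    then have "Poly_Mapping.keys (m - unit_exp i) \<subseteq> {1..n}" using F by (simp add: poly_space_def)
    moreover have "Poly_Mapping.keys m \<subseteq> insert i (Poly_Mapping.keys (m - unit_exp i))"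
      by (auto simp: in_keys_iff lookup_minus split: if_splits)
    ultimately show ?thesis using i by blast
  qed
  ultimately show ?thesis by (simp add: poly_space_def standard_x_var)
qed

lemma poly_space_mono_induct:
  assumes emb: "\<And>v. v \<in> V \<Longrightarrow> P (emb v)"
    and x: "\<And>i F. i \<in> {1..n} \<Longrightarrow> F \<in> poly_space \<Longrightarrow> P F \<Longrightarrow> P (standard_x i F)"
    and v: "v \<in> V" and m: "Poly_Mapping.keys m \<subseteq> {1..n}"
  shows "P (\<lambda>w. Poly_Mapping.single m (v w)) \<and> (\<lambda>w. Poly_Mapping.single m (v w)) \<in> poly_space"
  using m
proof (induction "\<Sum>i\<in>{1..n}. Lk m i" arbitrary: m)
  case 0
  have "m = 0"
  proof (rule poly_mapping_eqI)
    fix i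
    have "Lk m i = 0"
    proof (cases "i \<in> {1..n}")
      case True
      have "\<forall>i\<in>{1..n}. Lk m i = 0" using 0(1) by (simp only: eq_commute[of 0] sum_eq_0_iff finite_atLeastAtMost)
      then show ?thesis using True by blast
    next
      case False
      then show ?thesis using 0(2) by (metis in_keys_iff subsetD)
    qed
    then show "Lk m i = Lk 0 i" by simp
  qed
  then show ?case using emb[OF v] emb_space[OF v] by (simp add: emb_def)
next
  case (Suc k)
  have "\<exists>i\<in>{1..n}. Lk m i \<noteq> 0"
  proof (rule ccontr)
    assume "\<not> ?thesis"
    then have "(\<Sum>i\<in>{1..n}. Lk m i) = 0" by simp
    then show False using Suc.hyps(2) by simp
  qed
  then obtain i where i: "i \<in> {1..n}" "Lk m i > 0" by auto
  define m' where "m' = m - unit_exp i"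
  have m: "m = unit_exp i + m'" using add_unit_exp_eq[of i m' m] i by (simp add: m'_def)
  have "(\<Sum>i\<in>{1..n}. Lk m i) = (\<Sum>j\<in>{1..n}. (if j = i then 1 else 0) + Lk m' j)"
    unfolding m by (intro sum.cong) (auto simp: lookup_add lookup_single when_def)
  also have "\<dots> = Suc (\<Sum>j\<in>{1..n}. Lk m' j)" using i by (simp add: sum.distrib)
  finally have "k = (\<Sum>j\<in>{1..n}. Lk m' j)" using Suc.hyps by simp
  moreover have "Poly_Mapping.keys m' \<subseteq> {1..n}"
    using Suc.prems by (auto simp: m'_def in_keys_iff lookup_minus)
  ultimately have "P (\<lambda>w. Poly_Mapping.single m' (v w))" "(\<lambda>w. Poly_Mapping.single m' (v w)) \<in> poly_space"
    using Suc.hyps(1) by blast+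
  moreover have "standard_x i (\<lambda>w. Poly_Mapping.single m' (v w)) = (\<lambda>w. Poly_Mapping.single m (v w))"
    by (simp add: standard_x_var var_mult_single m)
  ultimately show ?case using x[OF i(1)] poly_space_x[OF i(1)] by metis
qed

lemma poly_space_support:
  assumes F: "F \<in> poly_space"
  shows "finite (\<Union>w. Poly_Mapping.keys (F w))"
proof -
  have "F w = 0" if "w \<notin> perms n" for w
  proof (rule poly_mapping_eqI)
    fix m
    have "(\<lambda>w. Lk (F w) m) \<in> hecke_space n" using F V_space by (auto simp: poly_space_def)
    then show "Lk (F w) m = Lk 0 m" using that by (simp add: hecke_space_def)
  qed
  then have "(\<Union>w. Poly_Mapping.keys (F w)) = (\<Union>w\<in>perms n. Poly_Mapping.keys (F w))" by force
  then show ?thesis using finite_perms by simp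
qed

lemma poly_space_expand:
  assumes F: "F \<in> poly_space"
  shows "F = (\<Sum>m\<in>(\<Union>w. Poly_Mapping.keys (F w)). (\<lambda>w. Poly_Mapping.single m (Lk (F w) m)))"
proof
  fix w
  let ?K = "\<Union>w. Poly_Mapping.keys (F w)"
  show "F w = (\<Sum>m\<in>?K. (\<lambda>w. Poly_Mapping.single m (Lk (F w) m))) w"
    unfolding sum_apply
  proof (rule poly_mapping_eqI)
    fix m
    have "Lk (\<Sum>k\<in>?K. Poly_Mapping.single k (Lk (F w) k)) m = (\<Sum>k\<in>?K. if k = m then Lk (F w) m else 0)"
      unfolding lookup_sum by (intro sum.cong) (auto simp: lookup_single when_def)
    also have "\<dots> = Lk (F w) m" using poly_space_support[OF F] by (auto simp: in_keys_iff)
    finally show "Lk (F w) m = Lk (\<Sum>k\<in>?K. Poly_Mapping.single k (Lk (F w) k)) m" by simp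
  qed
qed

text \<open>The space is generated from its constants by multiplication with the variables and by
  sums. An identity is thus verified on constants and carried past one variable at a time.\<close>

lemma poly_space_induct [consumes 1, case_names emb x add]:
  assumes F: "F \<in> poly_space"
    and emb: "\<And>v. v \<in> V \<Longrightarrow> P (emb v)"
    and x: "\<And>i F. i \<in> {1..n} \<Longrightarrow> F \<in> poly_space \<Longrightarrow> P F \<Longrightarrow> P (standard_x i F)"
    and add: "\<And>F G. F \<in> poly_space \<Longrightarrow> G \<in> poly_space \<Longrightarrow> P F \<Longrightarrow> P G \<Longrightarrow> P (F + G)"
  shows "P F"
proof -
  have z: "emb 0 = 0" by (simp add: emb_def fun_eq_iff)
  have 0: "P 0" "0 \<in> poly_space"
    using emb[OF hv.subspace_0[OF V_sub]] emb_space[OF hv.subspace_0[OF V_sub]] unfolding z by auto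
  have "P (\<Sum>m\<in>K. (\<lambda>w. Poly_Mapping.single m (Lk (F w) m))) \<and> (\<Sum>m\<in>K. (\<lambda>w. Poly_Mapping.single m (Lk (F w) m))) \<in> poly_space"
    if "finite K" "K \<subseteq> (\<Union>w. Poly_Mapping.keys (F w))" for K
    using that
  proof (induction K rule: finite_induct)
    case (insert m K)
    have v: "(\<lambda>w. Lk (F w) m) \<in> V" "Poly_Mapping.keys m \<subseteq> {1..n}"
      using F insert.prems by (auto simp: poly_space_def)
    have "P (\<lambda>w. Poly_Mapping.single m (Lk (F w) m)) \<and> (\<lambda>w. Poly_Mapping.single m (Lk (F w) m)) \<in> poly_space"
      by (rule poly_space_mono_induct[OF emb x v])
    then show ?case using insert add poly_space_add by (simp del: plus_fun_apply)
  qed (use 0 in \<open>simp_all\<close>)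
  from this[OF poly_space_support[OF F] subset_refl] show ?thesis
    unfolding poly_space_expand[OF F, symmetric] ..
qed

end

section \<open>Dunkl operators on vector-valued polynomials\<close>

context left_translation_module
begin

definition ref_sum :: "nat \<Rightarrow> ((nat \<Rightarrow> nat) \<Rightarrow> cpoly) \<Rightarrow> (nat \<Rightarrow> nat) \<Rightarrow> cpoly" where
  "ref_sum i F = (\<Sum>j\<in>{1..n} - {i}. standard_w (transp i j) F)"

text \<open>The operator y_i = d/dx_i - c \<Sum> (1 - s_ij)/(x_i - x_j) \<otimes> s_ij, summed over
  the j different from i. The second tensor factor acts on \<tau> by translating the index, and a
  transposition is its own inverse.\<close>

definition dunkl :: "real \<Rightarrow> nat \<Rightarrow> ((nat \<Rightarrow> nat) \<Rightarrow> cpoly) \<Rightarrow> (nat \<Rightarrow> nat) \<Rightarrow> cpoly" where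
  "dunkl c i F = (\<lambda>w. part_deriv i (F w) -
     const (of_real c) * (\<Sum>j\<in>{1..n} - {i}. div_diff i j (F (transp i j \<circ> w))))"

lemma permsD: "u \<in> perms n \<Longrightarrow> bij u"
  using permutes_bij by auto

lemma transp_perms: "i \<in> {1..n} \<Longrightarrow> j \<in> {1..n} \<Longrightarrow> transp i j \<in> perms n"
  by (simp add: permutes_swap_id)

lemma w_add: "bij u \<Longrightarrow> standard_w u (F + G) = standard_w u F + standard_w u G"
  by (auto simp: standard_w_def fun_eq_iff permute_vars_add)

lemma w_scale: "bij u \<Longrightarrow> standard_w u (mscale a F) = mscale a (standard_w u F)"
  by (auto simp: standard_w_def fun_eq_iff permute_vars_const_mult)

lemma w_x: "bij u \<Longrightarrow> standard_w u (standard_x i F) = standard_x (u i) (standard_w u F)"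
  by (auto simp: standard_w_def standard_x_var fun_eq_iff permute_vars_var_mult)

lemma w_emb: "bij u \<Longrightarrow> standard_w u (emb v) = emb (\<lambda>w. v (inv_into UNIV u \<circ> w))"
  by (auto simp: standard_w_def emb_def fun_eq_iff permute_vars_const)

lemma w_comp: "bij u \<Longrightarrow> bij v \<Longrightarrow> standard_w (u \<circ> v) F = standard_w u (standard_w v F)"
  by (auto simp: standard_w_def fun_eq_iff permute_vars_comp o_inv_distrib o_assoc)

lemma w_id: "standard_w id F = F"
  by (simp add: standard_w_def permute_vars_id)

lemma x_add: "standard_x i (F + G) = standard_x i F + standard_x i G"
  by (auto simp: standard_x_var fun_eq_iff distrib_left)

lemma x_scale: "standard_x i (mscale a F) = mscale a (standard_x i F)"
  by (auto simp: standard_x_var fun_eq_iff mult.left_commute)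

lemma x_comm: "standard_x i (standard_x j F) = standard_x j (standard_x i F)"
  by (auto simp: standard_x_var fun_eq_iff mult.left_commute)

lemma dunkl_add: "dunkl c i (F + G) = dunkl c i F + dunkl c i G"
proof -
  have "(\<Sum>j\<in>{1..n} - {i}. div_diff i j (F (transp i j \<circ> w) + G (transp i j \<circ> w))) =
    (\<Sum>j\<in>{1..n} - {i}. div_diff i j (F (transp i j \<circ> w))) + (\<Sum>j\<in>{1..n} - {i}. div_diff i j (G (transp i j \<circ> w)))" for w
    unfolding sum.distrib[symmetric] by (intro sum.cong refl div_diff_add) auto
  then show ?thesis by (auto simp: dunkl_def fun_eq_iff part_deriv_add algebra_simps)
qed

lemma dunkl_scale: "dunkl c i (mscale a F) = mscale a (dunkl c i F)"
proof -
  have "(\<Sum>j\<in>{1..n} - {i}. div_diff i j (const a * F (transp i j \<circ> w))) =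
    const a * (\<Sum>j\<in>{1..n} - {i}. div_diff i j (F (transp i j \<circ> w)))" for w
    unfolding sum_distrib_left by (intro sum.cong refl div_diff_const_mult) auto
  then show ?thesis
    by (simp add: dunkl_def fun_eq_iff part_deriv_const_mult right_diff_distrib mult.left_commute)
qed

lemma dunkl_emb: "dunkl c i (emb v) = 0"
proof -
  have "(\<Sum>j\<in>{1..n} - {i}. div_diff i j (const (v (transp i j \<circ> w)))) = 0" for w
    by (intro sum.neutral ballI div_diff_const) auto
  then show ?thesis by (auto simp: dunkl_def emb_def fun_eq_iff part_deriv_const)
qed

lemma dunkl_x:
  assumes i: "i \<in> {1..n}" and k: "k \<in> {1..n}"
  shows "dunkl c i (standard_x k F) = standard_x k (dunkl c i F) +
    (if k = i then F - mscale (of_real c) (ref_sum i F) else mscale (of_real c) (standard_w (transp i k) F))"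
proof
  fix w
  let ?J = "{1..n} - {i}" and ?F = "\<lambda>j. F (transp i j \<circ> w)"
  have sw: "swap_vars i j (?F j) = standard_w (transp i j) F w" for j
    by (simp add: standard_w_def)
  have "(\<Sum>j\<in>?J. div_diff i j (var k * ?F j)) =
    (\<Sum>j\<in>?J. var k * div_diff i j (?F j) + (if k = i then standard_w (transp i j) F w else if k = j then - standard_w (transp i j) F w else 0))"
    by (intro sum.cong refl, subst div_diff_var_mult) (auto simp: sw)
  also have "\<dots> = var k * (\<Sum>j\<in>?J. div_diff i j (?F j)) +
      (if k = i then ref_sum i F w else - standard_w (transp i k) F w)"
    using k by (auto simp: sum.distrib sum_distrib_left ref_sum_def sum_apply)
  finally have "(\<Sum>j\<in>?J. div_diff i j (var k * ?F j)) = \<dots>" .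
  then show "dunkl c i (standard_x k F) w = (standard_x k (dunkl c i F) +
    (if k = i then F - mscale (of_real c) (ref_sum i F) else mscale (of_real c) (standard_w (transp i k) F))) w"
    unfolding dunkl_def standard_x_var part_deriv_var_mult by (auto simp: algebra_simps)
qed

lemma dunkl_w:
  assumes u: "u \<in> perms n" and i: "i \<in> {1..n}"
  shows "standard_w u (dunkl c i F) = dunkl c (u i) (standard_w u F)"
proof
  fix w
  have b: "bij u" using permsD[OF u] .
  have J: "{1..n} - {u i} = u ` ({1..n} - {i})"
    using u permutes_image[of u "{1..n}"] b by (auto simp: bij_def image_set_diff)
  have "(\<Sum>j\<in>{1..n} - {u i}. div_diff (u i) j (standard_w u F (transp (u i) j \<circ> w))) =
    (\<Sum>j\<in>{1..n} - {i}. div_diff (u i) (u j) (standard_w u F (transp (u i) (u j) \<circ> w)))"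
    unfolding J using b by (subst sum.reindex) (auto simp: bij_def inj_on_def)
  also have "\<dots> = (\<Sum>j\<in>{1..n} - {i}. permute_vars u (div_diff i j (F (transp i j \<circ> (inv_into UNIV u \<circ> w)))))"
  proof (intro sum.cong refl)
    fix j assume j: "j \<in> {1..n} - {i}"
    have "inv_into UNIV u \<circ> (transp (u i) (u j) \<circ> w) = transp i j \<circ> (inv_into UNIV u \<circ> w)"
    proof
      fix x
      have "u (transp i j (inv_into UNIV u (w x))) = transp (u i) (u j) (w x)"
        using fun_cong[OF comp_transp[OF b, of i j], of "inv_into UNIV u (w x)"] b by (simp add: bij_is_surj surj_f_inv_f)
      then show "(inv_into UNIV u \<circ> (transp (u i) (u j) \<circ> w)) x = (transp i j \<circ> (inv_into UNIV u \<circ> w)) x"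
        using b by (metis bij_is_inj comp_apply inv_f_f)
    qed
    then show "div_diff (u i) (u j) (standard_w u F (transp (u i) (u j) \<circ> w)) =
      permute_vars u (div_diff i j (F (transp i j \<circ> (inv_into UNIV u \<circ> w))))"
      using j div_diff_permute[OF b] by (simp add: standard_w_def)
  qed
  also have "\<dots> = permute_vars u (\<Sum>j\<in>{1..n} - {i}. div_diff i j (F (transp i j \<circ> (inv_into UNIV u \<circ> w))))"
  proof -
    have "(\<Sum>j\<in>J. permute_vars u (g j)) = permute_vars u (\<Sum>j\<in>J. g j)" for J and g :: "nat \<Rightarrow> cpoly"
      by (induction J rule: infinite_finite_induct) (auto simp: permute_vars_zero permute_vars_add b)
    then show ?thesis .
  qed
  finally show "standard_w u (dunkl c i F) w = dunkl c (u i) (standard_w u F) w"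
    by (simp add: dunkl_def standard_w_def permute_vars_diff permute_vars_const_mult b part_deriv_permute)
qed

lemma poly_space_w:
  assumes F: "F \<in> poly_space" and u: "u \<in> perms n"
  shows "standard_w u F \<in> poly_space"
  using F
proof (induction rule: poly_space_induct)
  case (emb v)
  then show ?case using V_trans[OF u] emb_space by (simp add: w_emb permsD[OF u])
next
  case (x i F)
  have "u i \<in> {1..n}" using u x(1) permutes_in_image[of u "{1..n}"] by simp
  then show ?case using x poly_space_x by (simp add: w_x permsD[OF u])
next
  case (add F G)
  then show ?case using poly_space_add by (simp add: w_add permsD[OF u] del: plus_fun_apply)
qed

lemma poly_space_0: "0 \<in> poly_space"
  using hv.subspace_0[OF V_sub] by (auto simp: poly_space_def zero_fun_def)

lemma poly_space_sum: "(\<And>i. i \<in> I \<Longrightarrow> X i \<in> poly_space) \<Longrightarrow> (\<Sum>i\<in>I. X i) \<in> poly_space"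
  by (induction I rule: infinite_finite_induct) (auto intro: poly_space_0 poly_space_add simp del: plus_fun_apply)

lemma mscale_neg: "mscale (-1) F = - F"
  by (auto simp: fun_eq_iff single_uminus)

lemma poly_space_diff: "F \<in> poly_space \<Longrightarrow> G \<in> poly_space \<Longrightarrow> F - G \<in> poly_space"
  using poly_space_add[of F "mscale (-1) G"] poly_space_scale[of G "-1"] by (simp only: mscale_neg add_uminus_conv_diff)

lemma poly_space_ref_sum: "i \<in> {1..n} \<Longrightarrow> F \<in> poly_space \<Longrightarrow> ref_sum i F \<in> poly_space"
  unfolding ref_sum_def by (intro poly_space_sum poly_space_w transp_perms) auto

lemma poly_space_dunkl:
  assumes F: "F \<in> poly_space" and i: "i \<in> {1..n}"
  shows "dunkl c i F \<in> poly_space"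
  using F
proof (induction rule: poly_space_induct)
  case (emb v)
  show ?case unfolding dunkl_emb by (rule poly_space_0)
next
  case (x k F)
  have "(if k = i then F - mscale (of_real c) (ref_sum i F) else mscale (of_real c) (standard_w (transp i k) F)) \<in> poly_space"
    using x i by (auto intro!: poly_space_diff poly_space_scale poly_space_ref_sum poly_space_w transp_perms permutes_swap_id simp del: minus_apply)
  then show ?case unfolding dunkl_x[OF i x(1)] by (intro poly_space_add poly_space_x x)
next
  case (add F G)
  then show ?case using poly_space_add by (simp add: dunkl_add del: plus_fun_apply)
qed

lemma dunkl_diff: "dunkl c i (F - G) = dunkl c i F - dunkl c i G"
  using dunkl_add[of c i "F - G" G] by (simp add: algebra_simps del: plus_fun_apply)

lemma dunkl_0: "dunkl c i 0 = 0"
  using dunkl_diff[of c i 0 0] by (simp only: diff_self)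

lemma dunkl_sum: "dunkl c i (\<Sum>j\<in>J. X j) = (\<Sum>j\<in>J. dunkl c i (X j))"
proof (induction J rule: infinite_finite_induct)
  case (insert j J)
  then show ?case by (simp add: dunkl_add del: plus_fun_apply)
qed (simp_all only: sum.empty sum.infinite dunkl_0 not_False_eq_True)

text \<open>Both sides vanish on constants. Carrying the two operators past one more variable
  \<open>x_k\<close> produces the corrections \<open>R\<close> of the defining relations, so the
  claim reduces to the symmetry in i and j of the total correction, which equivariance under
  transpositions provides.\<close>

lemma dunkl_comm:
  assumes F: "F \<in> poly_space" and i: "i \<in> {1..n}" and j: "j \<in> {1..n}"
  shows "dunkl c i (dunkl c j F) = dunkl c j (dunkl c i F)"
  using F
proof (induction rule: poly_space_induct)
  case (emb v)
  show ?case by (simp only: dunkl_emb dunkl_0)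
next
  case (add F G)
  then show ?case by (simp add: dunkl_add del: plus_fun_apply)
next
  case (x k F)
  let ?C = "mscale (of_real c)" and ?Y = "dunkl c"
  define R where "R = (\<lambda>i F. if k = i then F - ?C (ref_sum i F) else ?C (standard_w (transp i k) F))"
  have Rx: "?Y i (standard_x k F) = standard_x k (?Y i F) + R i F" if "i \<in> {1..n}" for i F
    unfolding R_def by (rule dunkl_x[OF that x(1)])
  have eqv: "standard_w (transp a b) (?Y a F) = ?Y b (standard_w (transp a b) F)"
    if "a \<in> {1..n}" "b \<in> {1..n}" for a b F
    using dunkl_w[OF transp_perms[OF that] that(1)] by simp
  have eqv2: "standard_w (transp a b) (?Y d F) = ?Y d (standard_w (transp a b) F)"
    if "a \<in> {1..n}" "b \<in> {1..n}" "d \<in> {1..n}" "d \<noteq> a" "d \<noteq> b" for a b d F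
    using dunkl_w[OF transp_perms[OF that(1,2)] that(3)] that by (simp add: Transposition.transpose_apply_other)
  have tc: "transp a b = transp b a" for a b :: nat by (rule Transposition.transpose_commute)
  \<comment> \<open>For distinct i and j at most one of them equals k, so by symmetry it suffices to
    treat \<open>k \<noteq> j\<close>. If k = i, the transposition of i and j is split off from the
    reflection sum of i; the other summands commute with the operator of index j.\<close>
  have key: "R i (?Y j F) + ?Y i (R j F) = R j (?Y i F) + ?Y j (R i F)" if kj: "k \<noteq> j" "i \<in> {1..n}" "j \<in> {1..n}" "i \<noteq> j" for i j
  proof (cases "k = i")
    case False
    then show ?thesis using kj x(1) eqv2[of i k j F] eqv2[of j k i F]
      by (simp add: R_def dunkl_scale add.commute del: plus_fun_apply)
  next
    case True
    have ij: "i \<noteq> j" and jA: "j \<in> {1..n} - {i}" using kj by auto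
    have split: "ref_sum i G = standard_w (transp i j) G + (\<Sum>l\<in>{1..n} - {i} - {j}. standard_w (transp i l) G)" for G
      unfolding ref_sum_def using jA by (simp add: sum.remove[of _ j] del: plus_fun_apply)
    have rest: "(\<Sum>l\<in>{1..n} - {i} - {j}. standard_w (transp i l) (?Y j F)) = ?Y j (\<Sum>l\<in>{1..n} - {i} - {j}. standard_w (transp i l) F)"
      unfolding dunkl_sum using kj ij by (intro sum.cong refl eqv2) auto
    have mscale_add: "?C (A + B) = ?C A + ?C B" for A B by (auto simp: fun_eq_iff distrib_left)
    have 1: "standard_w (transp i j) (?Y j F) = ?Y i (standard_w (transp i j) F)"
      using eqv[OF kj(3,2), of F] by (simp add: tc[of j i])
    have 2: "standard_w (transp j i) (?Y i F) = ?Y j (standard_w (transp i j) F)"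
      using eqv[OF kj(2,3), of F] by (simp add: tc[of j i])
    have "R i (?Y j F) + ?Y i (R j F) = ?Y j F - ?C (?Y i (standard_w (transp i j) F)) -
        ?C (?Y j (\<Sum>l\<in>{1..n} - {i} - {j}. standard_w (transp i l) F)) + ?C (?Y i (standard_w (transp i j) F))"
      using True ij by (simp add: R_def split mscale_add rest 1 dunkl_scale tc[of j i] algebra_simps del: plus_fun_apply minus_apply One_nat_def)
    also have "\<dots> = ?C (?Y j (standard_w (transp i j) F)) + (?Y j F - ?C (?Y j (standard_w (transp i j) F)) -
        ?C (?Y j (\<Sum>l\<in>{1..n} - {i} - {j}. standard_w (transp i l) F)))"
      by (simp add: algebra_simps del: plus_fun_apply minus_apply One_nat_def)
    also have "\<dots> = R j (?Y i F) + ?Y j (R i F)"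
      using True ij by (simp add: R_def split mscale_add dunkl_diff dunkl_add dunkl_scale 2 algebra_simps del: plus_fun_apply minus_apply One_nat_def)
    finally show ?thesis .
  qed
  have "R i (?Y j F) + ?Y i (R j F) = R j (?Y i F) + ?Y j (R i F)"
  proof (cases "i = j")
    case False
    then consider "k \<noteq> j" | "k \<noteq> i" by blast
    then show ?thesis using key[of j i] key[of i j] i j False by cases (simp_all del: plus_fun_apply)
  qed simp
  then show ?case using x(3) i j by (simp add: Rx dunkl_add add.assoc x_add del: plus_fun_apply)
qed

lemma cherednik_dunkl: "cherednik_module n c mscale poly_space standard_w standard_x (dunkl c)"
proof -
  interpret mv: vector_space mscale by (rule vector_space_mscale)
  have sub: "mv.subspace poly_space"
    unfolding mv.subspace_def using poly_space_0 poly_space_add poly_space_scale by blast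
  have swY: "dunkl c i (standard_x j F) - standard_x j (dunkl c i F) = mscale (of_real c) (standard_w (transp i j) F)"
    if "i \<in> {1..n}" "j \<in> {1..n}" "i \<noteq> j" for i j F
    using dunkl_x[OF that(1,2), of c F] that(3) by (simp del: plus_fun_apply minus_apply)
  have diag: "dunkl c i (standard_x i F) - standard_x i (dunkl c i F) =
     F - mscale (of_real c) (\<Sum>j\<in>{1..n} - {i}. standard_w (transp i j) F)"
    if "i \<in> {1..n}" for i F
    using dunkl_x[OF that that, of c F] by (simp add: ref_sum_def del: plus_fun_apply minus_apply)
  have lin: "linear_on_space mscale poly_space (standard_w u)" if "u \<in> perms n" for u
    unfolding linear_on_space_def using that poly_space_w w_add w_scale permsD by blast
  have lin': "linear_on_space mscale poly_space (standard_x i) \<and> linear_on_space mscale poly_space (dunkl c i)"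
    if "i \<in> {1..n}" for i
    unfolding linear_on_space_def using that poly_space_x x_add x_scale poly_space_dunkl dunkl_add dunkl_scale by blast
  have eqv: "standard_w (u \<circ> v) F = standard_w u (standard_w v F)" if "u \<in> perms n" "v \<in> perms n" for u v F
    using that w_comp permsD by blast
  have eqv': "standard_w u (standard_x i F) = standard_x (u i) (standard_w u F)" if "u \<in> perms n" for u i F
    using that w_x permsD by blast
  show ?thesis
    unfolding cherednik_module_def
    by (intro conjI ballI allI impI;
      (rule sub lin lin'[THEN conjunct1] lin'[THEN conjunct2] w_id eqv eqv' dunkl_w x_comm dunkl_comm swY diag; assumption))
qed

end


section \<open>The contravariant form\<close>

definition pairing :: "cpoly \<Rightarrow> ((nat \<Rightarrow>\<^sub>0 nat) \<Rightarrow> complex) \<Rightarrow> complex" where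
  "pairing p h = (\<Sum>m\<in>Poly_Mapping.keys p. Lk p m * h m)"

lemma pairing_superset: "finite S \<Longrightarrow> Poly_Mapping.keys p \<subseteq> S \<Longrightarrow> pairing p h = (\<Sum>m\<in>S. Lk p m * h m)"
  unfolding pairing_def by (rule sum.mono_neutral_left) (auto simp: in_keys_iff)

lemma pairing_add: "pairing (p + q) h = pairing p h + pairing q h"
proof -
  let ?S = "Poly_Mapping.keys p \<union> Poly_Mapping.keys q"
  show ?thesis
    using pairing_superset[of ?S p h] pairing_superset[of ?S q h] pairing_superset[of ?S "p + q" h] keys_add[of p q]
    by (simp add: lookup_add distrib_right sum.distrib)
qed

lemma pairing_single: "pairing (Poly_Mapping.single m a) h = a * h m"
  by (simp add: pairing_def)

lemma pairing_zero [simp]: "pairing 0 h = 0"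
  by (simp add: pairing_def)

lemma pairing_const_mult: "pairing (const a * p) h = a * pairing p h"
proof -
  have "Poly_Mapping.keys (const a * p) \<subseteq> Poly_Mapping.keys p"
    by (auto simp: in_keys_iff lookup_const_mult)
  then show ?thesis
    using pairing_superset[of "Poly_Mapping.keys p" "const a * p" h]
    by (simp add: lookup_const_mult pairing_def sum_distrib_left mult.assoc)
qed

lemma pairing_var_mult: "pairing (var i * p) h = pairing p (\<lambda>m. h (unit_exp i + m))"
proof (induction p rule: update_induct)
  case (update f a b)
  then show ?case
    by (simp add: poly_mapping_update_add distrib_left pairing_add var_mult_single pairing_single)
qed simp

lemma pairing_right_add: "pairing p (\<lambda>m. g m + h m) = pairing p g + pairing p h"
  by (simp add: pairing_def distrib_left sum.distrib)

lemma pairing_right_scale: "pairing p (\<lambda>m. a * h m) = a * pairing p h"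
  by (simp add: pairing_def sum_distrib_left mult.left_commute)

text \<open>The operators \<open>Y\<close> are kept abstract because \<open>standard_y\<close> is an
  arbitrary choice among the operators that satisfy the relations.\<close>

locale cherednik_poly = left_translation_module +
  fixes c :: real and Y :: "nat \<Rightarrow> ((nat \<Rightarrow> nat) \<Rightarrow> cpoly) \<Rightarrow> (nat \<Rightarrow> nat) \<Rightarrow> cpoly"
  assumes ch: "cherednik_module n c mscale poly_space standard_w standard_x Y"
    and Y_emb: "\<And>i v. i \<in> {1..n} \<Longrightarrow> v \<in> V \<Longrightarrow> Y i (emb v) = 0"
begin

abbreviation M where "M \<equiv> poly_space"
abbreviation C where "C \<equiv> mscale (complex_of_real c)"

lemma Y_closed: "i \<in> {1..n} \<Longrightarrow> F \<in> M \<Longrightarrow> Y i F \<in> M"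
  and Y_add: "i \<in> {1..n} \<Longrightarrow> F \<in> M \<Longrightarrow> G \<in> M \<Longrightarrow> Y i (F + G) = Y i F + Y i G"
  and Y_scale: "i \<in> {1..n} \<Longrightarrow> F \<in> M \<Longrightarrow> Y i (mscale a F) = mscale a (Y i F)"
  using ch unfolding cherednik_module_def linear_on_space_def by blast+

lemma Y_comm: "i \<in> {1..n} \<Longrightarrow> j \<in> {1..n} \<Longrightarrow> F \<in> M \<Longrightarrow> Y i (Y j F) = Y j (Y i F)"
  and w_Y: "u \<in> perms n \<Longrightarrow> i \<in> {1..n} \<Longrightarrow> F \<in> M \<Longrightarrow> standard_w u (Y i F) = Y (u i) (standard_w u F)"
  using ch unfolding cherednik_module_def by blast+

lemma Y_x:
  assumes "i \<in> {1..n}" "j \<in> {1..n}" "i \<noteq> j" "F \<in> M"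
  shows "Y i (standard_x j F) = standard_x j (Y i F) + C (standard_w (transp i j) F)"
proof -
  have "Y i (standard_x j F) - standard_x j (Y i F) = C (standard_w (transp i j) F)"
    using ch assms unfolding cherednik_module_def by blast
  then show ?thesis by (metis add.commute diff_add_cancel)
qed

lemma Y_x_self:
  assumes "i \<in> {1..n}" "F \<in> M"
  shows "Y i (standard_x i F) = standard_x i (Y i F) + (F - C (ref_sum i F))"
proof -
  have "Y i (standard_x i F) - standard_x i (Y i F) = F - C (ref_sum i F)"
    using ch assms unfolding cherednik_module_def ref_sum_def by blast
  then show ?thesis by (metis add.commute diff_add_cancel)
qed

lemma Y_pow_closed: "i \<in> {1..n} \<Longrightarrow> F \<in> M \<Longrightarrow> (Y i ^^ k) F \<in> M"
  by (induction k) (auto intro: Y_closed)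

lemma Y_fold_closed: "set L \<subseteq> {1..n} \<Longrightarrow> F \<in> M \<Longrightarrow> foldr (\<lambda>k. Y k ^^ Lk m k) L F \<in> M"
  by (induction L) (auto intro: Y_pow_closed)

lemma Y_pow_comm: "i \<in> {1..n} \<Longrightarrow> j \<in> {1..n} \<Longrightarrow> F \<in> M \<Longrightarrow> Y i ((Y j ^^ k) F) = (Y j ^^ k) (Y i F)"
proof (induction k)
  case (Suc k)
  then show ?case using Y_comm[of i j "(Y j ^^ k) F"] Y_pow_closed[of j F k] by simp
qed simp

lemma Y_fold_comm:
  "i \<in> {1..n} \<Longrightarrow> set L \<subseteq> {1..n} \<Longrightarrow> F \<in> M \<Longrightarrow>
   Y i (foldr (\<lambda>k. Y k ^^ Lk m k) L F) = foldr (\<lambda>k. Y k ^^ Lk m k) L (Y i F)"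
  by (induction L) (simp_all add: Y_pow_comm Y_fold_closed)

definition Y_mono :: "(nat \<Rightarrow>\<^sub>0 nat) \<Rightarrow> ((nat \<Rightarrow> nat) \<Rightarrow> cpoly) \<Rightarrow> (nat \<Rightarrow> nat) \<Rightarrow> cpoly" where
  "Y_mono m = foldr (\<lambda>k. Y k ^^ Lk m k) [1..<Suc n]"

lemma Y_mono_unit:
  assumes i: "i \<in> {1..n}" and F: "F \<in> M"
  shows "Y_mono (unit_exp i + m) F = Y_mono m (Y i F)"
proof -
  have same: "foldr (\<lambda>k. Y k ^^ Lk (unit_exp i + m) k) L F = foldr (\<lambda>k. Y k ^^ Lk m k) L F"
    if "i \<notin> set L" for L
    using that by (induction L) (auto simp: lookup_add)
  have "foldr (\<lambda>k. Y k ^^ Lk (unit_exp i + m) k) L F = foldr (\<lambda>k. Y k ^^ Lk m k) L (Y i F)"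
    if "i \<in> set L" "distinct L" "set L \<subseteq> {1..n}" for L
    using that
  proof (induction L)
    case (Cons a L)
    show ?case
    proof (cases "a = i")
      case True
      then have "i \<notin> set L" "set L \<subseteq> {1..n}" using Cons.prems by auto
      then show ?thesis using True same[of L] Y_fold_comm[OF i _ F, of L m]
        by (simp add: lookup_add funpow_swap1)
    next
      case False
      then show ?thesis using Cons by (simp add: lookup_add)
    qed
  qed simp
  from this[of "[1..<Suc n]"] show ?thesis using i unfolding Y_mono_def set_upt by (simp only: distinct_upt atLeastLessThanSuc_atLeastAtMost subset_refl simp_thms)
qed

lemma Y_pow_lin:
  assumes "i \<in> {1..n}" "F \<in> M" "G \<in> M"
  shows "(Y i ^^ k) (F + G) = (Y i ^^ k) F + (Y i ^^ k) G" "(Y i ^^ k) (mscale a F) = mscale a ((Y i ^^ k) F)"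
  using assms by (induction k) (simp_all add: Y_add Y_scale Y_pow_closed del: plus_fun_apply)

lemma Y_mono_lin:
  assumes "F \<in> M" "G \<in> M"
  shows "Y_mono m (F + G) = Y_mono m F + Y_mono m G" "Y_mono m (mscale a F) = mscale a (Y_mono m F)"
proof -
  have "set L \<subseteq> {1..n} \<Longrightarrow> foldr (\<lambda>k. Y k ^^ Lk m k) L (F + G) =
      foldr (\<lambda>k. Y k ^^ Lk m k) L F + foldr (\<lambda>k. Y k ^^ Lk m k) L G \<and>
      foldr (\<lambda>k. Y k ^^ Lk m k) L (mscale a F) = mscale a (foldr (\<lambda>k. Y k ^^ Lk m k) L F)" for L
    by (induction L) (use assms in \<open>simp_all add: Y_pow_lin Y_fold_closed del: plus_fun_apply\<close>)
  from this[of "[1..<Suc n]"] show "Y_mono m (F + G) = Y_mono m F + Y_mono m G" "Y_mono m (mscale a F) = mscale a (Y_mono m F)"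
    unfolding Y_mono_def set_upt by (simp_all only: atLeastLessThanSuc_atLeastAtMost subset_refl simp_thms)
qed

lemma Y_mono_0: "Y_mono 0 F = F"
proof -
  have "foldr (\<lambda>k. Y k ^^ Lk 0 k) L F = F" for L by (induction L) auto
  then show ?thesis by (simp add: Y_mono_def)
qed

text \<open>The form is forced by contravariance: \<open>\<langle>x\<^sup>m \<otimes> v, G\<rangle> = \<langle>v, y\<^sup>m G\<rangle>\<close>, where only the constant
  term of \<open>y\<^sup>m G\<close> contributes.\<close>

definition cform :: "((nat \<Rightarrow> nat) \<Rightarrow> cpoly) \<Rightarrow> ((nat \<Rightarrow> nat) \<Rightarrow> cpoly) \<Rightarrow> complex" where
  "cform F G = (\<Sum>w\<in>perms n. pairing (F w) (\<lambda>m. cnj (Lk (Y_mono m G w) 0)))"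

lemma cform_add_left: "cform (F + F') G = cform F G + cform F' G"
  by (simp add: cform_def pairing_add sum.distrib)

lemma cform_scale_left: "cform (mscale a F) G = a * cform F G"
  by (simp add: cform_def pairing_const_mult sum_distrib_left)

lemma cform_add_right: "G \<in> M \<Longrightarrow> H \<in> M \<Longrightarrow> cform F (G + H) = cform F G + cform F H"
  by (simp add: cform_def Y_mono_lin lookup_add pairing_right_add sum.distrib)

lemma cform_scale_right: "G \<in> M \<Longrightarrow> cform F (mscale a G) = cnj a * cform F G"
  by (simp add: cform_def Y_mono_lin lookup_const_mult pairing_right_scale sum_distrib_left)

lemma cform_emb: "cform (emb v) G = (\<Sum>w\<in>perms n. v w * cnj (Lk (G w) 0))"
  by (simp add: cform_def emb_def pairing_single Y_mono_0)

lemma cform_x_left: "i \<in> {1..n} \<Longrightarrow> G \<in> M \<Longrightarrow> cform (standard_x i F) G = cform F (Y i G)"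
  by (simp add: cform_def standard_x_var pairing_var_mult Y_mono_unit)

lemma cform_0_left: "cform 0 G = 0" by (simp add: cform_def)

lemma cform_0_right: "cform F 0 = 0"
  using cform_scale_right[OF poly_space_0, of F 0] by (simp add: zero_fun_def)

lemma cform_sum_left: "cform (\<Sum>i\<in>I. X i) G = (\<Sum>i\<in>I. cform (X i) G)"
  by (induction I rule: infinite_finite_induct) (simp_all add: cform_0_left[unfolded zero_fun_def] zero_fun_def cform_add_left del: plus_fun_apply)

lemma cform_sum_right: "(\<And>i. i \<in> I \<Longrightarrow> X i \<in> M) \<Longrightarrow> cform F (\<Sum>i\<in>I. X i) = (\<Sum>i\<in>I. cform F (X i))"
  by (induction I rule: infinite_finite_induct)
    (simp_all add: cform_0_right[unfolded zero_fun_def] zero_fun_def cform_add_right poly_space_sum del: plus_fun_apply)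

lemma lookup_x_0: "Lk (standard_x i F w) 0 = 0"
  by (simp add: standard_x_var lookup_var_mult)

lemma cform_w:
  assumes F: "F \<in> M" and G: "G \<in> M" and u: "u \<in> perms n"
  shows "cform (standard_w u F) (standard_w u G) = cform F G"
  using F G
proof (induction arbitrary: G rule: poly_space_induct)
  case (emb v)
  have b: "bij u" and up: "u permutes {1..n}" using u permsD by auto
  have "cform (standard_w u (emb v)) (standard_w u G) =
    (\<Sum>w\<in>perms n. v (inv_into UNIV u \<circ> w) * cnj (Lk (G (inv_into UNIV u \<circ> w)) 0))"
    unfolding w_emb[OF b] cform_emb using b by (simp add: standard_w_def lookup_permute_vars bij_is_inj)
  also have "\<dots> = (\<Sum>w\<in>perms n. v w * cnj (Lk (G w) 0))"
  proof (rule sum.reindex_bij_witness[of _ "\<lambda>w. u \<circ> w" "\<lambda>w. inv_into UNIV u \<circ> w"])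
    fix w assume "w \<in> perms n"
    then show "inv_into UNIV u \<circ> w \<in> perms n" "u \<circ> w \<in> perms n"
      using up permutes_inv[OF up] permutes_compose by auto
    show "u \<circ> (inv_into UNIV u \<circ> w) = w" "inv_into UNIV u \<circ> (u \<circ> w) = w"
      using b by (auto simp: fun_eq_iff bij_is_inj bij_is_surj surj_f_inv_f)
  qed simp
  finally show ?case by (simp add: cform_emb)
next
  case (x i F)
  have ui: "u i \<in> {1..n}" using u x(1) permutes_in_image[of u "{1..n}"] by simp
  have "cform (standard_w u (standard_x i F)) (standard_w u G) = cform (standard_w u F) (Y (u i) (standard_w u G))"
    using x ui u by (simp add: w_x permsD cform_x_left poly_space_w)
  also have "\<dots> = cform (standard_w u F) (standard_w u (Y i G))" using x u by (simp add: w_Y)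
  also have "\<dots> = cform F (Y i G)" using x Y_closed by blast
  finally show ?case using x by (simp add: cform_x_left)
next
  case (add F F')
  then show ?case using u by (simp add: w_add permsD cform_add_left del: plus_fun_apply)
qed

lemma cform_transp:
  assumes "F \<in> M" "G \<in> M" "i \<in> {1..n}" "j \<in> {1..n}"
  shows "cform F (standard_w (transp i j) G) = cform (standard_w (transp i j) F) G"
proof -
  have t: "transp i j \<in> perms n" using transp_perms assms by blast
  have "standard_w (transp i j) (standard_w (transp i j) G) = G"
    by (simp add: w_comp[symmetric] w_id)
  then show ?thesis using cform_w[OF assms(1) poly_space_w[OF assms(2) t] t] by simp
qed

lemma cform_ref_sum:
  assumes "F \<in> M" "G \<in> M" "i \<in> {1..n}"
  shows "cform F (ref_sum i G) = cform (ref_sum i F) G"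
proof -
  have "cform F (ref_sum i G) = (\<Sum>j\<in>{1..n} - {i}. cform F (standard_w (transp i j) G))"
    unfolding ref_sum_def by (rule cform_sum_right) (use assms poly_space_w transp_perms in auto)
  also have "\<dots> = (\<Sum>j\<in>{1..n} - {i}. cform (standard_w (transp i j) F) G)"
    by (intro sum.cong refl cform_transp assms) (use assms in auto)
  finally show ?thesis by (simp add: ref_sum_def cform_sum_left)
qed

lemma scale_neg_diff: "F - C G = F + mscale (- complex_of_real c) G"
  by (auto simp: fun_eq_iff single_uminus)

text \<open>The definition makes x_i adjoint to y_i only when x_i stands on the left. The other case
  follows by induction on the left argument: moving y past x by the defining relations leaves
  corrections that are sums of transpositions, and these are self-adjoint. Hermitian symmetry is
  then a consequence.\<close>

lemma cform_x_right:
  assumes "F \<in> M" "G \<in> M" "i \<in> {1..n}"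
  shows "cform F (standard_x i G) = cform (Y i F) G"
  using assms
proof (induction arbitrary: G i rule: poly_space_induct)
  case (emb v)
  then show ?case unfolding cform_emb lookup_x_0 by (simp add: Y_emb cform_0_left[unfolded zero_fun_def] zero_fun_def)
next
  case (add F F')
  then show ?case by (simp add: cform_add_left Y_add del: plus_fun_apply)
next
  case (x j F)
  note F = x(2) and G = x(4) and i = x(5) and j = x(1)
  note cl = poly_space_x poly_space_add poly_space_scale Y_closed poly_space_w transp_perms poly_space_ref_sum
  show ?case
  proof (cases "i = j")
    case False
    have "cform (standard_x j F) (standard_x i G) = cform F (Y j (standard_x i G))"
      using x by (simp add: cform_x_left poly_space_x)
    also have "Y j (standard_x i G) = standard_x i (Y j G) + C (standard_w (transp j i) G)"
      using Y_x[OF j i _ G] False by simp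
    also have "cform F \<dots> = cform F (standard_x i (Y j G)) + complex_of_real c * cform F (standard_w (transp j i) G)"
    proof -
      have t: "standard_w (transp j i) G \<in> M" by (rule poly_space_w[OF G transp_perms[OF j i]])
      show ?thesis
        unfolding cform_add_right[OF poly_space_x[OF i Y_closed[OF j G]] poly_space_scale[OF t]] cform_scale_right[OF t]
        by simp
    qed
    also have "cform F (standard_x i (Y j G)) = cform (Y i F) (Y j G)" using x(3) Y_closed[OF j G] i by blast
    also have "\<dots> = cform (standard_x j (Y i F)) G" using G j by (simp add: cform_x_left)
    also have "cform F (standard_w (transp j i) G) = cform (standard_w (transp i j) F) G"
      using cform_transp[OF F G j i] by (simp add: Transposition.transpose_commute)
    also have "cform (standard_x j (Y i F)) G + complex_of_real c * cform (standard_w (transp i j) F) G =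
        cform (Y i (standard_x j F)) G"
      using Y_x[OF i j False F] by (simp add: cform_add_left cform_scale_left del: plus_fun_apply)
    finally show ?thesis .
  next
    case True
    have "cform (standard_x j F) (standard_x i G) = cform F (Y i (standard_x i G))"
      using x True by (simp add: cform_x_left poly_space_x)
    also have "Y i (standard_x i G) = standard_x i (Y i G) + (G + mscale (- complex_of_real c) (ref_sum i G))"
      unfolding Y_x_self[OF i G] scale_neg_diff ..
    also have "cform F \<dots> = cform F (standard_x i (Y i G)) + (cform F G - complex_of_real c * cform F (ref_sum i G))"
    proof -
      have 1: "standard_x i (Y i G) \<in> M" "mscale (- complex_of_real c) (ref_sum i G) \<in> M" using G i by (auto intro!: cl)
      show ?thesis
        unfolding cform_add_right[OF 1(1) poly_space_add[OF G 1(2)]] cform_add_right[OF G 1(2)]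
          cform_scale_right[OF poly_space_ref_sum[OF i G]] by simp
    qed
    also have "cform F (standard_x i (Y i G)) = cform (Y i F) (Y i G)" using x(3) Y_closed[OF i G] i by blast
    also have "\<dots> = cform (standard_x i (Y i F)) G" using G i by (simp add: cform_x_left)
    also have "cform F (ref_sum i G) = cform (ref_sum i F) G" by (rule cform_ref_sum[OF F G i])
    also have "cform (standard_x i (Y i F)) G + (cform F G - complex_of_real c * cform (ref_sum i F) G) =
        cform (Y i (standard_x i F)) G"
      unfolding Y_x_self[OF i F] scale_neg_diff cform_add_left cform_scale_left by simp
    finally show ?thesis using True by simp
  qed
qed

lemma cform_emb_herm:
  assumes v: "v \<in> V" and G: "G \<in> M"
  shows "cform (emb v) G = cnj (cform G (emb v))"
  using G
proof (induction rule: poly_space_induct)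
  case (emb u)
  show ?case unfolding cform_emb by (simp add: emb_def mult.commute)
next
  case (x i G)
  then show ?case using Y_emb[of i v] v
    unfolding cform_emb[of v] lookup_x_0 by (simp add: cform_x_left emb_space cform_0_right[unfolded zero_fun_def] zero_fun_def)
next
  case (add F G)
  then show ?case by (simp add: cform_add_left cform_add_right del: plus_fun_apply)
qed

lemma cform_herm:
  assumes "F \<in> M" "G \<in> M"
  shows "cform F G = cnj (cform G F)"
  using assms
proof (induction arbitrary: G rule: poly_space_induct)
  case (emb v)
  then show ?case by (rule cform_emb_herm)
next
  case (x i F)
  then show ?case using cform_x_right[of G F i] Y_closed[of i G] by (simp add: cform_x_left)
next
  case (add F G)
  then show ?case by (simp add: cform_add_left cform_add_right del: plus_fun_apply)
qed

lemma hermitian_cform: "hermitian_form mscale M cform"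
  unfolding hermitian_form_def using cform_add_left cform_scale_left cform_herm by blast

lemma cform_positive: "v \<in> V \<Longrightarrow> v \<noteq> 0 \<Longrightarrow> Re (cform (emb v) (emb v)) > 0"
proof -
  assume v: "v \<in> V" "v \<noteq> 0"
  then obtain w where w: "v w \<noteq> 0" by (auto simp: fun_eq_iff)
  have wp: "w \<in> perms n" using v(1) V_space w by (auto simp: hecke_space_def)
  have "cform (emb v) (emb v) = (\<Sum>w\<in>perms n. complex_of_real ((cmod (v w))\<^sup>2))"
    unfolding cform_emb complex_norm_square by (simp add: emb_def)
  then have "Re (cform (emb v) (emb v)) = (\<Sum>w\<in>perms n. (cmod (v w))\<^sup>2)" by simp
  also have "\<dots> > 0" by (rule sum_pos2[OF finite_perms wp]) (use w in auto)
  finally show ?thesis .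
qed

end


section \<open>Weight vectors of Cherednik modules\<close>

text \<open>A weight is a list of pairs \<open>(m, x)\<close>, where \<open>x\<close> is a content and the level \<open>m\<close> counts how often
  the entry has passed the end of the list; the pair stands for the eigenvalue \<open>m + 1 - c x\<close>.\<close>

definition content_weight :: "real \<Rightarrow> nat \<times> int \<Rightarrow> real" where
  "content_weight c p = real (fst p) + 1 - c * of_int (snd p)"

text \<open>The effect of the affine intertwiner on a weight: the last entry moves to the front, and
  its eigenvalue grows by 1, that is, its level rises by one.\<close>

definition rot :: "(nat \<times> int) list \<Rightarrow> (nat \<times> int) list" where
  "rot st = (Suc (fst (last st)), snd (last st)) # butlast st"

lemma length_rot: "st \<noteq> [] \<Longrightarrow> length (rot st) = length st"
  by (simp add: rot_def)

lemma irrational_mult_eq':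
  assumes "c \<notin> \<rat>"
  shows "of_int a = c * (of_int x :: real) \<longleftrightarrow> a = 0 \<and> x = 0"
proof
  assume e: "of_int a = c * (of_int x :: real)"
  show "a = 0 \<and> x = 0"
  proof (cases "x = 0")
    case False
    then have "c = of_int a / of_int x" using e by (simp add: field_simps)
    then have "c \<in> \<rat>" by (metis Rats_divide Rats_of_int)
    then show ?thesis using assms by blast
  qed (use e in simp)
qed simp

lemma irrational_mult_eq:
  assumes "c \<notin> \<rat>"
  shows "real a = c * of_int x \<longleftrightarrow> a = 0 \<and> x = 0"
  using irrational_mult_eq'[OF assms, of "int a" x] by simp

locale contravariant_module = hermitian_space scale M \<beta>
  for scale :: "complex \<Rightarrow> 'v::ab_group_add \<Rightarrow> 'v" and M \<beta> +
  fixes n :: nat and c :: real and W :: "(nat \<Rightarrow> nat) \<Rightarrow> 'v \<Rightarrow> 'v" and X Y :: "nat \<Rightarrow> 'v \<Rightarrow> 'v"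
  assumes n_pos: "n \<ge> 1" and irrational: "c \<notin> \<rat>"
    and ch: "cherednik_module n c scale M W X Y"
    and invariant: "\<And>w u v. w \<in> perms n \<Longrightarrow> u \<in> M \<Longrightarrow> v \<in> M \<Longrightarrow> \<beta> (W w u) (W w v) = \<beta> u v"
    and contravariant: "\<And>i u v. i \<in> {1..n} \<Longrightarrow> u \<in> M \<Longrightarrow> v \<in> M \<Longrightarrow> \<beta> (X i u) v = \<beta> u (Y i v)"
begin

lemma X_mem: "i \<in> {1..n} \<Longrightarrow> F \<in> M \<Longrightarrow> X i F \<in> M"
  and X_add: "i \<in> {1..n} \<Longrightarrow> F \<in> M \<Longrightarrow> G \<in> M \<Longrightarrow> X i (F + G) = X i F + X i G"
  and X_scale: "i \<in> {1..n} \<Longrightarrow> F \<in> M \<Longrightarrow> X i (scale a F) = scale a (X i F)"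
  and Y_mem: "i \<in> {1..n} \<Longrightarrow> F \<in> M \<Longrightarrow> Y i F \<in> M"
  and Y_add: "i \<in> {1..n} \<Longrightarrow> F \<in> M \<Longrightarrow> G \<in> M \<Longrightarrow> Y i (F + G) = Y i F + Y i G"
  and Y_scale: "i \<in> {1..n} \<Longrightarrow> F \<in> M \<Longrightarrow> Y i (scale a F) = scale a (Y i F)"
  and W_mem: "u \<in> perms n \<Longrightarrow> F \<in> M \<Longrightarrow> W u F \<in> M"
  and W_add: "u \<in> perms n \<Longrightarrow> F \<in> M \<Longrightarrow> G \<in> M \<Longrightarrow> W u (F + G) = W u F + W u G"
  and W_scale: "u \<in> perms n \<Longrightarrow> F \<in> M \<Longrightarrow> W u (scale a F) = scale a (W u F)"
proof -
  have l: "i \<in> {1..n} \<Longrightarrow> linear_on_space scale M (X i)" "i \<in> {1..n} \<Longrightarrow> linear_on_space scale M (Y i)"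
    "u \<in> perms n \<Longrightarrow> linear_on_space scale M (W u)"
    using ch[unfolded cherednik_module_def, THEN conjunct2, THEN conjunct2, THEN conjunct1]
      ch[unfolded cherednik_module_def, THEN conjunct2, THEN conjunct1] by blast+
  show "i \<in> {1..n} \<Longrightarrow> F \<in> M \<Longrightarrow> X i F \<in> M"
    "i \<in> {1..n} \<Longrightarrow> F \<in> M \<Longrightarrow> G \<in> M \<Longrightarrow> X i (F + G) = X i F + X i G"
    "i \<in> {1..n} \<Longrightarrow> F \<in> M \<Longrightarrow> X i (scale a F) = scale a (X i F)"
    using l(1) unfolding linear_on_space_def by blast+
  show "i \<in> {1..n} \<Longrightarrow> F \<in> M \<Longrightarrow> Y i F \<in> M"
    "i \<in> {1..n} \<Longrightarrow> F \<in> M \<Longrightarrow> G \<in> M \<Longrightarrow> Y i (F + G) = Y i F + Y i G"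
    "i \<in> {1..n} \<Longrightarrow> F \<in> M \<Longrightarrow> Y i (scale a F) = scale a (Y i F)"
    using l(2) unfolding linear_on_space_def by blast+
  show "u \<in> perms n \<Longrightarrow> F \<in> M \<Longrightarrow> W u F \<in> M"
    "u \<in> perms n \<Longrightarrow> F \<in> M \<Longrightarrow> G \<in> M \<Longrightarrow> W u (F + G) = W u F + W u G"
    "u \<in> perms n \<Longrightarrow> F \<in> M \<Longrightarrow> W u (scale a F) = scale a (W u F)"
    using l(3) unfolding linear_on_space_def by blast+
qed

lemma W_id: "F \<in> M \<Longrightarrow> W id F = F"
  and W_comp: "u \<in> perms n \<Longrightarrow> w \<in> perms n \<Longrightarrow> F \<in> M \<Longrightarrow> W (u \<circ> w) F = W u (W w F)"
  and X_comm: "i \<in> {1..n} \<Longrightarrow> j \<in> {1..n} \<Longrightarrow> F \<in> M \<Longrightarrow> X i (X j F) = X j (X i F)"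
  and W_X: "u \<in> perms n \<Longrightarrow> i \<in> {1..n} \<Longrightarrow> F \<in> M \<Longrightarrow> W u (X i F) = X (u i) (W u F)"
  and W_Y: "u \<in> perms n \<Longrightarrow> i \<in> {1..n} \<Longrightarrow> F \<in> M \<Longrightarrow> W u (Y i F) = Y (u i) (W u F)"
  using ch[unfolded cherednik_module_def, THEN conjunct2, THEN conjunct2, THEN conjunct2] by blast+

lemma Y_X:
  assumes "i \<in> {1..n}" "j \<in> {1..n}" "i \<noteq> j" "F \<in> M"
  shows "Y i (X j F) = X j (Y i F) + scale (of_real c) (W (transp i j) F)"
proof -
  have "Y i (X j F) - X j (Y i F) = scale (of_real c) (W (transp i j) F)"
    using ch assms unfolding cherednik_module_def by blast
  then show ?thesis by (metis add.commute diff_add_cancel)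
qed

definition psum :: "nat \<Rightarrow> nat set \<Rightarrow> 'v \<Rightarrow> 'v" where
  "psum j K F = (\<Sum>k\<in>K. W (transp j k) F)"

lemma Y_X_self:
  assumes "i \<in> {1..n}" "F \<in> M"
  shows "Y i (X i F) = X i (Y i F) + (F - scale (of_real c) (psum i ({1..n} - {i}) F))"
proof -
  have "Y i (X i F) - X i (Y i F) = F - scale (of_real c) (psum i ({1..n} - {i}) F)"
    using ch assms unfolding cherednik_module_def psum_def by blast
  then show ?thesis by (metis add.commute diff_add_cancel)
qed

lemma transp_mem: "i \<in> {1..n} \<Longrightarrow> j \<in> {1..n} \<Longrightarrow> transp i j \<in> perms n"
  by (simp add: permutes_swap_id)

lemma simple_mem: "i \<in> {1..<n} \<Longrightarrow> transp i (Suc i) \<in> perms n"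
  by (rule transp_mem) auto

lemma perms_mem: "u \<in> perms n \<Longrightarrow> i \<in> {1..n} \<Longrightarrow> u i \<in> {1..n}"
  using permutes_in_image[of u "{1..n}" i] by blast

lemma perms_inj: "u \<in> perms n \<Longrightarrow> inj u"
  using permutes_inj[of u] by blast

lemma psum_mem: "j \<in> {1..n} \<Longrightarrow> K \<subseteq> {1..n} \<Longrightarrow> F \<in> M \<Longrightarrow> psum j K F \<in> M"
  unfolding psum_def by (intro subspace_sum[OF sub] W_mem transp_mem) blast+

lemma W_sum:
  assumes "u \<in> perms n" "\<And>i. i \<in> I \<Longrightarrow> f i \<in> M"
  shows "W u (\<Sum>i\<in>I. f i) = (\<Sum>i\<in>I. W u (f i))"
  using assms(2)
proof (induction I rule: infinite_finite_induct)
  case (insert i I)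
  then have "f i \<in> M" "sum f I \<in> M" by (auto intro: subspace_sum[OF sub])
  then show ?case using insert W_add[OF assms(1)] by simp
qed (use W_scale[OF assms(1) subspace_0[OF sub], of 0] in simp_all)

lemma W_psum:
  assumes u: "u \<in> perms n" and j: "j \<in> {1..n}" and K: "K \<subseteq> {1..n}" and F: "F \<in> M"
  shows "W u (psum j K F) = psum (u j) (u ` K) (W u F)"
proof -
  have "W u (psum j K F) = (\<Sum>k\<in>K. W u (W (transp j k) F))"
    unfolding psum_def by (rule W_sum[OF u]) (use j K F in \<open>intro W_mem transp_mem, auto\<close>)
  also have "\<dots> = (\<Sum>k\<in>K. W (transp (u j) (u k)) (W u F))"
  proof (rule sum.cong[OF refl])
    fix k assume "k \<in> K"
    then have k: "k \<in> {1..n}" using K by blast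
    have "u \<circ> transp j k = transp (u j) (u k) \<circ> u"
      using perms_inj[OF u] by (auto simp: fun_eq_iff Transposition.transpose_def inj_eq)
    then show "W u (W (transp j k) F) = W (transp (u j) (u k)) (W u F)"
      using W_comp[OF u transp_mem[OF j k] F] W_comp[OF transp_mem[OF perms_mem[OF u j] perms_mem[OF u k]] u F] by simp
  qed
  also have "\<dots> = psum (u j) (u ` K) (W u F)"
    unfolding psum_def by (subst sum.reindex) (auto intro: inj_on_subset[OF perms_inj[OF u]])
  finally show ?thesis .
qed

lemma psum_insert: "finite K \<Longrightarrow> k \<notin> K \<Longrightarrow> psum j (insert k K) F = W (transp j k) F + psum j K F"
  by (simp add: psum_def)

text \<open>Cherednik's commuting operators. Their joint spectrum is simple because \<open>c\<close> is irrational.\<close>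

definition zop :: "nat \<Rightarrow> 'v \<Rightarrow> 'v" where
  "zop i F = X i (Y i F) + F + scale (- of_real c) (psum i {1..<i} F)"

lemma ltn: "i \<in> {1..n} \<Longrightarrow> {1..<i} \<subseteq> {1..n}" by auto

lemmas mem_intros = subspace_add[OF sub] subspace_scale[OF sub] X_mem Y_mem W_mem psum_mem ltn

lemma zop_mem: "i \<in> {1..n} \<Longrightarrow> F \<in> M \<Longrightarrow> zop i F \<in> M"
  unfolding zop_def by (intro mem_intros)

lemma W_zop:
  assumes u: "u \<in> perms n" and i: "i \<in> {1..n}" and F: "F \<in> M"
  shows "W u (zop i F) = X (u i) (Y (u i) (W u F)) + W u F + scale (- of_real c) (psum (u i) (u ` {1..<i}) (W u F))"
proof -
  have m: "X i (Y i F) \<in> M" "psum i {1..<i} F \<in> M" "X i (Y i F) + F \<in> M" "scale (- of_real c) (psum i {1..<i} F) \<in> M"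
    by (intro mem_intros i F)+
  show ?thesis
    unfolding zop_def W_add[OF u m(3,4)] W_add[OF u m(1) F] W_scale[OF u m(2)] W_psum[OF u i ltn[OF i] F]
      W_X[OF u i Y_mem[OF i F]] W_Y[OF u i F] ..
qed

lemma zop_commute:
  assumes i: "i \<in> {1..<n}" and j: "j \<in> {1..n}" "j \<noteq> i" "j \<noteq> Suc i" and F: "F \<in> M"
  shows "zop j (W (transp i (Suc i)) F) = W (transp i (Suc i)) (zop j F)"
proof -
  let ?s = "transp i (Suc i)"
  have "?s ` {1..<j} = {1..<j}"
  proof -
    have "?s ` {1..<j} \<subseteq> {1..<j}" using i j by (auto simp: Transposition.transpose_def)
    then show ?thesis by (rule endo_inj_surj[OF finite_atLeastLessThan _ inj_on_subset[OF perms_inj[OF simple_mem[OF i]] subset_UNIV]])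
  qed
  moreover have "?s j = j" using j by simp
  moreover note simple_mem[OF i]
  ultimately show ?thesis using W_zop[of ?s j F] j F by (simp add: zop_def)
qed

text \<open>The cross relation of the degenerate affine Hecke algebra. The partial sum for i + 1
  contains one transposition more than the image of the partial sum for i, and that transposition
  undoes the simple one.\<close>

lemma zop_exchange:
  assumes i: "i \<in> {1..<n}" and F: "F \<in> M"
  shows "W (transp i (Suc i)) (zop i F) = zop (Suc i) (W (transp i (Suc i)) F) + scale (of_real c) F"
proof -
  let ?s = "transp i (Suc i)" and ?c = "complex_of_real c"
  have s: "?s \<in> perms n" by (rule simple_mem[OF i])
  have i': "i \<in> {1..n}" using i by auto
  have im: "?s ` {1..<i} = {1..<i}" by (rule image_cong[of _ _ _ id, simplified]) (auto simp: Transposition.transpose_def)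
  have e: "{1..<Suc i} = insert i {1..<i}" using i by auto
  have "W ?s (W ?s F) = W (?s \<circ> ?s) F" by (rule W_comp[OF s s F, symmetric])
  then have id: "W (transp (Suc i) i) (W ?s F) = F"
    by (simp add: Transposition.transpose_commute[of "Suc i"] W_id[OF F, unfolded id_def] W_id[OF F])
  have "psum (Suc i) {1..<Suc i} (W ?s F) = F + psum (Suc i) {1..<i} (W ?s F)"
    unfolding e by (subst psum_insert) (simp_all add: id)
  then have z: "zop (Suc i) (W ?s F) = X (Suc i) (Y (Suc i) (W ?s F)) + W ?s F +
      (scale (- ?c) F + scale (- ?c) (psum (Suc i) {1..<i} (W ?s F)))"
    unfolding zop_def by (simp only: scale_right_distrib)
  show ?thesis
    unfolding z W_zop[OF s i' F] im transpose_apply_first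
    by (simp add: scale_minus_left algebra_simps)
qed

lemma zop_exchange':
  assumes i: "i \<in> {1..<n}" and F: "F \<in> M"
  shows "zop i (W (transp i (Suc i)) F) = W (transp i (Suc i)) (zop (Suc i) F) + scale (of_real c) F"
proof -
  let ?s = "transp i (Suc i)" and ?c = "complex_of_real c"
  have s: "?s \<in> perms n" by (rule simple_mem[OF i])
  have i': "i \<in> {1..n}" "Suc i \<in> {1..n}" using i by auto
  have inv: "W ?s (W ?s G) = G" if "G \<in> M" for G
    using W_comp[OF s s that] W_id[OF that] by simp
  have zM: "zop (Suc i) F \<in> M" "scale ?c (W ?s F) \<in> M" "zop i (W ?s F) \<in> M"
    by (intro mem_intros zop_mem i' s F)+
  have "zop i (W ?s F) = W ?s (W ?s (zop i (W ?s F)))" using inv zM by simp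
  also have "W ?s (zop i (W ?s F)) = zop (Suc i) F + scale ?c (W ?s F)"
    using zop_exchange[OF i W_mem[OF s F]] inv[OF F] by simp
  also have "W ?s \<dots> = W ?s (zop (Suc i) F) + scale ?c F"
    using W_add[OF s zM(1,2)] W_scale[OF s W_mem[OF s F]] inv[OF F] by simp
  finally show ?thesis .
qed

lemma W_self_adjoint:
  assumes "i \<in> {1..n}" "j \<in> {1..n}" "F \<in> M" "G \<in> M"
  shows "\<beta> (W (transp i j) F) G = \<beta> F (W (transp i j) G)"
proof -
  have t: "transp i j \<in> perms n" by (rule transp_mem[OF assms(1,2)])
  have "W (transp i j) (W (transp i j) G) = G" using W_comp[OF t t assms(4)] W_id[OF assms(4)] by simp
  then show ?thesis using invariant[OF t assms(3) W_mem[OF t assms(4)]] by simp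
qed

lemma psum_self_adjoint:
  assumes "j \<in> {1..n}" "K \<subseteq> {1..n}" "F \<in> M" "G \<in> M"
  shows "\<beta> (psum j K F) G = \<beta> F (psum j K G)"
proof -
  have K: "finite K" "\<And>k. k \<in> K \<Longrightarrow> k \<in> {1..n}" using assms(2) finite_subset by blast+
  have mem: "H \<in> M \<Longrightarrow> k \<in> K \<Longrightarrow> W (transp j k) H \<in> M" for H k by (intro W_mem transp_mem assms K)
  show ?thesis
    using sum_left[of K "\<lambda>k. W (transp j k) F" G "\<lambda>_. 1"] sum_right[of K "\<lambda>k. W (transp j k) G" F "\<lambda>_. 1"]
      assms K mem by (simp add: psum_def W_self_adjoint)
qed

lemma zop_self_adjoint:
  assumes i: "i \<in> {1..n}" and F: "F \<in> M" and G: "G \<in> M"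
  shows "\<beta> (zop i F) G = \<beta> F (zop i G)"
proof -
  note m = mem_intros i F G
  have "\<beta> (X i (Y i F)) G = cnj (\<beta> (Y i G) (Y i F))"
    using contravariant[of i "Y i F" G] conj_sym[of "Y i F" "Y i G"] Y_mem i F G by simp
  also have "\<dots> = cnj (\<beta> (X i (Y i G)) F)" using contravariant[of i "Y i G" F] Y_mem i F G by simp
  also have "\<dots> = \<beta> F (X i (Y i G))" using conj_sym[of F "X i (Y i G)"] X_mem Y_mem i F G by simp
  finally have 1: "\<beta> (X i (Y i F)) G = \<beta> F (X i (Y i G))" .
  have 2: "\<beta> (zop i F) G = \<beta> (X i (Y i F)) G + \<beta> F G - of_real c * \<beta> (psum i {1..<i} F) G"
    unfolding zop_def by (subst add_left, (intro m)+, subst add_left, (intro m)+, subst scale_left, (intro m)+, simp)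
  have 3: "\<beta> F (zop i G) = \<beta> F (X i (Y i G)) + \<beta> F G - of_real c * \<beta> F (psum i {1..<i} G)"
    unfolding zop_def by (subst add_right, (intro m)+, subst add_right, (intro m)+, subst scale_right, (intro m)+, simp)
  show ?thesis unfolding 2 3 1 psum_self_adjoint[OF i ltn[OF i] F G] ..
qed

lemma zop_add: "i \<in> {1..n} \<Longrightarrow> F \<in> M \<Longrightarrow> G \<in> M \<Longrightarrow> zop i (F + G) = zop i F + zop i G"
proof -
  assume i: "i \<in> {1..n}" and F: "F \<in> M" and G: "G \<in> M"
  have "psum i {1..<i} (F + G) = psum i {1..<i} F + psum i {1..<i} G"
    unfolding psum_def sum.distrib[symmetric]
    by (rule sum.cong[OF refl], rule W_add[OF transp_mem[OF i] F G]) (use i in auto)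
  then show ?thesis unfolding zop_def Y_add[OF i F G] X_add[OF i Y_mem[OF i F] Y_mem[OF i G]]
    by (simp add: scale_right_distrib algebra_simps)
qed

lemma zop_scale: "i \<in> {1..n} \<Longrightarrow> F \<in> M \<Longrightarrow> zop i (scale a F) = scale a (zop i F)"
proof -
  assume i: "i \<in> {1..n}" and F: "F \<in> M"
  have "psum i {1..<i} (scale a F) = scale a (psum i {1..<i} F)"
    unfolding psum_def scale_sum_right
    by (rule sum.cong[OF refl], rule W_scale[OF transp_mem[OF i] F]) (use i in auto)
  then show ?thesis unfolding zop_def Y_scale[OF i F] X_scale[OF i Y_mem[OF i F]]
    by (simp add: scale_right_distrib scale_right_diff_distrib mult.commute)
qed

text \<open>The affine intertwiner \<open>x\<^sub>1 \<pi>\<close>, with \<open>\<pi>\<close> the long cycle, rotates the weights and raises the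
  degree by one.\<close>

definition cyc :: "nat \<Rightarrow> nat" where
  "cyc i = (if i = n then 1 else if i \<in> {1..n} then Suc i else i)"

lemma cyc_perms: "cyc \<in> perms n"
proof -
  have "cyc ` {1..n} \<subseteq> {1..n}" using n_pos by (auto simp: cyc_def)
  moreover have "inj_on cyc {1..n}" by (auto simp: inj_on_def cyc_def split: if_splits)
  ultimately have "bij_betw cyc {1..n} {1..n}" by (simp add: bij_betw_def endo_inj_surj)
  then have "cyc permutes {1..n}"
  proof (rule bij_imp_permutes)
    fix x assume "x \<notin> {1..n}"
    then show "cyc x = x" using n_pos by (auto simp: cyc_def)
  qed
  then show ?thesis by simp
qed

definition shift_op :: "'v \<Rightarrow> 'v" where "shift_op F = X 1 (W cyc F)"

lemma one_n: "1 \<in> {1..n}" "n \<in> {1..n}" using n_pos by auto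

lemma shift_op_mem: "F \<in> M \<Longrightarrow> shift_op F \<in> M"
  unfolding shift_op_def by (intro X_mem W_mem cyc_perms one_n)

text \<open>For the last index the partial sum is the complete one, so the defining relation turns
  x_n y_n plus corrections into y_n x_n. This makes the norm of the shifted vector the eigenvalue of
  \<open>zop n\<close> times the old norm.\<close>

lemma zop_last: "F \<in> M \<Longrightarrow> zop n F = Y n (X n F)"
proof -
  assume F: "F \<in> M"
  have "{1..n} - {n} = {1..<n}" by auto
  then show ?thesis using Y_X_self[OF one_n(2) F] by (simp add: zop_def algebra_simps)
qed

lemma W_zop_last: "F \<in> M \<Longrightarrow> W cyc (zop n F) = Y 1 (shift_op F)"
  using W_Y[OF cyc_perms one_n(2) X_mem[OF one_n(2)], of F] W_X[OF cyc_perms one_n(2), of F]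
  by (simp add: zop_last shift_op_def cyc_def)

lemma shift_op_first:
  assumes F: "F \<in> M"
  shows "zop 1 (shift_op F) = shift_op (zop n F) + shift_op F"
  unfolding shift_op_def[of "zop n F"] W_zop_last[OF F] by (simp add: zop_def psum_def)

lemma shift_op_norm:
  assumes F: "F \<in> M"
  shows "\<beta> (shift_op F) (shift_op F) = \<beta> F (zop n F)"
proof -
  have "\<beta> (shift_op F) (shift_op F) = \<beta> (W cyc F) (Y 1 (shift_op F))"
    unfolding shift_op_def[of F] by (rule contravariant) (intro one_n W_mem cyc_perms F X_mem)+
  also have "\<dots> = \<beta> F (zop n F)"
    unfolding W_zop_last[OF F, symmetric] by (rule invariant[OF cyc_perms F zop_mem[OF one_n(2) F]])
  finally show ?thesis .
qed

text \<open>Moving y_(j+1) past x_1 creates the transposition of j + 1 and 1. It cancels the one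
  term of the partial sum for j + 1 that the long cycle does not produce from the partial sum for
  j.\<close>

lemma shift_op_Suc:
  assumes j: "j \<in> {1..<n}" and F: "F \<in> M"
  shows "zop (Suc j) (shift_op F) = shift_op (zop j F)"
proof -
  let ?G = "W cyc F" and ?c = "complex_of_real c"
  have j': "j \<in> {1..n}" "Suc j \<in> {1..n}" and nj: "Suc j \<noteq> 1" using j by auto
  note 1 = one_n(1)
  have G: "?G \<in> M" by (rule W_mem[OF cyc_perms F])
  have cj: "cyc j = Suc j" using j by (auto simp: cyc_def)
  have im: "cyc ` {1..<j} = {2..<Suc j}"
  proof -
    have "cyc ` {1..<j} = Suc ` {1..<j}" by (rule image_cong) (use j in \<open>auto simp: cyc_def\<close>)
    then show ?thesis by (simp add: image_Suc_atLeastLessThan numeral_2_eq_2)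
  qed
  have sub2: "{2..<Suc j} \<subseteq> {1..n}" using j by auto
  have e: "{1..<Suc j} = insert 1 {2..<Suc j}" using j by auto
  define T where "T = W (transp (Suc j) 1) ?G"
  have T: "T \<in> M" unfolding T_def by (rule W_mem[OF transp_mem[OF j'(2) 1] G])
  have wt: "W (transp (Suc j) 1) (X 1 ?G) = X (Suc j) T"
    unfolding T_def using W_X[OF transp_mem[OF j'(2) 1] 1 G] by simp
  have ps: "psum (Suc j) {2..<Suc j} (X 1 ?G) = X 1 (psum (Suc j) {2..<Suc j} ?G)"
  proof -
    have "X 1 (psum (Suc j) {2..<Suc j} ?G) = (\<Sum>k\<in>{2..<Suc j}. X 1 (W (transp (Suc j) k) ?G))"
    proof -
      have "X 1 (\<Sum>k\<in>K. W (transp (Suc j) k) ?G) = (\<Sum>k\<in>K. X 1 (W (transp (Suc j) k) ?G))" if "finite K" "K \<subseteq> {1..n}" for K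
        using that
      proof (induction K rule: finite_induct)
        case (insert k K)
        then show ?case
          using X_add[OF 1 W_mem[OF transp_mem[OF j'(2)] G, of k] psum_mem[OF j'(2) _ G, of K, unfolded psum_def]] by simp
      qed (use X_scale[OF 1 subspace_0[OF sub], of 0] in simp)
      then show ?thesis unfolding psum_def using sub2 by blast
    qed
    also have "\<dots> = psum (Suc j) {2..<Suc j} (X 1 ?G)" unfolding psum_def
    proof (rule sum.cong[OF refl])
      fix k assume k: "k \<in> {2..<Suc j}"
      then have "k \<in> {1..n}" "transp (Suc j) k 1 = 1" using sub2 nj by (auto simp: Transposition.transpose_def)
      then show "X 1 (W (transp (Suc j) k) ?G) = W (transp (Suc j) k) (X 1 ?G)"
        using W_X[OF transp_mem[OF j'(2)] 1 G, of k] by simp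
    qed
    finally show ?thesis ..
  qed
  have yx: "X (Suc j) (Y (Suc j) (X 1 ?G)) = X 1 (X (Suc j) (Y (Suc j) ?G)) + scale ?c (X (Suc j) T)"
    unfolding Y_X[OF j'(2) 1 nj G] T_def[symmetric] X_comm[OF 1 j'(2) Y_mem[OF j'(2) G]]
      X_add[OF j'(2) X_mem[OF 1 Y_mem[OF j'(2) G]] subspace_scale[OF sub T]] X_scale[OF j'(2) T] ..
  have "psum (Suc j) {1..<Suc j} (X 1 ?G) = X (Suc j) T + X 1 (psum (Suc j) {2..<Suc j} ?G)"
    unfolding e wt[symmetric] ps[symmetric] by (rule psum_insert) auto
  then have "zop (Suc j) (X 1 ?G) =
      X 1 (X (Suc j) (Y (Suc j) ?G)) + X 1 ?G + scale (- ?c) (X 1 (psum (Suc j) {2..<Suc j} ?G))"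
    unfolding zop_def yx by (simp add: scale_right_distrib)
  also have "\<dots> = X 1 (X (Suc j) (Y (Suc j) ?G) + ?G + scale (- ?c) (psum (Suc j) {2..<Suc j} ?G))"
  proof -
    have m: "X (Suc j) (Y (Suc j) ?G) \<in> M" "psum (Suc j) {2..<Suc j} ?G \<in> M" "X (Suc j) (Y (Suc j) ?G) + ?G \<in> M"
       "scale (- ?c) (psum (Suc j) {2..<Suc j} ?G) \<in> M"
      by (intro mem_intros sub2 j' G)+
    show ?thesis unfolding X_add[OF 1 m(3,4)] X_add[OF 1 m(1) G] X_scale[OF 1 m(2)] ..
  qed
  also have "\<dots> = shift_op (zop j F)"
    unfolding shift_op_def W_zop[OF cyc_perms j'(1) F] cj im ..
  finally show ?thesis unfolding shift_op_def[of F] .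
qed

abbreviation zeta :: "nat \<times> int \<Rightarrow> real" where "zeta \<equiv> content_weight c"

definition weight :: "(nat \<times> int) list \<Rightarrow> 'v \<Rightarrow> bool" where
  "weight st F \<longleftrightarrow> length st = n \<and> F \<in> M \<and> (\<forall>i<n. zop (Suc i) F = scale (of_real (zeta (st ! i))) F)"

lemmas irrational_eq' = irrational_mult_eq'[OF irrational]

lemma zeta_inj: "zeta p = zeta q \<longleftrightarrow> p = q"
proof
  assume "zeta p = zeta q"
  then have "of_int (int (fst p) - int (fst q)) = c * of_int (snd p - snd q)"
    by (simp add: content_weight_def algebra_simps)
  then show "p = q" unfolding irrational_eq' by (simp add: prod_eq_iff)
qed simp

lemma weight_orth:
  assumes F: "weight st F" and G: "weight st' G" and ne: "st \<noteq> st'"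
  shows "\<beta> F G = 0"
proof -
  have "length st = length st'" using F G by (simp add: weight_def)
  then obtain i where i: "i < n" "st ! i \<noteq> st' ! i" using ne F nth_equalityI[of st st'] by (auto simp: weight_def)
  have FM: "F \<in> M" "G \<in> M" using F G by (auto simp: weight_def)
  have "of_real (zeta (st ! i)) * \<beta> F G = \<beta> (zop (Suc i) F) G"
    using F i FM by (simp add: weight_def scale_left)
  also have "\<dots> = \<beta> F (zop (Suc i) G)" using i FM by (intro zop_self_adjoint) auto
  also have "\<dots> = of_real (zeta (st' ! i)) * \<beta> F G"
    using G i FM by (simp add: weight_def scale_right)
  finally have "(of_real (zeta (st ! i)) - of_real (zeta (st' ! i))) * \<beta> F G = (0::complex)"
    by (simp add: left_diff_distrib)
  then show ?thesis using i zeta_inj[of "st ! i" "st' ! i"] by simp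
qed

lemma weight_shift:
  assumes F: "weight st F"
  shows "weight (rot st) (shift_op F)"
    "\<beta> (shift_op F) (shift_op F) = of_real (zeta (last st)) * \<beta> F F"
proof -
  have FM: "F \<in> M" and len: "length st = n" and ne: "st \<noteq> []" using F n_pos by (auto simp: weight_def)
  have zn: "zop n F = scale (of_real (zeta (last st))) F"
    using F n_pos ne len last_conv_nth[OF ne] by (auto simp: weight_def dest: spec[of _ "n - 1"])
  have shs: "shift_op (scale a F) = scale a (shift_op F)" for a
    unfolding shift_op_def W_scale[OF cyc_perms FM] X_scale[OF one_n(1) W_mem[OF cyc_perms FM]] ..
  show "weight (rot st) (shift_op F)"
    unfolding weight_def
  proof (intro conjI allI impI)
    show "length (rot st) = n" using len length_rot[OF ne] by simp
    show "shift_op F \<in> M" by (rule shift_op_mem[OF FM])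
    fix i assume i: "i < n"
    show "zop (Suc i) (shift_op F) = scale (of_real (zeta (rot st ! i))) (shift_op F)"
    proof (cases i)
      case 0
      have "zeta (rot st ! 0) = zeta (last st) + 1" by (simp add: rot_def content_weight_def)
      then show ?thesis using shift_op_first[OF FM] 0 by (simp add: zn shs scale_left_distrib)
    next
      case (Suc j)
      have "zop (Suc j) F = scale (of_real (zeta (st ! j))) F" using F i Suc by (simp add: weight_def)
      moreover have "rot st ! Suc j = st ! j" using i Suc len by (simp add: rot_def nth_butlast)
      ultimately show ?thesis using shift_op_Suc[of "Suc j" F] FM i Suc by (simp add: shs)
    qed
  qed
  show "\<beta> (shift_op F) (shift_op F) = of_real (zeta (last st)) * \<beta> F F"
    unfolding shift_op_norm[OF FM] zn using FM by (simp add: scale_right)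
qed

definition kappa :: "nat \<times> int \<Rightarrow> nat \<times> int \<Rightarrow> real" where
  "kappa p q = c / (zeta q - zeta p)"

definition intertwine :: "nat \<Rightarrow> real \<Rightarrow> 'v \<Rightarrow> 'v" where
  "intertwine i k F = W (transp i (Suc i)) F + scale (of_real k) F"

text \<open>The exchange relations leave multiples of \<open>F\<close> that cancel for precisely
  this value of \<open>kappa\<close>. For the norm: the new vector has another weight and is
  orthogonal to \<open>F\<close>, which gives the pairing of \<open>F\<close> with its image under
  the transposition, and the transposition itself is an isometry.\<close>

lemma weight_intertwine:
  assumes F: "weight (pre @ p # q # post) F" and pq: "p \<noteq> q"
  defines "G \<equiv> intertwine (Suc (length pre)) (kappa p q) F"
  shows "weight (pre @ q # p # post) G"
    "\<beta> G G = of_real (1 - (kappa p q)\<^sup>2) * \<beta> F F"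
proof -
  define i where "i = Suc (length pre)"
  let ?s = "W (transp i (Suc i))"
  have FM: "F \<in> M" and len: "length pre + length post + 2 = n" using F by (auto simp: weight_def)
  have i: "i \<in> {1..<n}" "i \<in> {1..n}" "Suc i \<in> {1..n}" using len by (auto simp: i_def)
  have sM: "?s F \<in> M" using i FM by (intro mem_intros transp_mem) auto
  have kM: "scale (of_real (kappa p q)) F \<in> M" by (rule subspace_scale[OF sub FM])
  have G: "G = ?s F + scale (of_real (kappa p q)) F" by (simp add: G_def intertwine_def i_def)
  have GM: "G \<in> M" unfolding G by (rule subspace_add[OF sub sM kM])
  have zi: "zop i F = scale (of_real (zeta p)) F" "zop (Suc i) F = scale (of_real (zeta q)) F"
    using F len by (auto simp: weight_def i_def nth_append dest: spec[of _ "length pre"] spec[of _ "Suc (length pre)"])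
  have k: "kappa p q * (zeta q - zeta p) = c" using zeta_inj[of q p] pq by (auto simp: kappa_def)
  have sc: "?s (scale a F) = scale a (?s F)" for a using i FM by (intro W_scale transp_mem) auto
  have zG: "zop j G = zop j (?s F) + scale (of_real (kappa p q)) (zop j F)" if "j \<in> {1..n}" for j
    unfolding G zop_add[OF that sM kM] zop_scale[OF that FM] ..
  have z1: "zop i G = scale (of_real (zeta q)) G"
  proof -
    have "zop i G = scale (of_real (zeta q)) (?s F) + scale (of_real (c + kappa p q * zeta p)) F"
      unfolding zG[OF i(2)] zop_exchange'[OF i(1) FM] zi sc by (simp add: scale_left_distrib)
    also have "c + kappa p q * zeta p = zeta q * kappa p q" using k by (simp add: algebra_simps)
    finally show ?thesis unfolding G by (simp add: scale_right_distrib)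
  qed
  have z2: "zop (Suc i) G = scale (of_real (zeta p)) G"
  proof -
    have "zop (Suc i) (?s F) = scale (of_real (zeta p)) (?s F) + scale (of_real (- c)) F"
      using zop_exchange[OF i(1) FM] unfolding zi sc by (simp add: eq_diff_eq[symmetric] scale_minus_left)
    then have "zop (Suc i) G = scale (of_real (zeta p)) (?s F) + scale (of_real (- c + kappa p q * zeta q)) F"
      unfolding zG[OF i(3)] zi by (simp add: scale_left_distrib scale_left_diff_distrib)
    also have "- c + kappa p q * zeta q = zeta p * kappa p q" using k by (simp add: algebra_simps)
    finally show ?thesis unfolding G by (simp add: scale_right_distrib)
  qed
  show w: "weight (pre @ q # p # post) G"
    unfolding weight_def
  proof (intro conjI allI impI GM)
    show "length (pre @ q # p # post) = n" using len by simp
    fix j assume j: "j < n"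
    consider "j = length pre" | "j = Suc (length pre)" | "j \<noteq> length pre" "j \<noteq> Suc (length pre)" by blast
    then show "zop (Suc j) G = scale (of_real (zeta ((pre @ q # p # post) ! j))) G"
    proof cases
      case 1
      then show ?thesis using z1 by (simp add: i_def)
    next
      case 2
      then show ?thesis using z2 by (simp add: i_def nth_append)
    next
      case 3
      have nth: "(pre @ q # p # post) ! j = (pre @ p # q # post) ! j"
        using 3 by (auto simp: nth_append nth_Cons' numeral_2_eq_2)
      have "zop (Suc j) F = scale (of_real (zeta ((pre @ p # q # post) ! j))) F" using F j by (simp add: weight_def)
      then show ?thesis using zG[of "Suc j"] zop_commute[OF i(1) _ _ _ FM, of "Suc j"] 3 j
        by (simp add: nth sc scale_right_distrib i_def[symmetric] mult.commute) (simp add: G scale_right_distrib i_def)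
    qed
  qed
  have ne: "pre @ q # p # post \<noteq> pre @ p # q # post" using pq by simp
  have o: "\<beta> G F = 0" by (rule weight_orth[OF w F ne])
  have sF: "\<beta> (?s F) F = - of_real (kappa p q) * \<beta> F F"
    using o unfolding G by (simp add: add_left[OF sM kM FM] scale_left[OF FM FM] eq_neg_iff_add_eq_0)
  have tM: "transp i (Suc i) \<in> perms n" by (rule transp_mem[OF i(2,3)])
  have "\<beta> G G = \<beta> G (?s F)"
    using o add_right[OF sM kM GM] scale_right[OF FM GM] by (simp flip: G)
  also have "\<dots> = \<beta> (?s F) (?s F) + of_real (kappa p q) * \<beta> F (?s F)"
    unfolding G by (simp add: add_left[OF sM kM sM] scale_left[OF FM sM])
  also have "\<dots> = \<beta> F F + of_real (kappa p q) * \<beta> (?s F) F"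
    using invariant[OF tM FM FM] W_self_adjoint[OF i(2,3) FM FM] by simp
  finally show "\<beta> G G = of_real (1 - (kappa p q)\<^sup>2) * \<beta> F F"
    unfolding sF by (simp add: algebra_simps power2_eq_square)
qed

end

section \<open>Signs of the norms along paths of intertwiners\<close>

definition sg :: "real \<Rightarrow> int" where
  "sg r = (if r > 0 then 1 else if r < 0 then - 1 else 0)"

lemma sg_mult: "sg (a * b) = sg a * sg b"
  by (auto simp: sg_def zero_less_mult_iff mult_less_0_iff)

lemma sg_eq_0 [simp]: "sg r = 0 \<longleftrightarrow> r = 0"
  by (auto simp: sg_def)

lemma sum_sg:
  assumes "finite I"
  shows "(\<Sum>i\<in>I. sg (f i)) = int (card {i\<in>I. f i > 0}) - int (card {i\<in>I. f i < 0})"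
proof -
  have "(\<Sum>i\<in>I. sg (f i)) = (\<Sum>i\<in>I. (if f i > 0 then 1 else 0) - (if f i < 0 then 1 else 0))"
    by (intro sum.cong) (auto simp: sg_def)
  then show ?thesis using assms by (simp add: sum_subtractf sum.If_cases Int_def conj_commute)
qed

text \<open>The sign of the norm factor \<open>1 - \<kappa>\<^sup>2\<close> of the intertwiner that moves an entry of level \<open>m + 1\<close>
  past an entry of level \<open>0\<close>; \<open>d\<close> is the difference of their contents.\<close>

definition pass_sign :: "real \<Rightarrow> nat \<Rightarrow> int \<Rightarrow> int" where
  "pass_sign c m d = sg (1 - (c / (real m + 1 - c * of_int d))\<^sup>2)"

definition move_sign :: "real \<Rightarrow> int list \<Rightarrow> nat \<times> int \<Rightarrow> int" where
  "move_sign c pre p = sg (content_weight c p) * (\<Prod>l\<leftarrow>pre. pass_sign c (fst p) (snd p - l))"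

text \<open>The weight reached from the contents \<open>xs\<close> in degree zero by applying, for \<open>j = n, \<dots>, 1\<close>,
  the operator \<open>\<sigma>\<^sub>j\<^sub>-\<^sub>1 \<dots> \<sigma>\<^sub>1 \<Phi>\<close>, as often as the second list tells; it rotates the
  entries from \<open>j\<close> on and fixes the first \<open>j - 1\<close> ones.\<close>

fun state_of :: "int list \<Rightarrow> nat list \<Rightarrow> (nat \<times> int) list" where
  "state_of (x # xs) (a # as) = (rot ^^ a) ((0, x) # state_of xs as)"
| "state_of _ _ = []"

text \<open>The signs of the norm factors met on the way to \<open>state_of\<close>. In a stage the
  entries \<open>pre\<close> stay in place at level 0, and each rotated entry is carried back past
  all of them.\<close>

fun path_sign :: "real \<Rightarrow> int list \<Rightarrow> int list \<Rightarrow> nat list \<Rightarrow> int" where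
  "path_sign c pre (x # xs) (a # as) =
     (\<Prod>m<a. move_sign c pre (last ((rot ^^ m) ((0, x) # state_of xs as)))) * path_sign c (pre @ [x]) xs as"
| "path_sign c pre _ _ = 1"

lemma rot_pow: "st \<noteq> [] \<Longrightarrow> (rot ^^ k) st \<noteq> [] \<and> length ((rot ^^ k) st) = length st"
proof (induction k)
  case (Suc k)
  then show ?case using length_rot[of "(rot ^^ k) st"] by (simp add: rot_def)
qed simp

lemma length_state_of: "length as = length xs \<Longrightarrow> length (state_of xs as) = length xs"
  by (induction xs as rule: state_of.induct) (simp_all add: rot_pow)

lemma rot_inj: "st \<noteq> [] \<Longrightarrow> st' \<noteq> [] \<Longrightarrow> rot st = rot st' \<Longrightarrow> st = st'"
proof -
  assume ne: "st \<noteq> []" "st' \<noteq> []" and "rot st = rot st'"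
  then have "last st = last st'" "butlast st = butlast st'" by (auto simp: rot_def prod_eq_iff)
  then show "st = st'" using append_butlast_last_id ne by metis
qed

lemma rot_pow_inj: "st \<noteq> [] \<Longrightarrow> st' \<noteq> [] \<Longrightarrow> (rot ^^ k) st = (rot ^^ k) st' \<Longrightarrow> st = st'"
  by (induction k) (use rot_inj rot_pow in auto)

text \<open>A rotated weight starts with a positive level. So the number of rotations applied since
  an entry of level 0 stood at the head can be recovered.\<close>

lemma rot_pow_le:
  assumes "(rot ^^ a) ((0, x) # L) = (rot ^^ b) ((0, y) # L')" "a \<le> b"
  shows "a = b"
proof (rule ccontr)
  assume "a \<noteq> b"
  then obtain k where k: "b = a + Suc k" using assms(2) by (metis add_Suc_right le_neq_implies_less less_imp_Suc_add)
  have "(rot ^^ b) ((0, y) # L') = (rot ^^ a) ((rot ^^ Suc k) ((0, y) # L'))" unfolding k funpow_add by simp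
  then have "(0, x) # L = (rot ^^ Suc k) ((0, y) # L')"
    using assms(1) rot_pow_inj[of "(0, x) # L" "(rot ^^ Suc k) ((0, y) # L')" a] rot_pow[of "(0, y) # L'" "Suc k"] by simp
  then show False by (simp add: rot_def)
qed

lemma rot_pow_eq:
  assumes "(rot ^^ a) ((0, x) # L) = (rot ^^ b) ((0, y) # L')"
  shows "a = b \<and> x = y \<and> L = L'"
proof -
  have "a = b" using rot_pow_le[OF assms] rot_pow_le[OF assms[symmetric]] by linarith
  then show ?thesis using rot_pow_inj[of "(0, x) # L" "(0, y) # L'" b] assms by simp
qed

lemma state_of_inj:
  "length as = length xs \<Longrightarrow> length bs = length ys \<Longrightarrow> length xs = length ys \<Longrightarrow>
   state_of xs as = state_of ys bs \<Longrightarrow> xs = ys \<and> as = bs"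
proof (induction xs as arbitrary: ys bs rule: state_of.induct)
  case (1 x xs a as)
  then obtain y ys' b bs' where ys: "ys = y # ys'" "bs = b # bs'" by (cases ys; cases bs) auto
  with 1 rot_pow_eq[of a x "state_of xs as" b y "state_of ys' bs'"] show ?case by auto
qed auto

lemma content_weight_nonzero:
  assumes "c \<notin> \<rat>"
  shows "content_weight c p \<noteq> 0"
proof
  assume "content_weight c p = 0"
  then have "real (Suc (fst p)) = c * of_int (snd p)" by (simp add: content_weight_def)
  then show False unfolding irrational_mult_eq[OF assms] by simp
qed

lemma pass_sign_nonzero:
  assumes "c \<notin> \<rat>"
  shows "pass_sign c m d \<noteq> 0"
proof
  assume "pass_sign c m d = 0"
  then have "(c / (real m + 1 - c * of_int d))\<^sup>2 = 1" by (simp add: pass_sign_def)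
  then have "c / (real m + 1 - c * of_int d) = 1 \<or> c / (real m + 1 - c * of_int d) = - 1"
    by (simp add: power2_eq_1_iff)
  then have "real (Suc m) = c * of_int (d + 1) \<or> real (Suc m) = c * of_int (d - 1)"
    by (auto simp: divide_eq_eq algebra_simps split: if_splits)
  then show False unfolding irrational_mult_eq[OF assms] by simp
qed

lemma move_sign_nonzero: "c \<notin> \<rat> \<Longrightarrow> move_sign c pre p \<noteq> 0"
  using content_weight_nonzero pass_sign_nonzero by (auto simp: move_sign_def prod_list_zero_iff)

locale graded_contravariant = contravariant_module +
  fixes D :: "nat \<Rightarrow> 'a set" and C :: "int list set" and e :: "int list \<Rightarrow> 'a"
  assumes D_sub: "\<And>d. subspace (D d)" and D_M: "\<And>d. D d \<subseteq> M"
    and X_D: "\<And>i d F. i \<in> {1..n} \<Longrightarrow> F \<in> D d \<Longrightarrow> X i F \<in> D (Suc d)"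
    and W_D: "\<And>w d F. w \<in> perms n \<Longrightarrow> F \<in> D d \<Longrightarrow> W w F \<in> D d"
    and finite_C: "finite C"
    and e_D: "\<And>cs. cs \<in> C \<Longrightarrow> e cs \<in> D 0" and e_weight: "\<And>cs. cs \<in> C \<Longrightarrow> weight (map (Pair 0) cs) (e cs)"
    and e_pos: "\<And>cs. cs \<in> C \<Longrightarrow> Re (\<beta> (e cs) (e cs)) > 0"
begin

text \<open>Of a vector only the weight and the sign of its norm are recorded; positive factors are
  dropped from here on.\<close>

definition reach :: "(nat \<times> int) list \<Rightarrow> nat \<Rightarrow> int \<Rightarrow> bool" where
  "reach st d s \<longleftrightarrow> (\<exists>F\<in>D d. weight st F \<and> sg (Re (\<beta> F F)) = s)"

lemma pass_sign_kappa: "sg (1 - (kappa (Suc m, y) (0, l))\<^sup>2) = pass_sign c m (y - l)"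
proof -
  have "zeta (0, l) - zeta (Suc m, y) = - (real m + 1 - c * of_int (y - l))"
    by (simp add: content_weight_def algebra_simps)
  then show ?thesis unfolding pass_sign_def kappa_def by (simp only: divide_minus_right power2_minus)
qed

lemma reach_pass:
  "reach (pre @ (Suc m, y) # map (Pair 0) ls @ post) d s \<Longrightarrow>
   reach (pre @ map (Pair 0) ls @ (Suc m, y) # post) d (s * (\<Prod>l\<leftarrow>ls. pass_sign c m (y - l)))"
proof (induction ls arbitrary: pre s)
  case (Cons l ls)
  obtain F where F: "F \<in> D d" "weight (pre @ (Suc m, y) # (0, l) # map (Pair 0) ls @ post) F" "sg (Re (\<beta> F F)) = s"
    using Cons.prems by (auto simp: reach_def)
  have ne: "(Suc m, y) \<noteq> (0, l)" by simp
  have i: "Suc (length pre) \<in> {1..<n}" using F(2) by (simp add: weight_def)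
  let ?G = "intertwine (Suc (length pre)) (kappa (Suc m, y) (0, l)) F"
  note G = weight_intertwine[OF F(2) ne]
  have "?G \<in> D d" unfolding intertwine_def
    by (intro subspace_add[OF D_sub] subspace_scale[OF D_sub] W_D simple_mem[OF i] F(1))
  moreover have "sg (Re (\<beta> ?G ?G)) = s * pass_sign c m (y - l)"
    unfolding G(2) using F(3) by (simp add: sg_mult pass_sign_kappa[symmetric] mult.commute)
  ultimately have "reach ((pre @ [(0, l)]) @ (Suc m, y) # map (Pair 0) ls @ post) d (s * pass_sign c m (y - l))"
    using G(1) by (auto simp: reach_def)
  from Cons.IH[OF this] show ?case by (simp add: mult.assoc)
qed simp

lemma reach_rot:
  assumes r: "reach (map (Pair 0) pre @ xs) d s" and xs: "xs \<noteq> []"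
  shows "reach (map (Pair 0) pre @ rot xs) (Suc d) (s * move_sign c pre (last xs))"
proof -
  obtain F where F: "F \<in> D d" "weight (map (Pair 0) pre @ xs) F" "sg (Re (\<beta> F F)) = s"
    using r by (auto simp: reach_def)
  obtain m y where l: "last xs = (m, y)" by (cases "last xs")
  note G = weight_shift[OF F(2)]
  have "shift_op F \<in> D (Suc d)" unfolding shift_op_def by (intro X_D W_D one_n cyc_perms F(1))
  moreover have "sg (Re (\<beta> (shift_op F) (shift_op F))) = s * sg (zeta (m, y))"
    unfolding G(2) using F(3) xs l by (simp add: sg_mult mult.commute)
  moreover have "rot (map (Pair 0) pre @ xs) = [] @ (Suc m, y) # map (Pair 0) pre @ butlast xs"
    using xs l by (simp add: rot_def butlast_append)
  ultimately have "reach ([] @ (Suc m, y) # map (Pair 0) pre @ butlast xs) (Suc d) (s * sg (zeta (m, y)))"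
    using G(1) by (auto simp: reach_def)
  from reach_pass[OF this] show ?thesis by (simp add: rot_def l move_sign_def mult.assoc)
qed

lemma reach_rot_pow:
  assumes r: "reach (map (Pair 0) pre @ xs) d s" and xs: "xs \<noteq> []"
  shows "reach (map (Pair 0) pre @ (rot ^^ a) xs) (d + a) (s * (\<Prod>m<a. move_sign c pre (last ((rot ^^ m) xs))))"
proof (induction a)
  case (Suc a)
  from reach_rot[OF Suc] show ?case using rot_pow[OF xs] by (simp add: mult.assoc)
qed (use r in simp)

lemma reach_state_of:
  "length as = length xs \<Longrightarrow> reach (map (Pair 0) (pre @ xs)) 0 1 \<Longrightarrow>
   reach (map (Pair 0) pre @ state_of xs as) (sum_list as) (path_sign c pre xs as)"
proof (induction xs as arbitrary: pre rule: state_of.induct)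
  case (1 x xs a as)
  have "reach (map (Pair 0) (pre @ [x]) @ state_of xs as) (sum_list as) (path_sign c (pre @ [x]) xs as)"
    using 1(1)[of "pre @ [x]"] 1(2,3) by simp
  then have "reach (map (Pair 0) pre @ (0, x) # state_of xs as) (sum_list as) (path_sign c (pre @ [x]) xs as)" by simp
  from reach_rot_pow[OF this] show ?case by (simp add: add.commute mult.commute)
qed auto

lemma path_sign_nonzero: "path_sign c pre xs as \<noteq> 0"
  by (induction c\<equiv>c pre xs as rule: path_sign.induct) (simp_all add: move_sign_nonzero[OF irrational])

definition index :: "nat \<Rightarrow> (nat list \<times> int list) set" where
  "index d = {a. length a = n \<and> sum_list a = d} \<times> C"

lemma finite_index: "finite (index d)"
proof -
  have "{a. length a = n \<and> sum_list a = d} \<subseteq> {a. set a \<subseteq> {..d} \<and> length a = n}"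
    using member_le_sum_list by fastforce
  then have "finite {a. length a = n \<and> sum_list a = d}"
    using finite_lists_length_eq[of "{..d}" n] finite_subset by blast
  then show ?thesis using finite_C by (simp add: index_def)
qed

text \<open>An exponent vector tells how often each stage is repeated, so its sum is the degree.
  Different indices lead to different weights by \<open>state_of_inj\<close>, and vectors of
  different weights are orthogonal.\<close>

lemma family:
  obtains F where "\<And>d p. p \<in> index d \<Longrightarrow> F p \<in> D d"
    "\<And>d p. p \<in> index d \<Longrightarrow> sg (Re (\<beta> (F p) (F p))) = path_sign c [] (snd p) (fst p)"
    "\<And>d p d' p'. p \<in> index d \<Longrightarrow> p' \<in> index d' \<Longrightarrow> p \<noteq> p' \<Longrightarrow> \<beta> (F p) (F p') = 0"
proof -
  have len: "cs \<in> C \<Longrightarrow> length cs = n" for cs using e_weight[of cs] by (simp add: weight_def)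
  have "\<exists>F\<in>D d. weight (state_of (snd p) (fst p)) F \<and> sg (Re (\<beta> F F)) = path_sign c [] (snd p) (fst p)"
    if p: "p \<in> index d" for p d
  proof -
    have c: "snd p \<in> C" "length (fst p) = n" "sum_list (fst p) = d" using p by (auto simp: index_def)
    have "reach (map (Pair 0) ([] @ snd p)) 0 1"
      unfolding reach_def using e_D e_weight e_pos c(1) by (intro bexI[of _ "e (snd p)"]) (auto simp: sg_def)
    from reach_state_of[OF _ this, of "fst p"] show ?thesis using c len by (simp add: reach_def)
  qed
  then have "\<forall>p\<in>(\<Union>d. index d). \<exists>F. F \<in> D (sum_list (fst p)) \<and> weight (state_of (snd p) (fst p)) F \<and>
      sg (Re (\<beta> F F)) = path_sign c [] (snd p) (fst p)"
    by (force simp: index_def)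
  then obtain F where F: "\<forall>p\<in>(\<Union>d. index d). F p \<in> D (sum_list (fst p)) \<and> weight (state_of (snd p) (fst p)) (F p) \<and>
      sg (Re (\<beta> (F p) (F p))) = path_sign c [] (snd p) (fst p)"
    by (rule bchoice[THEN exE])
  show ?thesis
  proof (rule that[of F])
    fix p d assume p: "p \<in> index d"
    then have d: "sum_list (fst p) = d" by (auto simp: index_def)
    have pI: "p \<in> (\<Union>d. index d)" using p by blast
    show "F p \<in> D d" "sg (Re (\<beta> (F p) (F p))) = path_sign c [] (snd p) (fst p)" using bspec[OF F pI] d by simp_all
    fix p' d' assume p': "p' \<in> index d'" and ne: "p \<noteq> p'"
    have "state_of (snd p) (fst p) \<noteq> state_of (snd p') (fst p')"
    proof
      assume "state_of (snd p) (fst p) = state_of (snd p') (fst p')"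
      moreover have "length (fst p) = n" "length (snd p) = n" "length (fst p') = n" "length (snd p') = n"
        using p p' len by (auto simp: index_def)
      ultimately have "snd p = snd p' \<and> fst p = fst p'" using state_of_inj[of "fst p" "snd p" "fst p'" "snd p'"] by simp
      then show False using ne by (simp add: prod_eq_iff)
    qed
    moreover have "p' \<in> (\<Union>d. index d)" using p' by blast
    ultimately show "\<beta> (F p) (F p') = 0" using weight_orth bspec[OF F pI] bspec[OF F, of p'] by blast
  qed
qed

lemma graded_signature:
  assumes T: "finite T" "D d \<subseteq> span T" "card T \<le> card (index d)"
  shows "form_signature scale (D d) \<beta> = (\<Sum>p\<in>index d. path_sign c [] (snd p) (fst p))"
proof -
  interpret D: hermitian_space scale "D d" \<beta>
  proof unfold_locales
    show "subspace (D d)" by (rule D_sub)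
    show "hermitian_form scale (D d) \<beta>" using herm D_M[of d] unfolding hermitian_form_def by blast
  qed
  obtain F where F: "\<And>d p. p \<in> index d \<Longrightarrow> F p \<in> D d"
    "\<And>d p. p \<in> index d \<Longrightarrow> sg (Re (\<beta> (F p) (F p))) = path_sign c [] (snd p) (fst p)"
    "\<And>d p d' p'. p \<in> index d \<Longrightarrow> p' \<in> index d' \<Longrightarrow> p \<noteq> p' \<Longrightarrow> \<beta> (F p) (F p') = 0"
    using family by metis
  have o: "D.orth (index d) F" unfolding D.orth_def using F finite_index by blast
  have nz: "p \<in> index d \<Longrightarrow> Re (\<beta> (F p) (F p)) \<noteq> 0" for p using F(2)[of p d] path_sign_nonzero by (metis sg_eq_0)
  have "form_signature scale (D d) \<beta> = (\<Sum>p\<in>index d. sg (Re (\<beta> (F p) (F p))))"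
    unfolding sum_sg[OF finite_index] by (rule D.form_signature_orth[OF o nz T])
  then show ?thesis using F(2) by simp
qed

text \<open>In each degree the orthogonal family has as many vectors as a spanning set, so it spans.
  A finite union over the degrees then spans around any given vector, and all norms are nonzero.
  This supplies the nondegeneracy demanded of a contravariant form.\<close>

lemma graded_nondegenerate:
  assumes T: "\<And>d. \<exists>T. finite T \<and> D d \<subseteq> span T \<and> card T \<le> card (index d)"
    and M: "\<And>u. u \<in> M \<Longrightarrow> \<exists>N. u \<in> span (\<Union>d\<le>N. D d)"
  shows "nondegenerate M \<beta>"
  unfolding nondegenerate_def
proof (intro ballI impI)
  fix u assume u: "u \<in> M" "\<forall>v\<in>M. \<beta> u v = 0"
  obtain F where F: "\<And>d p. p \<in> index d \<Longrightarrow> F p \<in> D d"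
    "\<And>d p. p \<in> index d \<Longrightarrow> sg (Re (\<beta> (F p) (F p))) = path_sign c [] (snd p) (fst p)"
    "\<And>d p d' p'. p \<in> index d \<Longrightarrow> p' \<in> index d' \<Longrightarrow> p \<noteq> p' \<Longrightarrow> \<beta> (F p) (F p') = 0"
    using family by metis
  have nz: "p \<in> index d \<Longrightarrow> Re (\<beta> (F p) (F p)) \<noteq> 0" for p d using F(2)[of p d] path_sign_nonzero by (metis sg_eq_0)
  have sp: "D d \<subseteq> span (F ` index d)" for d
  proof -
    interpret D: hermitian_space scale "D d" \<beta>
    proof unfold_locales
      show "subspace (D d)" by (rule D_sub)
      show "hermitian_form scale (D d) \<beta>" using herm D_M[of d] unfolding hermitian_form_def by blast
    qed
    obtain T where T: "finite T" "D d \<subseteq> span T" "card T \<le> card (index d)" using T by blast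
    have o: "D.orth (index d) F" unfolding D.orth_def using F finite_index by blast
    show ?thesis by (rule D.orth_span[OF o nz T])
  qed
  obtain N where N: "u \<in> span (\<Union>d\<le>N. D d)" using M[OF u(1)] by blast
  let ?I = "\<Union>d\<le>N. index d"
  have "(\<Union>d\<le>N. D d) \<subseteq> span (F ` ?I)" using sp span_mono[of "F ` index _" "F ` ?I"] by blast
  then have uI: "u \<in> span (F ` ?I)" using N span_minimal[OF _ subspace_span] by blast
  have o: "orth ?I F" unfolding orth_def using F D_M finite_index by blast
  show "u = 0" by (rule orth_nondegenerate[OF o _ uI]) (use nz u(2) o in \<open>auto simp: orth_def\<close>)
qed

end


section \<open>Asymptotic signs\<close>

definition compositions :: "nat \<Rightarrow> nat \<Rightarrow> nat list set" where
  "compositions n d = {a. length a = n \<and> sum_list a = d}"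

lemma finite_compositions: "finite (compositions n d)"
proof -
  have "compositions n d \<subseteq> {a. set a \<subseteq> {..d} \<and> length a = n}"
    using member_le_sum_list by (fastforce simp: compositions_def)
  then show ?thesis using finite_lists_length_eq[of "{..d}" n] finite_subset by blast
qed

definition comp_gf :: "nat \<Rightarrow> (nat list \<Rightarrow> int) \<Rightarrow> int fps" where
  "comp_gf n s = Abs_fps (\<lambda>d. \<Sum>a\<in>compositions n d. s a)"

lemma comp_gf_cong: "(\<And>a. length a = n \<Longrightarrow> s a = s' a) \<Longrightarrow> comp_gf n s = comp_gf n s'"
  unfolding comp_gf_def by (intro arg_cong[of _ _ Abs_fps] ext sum.cong) (auto simp: compositions_def)

lemma comp_gf_Suc:
  "comp_gf (Suc n) s = comp_gf n (\<lambda>a. s (0 # a)) + fps_X * comp_gf (Suc n) (\<lambda>a. s (Suc (hd a) # tl a))"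
proof (rule fps_ext)
  fix d
  let ?inc = "\<lambda>a. Suc (hd a) # tl a"
  have inc: "inj_on ?inc (compositions (Suc n) d)" for d
  proof
    fix a b assume ab: "a \<in> compositions (Suc n) d" "b \<in> compositions (Suc n) d" "?inc a = ?inc b"
    then have "a \<noteq> []" "b \<noteq> []" by (auto simp: compositions_def)
    then show "a = b" using ab(3) by (metis list.inject nat.inject list.collapse)
  qed
  show "fps_nth (comp_gf (Suc n) s) d = fps_nth (comp_gf n (\<lambda>a. s (0 # a)) + fps_X * comp_gf (Suc n) (\<lambda>a. s (?inc a))) d"
  proof (cases d)
    case 0
    have "compositions (Suc n) 0 = (#) 0 ` compositions n 0"
      by (auto simp: compositions_def length_Suc_conv image_iff)
    then show ?thesis using 0 by (simp add: comp_gf_def sum.reindex)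
  next
    case (Suc e)
    have split: "compositions (Suc n) (Suc e) = (#) 0 ` compositions n (Suc e) \<union> ?inc ` compositions (Suc n) e"
    proof (intro equalityI subsetI)
      fix a assume a: "a \<in> compositions (Suc n) (Suc e)"
      then obtain k b where b: "a = k # b" "length b = n" "k + sum_list b = Suc e"
        by (auto simp: compositions_def length_Suc_conv)
      show "a \<in> (#) 0 ` compositions n (Suc e) \<union> ?inc ` compositions (Suc n) e"
      proof (cases k)
        case 0
        then show ?thesis using b by (auto simp: compositions_def)
      next
        case (Suc j)
        then have "a = ?inc (j # b)" "j # b \<in> compositions (Suc n) e" using b by (auto simp: compositions_def)
        then show ?thesis by blast
      qed
    qed (auto simp: compositions_def length_Suc_conv)
    have "(\<Sum>a\<in>compositions (Suc n) (Suc e). s a) =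
      (\<Sum>a\<in>(#) 0 ` compositions n (Suc e). s a) + (\<Sum>a\<in>?inc ` compositions (Suc n) e. s a)"
      unfolding split by (rule sum.union_disjoint) (auto intro: finite_compositions)
    also have "\<dots> = (\<Sum>a\<in>compositions n (Suc e). s (0 # a)) + (\<Sum>a\<in>compositions (Suc n) e. s (?inc a))"
      by (subst sum.reindex[OF inc], subst sum.reindex) auto
    finally show ?thesis using Suc by (simp add: comp_gf_def)
  qed
qed

text \<open>If the coefficients become constant once an exponent reaches B, splitting off the values
  0, ..., B - 1 of the first exponent leaves a geometric series for the rest. The factor 1 - t
  annihilates the split-off parts at t = 1, so only the value with all exponents equal to B
  survives.\<close>

lemma comp_gf_rational:
  assumes "\<And>a. length a = n \<Longrightarrow> s a = s (map (min B) a)"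
  shows "\<exists>p. fps_of_poly p = comp_gf n s * (1 - fps_X) ^ n \<and> poly p 1 = s (replicate n B)"
  using assms
proof (induction n arbitrary: s)
  case 0
  have "comp_gf 0 s = fps_const (s [])"
  proof (rule fps_ext)
    fix d
    have "compositions 0 d = (if d = 0 then {[]} else {})" by (auto simp: compositions_def)
    then show "fps_nth (comp_gf 0 s) d = fps_nth (fps_const (s [])) d" by (simp add: comp_gf_def)
  qed
  then show ?case by (intro exI[of _ "[:s []:]"]) (simp add: fps_of_poly_const)
next
  case (Suc n)
  note IH = Suc.IH
  \<comment> \<open>The bound \<open>b\<close> for the first exponent is separated from the bound
    \<open>B\<close> for the others, so that it can be lowered by an inner induction.\<close>
  have "\<exists>p. fps_of_poly p = comp_gf (Suc n) s * (1 - fps_X) ^ Suc n \<and> poly p 1 = s (b # replicate n B)"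
    if "\<And>k a. length a = n \<Longrightarrow> s (k # a) = s (min b k # map (min B) a)" for b s
    using that
  proof (induction b arbitrary: s)
    case 0
    have tl: "length a = n \<Longrightarrow> s (0 # a) = s (0 # map (min B) a)" for a using 0[of a 0] by simp
    obtain p where p: "fps_of_poly p = comp_gf n (\<lambda>a. s (0 # a)) * (1 - fps_X) ^ n" "poly p 1 = s (0 # replicate n B)"
      using IH[of "\<lambda>a. s (0 # a)", OF tl] by blast
    have "comp_gf (Suc n) (\<lambda>a. s (Suc (hd a) # tl a)) = comp_gf (Suc n) s"
    proof (rule comp_gf_cong)
      fix a :: "nat list" assume "length a = Suc n"
      then obtain k a' where "a = k # a'" "length a' = n" by (auto simp: length_Suc_conv)
      then show "s (Suc (hd a) # tl a) = s a" using 0[of a' "Suc k"] 0[of a' k] by simp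
    qed
    then have "comp_gf (Suc n) s * (1 - fps_X) = comp_gf n (\<lambda>a. s (0 # a))"
      using comp_gf_Suc[of n s] by (simp add: algebra_simps)
    then have "comp_gf (Suc n) s * (1 - fps_X) ^ Suc n = comp_gf n (\<lambda>a. s (0 # a)) * (1 - fps_X) ^ n"
      by (simp add: mult.assoc[symmetric])
    then show ?case using p by (intro exI[of _ p]) (simp only: simp_thms)
  next
    case (Suc b)
    let ?s = "\<lambda>a. s (Suc (hd a) # tl a)"
    have tl: "length a = n \<Longrightarrow> s (0 # a) = s (0 # map (min B) a)" for a using Suc.prems[of a 0] by simp
    obtain p where p: "fps_of_poly p = comp_gf n (\<lambda>a. s (0 # a)) * (1 - fps_X) ^ n" "poly p 1 = s (0 # replicate n B)"
      using IH[of "\<lambda>a. s (0 # a)", OF tl] by blast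
    have "?s (k # a) = ?s (min b k # map (min B) a)" if "length a = n" for k a
      using Suc.prems[OF that, of "Suc k"] by simp
    from Suc.IH[of ?s, OF this] obtain p' where
      p': "fps_of_poly p' = comp_gf (Suc n) ?s * (1 - fps_X) ^ Suc n" "poly p' 1 = s (Suc b # replicate n B)" by auto
    have "fps_of_poly ([:1, - 1:] * p + [:0, 1:] * p') = comp_gf (Suc n) s * (1 - fps_X) ^ Suc n"
    proof -
      have x: "fps_of_poly [:1, - 1:] = (1 - fps_X :: int fps)" "fps_of_poly [:0, 1:] = (fps_X :: int fps)"
        by (rule fps_ext, auto simp: coeff_pCons split: nat.splits)+
      show ?thesis
        unfolding fps_of_poly_add fps_of_poly_mult x p(1) p'(1) comp_gf_Suc[of n s] by (simp add: algebra_simps)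
    qed
    then show ?case using p'(2) by (intro exI[of _ "[:1, - 1:] * p + [:0, 1:] * p'"]) simp
  qed
  moreover have "s (k # a) = s (min B k # map (min B) a)" if "length a = n" for k a
    using Suc.prems[of "k # a"] that by simp
  ultimately show ?case unfolding replicate_Suc by blast
qed

text \<open>The sign that one entry collects while its level rises from 0. It depends on that entry
  and on the fixed \<open>pre\<close> alone, which decouples the entries of a stage from each
  other.\<close>

definition level_sign :: "real \<Rightarrow> int list \<Rightarrow> nat \<times> int \<Rightarrow> int" where
  "level_sign c pre p = (\<Prod>m<fst p. move_sign c pre (m, snd p))"

definition state_sign :: "real \<Rightarrow> int list \<Rightarrow> (nat \<times> int) list \<Rightarrow> int" where
  "state_sign c pre st = (\<Prod>p\<leftarrow>st. level_sign c pre p)"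

lemma sg_square: "r \<noteq> 0 \<Longrightarrow> sg r * sg r = 1"
  by (auto simp: sg_def)

lemma pass_sign_square: "c \<notin> \<rat> \<Longrightarrow> pass_sign c m d * pass_sign c m d = 1"
  using pass_sign_nonzero[of c m d] sg_square by (auto simp: pass_sign_def)

lemma prod_list_square: "(\<And>x. x \<in> set xs \<Longrightarrow> f x * f x = (1::int)) \<Longrightarrow> (\<Prod>x\<leftarrow>xs. f x) * (\<Prod>x\<leftarrow>xs. f x) = 1"
proof (induction xs)
  case (Cons x xs)
  have "(f x * prod_list (map f xs)) * (f x * prod_list (map f xs)) = (f x * f x) * (prod_list (map f xs) * prod_list (map f xs))"
    by (simp only: mult_ac)
  then show ?case using Cons by simp
qed simp

lemma move_sign_square: "c \<notin> \<rat> \<Longrightarrow> move_sign c pre p * move_sign c pre p = 1"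
proof -
  assume c: "c \<notin> \<rat>"
  let ?f = "\<lambda>l. pass_sign c (fst p) (snd p - l)"
  have "move_sign c pre p * move_sign c pre p =
      (sg (content_weight c p) * sg (content_weight c p)) * ((\<Prod>l\<leftarrow>pre. ?f l) * (\<Prod>l\<leftarrow>pre. ?f l))"
    unfolding move_sign_def by (simp only: mult_ac)
  then show ?thesis using sg_square[OF content_weight_nonzero[OF c]] prod_list_square[of pre ?f] pass_sign_square[OF c] by simp
qed

lemma level_sign_square: "c \<notin> \<rat> \<Longrightarrow> level_sign c pre p * level_sign c pre p = 1"
  by (simp add: level_sign_def move_sign_square flip: prod.distrib)

lemma state_sign_square: "c \<notin> \<rat> \<Longrightarrow> state_sign c pre st * state_sign c pre st = 1"
  unfolding state_sign_def by (rule prod_list_square) (rule level_sign_square)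

lemma state_sign_rot: "st \<noteq> [] \<Longrightarrow> state_sign c pre (rot st) = state_sign c pre st * move_sign c pre (last st)"
proof -
  assume "st \<noteq> []"
  then have "st = butlast st @ [last st]" by simp
  moreover have "state_sign c pre (U @ [p]) = state_sign c pre U * level_sign c pre p" for U p
    by (simp add: state_sign_def)
  ultimately have "state_sign c pre st = state_sign c pre (butlast st) * level_sign c pre (last st)" by metis
  moreover have "level_sign c pre (Suc (fst (last st)), snd (last st)) = level_sign c pre (last st) * move_sign c pre (last st)"
    by (simp add: level_sign_def)
  ultimately show ?thesis by (simp add: rot_def state_sign_def)
qed

lemma state_sign_rot_pow:
  "st \<noteq> [] \<Longrightarrow> state_sign c pre ((rot ^^ a) st) = state_sign c pre st * (\<Prod>m<a. move_sign c pre (last ((rot ^^ m) st)))"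
  by (induction a) (simp_all add: state_sign_rot rot_pow)

text \<open>Each entry is moved once at each level, so the signs of the moves of one stage can be
  collected entry by entry.\<close>

lemma path_sign_Cons:
  assumes c: "c \<notin> \<rat>"
  shows "path_sign c pre (x # xs) (a # as) =
    state_sign c pre (state_of (x # xs) (a # as)) * state_sign c pre (state_of xs as) * path_sign c (pre @ [x]) xs as"
proof -
  let ?L = "state_of xs as"
  have "state_sign c pre ((0, x) # ?L) = state_sign c pre ?L" by (simp add: state_sign_def level_sign_def)
  then have "(\<Prod>m<a. move_sign c pre (last ((rot ^^ m) ((0, x) # ?L)))) =
      state_sign c pre (state_of (x # xs) (a # as)) * state_sign c pre ?L"
    using state_sign_rot_pow[of "(0, x) # ?L" c pre a] state_sign_square[OF c, of pre ?L] by simp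
  then show ?thesis by simp
qed

text \<open>Entries of level at least K are identified even if their contents differ, because
  additional rotations permute them. Their contents are compared separately, as a multiset.\<close>

definition same_upto :: "nat \<Rightarrow> nat \<times> int \<Rightarrow> nat \<times> int \<Rightarrow> bool" where
  "same_upto K p q \<longleftrightarrow> p = q \<or> K \<le> fst p \<and> K \<le> fst q"

lemma same_rot: "list_all2 (same_upto K) U U' \<Longrightarrow> U \<noteq> [] \<Longrightarrow> list_all2 (same_upto K) (rot U) (rot U')"
proof -
  assume a: "list_all2 (same_upto K) U U'" and U: "U \<noteq> []"
  then have U': "U' \<noteq> []" by auto
  have "list_all2 (same_upto K) (butlast U @ [last U]) (butlast U' @ [last U'])" using a U U' by simp
  then have "list_all2 (same_upto K) (butlast U) (butlast U')" "same_upto K (last U) (last U')"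
    using list_all2_lengthD[OF a] by (auto simp: list_all2_append)
  then show ?thesis by (auto simp: rot_def same_upto_def)
qed

lemma same_rot_pow: "list_all2 (same_upto K) U U' \<Longrightarrow> U \<noteq> [] \<Longrightarrow> list_all2 (same_upto K) ((rot ^^ a) U) ((rot ^^ a) U')"
  by (induction a) (use same_rot rot_pow in auto)

lemma rot_pow_le_length:
  "j \<le> length U \<Longrightarrow> (rot ^^ j) U = map (apfst Suc) (drop (length U - j) U) @ take (length U - j) U"
proof (induction j)
  case (Suc j)
  define i where "i = length U - Suc j"
  have i: "length U - j = Suc i" "i < length U" using Suc.prems by (auto simp: i_def)
  have t: "take (Suc i) U = take i U @ [U ! i]" using i(2) by (rule take_Suc_conv_app_nth)
  have d: "drop i U = U ! i # drop (Suc i) U" using i(2) by (rule Cons_nth_drop_Suc[symmetric])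
  have "(rot ^^ Suc j) U = rot (map (apfst Suc) (drop (Suc i) U) @ take i U @ [U ! i])"
    using Suc i t by simp
  also have "\<dots> = apfst Suc (U ! i) # map (apfst Suc) (drop (Suc i) U) @ take i U"
    by (simp add: rot_def butlast_append apfst_def map_prod_def case_prod_unfold)
  also have "\<dots> = map (apfst Suc) (drop i U) @ take i U" unfolding d by simp
  finally show ?case unfolding i_def .
qed simp

lemma rot_pow_length: "(rot ^^ length U) U = map (apfst Suc) U"
  using rot_pow_le_length[of "length U" U] by simp

text \<open>A full round of \<open>length U\<close> rotations restores the order of the entries and
  raises every level by one.\<close>

lemma rot_pow_levels: "U \<noteq> [] \<Longrightarrow> a \<ge> length U * K \<Longrightarrow> \<forall>p\<in>set ((rot ^^ a) U). K \<le> fst p"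
proof (induction K arbitrary: a U)
  case (Suc K)
  then obtain b where b: "a = b + length U" "b \<ge> length U * K" by (metis add.commute le_Suc_ex mult_Suc_right add.assoc le_add1)
  let ?U = "map (apfst Suc) U"
  have "(rot ^^ a) U = (rot ^^ b) ?U" unfolding b(1) funpow_add by (simp add: rot_pow_length)
  moreover have "\<forall>p\<in>set ((rot ^^ b) ?U). Suc K \<le> fst p"
  proof -
    have shift: "(rot ^^ b) (map (apfst Suc) L) = map (apfst Suc) ((rot ^^ b) L)" if "L \<noteq> []" for L
    proof (induction b)
      case (Suc b)
      have "rot (map (apfst Suc) U) = map (apfst Suc) (rot U)" if "U \<noteq> []" for U
        using that by (simp add: rot_def last_map map_butlast)
      then show ?case using Suc rot_pow[OF that, of b] by simp
    qed simp
    show ?thesis unfolding shift[OF Suc.prems(1)] using Suc.IH[OF Suc.prems(1) b(2)] by auto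
  qed
  ultimately show ?case by simp
qed simp

lemma same_uptoI:
  "length U = length U' \<Longrightarrow> \<forall>p\<in>set U. K \<le> fst p \<Longrightarrow> \<forall>p\<in>set U'. K \<le> fst p \<Longrightarrow> list_all2 (same_upto K) U U'"
  by (simp add: list_all2_conv_all_nth same_upto_def)

text \<open>A stage involves at most n entries, so n * K rotations lift all of them to level K,
  whatever the start. Cutting off the exponents at such a bound changes only what
  \<open>same_upto\<close> ignores.\<close>

lemma same_state_of:
  assumes B: "n * K \<le> B"
  shows "length as = length xs \<Longrightarrow> length xs \<le> n \<Longrightarrow>
    list_all2 (same_upto K) (state_of xs as) (state_of xs (map (min B) as))"
proof (induction xs as rule: state_of.induct)
  case (1 x xs a as)
  let ?U = "(0, x) # state_of xs as" and ?U' = "(0, x) # state_of xs (map (min B) as)"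
  have "same_upto K p p" for p by (simp add: same_upto_def)
  then have U: "list_all2 (same_upto K) ?U ?U'" using 1 by simp
  have len: "length ?U = Suc (length xs)" "length ?U' = Suc (length xs)" using 1(2) by (simp_all add: length_state_of)
  show ?case
  proof (cases "a \<le> B")
    case True
    then show ?thesis using same_rot_pow[OF U, of a] by (simp add: min_absorb2)
  next
    case False
    have le: "Suc (length xs) * K \<le> B" using B 1(3) mult_le_mono1[of "Suc (length xs)" n K] by simp
    have "list_all2 (same_upto K) ((rot ^^ a) ?U) ((rot ^^ B) ?U')"
    proof (rule same_uptoI)
      show "length ((rot ^^ a) ?U) = length ((rot ^^ B) ?U')" using rot_pow[of ?U a] rot_pow[of ?U' B] len by simp
      show "\<forall>p\<in>set ((rot ^^ a) ?U). K \<le> fst p" by (rule rot_pow_levels) (use le False len in auto)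
      show "\<forall>p\<in>set ((rot ^^ B) ?U'). K \<le> fst p" by (rule rot_pow_levels) (use le len in auto)
    qed
    then show ?thesis using False by (simp add: min_absorb1)
  qed
qed auto

lemma state_of_levels:
  assumes B: "n * K \<le> B"
  shows "length xs \<le> n \<Longrightarrow> \<forall>p\<in>set (state_of xs (replicate (length xs) B)). K \<le> fst p"
proof (cases xs)
  case (Cons x ys)
  assume len: "length xs \<le> n"
  have "length ((0::nat, x) # state_of ys (replicate (length ys) B)) * K \<le> B"
    using B len Cons mult_le_mono1[of "Suc (length ys)" n K] by (simp add: length_state_of)
  from rot_pow_levels[OF _ this] show ?thesis using Cons by simp
qed simp

lemma mset_rot: "st \<noteq> [] \<Longrightarrow> mset (map snd (rot st)) = mset (map snd st)"
proof -
  assume "st \<noteq> []"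
  then have "mset (map snd st) = mset (map snd (butlast st @ [last st]))" by simp
  then show ?thesis by (simp add: rot_def)
qed

lemma mset_state_of: "length as = length xs \<Longrightarrow> mset (map snd (state_of xs as)) = mset xs"
proof (induction xs as rule: state_of.induct)
  case (1 x xs a as)
  have "mset (map snd ((rot ^^ a) st)) = mset (map snd st)" if "st \<noteq> []" for st
    by (induction a) (use mset_rot rot_pow that in auto)
  then show ?case using 1 by simp
qed auto

definition stable_from :: "real \<Rightarrow> int set \<Rightarrow> nat \<Rightarrow> bool" where
  "stable_from c S K \<longleftrightarrow> (\<forall>pre y m. set pre \<subseteq> S \<longrightarrow> y \<in> S \<longrightarrow> K \<le> m \<longrightarrow> move_sign c pre (m, y) = 1)"

lemma level_sign_stable:
  assumes "stable_from c S K" "set pre \<subseteq> S" "snd p \<in> S" "K \<le> fst p"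
  shows "level_sign c pre p = level_sign c pre (K, snd p)"
proof -
  have "level_sign c pre p = (\<Prod>m\<in>{..<fst p}. move_sign c pre (m, snd p))" by (simp add: level_sign_def)
  also have "\<dots> = (\<Prod>m\<in>{..<K}. move_sign c pre (m, snd p))"
    by (rule prod.mono_neutral_right) (use assms in \<open>auto simp: stable_from_def\<close>)
  finally show ?thesis by (simp add: level_sign_def)
qed

text \<open>From level K on the sign of an entry depends only on its content. Multiplying each entry
  by this limiting sign makes all high entries contribute 1, and the compensating product depends
  only on the multiset of contents. Signs are their own inverses, so the compensation can be
  undone.\<close>

lemma state_sign_same:
  assumes c: "c \<notin> \<rat>" and K: "stable_from c S K" "set pre \<subseteq> S"
    and U: "list_all2 (same_upto K) U U'" "mset (map snd U) = mset (map snd U')" "snd ` set U \<subseteq> S"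
  shows "state_sign c pre U = state_sign c pre U'"
proof -
  let ?g = "\<lambda>y. level_sign c pre (K, y)" and ?f = "level_sign c pre"
  have U': "snd ` set U' \<subseteq> S" using U(2,3) by (metis image_set set_mset_mset)
  have h: "level_sign c pre (m, y) * ?g y = 1" if "K \<le> m" "y \<in> S" for m y
    using level_sign_stable[OF K, of "(m, y)"] level_sign_square[OF c, of pre "(K, y)"] that by simp
  have "list_all2 (\<lambda>p q. same_upto K p q \<and> snd p \<in> S \<and> snd q \<in> S) U U'"
    using U(1,3) U' by (auto simp: list_all2_conv_all_nth)
  then have eq: "map (\<lambda>p. ?f p * ?g (snd p)) U = map (\<lambda>p. ?f p * ?g (snd p)) U'"
    by (induction rule: list_all2_induct) (use h in \<open>auto simp: same_upto_def\<close>)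
  have split: "(\<Prod>p\<leftarrow>L. ?f p) = (\<Prod>p\<leftarrow>L. ?f p * ?g (snd p)) * (\<Prod>y\<leftarrow>map snd L. ?g y)" for L
  proof -
    have "(\<Prod>p\<leftarrow>L. ?f p * ?g (snd p)) = (\<Prod>p\<leftarrow>L. ?f p) * (\<Prod>y\<leftarrow>map snd L. ?g y)"
      by (induction L) (simp_all add: mult_ac)
    moreover have "(\<Prod>y\<leftarrow>map snd L. ?g y) * (\<Prod>y\<leftarrow>map snd L. ?g y) = 1"
      by (rule prod_list_square) (rule level_sign_square[OF c])
    ultimately show ?thesis by (simp add: mult.assoc)
  qed
  have "(\<Prod>y\<leftarrow>map snd U. ?g y) = (\<Prod>y\<leftarrow>map snd U'. ?g y)"
    using arg_cong[OF U(2), of "\<lambda>M. prod_mset (image_mset ?g M)"] by (simp only: mset_map[symmetric] prod_mset_prod_list)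
  then show ?thesis unfolding state_sign_def split[of U] split[of U'] eq by simp
qed

lemma path_sign_min:
  assumes c: "c \<notin> \<rat>" and K: "stable_from c S K" and B: "n * K \<le> B"
  shows "length as = length xs \<Longrightarrow> length xs \<le> n \<Longrightarrow> set pre \<subseteq> S \<Longrightarrow> set xs \<subseteq> S \<Longrightarrow>
    path_sign c pre xs as = path_sign c pre xs (map (min B) as)"
proof (induction xs as arbitrary: pre rule: state_of.induct)
  case (1 x xs a as)
  have s: "state_sign c pre (state_of ys bs) = state_sign c pre (state_of ys (map (min B) bs))"
    if "length bs = length ys" "length ys \<le> n" "set ys \<subseteq> S" for ys bs
  proof (rule state_sign_same[OF c K 1(4) same_state_of[OF B that(1,2)]])
    show m: "mset (map snd (state_of ys bs)) = mset (map snd (state_of ys (map (min B) bs)))"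
      using that(1) by (simp only: mset_state_of length_map)
    show "snd ` set (state_of ys bs) \<subseteq> S"
      using that(3) arg_cong[OF mset_state_of[OF that(1)], of set_mset] by simp
  qed
  have "path_sign c (pre @ [x]) xs as = path_sign c (pre @ [x]) xs (map (min B) as)" using 1 by simp
  then show ?case unfolding list.map(2) path_sign_Cons[OF c]
    using s[of "a # as" "x # xs"] s[of as xs] 1 by simp
qed auto

fun limit_sign :: "real \<Rightarrow> nat \<Rightarrow> int list \<Rightarrow> int list \<Rightarrow> int" where
  "limit_sign c K pre (x # xs) = level_sign c pre (K, x) * limit_sign c K (pre @ [x]) xs"
| "limit_sign c K pre [] = 1"

text \<open>For large exponents the entries behind the first one contribute the same signs to the
  two states in \<open>path_sign_Cons\<close>, so these cancel. Each stage leaves only the sign of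
  its own entry \<open>x\<close>.\<close>

lemma path_sign_limit:
  assumes c: "c \<notin> \<rat>" and K: "stable_from c S K" and B: "n * K \<le> B"
  shows "length xs \<le> n \<Longrightarrow> set pre \<subseteq> S \<Longrightarrow> set xs \<subseteq> S \<Longrightarrow>
    path_sign c pre xs (replicate (length xs) B) = limit_sign c K pre xs"
proof (induction xs arbitrary: pre)
  case (Cons x xs)
  have s: "state_sign c pre (state_of ys (replicate (length ys) B)) = (\<Prod>y\<leftarrow>ys. level_sign c pre (K, y))"
    if "length ys \<le> n" "set ys \<subseteq> S" for ys
  proof -
    let ?st = "state_of ys (replicate (length ys) B)"
    have m: "mset (map snd ?st) = mset ys" by (rule mset_state_of) simp
    have "state_sign c pre ?st = (\<Prod>p\<leftarrow>?st. level_sign c pre (K, snd p))"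
      unfolding state_sign_def
    proof (rule arg_cong[of _ _ prod_list], rule map_cong[OF refl])
      fix p assume p: "p \<in> set ?st"
      have "snd p \<in> S" using p that(2) arg_cong[OF m, of set_mset] by auto
      then show "level_sign c pre p = level_sign c pre (K, snd p)"
        using level_sign_stable[OF K Cons.prems(2)] state_of_levels[OF B that(1)] p by blast
    qed
    also have "\<dots> = (\<Prod>y\<leftarrow>map snd ?st. level_sign c pre (K, y))" by (simp add: comp_def)
    also have "\<dots> = (\<Prod>y\<leftarrow>ys. level_sign c pre (K, y))" using arg_cong[OF m, of "\<lambda>M. prod_mset (image_mset (\<lambda>y. level_sign c pre (K, y)) M)"]
      by (simp only: mset_map[symmetric] prod_mset_prod_list)
    finally show ?thesis .
  qed
  have sq: "(\<Prod>y\<leftarrow>xs. level_sign c pre (K, y)) * (\<Prod>y\<leftarrow>xs. level_sign c pre (K, y)) = 1"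
    by (rule prod_list_square) (rule level_sign_square[OF c])
  have "path_sign c pre (x # xs) (B # replicate (length xs) B) =
      (level_sign c pre (K, x) * (\<Prod>y\<leftarrow>xs. level_sign c pre (K, y))) * (\<Prod>y\<leftarrow>xs. level_sign c pre (K, y)) *
      path_sign c (pre @ [x]) xs (replicate (length xs) B)"
    unfolding path_sign_Cons[OF c] using s[of "x # xs"] s[of xs] Cons.prems by simp
  also have "\<dots> = level_sign c pre (K, x) * path_sign c (pre @ [x]) xs (replicate (length xs) B)"
    using sq by (simp add: mult.assoc)
  finally show ?case using Cons by simp
qed simp

lemma stable_from_exists:
  assumes S: "finite S"
  shows "\<exists>K0. \<forall>K\<ge>K0. stable_from c S K"
proof -
  obtain N where N: "\<And>y. y \<in> S \<Longrightarrow> \<bar>y\<bar> \<le> N"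
    using S by (metis bdd_above_finite finite_imageI bdd_above_def imageI)
  \<comment> \<open>N bounds the contents, so 2N bounds their differences d. From this level on m +
    1 - c d exceeds the absolute value of c, and every norm factor is positive.\<close>
  define K0 where "K0 = nat \<lceil>\<bar>c\<bar> * (2 * of_int \<bar>N\<bar> + 1)\<rceil>"
  have "stable_from c S K" if "K \<ge> K0" for K
    unfolding stable_from_def
  proof (intro allI impI)
    fix pre y m assume pre: "set pre \<subseteq> S" and y: "y \<in> S" and m: "K \<le> m"
    have big: "real m \<ge> \<bar>c\<bar> * (2 * of_int \<bar>N\<bar> + 1)"
      using m that real_nat_ceiling_ge[of "\<bar>c\<bar> * (2 * of_int \<bar>N\<bar> + 1)"] unfolding K0_def by linarith
    have small: "real m + 1 - c * of_int d > \<bar>c\<bar>" if "\<bar>d\<bar> \<le> 2 * \<bar>N\<bar>" for d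
    proof -
      have "c * of_int d \<le> \<bar>c\<bar> * \<bar>of_int d\<bar>" by (metis abs_ge_self abs_mult)
      also have "\<dots> \<le> \<bar>c\<bar> * (2 * of_int \<bar>N\<bar>)" using that by (intro mult_left_mono) linarith+
      finally show ?thesis using big by (simp add: algebra_simps)
    qed
    have "content_weight c (m, y) > 0"
      using small[of y] N[OF y] abs_ge_zero[of c] by (simp add: content_weight_def) linarith
    moreover have "pass_sign c m (y - l) = 1" if "l \<in> set pre" for l
    proof -
      have "\<bar>y - l\<bar> \<le> 2 * \<bar>N\<bar>" using N[OF y] N[of l] pre that by fastforce
      from small[OF this] have s: "real m + 1 - c * of_int (y - l) > \<bar>c\<bar>" .
      then have "\<bar>c / (real m + 1 - c * of_int (y - l))\<bar> < 1" by (simp add: abs_div)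
      then have "(c / (real m + 1 - c * of_int (y - l)))\<^sup>2 < 1" by (rule abs_square_less_1[THEN iffD2])
      then show ?thesis by (simp add: pass_sign_def sg_def)
    qed
    then have "map (\<lambda>l. pass_sign c m (y - l)) pre = map (\<lambda>_. 1) pre" by simp
    then have "(\<Prod>l\<leftarrow>pre. pass_sign c m (y - l)) = (\<Prod>l\<leftarrow>pre. 1)" by (simp only:)
    moreover have "(\<Prod>l\<leftarrow>pre. 1) = (1::int)" by (induction pre) auto
    ultimately show "move_sign c pre (m, y) = 1" by (simp add: move_sign_def sg_def)
  qed
  then show ?thesis by blast
qed

theorem signature_series:
  assumes c: "c \<notin> \<rat>" and K: "stable_from c S K" and C: "finite C" "\<And>cs. cs \<in> C \<Longrightarrow> length cs = n \<and> set cs \<subseteq> S"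
  shows "\<exists>p. fps_of_poly p = Abs_fps (\<lambda>d. \<Sum>a\<in>compositions n d. \<Sum>cs\<in>C. path_sign c [] cs a) * (1 - fps_X) ^ n \<and>
    poly p 1 = (\<Sum>cs\<in>C. limit_sign c K [] cs)"
proof -
  let ?s = "\<lambda>a. \<Sum>cs\<in>C. path_sign c [] cs a"
  have "?s a = ?s (map (min (n * K)) a)" if "length a = n" for a
    by (rule sum.cong[OF refl], rule path_sign_min[OF c K order_refl]) (use that C in auto)
  from comp_gf_rational[of n ?s, OF this] obtain p where
    p: "fps_of_poly p = comp_gf n ?s * (1 - fps_X) ^ n" "poly p 1 = ?s (replicate n (n * K))" by blast
  have "?s (replicate n (n * K)) = (\<Sum>cs\<in>C. limit_sign c K [] cs)"
  proof (rule sum.cong[OF refl])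
    fix cs assume "cs \<in> C"
    then show "path_sign c [] cs (replicate n (n * K)) = limit_sign c K [] cs"
      using path_sign_limit[OF c K order_refl, where n = n and xs = cs and pre = "[]"] C by simp
  qed
  then show ?thesis using p by (auto simp: comp_gf_def)
qed


section \<open>Standard modules\<close>

lemma quantum_one: "quantum 1"
  by unfold_locales (auto simp: qint_def)

lemma hecke_gen_one: "f \<in> hecke_space n \<Longrightarrow> i \<in> {1..<n} \<Longrightarrow> hecke_gen n 1 i f = (\<lambda>w. f (transp i (Suc i) \<circ> w))"
  by (auto simp: hecke_gen_def Let_def)

lemma inv_simple: "inv_into UNIV (transp i (Suc i)) = transp i (Suc i)"
  by (rule inv_unique_comp) (auto simp: fun_eq_iff)

text \<open>At q = 1 the generators act as left translations by simple transpositions, and words in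
  these give all permutations.\<close>

lemma specht_one_translate:
  assumes \<tau>: "is_partition n \<tau>" and u: "u \<in> perms n" and v: "v \<in> specht n 1 \<tau>"
  shows "(\<lambda>w. v (inv_into UNIV u \<circ> w)) \<in> specht n 1 \<tau>"
proof -
  have "set is \<subseteq> {1..<n} \<Longrightarrow> (\<lambda>w. v (inv_into UNIV (word_perm is) \<circ> w)) \<in> specht n 1 \<tau>" for "is"
  proof (induction "is")
    case Nil
    have "inv_into UNIV (word_perm []) = id" by (simp add: inv_id[unfolded id_def] id_def)
    then show ?case using v by simp
  next
    case (Cons i "is")
    let ?f = "\<lambda>w. v (inv_into UNIV (word_perm is) \<circ> w)"
    have s: "set is \<subseteq> {1..<n}" and i: "i \<in> {1..<n}" using Cons.prems by auto
    have f: "?f \<in> specht n 1 \<tau>" by (rule Cons.IH[OF s])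
    have "bij (word_perm is)" using word_perm_perms[of "is" n] Cons.prems permutes_bij by auto
    then have "inv_into UNIV (word_perm (i # is)) = inv_into UNIV (word_perm is) \<circ> transp i (Suc i)"
      by (simp add: o_inv_distrib inv_simple)
    then have "(\<lambda>w. v (inv_into UNIV (word_perm (i # is)) \<circ> w)) = hecke_gen n 1 i ?f"
      using hecke_gen_one[OF subsetD[OF specht_space[OF \<tau>] f] i] by (simp add: comp_assoc)
    then show ?case using specht_closed(3)[OF i f] by (simp only:)
  qed
  moreover obtain "is" where "reduced_word n u is" using reduced_word_exists[OF u] by blast
  ultimately show ?thesis by (auto simp: reduced_word_def)
qed

lemma swap_closed_length: "swap_closed n C \<Longrightarrow> c \<in> C \<Longrightarrow> length c = n"
  unfolding swap_closed_def by blast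

theorem (in quantum) specht_basis:
  assumes \<tau>: "is_partition n \<tau>"
  defines "C \<equiv> shape_contents n (part_shape \<tau>)"
  obtains R :: "((nat \<Rightarrow> nat) \<Rightarrow> complex) \<Rightarrow> int list \<Rightarrow> complex" and b where
    "\<And>f g. R (f + g) = (\<lambda>c. R f c + R g c)"
    "\<And>a f. R (hscale a f) = (\<lambda>c. a * R f c)"
    "\<And>i f. \<lbrakk>f \<in> specht n q \<tau>; i \<in> {1..<n}\<rbrakk> \<Longrightarrow> R (hecke_gen n q i f) = top (i - 1) (R f)"
    "bij_betw R (specht n q \<tau>) (supported C)"
    "\<And>c. c \<in> C \<Longrightarrow> b c \<in> specht n q \<tau>" "\<And>c. c \<in> C \<Longrightarrow> R (b c) = delta c"
    "\<And>v. v \<in> specht n q \<tau> \<Longrightarrow> v = (\<Sum>c\<in>C. hscale (R v c) (b c))"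
proof -
  obtain R where R: "\<And>f g. R (f + g) = (\<lambda>c. R f c + R g c)"
    "\<And>a f. R (hscale a f) = (\<lambda>c. a * R f c)"
    "\<And>i f. \<lbrakk>f \<in> specht n q \<tau>; i \<in> {1..<n}\<rbrakk> \<Longrightarrow> R (hecke_gen n q i f) = top (i - 1) (R f)"
    "bij_betw R (specht n q \<tau>) (supported C)"
    by (rule specht_seminormal[OF \<tau>, folded C_def]) (rule that)
  note sub = specht_closed(2)[of n q \<tau>]
  have fC: "finite C" unfolding C_def using finite_shape_words by blast
  define b where "b c = inv_into (specht n q \<tau>) R (delta c)" for c
  have dC: "delta c \<in> R ` specht n q \<tau>" if "c \<in> C" for c
    using that bij_betw_imp_surj_on[OF R(4)] by (auto simp: supported_def)
  have b: "b c \<in> specht n q \<tau>" "R (b c) = delta c" if "c \<in> C" for c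
    unfolding b_def by (rule inv_into_into[OF dC[OF that]], rule f_inv_into_f[OF dC[OF that]])
  have R0: "R 0 = (\<lambda>_. 0)" using R(2)[of 0 0] by (simp add: zero_fun_def)
  have Rsum: "R (\<Sum>i\<in>I. g i) = (\<lambda>c. \<Sum>i\<in>I. R (g i) c)" for I and g :: "int list \<Rightarrow> (nat \<Rightarrow> nat) \<Rightarrow> complex"
    by (induction I rule: infinite_finite_induct) (simp_all add: R0 R0[unfolded zero_fun_def] R(1) del: plus_fun_apply)
  show ?thesis
  proof (rule that[OF R b])
    fix v assume v: "v \<in> specht n q \<tau>"
    let ?s = "\<Sum>c\<in>C. hscale (R v c) (b c)"
    have "?s \<in> specht n q \<tau>" using b(1) by (intro hv.subspace_sum[OF sub] hv.subspace_scale[OF sub])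
    moreover have "R ?s = R v"
    proof
      fix c
      have "R ?s c = (\<Sum>c'\<in>C. if c' = c then R v c else 0)"
        unfolding Rsum R(2) by (intro sum.cong refl) (auto simp: b(2))
      also have "\<dots> = R v c" using fC bij_betwE[OF R(4)] v by (auto simp: supported_def)
      finally show "R ?s c = R v c" .
    qed
    ultimately show "v = ?s" using bij_betw_imp_inj_on[OF R(4)] v by (simp only: inj_on_eq_iff)
  qed
qed

locale standard_module =
  fixes n :: nat and \<tau> :: "nat list" and c :: real
  assumes \<tau>: "is_partition n \<tau>" and n: "n \<ge> 1" and irr: "c \<notin> \<rat>"
begin

sublocale one: quantum 1 by (rule quantum_one)

sublocale left_translation_module n "specht n 1 \<tau>"
  by unfold_locales (use specht_closed(2) specht_space[OF \<tau>] specht_one_translate[OF \<tau>] in auto)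

sublocale mv: vector_space mscale by (rule vector_space_mscale)

lemma poly_space_standard: "poly_space = standard_space n \<tau>"
  by (simp add: poly_space_def standard_space_def)

definition total :: "(nat \<Rightarrow>\<^sub>0 nat) \<Rightarrow> nat" where "total m = (\<Sum>i\<in>{1..n}. Lk m i)"

lemma standard_degree_iff:
  "F \<in> standard_degree n \<tau> d \<longleftrightarrow> F \<in> poly_space \<and> (\<forall>w m. Lk (F w) m \<noteq> 0 \<longrightarrow> total m = d)"
  by (auto simp: standard_degree_def poly_space_standard total_def in_keys_iff)

lemma total_zero: "total 0 = 0" by (simp add: total_def)

lemma total_unit: "i \<in> {1..n} \<Longrightarrow> total (unit_exp i + m) = Suc (total m)"
proof -
  assume i: "i \<in> {1..n}"
  have "total (unit_exp i + m) = (\<Sum>j\<in>{1..n}. (if j = i then 1 else 0) + Lk m j)"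
    unfolding total_def by (intro sum.cong) (auto simp: lookup_add lookup_single when_def)
  then show ?thesis using i by (simp add: sum.distrib total_def)
qed

lemma total_map_key: "u \<in> perms n \<Longrightarrow> total (Poly_Mapping.map_key u m) = total m"
proof -
  assume u: "u \<in> perms n"
  then have "bij_betw u {1..n} {1..n}" by (simp add: permutes_imp_bij)
  then show ?thesis unfolding total_def lookup_map_key[OF bij_is_inj[OF permsD[OF u]]]
    by (rule sum.reindex_bij_betw)
qed

lemma total_eq_0: "Poly_Mapping.keys m \<subseteq> {1..n} \<Longrightarrow> total m = 0 \<Longrightarrow> m = 0"
proof (rule poly_mapping_eqI)
  fix i assume k: "Poly_Mapping.keys m \<subseteq> {1..n}" and "total m = 0"
  then have z: "\<forall>i\<in>{1..n}. Lk m i = 0" unfolding total_def by (simp only: sum_eq_0_iff finite_atLeastAtMost)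
  have "Lk m i = 0"
  proof (cases "i \<in> {1..n}")
    case True
    then show ?thesis using z by blast
  next
    case False
    then have "i \<notin> Poly_Mapping.keys m" using k by blast
    then show ?thesis by (simp add: in_keys_iff)
  qed
  then show "Lk m i = Lk 0 i" by simp
qed

lemma degree_sub: "mv.subspace (standard_degree n \<tau> d)"
proof (rule mv.subspaceI)
  show "0 \<in> standard_degree n \<tau> d" unfolding standard_degree_iff using poly_space_0 by simp
  fix F G assume "F \<in> standard_degree n \<tau> d" "G \<in> standard_degree n \<tau> d"
  then have FG: "F \<in> poly_space" "G \<in> poly_space" "\<And>w m. Lk (F w) m \<noteq> 0 \<Longrightarrow> total m = d" "\<And>w m. Lk (G w) m \<noteq> 0 \<Longrightarrow> total m = d"
    unfolding standard_degree_iff by blast+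
  have "total m = d" if "Lk ((F + G) w) m \<noteq> 0" for w m
    using that FG(3,4)[of w m] by (cases "Lk (F w) m = 0") (auto simp: lookup_add)
  then show "F + G \<in> standard_degree n \<tau> d" unfolding standard_degree_iff using poly_space_add[OF FG(1,2)] by blast
next
  fix a F assume F: "F \<in> standard_degree n \<tau> d"
  then show "mscale a F \<in> standard_degree n \<tau> d"
    unfolding standard_degree_iff using poly_space_scale[of F a] by (auto simp: lookup_const_mult)
qed

lemma degree_x: "i \<in> {1..n} \<Longrightarrow> F \<in> standard_degree n \<tau> d \<Longrightarrow> standard_x i F \<in> standard_degree n \<tau> (Suc d)"
proof -
  assume i: "i \<in> {1..n}" and "F \<in> standard_degree n \<tau> d"
  then have F: "F \<in> poly_space" "\<And>w m. Lk (F w) m \<noteq> 0 \<Longrightarrow> total m = d" unfolding standard_degree_iff by blast+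
  have "total m = Suc d" if nz: "Lk (standard_x i F w) m \<noteq> 0" for w m
  proof -
    have "Lk m i > 0" "Lk (F w) (m - unit_exp i) \<noteq> 0"
      using nz by (auto simp: standard_x_var lookup_var_mult split: if_splits)
    then show ?thesis using add_unit_exp_eq[of i "m - unit_exp i" m] total_unit[OF i, of "m - unit_exp i"] F(2) by simp
  qed
  then show ?thesis unfolding standard_degree_iff using poly_space_x[OF i F(1)] by blast
qed

lemma degree_w: "u \<in> perms n \<Longrightarrow> F \<in> standard_degree n \<tau> d \<Longrightarrow> standard_w u F \<in> standard_degree n \<tau> d"
proof -
  assume u: "u \<in> perms n" and "F \<in> standard_degree n \<tau> d"
  then have F: "F \<in> poly_space" "\<And>w m. Lk (F w) m \<noteq> 0 \<Longrightarrow> total m = d" unfolding standard_degree_iff by blast+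
  have "total m = d" if "Lk (standard_w u F w) m \<noteq> 0" for w m
    using F(2)[of "inv_into UNIV u \<circ> w" "Poly_Mapping.map_key u m"] that total_map_key[OF u]
    by (simp add: standard_w_def lookup_permute_vars[OF permsD[OF u]])
  then show ?thesis unfolding standard_degree_iff using poly_space_w[OF F(1) u] by blast
qed

lemma degree_emb: "v \<in> specht n 1 \<tau> \<Longrightarrow> emb v \<in> standard_degree n \<tau> 0"
  unfolding standard_degree_iff using emb_space[of v] total_zero
  by (auto simp: emb_def lookup_single when_def)

lemma degree_0: "standard_degree n \<tau> 0 = emb ` specht n 1 \<tau>"
proof
  show "emb ` specht n 1 \<tau> \<subseteq> standard_degree n \<tau> 0" using degree_emb by blast
  show "standard_degree n \<tau> 0 \<subseteq> emb ` specht n 1 \<tau>"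
  proof
    fix F assume "F \<in> standard_degree n \<tau> 0"
    then have F: "F \<in> poly_space" "\<And>w m. Lk (F w) m \<noteq> 0 \<Longrightarrow> total m = 0" unfolding standard_degree_iff by blast+
    have z: "Lk (F w) m = 0" if m: "m \<noteq> 0" for w m
    proof (rule ccontr)
      assume nz: "Lk (F w) m \<noteq> 0"
      then have "Poly_Mapping.keys m \<subseteq> {1..n}" using F(1) by (auto simp: poly_space_def in_keys_iff)
      then show False using total_eq_0 F(2)[OF nz] m by blast
    qed
    have "F = emb (\<lambda>w. Lk (F w) 0)"
    proof
      fix w
      show "F w = emb (\<lambda>w. Lk (F w) 0) w"
        by (rule poly_mapping_eqI) (use z in \<open>auto simp: emb_def lookup_single when_def\<close>)
    qed
    moreover have "(\<lambda>w. Lk (F w) 0) \<in> specht n 1 \<tau>" using F(1) by (simp add: poly_space_def)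
    ultimately show "F \<in> emb ` specht n 1 \<tau>" by blast
  qed
qed

definition exponents :: "nat \<Rightarrow> (nat \<Rightarrow>\<^sub>0 nat) set" where
  "exponents d = {m. Poly_Mapping.keys m \<subseteq> {1..n} \<and> total m = d}"

lemma exponents_card: "finite (exponents d)" "card (exponents d) \<le> card (compositions n d)"
proof -
  define h where "h m = map (Lk m) [1..<Suc n]" for m :: "nat \<Rightarrow>\<^sub>0 nat"
  have s: "set [1..<Suc n] = {1..n}" unfolding set_upt by (rule atLeastLessThanSuc_atLeastAtMost)
  have inj: "inj_on h (exponents d)"
  proof
    fix a b assume ab: "a \<in> exponents d" "b \<in> exponents d" and h: "h a = h b"
    show "a = b"
    proof (rule poly_mapping_eqI)
      fix i
      show "Lk a i = Lk b i"
      proof (cases "i \<in> {1..n}")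
        case True
        then show ?thesis using h s unfolding h_def by (simp only: map_eq_conv)
      next
        case False
        then have "i \<notin> Poly_Mapping.keys a" "i \<notin> Poly_Mapping.keys b" using ab by (auto simp: exponents_def)
        then show ?thesis by (simp add: in_keys_iff)
      qed
    qed
  qed
  have sub: "h ` exponents d \<subseteq> compositions n d"
  proof (clarify)
    fix m assume "m \<in> exponents d"
    then have "(\<Sum>i\<in>{1..n}. Lk m i) = d" by (simp add: exponents_def total_def)
    then have "sum_list (h m) = d"
      unfolding h_def by (subst sum_list_distinct_conv_sum_set) (simp_all only: distinct_upt s)
    then show "h m \<in> compositions n d" by (simp add: h_def compositions_def)
  qed
  show "finite (exponents d)" using finite_imageD[OF finite_subset[OF sub finite_compositions] inj] .
  show "card (exponents d) \<le> card (compositions n d)"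
    using card_mono[OF finite_compositions sub] card_image[OF inj] by simp
qed

abbreviation C :: "int list set" where "C \<equiv> contents ` shape_words n (part_shape \<tau>)"

lemma finite_shape_contents: "finite C" using finite_shape_words by blast

text \<open>On the degree 0 part the partial sums of transpositions obey the recursion that defines
  \<open>jm\<close> at q = 1, so they act on Young's basis by its contents. The vectors are fixed
  before \<open>Y\<close> and the form are quantified in the last clause; the operator
  \<open>psum\<close> involves the group action alone.\<close>

lemma young_basis:
  obtains b where "\<And>cs. cs \<in> C \<Longrightarrow> b cs \<in> specht n 1 \<tau>" "\<And>cs. cs \<in> C \<Longrightarrow> b cs \<noteq> 0"
    "\<And>v. v \<in> specht n 1 \<tau> \<Longrightarrow> \<exists>f. v = (\<Sum>cs\<in>C. hscale (f cs) (b cs))"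
    "\<And>Y \<beta>' k cs. contravariant_module mscale poly_space \<beta>' n c standard_w standard_x Y \<Longrightarrow>
       k < n \<Longrightarrow> cs \<in> C \<Longrightarrow>
       contravariant_module.psum standard_w (Suc k) {1..<Suc k} (emb (b cs)) = mscale (of_int (cs ! k)) (emb (b cs))"
proof -
  obtain R b where R: "\<And>f g. R (f + g) = (\<lambda>c. R f c + R g c)"
    "\<And>a f. R (hscale a f) = (\<lambda>c. a * R f c)"
    "\<And>i f. \<lbrakk>f \<in> specht n 1 \<tau>; i \<in> {1..<n}\<rbrakk> \<Longrightarrow> R (hecke_gen n 1 i f) = one.top (i - 1) (R f)"
    "bij_betw R (specht n 1 \<tau>) (supported C)"
    and b: "\<And>c. c \<in> C \<Longrightarrow> b c \<in> specht n 1 \<tau>" "\<And>c. c \<in> C \<Longrightarrow> R (b c) = delta c"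
    "\<And>v. v \<in> specht n 1 \<tau> \<Longrightarrow> v = (\<Sum>c\<in>C. hscale (R v c) (b c))"
    by (rule one.specht_basis[OF \<tau>]) (rule that)
  note sub = specht_closed(2)[of n 1 \<tau>]
  have R0: "R 0 = (\<lambda>_. 0)" using R(2)[of 0 0] by (simp add: zero_fun_def)
  have dC: "delta cs \<in> supported C" if "cs \<in> C" for cs using that by (auto simp: supported_def)
  have Rinj: "inj_on R (specht n 1 \<tau>)" using R(4) by (simp add: bij_betw_def)
  show ?thesis
  proof (rule that[of b])
    fix cs assume cs: "cs \<in> C"
    show "b cs \<in> specht n 1 \<tau>" by (rule b(1)[OF cs])
    show "b cs \<noteq> 0"
    proof
      assume "b cs = 0"
      then have "delta cs = (\<lambda>_. 0)" using b(2)[OF cs] R0 by simp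
      then show False by (metis zero_neq_one)
    qed
  next
    fix v assume "v \<in> specht n 1 \<tau>"
    then show "\<exists>f. v = (\<Sum>cs\<in>C. hscale (f cs) (b cs))" using b(3) by blast
  next
    fix Y \<beta>' k cs assume K: "contravariant_module mscale poly_space \<beta>' n c standard_w standard_x Y" and k: "k < n" and cs: "cs \<in> C"
    interpret K: contravariant_module mscale poly_space \<beta>' n c standard_w standard_x Y by (rule K)
    have w: "standard_w (transp i (Suc i)) (emb v) = emb (hecke_gen n 1 i v)" if "i \<in> {1..<n}" "v \<in> specht n 1 \<tau>" for i v
      using that w_emb[OF permsD[OF K.simple_mem[OF that(1)]], of v] hecke_gen_one[OF subsetD[OF V_space that(2)] that(1)]
      by (simp add: inv_simple)
    have "\<exists>v'\<in>specht n 1 \<tau>. K.psum (Suc k) {1..<Suc k} (emb v) = emb v' \<and> R v' = one.jm k (R v)"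
      if "k < n" "v \<in> specht n 1 \<tau>" for k v
      using that
    proof (induction k arbitrary: v)
      case 0
      have "K.psum (Suc 0) {1..<Suc 0} (emb v) = emb 0" by (simp add: K.psum_def emb_def zero_fun_def)
      then show ?case using hv.subspace_0[OF sub] R0 by (intro bexI[of _ 0]) (simp_all only: one.jm.simps)
    next
      case (Suc k)
      let ?s = "transp (Suc k) (Suc (Suc k))" and ?h = "hecke_gen n 1 (Suc k)"
      have i: "Suc k \<in> {1..<n}" using Suc.prems by simp
      have hv: "?h v \<in> specht n 1 \<tau>" by (rule specht_closed(3)[OF i Suc.prems(2)])
      obtain v' where v': "v' \<in> specht n 1 \<tau>" "K.psum (Suc k) {1..<Suc k} (emb (?h v)) = emb v'" "R v' = one.jm k (R (?h v))"
        using Suc.IH[OF _ hv] Suc.prems by auto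
      have e: "{1..<Suc (Suc k)} = insert (Suc k) {1..<Suc k}" by auto
      have im: "?s ` {1..<Suc k} = {1..<Suc k}"
        by (rule image_cong[of _ _ _ id, simplified]) (auto simp: Transposition.transpose_def)
      have "K.psum (Suc (Suc k)) {1..<Suc k} (emb v) = standard_w ?s (K.psum (Suc k) {1..<Suc k} (emb (?h v)))"
      proof -
        have "standard_w ?s (emb (?h v)) = emb v"
        proof -
          have "standard_w ?s (emb (?h v)) = standard_w (?s \<circ> ?s) (emb v)"
            using K.W_comp[OF K.simple_mem[OF i] K.simple_mem[OF i] emb_space[OF Suc.prems(2)]] w[OF i Suc.prems(2)] by simp
          then show ?thesis by (simp add: w_id)
        qed
        then show ?thesis
          using K.W_psum[OF K.simple_mem[OF i] _ _ emb_space[OF hv], of "Suc k" "{1..<Suc k}"] i im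
            K.ltn[of "Suc k"] by (simp del: One_nat_def)
      qed
      then have ps: "K.psum (Suc (Suc k)) {1..<Suc k} (emb v) = emb (?h v')" unfolding v'(2) w[OF i v'(1)] .
      have hv': "?h v' \<in> specht n 1 \<tau>" by (rule specht_closed(3)[OF i v'(1)])
      have "K.psum (Suc (Suc k)) {1..<Suc (Suc k)} (emb v) = emb (?h v + ?h v')"
        unfolding e using ps w[OF i Suc.prems(2)]
        by (subst K.psum_insert) (auto simp: Transposition.transpose_commute[of "Suc (Suc k)"] emb_def fun_eq_iff single_add)
      moreover have "R (?h v + ?h v') = one.jm (Suc k) (R v)"
        using R(3)[OF Suc.prems(2) i] R(3)[OF v'(1) i] v'(3) by (simp add: R(1) add.commute del: plus_fun_apply)
      ultimately show ?case using hv.subspace_add[OF sub hv hv'] by blast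
    qed
    from this[OF k b(1)[OF cs]] obtain v' where v': "v' \<in> specht n 1 \<tau>"
        "K.psum (Suc k) {1..<Suc k} (emb (b cs)) = emb v'" "R v' = one.jm k (R (b cs))" by blast
    have "R v' = R (hscale (of_int (cs ! k)) (b cs))"
      unfolding v'(3) b(2)[OF cs] one.jm_eigen[OF swap_closed_shape k dC[OF cs]] R(2)
      by (auto simp: fun_eq_iff b(2)[OF cs] qint_def)
    then have "v' = hscale (of_int (cs ! k)) (b cs)"
      using Rinj v'(1) hv.subspace_scale[OF sub b(1)[OF cs]] by (auto simp: inj_on_def)
    then show "K.psum (Suc k) {1..<Suc k} (emb (b cs)) = mscale (of_int (cs ! k)) (emb (b cs))"
      using v'(2) by (simp add: emb_def mult_single del: single_of_int)
  qed
qed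

lemma single_sum: "Poly_Mapping.single m (\<Sum>i\<in>I. f i) = (\<Sum>i\<in>I. Poly_Mapping.single m (f i :: complex))"
  by (induction I rule: infinite_finite_induct) (simp_all add: single_add)

text \<open>Monomials times the vectors of Young's basis give the upper bound for the dimension. The
  orthogonal weight vectors provide the matching lower bound.\<close>

lemma degree_span:
  assumes b: "\<And>v. v \<in> specht n 1 \<tau> \<Longrightarrow> \<exists>f. v = (\<Sum>cs\<in>C. hscale (f cs) (b cs))"
  shows "\<exists>T. finite T \<and> standard_degree n \<tau> d \<subseteq> mv.span T \<and> card T \<le> card (compositions n d \<times> C)"
proof -
  define t where "t p = (\<lambda>w. Poly_Mapping.single (fst p) (b (snd p) w))" for p :: "(nat \<Rightarrow>\<^sub>0 nat) \<times> int list"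
  let ?T = "t ` (exponents d \<times> C)"
  have fin: "finite (exponents d \<times> C)" using exponents_card(1) finite_shape_contents by blast
  have "card ?T \<le> card (exponents d \<times> C)" by (rule card_image_le[OF fin])
  also have "\<dots> \<le> card (compositions n d \<times> C)" using exponents_card(2) by (simp add: card_cartesian_product)
  finally have "card ?T \<le> card (compositions n d \<times> C)" .
  moreover have "standard_degree n \<tau> d \<subseteq> mv.span ?T"
  proof
    fix F assume "F \<in> standard_degree n \<tau> d"
    then have F: "F \<in> poly_space" "\<And>w m. Lk (F w) m \<noteq> 0 \<Longrightarrow> total m = d" unfolding standard_degree_iff by blast+
    have "(\<lambda>w. Poly_Mapping.single m (Lk (F w) m)) \<in> mv.span ?T" if m: "m \<in> (\<Union>w. Poly_Mapping.keys (F w))" for m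
    proof -
      have me: "m \<in> exponents d" using m F unfolding exponents_def poly_space_def by (blast dest: in_keys_iff[THEN iffD1])
      have "(\<lambda>w. Lk (F w) m) \<in> specht n 1 \<tau>" using F(1) by (simp add: poly_space_def)
      from b[OF this] obtain f where f: "(\<lambda>w. Lk (F w) m) = (\<Sum>cs\<in>C. hscale (f cs) (b cs))" by blast
      have "(\<lambda>w. Poly_Mapping.single m (Lk (F w) m)) = (\<Sum>cs\<in>C. mscale (f cs) (t (m, cs)))"
      proof
        fix w
        have "Lk (F w) m = (\<Sum>cs\<in>C. f cs * b cs w)" using fun_cong[OF f, of w] by (simp add: sum_apply)
        then show "Poly_Mapping.single m (Lk (F w) m) = (\<Sum>cs\<in>C. mscale (f cs) (t (m, cs))) w"
          by (simp add: sum_apply t_def mult_single single_sum)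
      qed
      also have "\<dots> \<in> mv.span ?T" by (intro mv.span_sum mv.span_scale mv.span_base) (use me in blast)
      finally show ?thesis .
    qed
    then show "F \<in> mv.span ?T" by (subst poly_space_expand[OF F(1)]) (intro mv.span_sum)
  qed
  ultimately show ?thesis using fin by blast
qed

lemma space_span: "u \<in> poly_space \<Longrightarrow> \<exists>N. u \<in> mv.span (\<Union>d\<le>N. standard_degree n \<tau> d)"
proof -
  assume u: "u \<in> poly_space"
  let ?K = "\<Union>w. Poly_Mapping.keys (u w)"
  note fin = poly_space_support[OF u]
  define N where "N = (\<Sum>m\<in>?K. total m)"
  have "(\<lambda>w. Poly_Mapping.single m (Lk (u w) m)) \<in> mv.span (\<Union>d\<le>N. standard_degree n \<tau> d)" if m: "m \<in> ?K" for m
  proof (rule mv.span_base)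
    have v: "(\<lambda>w. Lk (u w) m) \<in> specht n 1 \<tau>" "Poly_Mapping.keys m \<subseteq> {1..n}" using u m by (auto simp: poly_space_def)
    have "(\<lambda>w. Poly_Mapping.single m (Lk (u w) m)) \<in> poly_space"
      using poly_space_mono_induct[OF _ _ v, of "\<lambda>_. True"] by simp
    then have "(\<lambda>w. Poly_Mapping.single m (Lk (u w) m)) \<in> standard_degree n \<tau> (total m)"
      unfolding standard_degree_iff by (auto simp: lookup_single when_def)
    moreover have "total m \<le> N" unfolding N_def by (rule member_le_sum) (use m fin in auto)
    ultimately show "(\<lambda>w. Poly_Mapping.single m (Lk (u w) m)) \<in> (\<Union>d\<le>N. standard_degree n \<tau> d)" by blast
  qed
  then show ?thesis by (intro exI[of _ N], subst poly_space_expand[OF u]) (intro mv.span_sum)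
qed

text \<open>The form is left general, since the result is applied twice: its first part shows that
  \<open>cform\<close> is nondegenerate, so that a contravariant form exists, and its second part
  evaluates the signature of the chosen form.\<close>

lemma contravariant_signature:
  assumes Y: "is_standard_y n c \<tau> Y" and herm: "hermitian_form mscale poly_space \<beta>"
    and inv: "\<And>w u v. w \<in> perms n \<Longrightarrow> u \<in> poly_space \<Longrightarrow> v \<in> poly_space \<Longrightarrow> \<beta> (standard_w w u) (standard_w w v) = \<beta> u v"
    and con: "\<And>i u v. i \<in> {1..n} \<Longrightarrow> u \<in> poly_space \<Longrightarrow> v \<in> poly_space \<Longrightarrow> \<beta> (standard_x i u) v = \<beta> u (Y i v)"
    and pos: "positive_definite (standard_degree n \<tau> 0) \<beta>"
  shows "nondegenerate poly_space \<beta>"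
    "form_signature mscale (standard_degree n \<tau> d) \<beta> = (\<Sum>a\<in>compositions n d. \<Sum>cs\<in>C. path_sign c [] cs a)"
proof -
  have ch: "cherednik_module n c mscale poly_space standard_w standard_x Y"
    and Y0: "\<And>i v. i \<in> {1..n} \<Longrightarrow> v \<in> standard_degree n \<tau> 0 \<Longrightarrow> Y i v = 0"
    using Y by (auto simp: is_standard_y_def poly_space_standard)
  have K: "contravariant_module mscale poly_space \<beta> n c standard_w standard_x Y"
    by unfold_locales (use ch[unfolded cherednik_module_def, THEN conjunct1] ch herm inv con n irr in blast)+
  interpret K: contravariant_module mscale poly_space \<beta> n c standard_w standard_x Y by (rule K)
  obtain b where b: "\<And>cs. cs \<in> C \<Longrightarrow> b cs \<in> specht n 1 \<tau>" "\<And>cs. cs \<in> C \<Longrightarrow> b cs \<noteq> 0"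
    "\<And>v. v \<in> specht n 1 \<tau> \<Longrightarrow> \<exists>f. v = (\<Sum>cs\<in>C. hscale (f cs) (b cs))"
    "\<And>Y \<beta>' k cs. contravariant_module mscale poly_space \<beta>' n c standard_w standard_x Y \<Longrightarrow>
       k < n \<Longrightarrow> cs \<in> C \<Longrightarrow>
       contravariant_module.psum standard_w (Suc k) {1..<Suc k} (emb (b cs)) = mscale (of_int (cs ! k)) (emb (b cs))"
    by (rule young_basis) (rule that)
  have "K.weight (map (Pair 0) cs) (emb (b cs))" if cs: "cs \<in> C" for cs
    unfolding K.weight_def
  proof (intro conjI allI impI)
    show len: "length (map (Pair 0) cs) = n" using swap_closed_length[OF swap_closed_shape cs] by simp
    show "emb (b cs) \<in> poly_space" by (rule emb_space[OF b(1)[OF cs]])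
    fix k assume k: "k < n"
    have "standard_x (Suc k) (Y (Suc k) (emb (b cs))) = 0"
      using Y0[OF _ degree_emb[OF b(1)[OF cs]], of "Suc k"] k by (simp add: standard_x_def zero_fun_def)
    then have "K.zop (Suc k) (emb (b cs)) = emb (b cs) + mscale (- of_real c) (mscale (of_int (cs ! k)) (emb (b cs)))"
      unfolding K.zop_def b(4)[OF K k cs] by (simp only: add_0)
    also have "\<dots> = mscale (of_real (content_weight c (map (Pair 0) cs ! k))) (emb (b cs))"
      using k len by (auto simp: fun_eq_iff emb_def mult_single single_add[symmetric] content_weight_def algebra_simps simp del: single_of_int)
    finally show "K.zop (Suc k) (emb (b cs)) = mscale (of_real (content_weight c (map (Pair 0) cs ! k))) (emb (b cs))" .
  qed
  note wt = this
  interpret G: graded_contravariant mscale poly_space \<beta> n c standard_w standard_x Y "standard_degree n \<tau>" C "\<lambda>cs. emb (b cs)"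
  proof unfold_locales
    show "mv.subspace (standard_degree n \<tau> d)" for d by (rule degree_sub)
    show "standard_degree n \<tau> d \<subseteq> poly_space" for d unfolding standard_degree_iff[THEN ext] by (auto simp: standard_degree_iff)
    show "finite C" by (rule finite_shape_contents)
    fix cs assume cs: "cs \<in> C"
    show "emb (b cs) \<in> standard_degree n \<tau> 0" by (rule degree_emb[OF b(1)[OF cs]])
    have "emb (b cs) \<noteq> 0"
    proof
      assume e: "emb (b cs) = 0"
      have "b cs w = 0" for w using arg_cong[OF fun_cong[OF e, of w], of "\<lambda>p. Lk p 0"] by (simp add: emb_def)
      then show False using b(2)[OF cs] by (auto simp: fun_eq_iff)
    qed
    then show "0 < Re (\<beta> (emb (b cs)) (emb (b cs)))"
      using pos degree_emb[OF b(1)[OF cs]] by (auto simp: positive_definite_def)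
  qed (use degree_x degree_w wt in blast)+
  have idx: "G.index d = compositions n d \<times> C" for d by (simp add: G.index_def compositions_def)
  have T: "\<exists>T. finite T \<and> standard_degree n \<tau> d \<subseteq> mv.span T \<and> card T \<le> card (G.index d)" for d
    unfolding idx by (rule degree_span[OF b(3)])
  show "nondegenerate poly_space \<beta>" by (rule G.graded_nondegenerate[OF T space_span])
  obtain T where "finite T" "standard_degree n \<tau> d \<subseteq> mv.span T" "card T \<le> card (G.index d)" using T by blast
  from G.graded_signature[OF this] show "form_signature mscale (standard_degree n \<tau> d) \<beta> = (\<Sum>a\<in>compositions n d. \<Sum>cs\<in>C. path_sign c [] cs a)"
    unfolding idx by (simp add: sum.cartesian_product case_prod_unfold)
qed

lemma standard_y: "is_standard_y n c \<tau> (standard_y n c \<tau>)"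
proof -
  have "is_standard_y n c \<tau> (dunkl c)"
    unfolding is_standard_y_def degree_0 using cherednik_dunkl[of c] dunkl_emb by (auto simp: poly_space_standard)
  then show ?thesis unfolding standard_y_def by (rule someI[of "is_standard_y n c \<tau>"])
qed

text \<open>The form \<open>cform\<close> of the chosen operators \<open>standard_y\<close> is a
  witness for the choice: contravariance is built into it, and its nondegeneracy comes from the
  weight basis.\<close>

lemma standard_form: "contravariant_form n c \<tau> (standard_form n c \<tau>)"
proof -
  let ?Y = "standard_y n c \<tau>"
  interpret P: cherednik_poly n "specht n 1 \<tau>" c ?Y
    by unfold_locales (use standard_y degree_emb in \<open>auto simp: is_standard_y_def poly_space_standard\<close>)
  have z: "emb 0 = 0" by (simp add: emb_def fun_eq_iff)
  have pos: "positive_definite (standard_degree n \<tau> 0) P.cform"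
    unfolding positive_definite_def degree_0 using P.cform_positive z by auto
  have "nondegenerate poly_space P.cform"
    by (rule contravariant_signature[OF standard_y P.hermitian_cform P.cform_w P.cform_x_left pos])
  then have "contravariant_form n c \<tau> P.cform"
    unfolding contravariant_form_def poly_space_standard[symmetric]
    using P.hermitian_cform P.cform_w P.cform_x_left pos by blast
  then show ?thesis unfolding standard_form_def by (rule someI[of "contravariant_form n c \<tau>"])
qed

theorem standard_signature:
  "form_signature mscale (standard_degree n \<tau> d) (standard_form n c \<tau>) = (\<Sum>a\<in>compositions n d. \<Sum>cs\<in>C. path_sign c [] cs a)"
  using standard_form contravariant_signature(2)[OF standard_y, of "standard_form n c \<tau>" d]
  unfolding contravariant_form_def poly_space_standard by blast

end


section \<open>The invariant form on the Hecke side\<close>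

text \<open>For large K this is the sign of 1/\<Gamma>(1 - c y), by Gauss's product for the Gamma
  function.\<close>

definition cut_sign :: "real \<Rightarrow> nat \<Rightarrow> int \<Rightarrow> int" where
  "cut_sign c K y = (\<Prod>m<K. sg (real m + 1 - c * of_int y))"

lemma sg_nonneg_mult: "0 < a \<Longrightarrow> sg (a * b) = sg b"
  by (auto simp: sg_def zero_less_mult_iff mult_less_0_iff)

lemma sg_minus: "sg (- a) = - sg a"
  by (simp add: sg_def)

text \<open>With x = m + 1 - c d, the factor 1 - (c/x)^2 has the sign of (x - c)(x + c), and
  shifting x by c shifts the content difference d by one.\<close>

lemma pass_sign_cut:
  assumes "c \<notin> \<rat>"
  shows "(\<Prod>m<K. pass_sign c m d) = cut_sign c K (d + 1) * cut_sign c K (d - 1)"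
proof -
  have "pass_sign c m d = sg (real m + 1 - c * of_int (d + 1)) * sg (real m + 1 - c * of_int (d - 1))" for m
  proof -
    define x where "x = real m + 1 - c * of_int d"
    have "real (Suc m) \<noteq> c * of_int d" unfolding irrational_mult_eq[OF assms] by simp
    then have x: "x \<noteq> 0" by (simp add: x_def)
    have "sg (x\<^sup>2 * (1 - (c / x)\<^sup>2)) = pass_sign c m d"
      unfolding pass_sign_def x_def[symmetric] using x by (intro sg_nonneg_mult) simp
    moreover have "x\<^sup>2 * (1 - (c / x)\<^sup>2) = (x - c) * (x + c)"
      using x by (simp add: field_simps power2_eq_square)
    ultimately have "pass_sign c m d = sg (x - c) * sg (x + c)" by (simp add: sg_mult)
    then show ?thesis by (simp add: x_def algebra_simps)
  qed
  then show ?thesis by (simp add: cut_sign_def prod.distrib)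
qed

text \<open>The factor m + 1 - x is negative for exactly the first floor(x) values of m, and the
  sine changes its sign at exactly that many integers between 0 and x.\<close>

lemma cut_sin:
  assumes "x > 0" "x \<notin> \<int>" "x \<le> real K"
  shows "(\<Prod>m<K. sg (real m + 1 - x) * sg (real m + 1 + x)) = sg (sin (pi * x))"
proof -
  define N where "N = nat \<lfloor>x\<rfloor>"
  have N: "real N \<le> x" "x < real N + 1" using assms(1) by (auto simp: N_def)
  have Nx: "real N < x" using N(1) assms(2) by (metis Ints_of_nat order_le_less)
  have NK: "N \<le> K" using Nx assms(3) by linarith
  have f: "sg (real m + 1 - x) * sg (real m + 1 + x) = (if m < N then - 1 else 1)" for m
  proof (cases "m < N")
    case True
    then have "real m + 1 \<le> real N" by linarith
    then show ?thesis using True Nx assms(1) by (simp add: sg_def)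
  next
    case False
    then have "real N \<le> real m" by simp
    then show ?thesis using False N(2) assms(1) by (simp add: sg_def)
  qed
  have "(\<Prod>m<K. if m < N then - 1 else 1 :: int) = (\<Prod>m<N. - 1)"
    by (rule prod.mono_neutral_cong_right) (use NK in auto)
  then have l: "(\<Prod>m<K. sg (real m + 1 - x) * sg (real m + 1 + x)) = (- 1) ^ N" unfolding f by simp
  have "sin (pi * x) = sin (pi * (x - real N) + real N * pi)" by (simp add: algebra_simps)
  also have "\<dots> = (- 1) ^ N * sin (pi * (x - real N))"
    by (simp add: sin_add sin_npi cos_npi mult.commute)
  finally have s: "sin (pi * x) = (- 1) ^ N * sin (pi * (x - real N))" .
  have "sin (pi * (x - real N)) > 0"
  proof (rule sin_gt_zero)
    show "0 < pi * (x - real N)" using Nx by simp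
    show "pi * (x - real N) < pi" using N(2) by simp
  qed
  then have "sg (sin (pi * x)) = (- 1) ^ N"
    unfolding s by (cases "even N") (auto simp: sg_def)
  then show ?thesis using l by simp
qed

lemma irrational_not_int: "c \<notin> \<rat> \<Longrightarrow> y \<noteq> 0 \<Longrightarrow> (c::real) * of_int y \<notin> \<int>"
proof
  assume c: "c \<notin> \<rat>" "y \<noteq> 0" and "c * of_int y \<in> \<int>"
  then obtain a where "of_int a = c * of_int y" by (metis Ints_cases)
  then show False using c irrational_mult_eq'[OF c(1), of a y] by simp
qed

lemma sin_nonzero:
  assumes "c \<notin> \<rat>" "y \<noteq> 0"
  shows "sin (pi * (c * of_int y)) \<noteq> 0"
proof
  assume "sin (pi * (c * of_int y)) = 0"
  then obtain i where "pi * (c * of_int y) = of_int i * pi" unfolding sin_zero_iff_int2 by blast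
  then have "of_int i = c * of_int y" by simp
  then show False using irrational_mult_eq'[OF assms(1), of i y] assms(2) by simp
qed

text \<open>The reflection formula of the Gamma function, reduced to signs. Negative arguments
  follow because the product is even in x and both factors on the right are odd.\<close>

lemma cut_sign_reflect:
  assumes c: "c \<notin> \<rat>" and y: "y \<noteq> 0" and K: "\<bar>c * of_int y\<bar> \<le> real K"
  shows "cut_sign c K y * cut_sign c K (- y) = sg (c * of_int y) * sg (sin (pi * (c * of_int y)))"
proof -
  define x where "x = c * of_int y"
  have x: "x \<notin> \<int>" "\<bar>x\<bar> \<le> real K" using irrational_not_int[OF c y] K by (auto simp: x_def)
  have p: "cut_sign c K y * cut_sign c K (- y) = (\<Prod>m<K. sg (real m + 1 - x) * sg (real m + 1 + x))"
    by (simp add: cut_sign_def x_def prod.distrib)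
  show ?thesis
  proof (cases "x > 0")
    case True
    then show ?thesis unfolding p x_def[symmetric] using cut_sin[of x K] x by (simp add: sg_def)
  next
    case False
    then have "x < 0" using x(1) by (cases "x = 0") auto
    moreover have "- x \<notin> \<int>" using x(1) by (metis Ints_minus minus_minus)
    ultimately have "(\<Prod>m<K. sg (real m + 1 - - x) * sg (real m + 1 + - x)) = sg (sin (pi * - x))"
      using cut_sin[of "- x" K] x(2) by simp
    then show ?thesis unfolding p x_def[symmetric] using \<open>x < 0\<close> by (simp add: sg_minus mult.commute) (simp add: sg_def)
  qed
qed

definition root_sin :: "real \<Rightarrow> int \<Rightarrow> real" where
  "root_sin c y = sin (pi * (c * of_int y))"

text \<open>Unitarity of the \<open>T\<^sub>i\<close> forces the ratio \<open>\<psi>(-d)/\<psi>(d) = sin(\<pi>c(d+1))/sin(\<pi>c(d-1))\<close> for the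
  weights \<open>\<psi>\<close> of pairs of contents with difference \<open>d\<close>. By the reflection formula above, the limits
  of the Cherednik signs have this ratio up to positive factors.\<close>

definition pair_weight :: "real \<Rightarrow> nat \<Rightarrow> int \<Rightarrow> real" where
  "pair_weight c K d = of_int (\<Prod>m<K. pass_sign c m d) * (if d = 1 then 1 else \<bar>root_sin c (d - 1)\<bar>)"

lemma sg_of_int_unit: "s * s = 1 \<Longrightarrow> sg (of_int s) = s"
proof -
  assume "s * s = (1::int)"
  then have "s = 1 \<or> s = - 1" by (simp add: square_eq_1_iff)
  then show ?thesis by (auto simp: sg_def)
qed

lemma prod_pass_square: "c \<notin> \<rat> \<Longrightarrow> (\<Prod>m<K. pass_sign c m d) * (\<Prod>m<K. pass_sign c m d) = 1"
  by (simp add: pass_sign_square flip: prod.distrib)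

lemma cut_sign_square: "c \<notin> \<rat> \<Longrightarrow> cut_sign c K y * cut_sign c K y = 1"
proof -
  assume c: "c \<notin> \<rat>"
  have "sg (real m + 1 - c * of_int y) * sg (real m + 1 - c * of_int y) = 1" for m
    using sg_square[OF content_weight_nonzero[OF c, of "(m, y)"]] by (simp add: content_weight_def)
  then show ?thesis by (simp add: cut_sign_def flip: prod.distrib)
qed

lemma sg_pair_weight: "c \<notin> \<rat> \<Longrightarrow> sg (pair_weight c K d) = (\<Prod>m<K. pass_sign c m d)"
proof -
  assume c: "c \<notin> \<rat>"
  have "sg (if d = 1 then 1 else \<bar>root_sin c (d - 1)\<bar>) = 1"
    using sin_nonzero[OF c, of "d - 1"] by (auto simp: sg_def root_sin_def)
  then show ?thesis unfolding pair_weight_def sg_mult sg_of_int_unit[OF prod_pass_square[OF c]] by simp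
qed

text \<open>The signs for d and -d regroup into the pairs d + 1, -(d + 1) and d - 1, -(d - 1), to
  which the reflection formula applies. Its algebraic factors disappear, because (d + 1)(d - 1) is
  positive for these d. The absolute values of sines in \<open>pair_weight\<close> promote the
  equality of signs to one of real numbers; its special value at d = 1 keeps the weight nonzero
  where the sine vanishes.\<close>

lemma pair_weight_ratio:
  assumes c: "c \<notin> \<rat>" and d: "\<bar>d\<bar> \<ge> 2"
    and K: "\<bar>c * of_int (d + 1)\<bar> \<le> real K" "\<bar>c * of_int (d - 1)\<bar> \<le> real K"
  shows "pair_weight c K d * root_sin c (d + 1) = pair_weight c K (- d) * root_sin c (d - 1)"
proof -
  define a b where "a = root_sin c (d + 1)" and "b = root_sin c (d - 1)"
  define s s' where "s = (\<Prod>m<K. pass_sign c m d)" and "s' = (\<Prod>m<K. pass_sign c m (- d))"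
  have ab: "a \<noteq> 0" "b \<noteq> 0" using sin_nonzero[OF c, of "d + 1"] sin_nonzero[OF c, of "d - 1"] d
    by (auto simp: a_def b_def root_sin_def)
  have "s * s' = (cut_sign c K (d + 1) * cut_sign c K (- (d + 1))) * (cut_sign c K (d - 1) * cut_sign c K (- (d - 1)))"
    unfolding s_def s'_def pass_sign_cut[OF c] by (simp add: mult_ac)
  also have "\<dots> = (sg (c * of_int (d + 1)) * sg a) * (sg (c * of_int (d - 1)) * sg b)"
    using cut_sign_reflect[OF c _ K(1)] cut_sign_reflect[OF c _ K(2)] d by (simp add: a_def b_def root_sin_def)
  also have "\<dots> = sg (c * c * (of_int (d + 1) * of_int (d - 1))) * (sg a * sg b)"
    by (simp add: sg_mult mult_ac)
  also have "sg (c * c * (of_int (d + 1) * of_int (d - 1))) = 1"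
  proof -
    have "c \<noteq> 0" using c by auto
    moreover have "0 < (of_int (d + 1) * of_int (d - 1) :: real)"
    proof (cases "d > 0")
      case True
      then show ?thesis using d by simp
    next
      case False
      then show ?thesis using d by (intro mult_neg_neg) simp_all
    qed
    moreover have "0 < c * c" using \<open>c \<noteq> 0\<close> by (metis not_square_less_zero linorder_neqE mult_eq_0_iff)
    ultimately have "0 < c * c * (of_int (d + 1) * of_int (d - 1))" by (metis mult_pos_pos)
    then show ?thesis unfolding sg_def by (rule if_P)
  qed
  finally have ss: "s * s' = sg a * sg b" by simp
  have "s * sg a = s' * sg b"
  proof -
    have "s' * s' = 1" "sg a * sg a = 1" using prod_pass_square[OF c] sg_square[OF ab(1)] by (auto simp: s'_def)
    have "s * sg a = s * sg a * (s' * s')" by (simp add: \<open>s' * s' = 1\<close>)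
    also have "\<dots> = (s * s') * (s' * sg a)" by (simp only: mult_ac)
    also have "\<dots> = s' * sg b * (sg a * sg a)" unfolding ss by (simp only: mult_ac)
    finally show ?thesis by (simp add: \<open>sg a * sg a = 1\<close>)
  qed
  then have "(of_int s :: real) * of_int (sg a) = of_int s' * of_int (sg b)" by (metis of_int_mult)
  moreover have "a = of_int (sg a) * \<bar>a\<bar>" "b = of_int (sg b) * \<bar>b\<bar>" by (auto simp: sg_def)
  ultimately have "of_int s * \<bar>b\<bar> * a = of_int s' * \<bar>a\<bar> * b"
    by (metis (no_types, opaque_lifting) mult.assoc mult.commute)
  moreover have "pi * (c * of_int (- d - 1)) = - (pi * (c * of_int (d + 1)))" by (simp add: algebra_simps)
  then have "root_sin c (- d - 1) = - a" unfolding a_def root_sin_def by (simp only: sin_minus)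
  ultimately show ?thesis using d unfolding pair_weight_def s_def[symmetric] s'_def[symmetric] a_def[symmetric] b_def[symmetric]
    by (auto simp: a_def[symmetric] b_def[symmetric])
qed

text \<open>A real-valued lift of \<open>limit_sign\<close>: the same signs, with absolute values
  that make it an exact solution of the invariance condition on adjacent swaps.\<close>

fun content_norm :: "real \<Rightarrow> nat \<Rightarrow> int list \<Rightarrow> int list \<Rightarrow> real" where
  "content_norm c K pre (x # xs) = of_int (cut_sign c K x) * (\<Prod>l\<leftarrow>pre. pair_weight c K (x - l)) * content_norm c K (pre @ [x]) xs"
| "content_norm c K pre [] = 1"

lemma content_norm_mset: "mset pre = mset pre' \<Longrightarrow> content_norm c K pre xs = content_norm c K pre' xs"
proof (induction xs arbitrary: pre pre')
  case (Cons x xs)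
  have "(\<Prod>l\<leftarrow>pre. pair_weight c K (x - l)) = (\<Prod>l\<leftarrow>pre'. pair_weight c K (x - l))"
    using arg_cong[OF Cons.prems, of "\<lambda>M. prod_mset (image_mset (\<lambda>l. pair_weight c K (x - l)) M)"]
    by (simp only: mset_map[symmetric] prod_mset_prod_list)
  moreover have "content_norm c K (pre @ [x]) xs = content_norm c K (pre' @ [x]) xs"
    by (rule Cons.IH) (simp add: Cons.prems)
  ultimately show ?case by simp
qed simp

text \<open>Every single entry and every pair of entries has the same factor on both sides, except
  for the pair at k and k + 1, whose order is reversed.\<close>

lemma content_norm_swap:
  "Suc k < length cs \<Longrightarrow>
   pair_weight c K (- axial cs k) * content_norm c K pre cs = pair_weight c K (axial cs k) * content_norm c K pre (swap_at k cs)"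
proof (induction k arbitrary: cs pre)
  case 0
  then obtain x y xs where cs: "cs = x # y # xs" by (cases cs; cases "tl cs") auto
  have "content_norm c K (pre @ [x, y]) xs = content_norm c K (pre @ [y, x]) xs" by (rule content_norm_mset) simp
  then show ?case by (simp add: cs swap_at_0 axial_def mult_ac)
next
  case (Suc k)
  then obtain x xs where cs: "cs = x # xs" "Suc k < length xs" by (cases cs) auto
  have "axial cs (Suc k) = axial xs k" by (simp add: cs axial_def)
  then show ?case using Suc.IH[OF cs(2), of "pre @ [x]"] by (simp add: cs(1) swap_at_Suc mult_ac)
qed

lemma sg_content_norm:
  assumes "c \<notin> \<rat>"
  shows "sg (content_norm c K pre xs) = limit_sign c K pre xs"
proof (induction xs arbitrary: pre)
  case (Cons x xs)
  have p: "sg (\<Prod>l\<leftarrow>pre. pair_weight c K (x - l)) = (\<Prod>l\<leftarrow>pre. \<Prod>m<K. pass_sign c m (x - l))"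
    by (induction pre) (simp_all add: sg_mult sg_pair_weight[OF assms], simp add: sg_def)
  have "(\<Prod>m<K. \<Prod>l\<leftarrow>pre. pass_sign c m (x - l)) = (\<Prod>l\<leftarrow>pre. \<Prod>m<K. pass_sign c m (x - l))"
    by (induction pre) (simp_all add: prod.distrib)
  then have "level_sign c pre (K, x) = cut_sign c K x * (\<Prod>l\<leftarrow>pre. \<Prod>m<K. pass_sign c m (x - l))"
    by (simp add: level_sign_def move_sign_def prod.distrib cut_sign_def content_weight_def)
  then show ?case using Cons by (simp add: sg_mult p sg_of_int_unit[OF cut_sign_square[OF assms]])
qed (simp add: sg_def)

section \<open>Unitarity in Young's seminormal basis\<close>

lemma cis_powi: "cis a powi d = cis (of_int d * a)"
  by (cases d rule: int_cases2) (simp_all add: DeMoivre power_int_minus cis_inverse)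

lemma cis_diff: "cis (2 * a) - cis (2 * b) = 2 * \<i> * cis (a + b) * of_real (sin (a - b))"
proof -
  have "cis (2 * a) = cis (a + b) * cis (a - b)" "cis (2 * b) = cis (a + b) * cis (b - a)"
    by (simp_all add: cis_mult)
  moreover have "cis (a - b) - cis (b - a) = 2 * \<i> * of_real (sin (a - b))"
    using sin_minus[of "a - b"] cos_minus[of "a - b"] by (simp add: complex_eq_iff)
  ultimately show ?thesis by (simp add: right_diff_distrib[symmetric] algebra_simps)
qed

locale unit_quantum =
  fixes c :: real and q :: complex
  assumes irr: "c \<notin> \<rat>" and q_cis: "q = cis (2 * pi * c)"
begin

lemma powi_cis: "q powi d = cis (2 * (pi * (c * of_int d)))"
  unfolding q_cis cis_powi by (simp add: mult_ac)

lemma powi_ne_1: "d \<noteq> 0 \<Longrightarrow> q powi d \<noteq> 1"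
  using cis_diff[of "pi * (c * of_int d)" 0] sin_nonzero[OF irr, of d] by (auto simp: powi_cis)

lemma q_ne_1: "q \<noteq> 1" using powi_ne_1[of 1] by simp

sublocale quantum q
  by unfold_locales (use powi_ne_1 q_ne_1 in \<open>auto simp: qint_def q_cis\<close>)

lemma cnj_powi: "cnj (q powi d) = inverse (q powi d)"
  by (simp add: powi_cis cis_cnj cis_inverse)

text \<open>Unitarity says that T is the adjoint of its inverse (T - (q - 1))/q. As the conjugate of
  q is 1/q, this reads T = q T* - 1 + q, stated here for the diagonal entries.\<close>

lemma dcoef_unitary:
  assumes d: "d \<noteq> 0"
  shows "dcoef d = q * cnj (dcoef d) - 1 + q"
proof -
  define z where "z = q powi d"
  have z: "z \<noteq> 0" "z \<noteq> 1" and q: "q \<noteq> 0" "q \<noteq> 1" using powi_ne_1[OF d] q0 q_ne_1 by (auto simp: z_def)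
  have cn: "cnj z = inverse z" "cnj q = inverse q" using cnj_powi[of d] cnj_powi[of 1] by (simp_all add: z_def)
  have t: "dcoef d = z * (q - 1) / (z - 1)" using q by (simp add: dcoef_def qint_def z_def)
  have "cnj (dcoef d) = inverse z * (inverse q - 1) / (inverse z - 1)" unfolding t by (simp add: cn)
  also have "\<dots> = (q - 1) / (q * (z - 1))"
  proof -
    have "inverse z - 1 = (1 - z) / z" "inverse q - 1 = (1 - q) / q" using z q by (simp_all add: field_simps)
    then show ?thesis using z q by (simp add: divide_simps) (simp add: algebra_simps)
  qed
  finally have "q * cnj (dcoef d) = (q - 1) / (z - 1)" using q by simp
  moreover have "z * (q - 1) / (z - 1) = (q - 1) / (z - 1) - 1 + q" using z by (simp add: field_simps)
  ultimately show ?thesis unfolding t by simp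
qed

text \<open>The off-diagonal part of the same equation. With z = q^d, the numbers q z - 1 and z - q
  are one common phase factor times sin(\<pi>c(d+1)) and sin(\<pi>c(d-1)), so what remains is a
  condition on a quotient of real weights.\<close>

lemma ocoef_unitary:
  assumes d: "\<bar>d\<bar> \<ge> 2" and h: "root_sin c (d + 1) * h = root_sin c (d - 1) * h'"
  shows "ocoef (- d) * of_real h' = q * cnj (ocoef d) * of_real h"
proof -
  define z where "z = q powi d"
  have d0: "d \<noteq> 0" using d by auto
  have z: "z \<noteq> 0" "z \<noteq> 1" and q: "q \<noteq> 0" "q \<noteq> 1" using powi_ne_1[OF d0] q0 q_ne_1 by (auto simp: z_def)
  have cn: "cnj z = inverse z" "cnj q = inverse q" using cnj_powi[of d] cnj_powi[of 1] by (simp_all add: z_def)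
  have p12: "q powi (d + 1) = q * z" "q powi (- d) = inverse z"
    using q by (simp_all add: z_def power_int_add power_int_minus mult.commute)
  have "q powi (- d + 1) = q powi (- d) * q powi 1" by (rule power_int_add) (use q in simp)
  then have "q powi (- d + 1) = q * inverse z" unfolding p12 by (simp only: power_int_1_right mult.commute)
  note p = p12 this
  have o1: "ocoef d = (q * z - 1) / (z - 1)" using d q by (simp add: ocoef_def qint_def p z_def[symmetric])
  have o2: "ocoef (- d) = (q * inverse z - 1) / (inverse z - 1)"
    unfolding ocoef_def qint_def p using d q by simp
  have i: "inverse z - 1 = (1 - z) / z" using z by (simp add: field_simps)
  have e2: "ocoef (- d) = (z - q) / (z - 1)" unfolding o2 i using z by (simp add: divide_simps) (simp add: algebra_simps)
  have "cnj (ocoef d) = (inverse q * inverse z - 1) / (inverse z - 1)" unfolding o1 by (simp add: cn)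
  then have e1: "q * cnj (ocoef d) = (q * z - 1) / (z - 1)" unfolding i using z q by (simp add: divide_simps) (simp add: algebra_simps)
  have "q * z - 1 = 2 * \<i> * cis (pi * (c * of_int (d + 1))) * of_real (root_sin c (d + 1))"
    using cis_diff[of "pi * (c * of_int (d + 1))" 0] unfolding p(1)[symmetric] powi_cis by (simp add: root_sin_def)
  moreover have "z - q = 2 * \<i> * cis (pi * (c * of_int (d + 1))) * of_real (root_sin c (d - 1))"
  proof -
    have "pi * (c * of_int d) + pi * c = pi * (c * of_int (d + 1))" "pi * (c * of_int d) - pi * c = pi * (c * of_int (d - 1))"
      by (simp_all add: algebra_simps)
    then show ?thesis
      using cis_diff[of "pi * (c * of_int d)" "pi * c"] powi_cis[of d] powi_cis[of 1] by (simp only: root_sin_def z_def) simp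
  qed
  moreover have "of_real (root_sin c (d + 1)) * of_real h = (of_real (root_sin c (d - 1)) * of_real h' :: complex)"
    using h by (metis of_real_mult)
  ultimately have "(z - q) * of_real h' = (q * z - 1) * of_real h" by (simp add: mult.assoc)
  then show ?thesis unfolding e1 e2 by simp
qed

definition seminormal_form :: "int list set \<Rightarrow> (int list \<Rightarrow> real) \<Rightarrow> (int list \<Rightarrow> complex) \<Rightarrow> (int list \<Rightarrow> complex) \<Rightarrow> complex" where
  "seminormal_form C h u v = (\<Sum>c\<in>C. u c * cnj (v c) * of_real (h c))"

definition top_inv :: "nat \<Rightarrow> (int list \<Rightarrow> complex) \<Rightarrow> int list \<Rightarrow> complex" where
  "top_inv k u = (\<lambda>c. (top k u c - (q - 1) * u c) / q)"

lemma top_top_inv: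
  assumes "swap_closed n C" "Suc k < n" "u \<in> supported C"
  shows "top k (top_inv k u) = u" "top_inv k (top k u) = u"
proof -
  have "top k (top_inv k u) = (\<lambda>c. (top k (top k u) c - (q - 1) * top k u c) / q)"
    unfolding top_def[of k "top_inv k u"] top_def[of k "top k u"] unfolding top_inv_def
    using q0 by (auto simp: top_def[of k u] fun_eq_iff field_simps)
  then show "top k (top_inv k u) = u" using q0 by (simp add: top_quad[OF assms])
  show "top_inv k (top k u) = u" using q0 by (simp add: top_inv_def top_quad[OF assms])
qed

text \<open>Reindexing the off-diagonal sum by the swap reduces the claim to the two entrywise
  identities. Outside the sequences with axial distance at least 2 the off-diagonal entries vanish,
  so the sum can be restricted to where the swap stays inside \<open>C\<close>.\<close>

lemma seminormal_unitary:
  assumes C: "swap_closed n C" and k: "Suc k < n"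
    and h: "\<And>cs. cs \<in> C \<Longrightarrow> \<bar>axial cs k\<bar> \<ge> 2 \<Longrightarrow>
      root_sin c (axial cs k + 1) * h cs = root_sin c (axial cs k - 1) * h (swap_at k cs)"
  shows "seminormal_form C h (top k u) v = seminormal_form C h u (top_inv k v)"
proof -
  define C2 where "C2 = {cs \<in> C. \<bar>axial cs k\<bar> \<ge> 2}"
  have fin: "finite C" and len: "\<And>cs. cs \<in> C \<Longrightarrow> length cs = n"
    and sw: "\<And>cs. cs \<in> C \<Longrightarrow> axial cs k \<noteq> 0" "\<And>cs. cs \<in> C2 \<Longrightarrow> swap_at k cs \<in> C"
    using C k by (auto simp: swap_closed_def C2_def)
  have ax: "axial (swap_at k cs) k = - axial cs k" "swap_at k (swap_at k cs) = cs" if "cs \<in> C" for cs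
    using len[OF that] k by (simp_all add: axial_swap_at swap_at_swap_at)
  have sw2: "swap_at k cs \<in> C2" if "cs \<in> C2" for cs using that sw ax by (auto simp: C2_def)
  have "seminormal_form C h (top k u) v =
    (\<Sum>cs\<in>C. dcoef (axial cs k) * u cs * cnj (v cs) * of_real (h cs)) +
    (\<Sum>cs\<in>C. ocoef (axial cs k) * u (swap_at k cs) * cnj (v cs) * of_real (h cs))"
    by (simp add: seminormal_form_def top_def algebra_simps sum.distrib)
  also have "(\<Sum>cs\<in>C. ocoef (axial cs k) * u (swap_at k cs) * cnj (v cs) * of_real (h cs)) =
    (\<Sum>cs\<in>C2. ocoef (axial cs k) * u (swap_at k cs) * cnj (v cs) * of_real (h cs))"
    by (rule sum.mono_neutral_right) (auto simp: fin C2_def ocoef_def)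
  also have "\<dots> = (\<Sum>cs\<in>C2. ocoef (- axial cs k) * u cs * cnj (v (swap_at k cs)) * of_real (h (swap_at k cs)))"
    by (rule sum.reindex_bij_witness[of _ "swap_at k" "swap_at k"]) (use sw2 ax in \<open>auto simp: C2_def\<close>)
  also have "\<dots> = (\<Sum>cs\<in>C2. q * cnj (ocoef (axial cs k)) * u cs * cnj (v (swap_at k cs)) * of_real (h cs))"
  proof (rule sum.cong[OF refl])
    fix cs assume cs: "cs \<in> C2"
    have "ocoef (- axial cs k) * of_real (h (swap_at k cs)) = q * cnj (ocoef (axial cs k)) * of_real (h cs)"
      by (rule ocoef_unitary) (use cs h in \<open>auto simp: C2_def\<close>)
    then show "ocoef (- axial cs k) * u cs * cnj (v (swap_at k cs)) * of_real (h (swap_at k cs)) =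
        q * cnj (ocoef (axial cs k)) * u cs * cnj (v (swap_at k cs)) * of_real (h cs)"
      by (metis (no_types, opaque_lifting) mult.assoc mult.commute)
  qed
  also have "\<dots> = (\<Sum>cs\<in>C. q * cnj (ocoef (axial cs k)) * u cs * cnj (v (swap_at k cs)) * of_real (h cs))"
    by (rule sum.mono_neutral_left) (auto simp: fin C2_def ocoef_def)
  also have "(\<Sum>cs\<in>C. dcoef (axial cs k) * u cs * cnj (v cs) * of_real (h cs)) =
    (\<Sum>cs\<in>C. (q * cnj (dcoef (axial cs k)) - 1 + q) * u cs * cnj (v cs) * of_real (h cs))"
    by (intro sum.cong refl) (metis dcoef_unitary sw(1))
  finally have "seminormal_form C h (top k u) v =
    (\<Sum>cs\<in>C. u cs * (q * cnj (dcoef (axial cs k) * v cs + ocoef (axial cs k) * v (swap_at k cs)) - (1 - q) * cnj (v cs)) * of_real (h cs))"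
    by (simp add: algebra_simps flip: sum.distrib)
  also have "\<dots> = seminormal_form C h u (top_inv k v)"
  proof -
    have "cnj (1 / q) = q" "cnj (q - 1) * q = 1 - q"
      using cnj_powi[of 1] q0 by (simp_all add: left_diff_distrib divide_inverse)
    then have "cnj (top_inv k v cs) = q * cnj (top k v cs) - (1 - q) * cnj (v cs)" for cs
    proof -
      have "cnj (top_inv k v cs) = cnj (1 / q) * cnj (top k v cs) - cnj (q - 1) * cnj (1 / q) * cnj (v cs)"
        unfolding top_inv_def by (simp add: diff_divide_distrib divide_inverse algebra_simps)
      then show ?thesis unfolding \<open>cnj (1 / q) = q\<close> \<open>cnj (q - 1) * q = 1 - q\<close> by (simp only: mult_ac)
    qed
    then show ?thesis by (simp add: seminormal_form_def top_def)
  qed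
  finally show ?thesis .
qed

text \<open>The weights \<open>h\<close> may be any nonzero real solution of the ratio condition.
  This freedom allows signs that come from the Cherednik side.\<close>

theorem hecke_form_signature:
  assumes \<tau>: "is_partition n \<tau>"
  defines "C \<equiv> shape_contents n (part_shape \<tau>)"
  assumes h: "\<And>cs. cs \<in> C \<Longrightarrow> h cs \<noteq> 0"
    and ratio: "\<And>cs k. cs \<in> C \<Longrightarrow> Suc k < n \<Longrightarrow> \<bar>axial cs k\<bar> \<ge> 2 \<Longrightarrow>
      root_sin c (axial cs k + 1) * h cs = root_sin c (axial cs k - 1) * h (swap_at k cs)"
  shows "\<exists>\<gamma>. hecke_form n q \<tau> \<gamma> \<and> form_signature hscale (specht n q \<tau>) \<gamma> = (\<Sum>cs\<in>C. sg (h cs))"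
proof -
  let ?S = "specht n q \<tau>"
  obtain R b where R: "\<And>f g. R (f + g) = (\<lambda>c. R f c + R g c)"
    "\<And>a f. R (hscale a f) = (\<lambda>c. a * R f c)"
    "\<And>i f. \<lbrakk>f \<in> ?S; i \<in> {1..<n}\<rbrakk> \<Longrightarrow> R (hecke_gen n q i f) = top (i - 1) (R f)"
    "bij_betw R ?S (supported C)"
    and b: "\<And>c. c \<in> C \<Longrightarrow> b c \<in> ?S" "\<And>c. c \<in> C \<Longrightarrow> R (b c) = delta c"
    "\<And>v. v \<in> ?S \<Longrightarrow> v = (\<Sum>c\<in>C. hscale (R v c) (b c))"
    by (rule specht_basis[OF \<tau>, folded C_def]) (rule that)
  have C: "swap_closed n C" unfolding C_def by (rule swap_closed_shape)
  then have fin: "finite C" by (simp add: swap_closed_def)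
  note sub = specht_closed(2)[of n q \<tau>]
  have Rs: "v \<in> ?S \<Longrightarrow> R v \<in> supported C" for v using bij_betwE[OF R(4)] by blast
  have Rinj: "inj_on R ?S" using R(4) by (simp add: bij_betw_def)
  define \<gamma> where "\<gamma> f g = seminormal_form C h (R f) (R g)" for f g
  have herm: "hermitian_form hscale ?S \<gamma>"
    unfolding hermitian_form_def \<gamma>_def R seminormal_form_def
    by (auto simp: algebra_simps sum.distrib sum_distrib_left)
  interpret G: hermitian_space hscale ?S \<gamma>
    by unfold_locales (use sub herm in auto)
  have bb: "\<gamma> (b cs) (b cs') = (if cs = cs' then of_real (h cs) else 0)" if "cs \<in> C" "cs' \<in> C" for cs cs'
  proof -
    have "\<gamma> (b cs) (b cs') = (\<Sum>c\<in>C. if c = cs then (if cs = cs' then of_real (h cs) else 0) else 0)"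
      unfolding \<gamma>_def seminormal_form_def b(2)[OF that(1)] b(2)[OF that(2)] by (intro sum.cong) auto
    then show ?thesis using that fin by simp
  qed
  have orth: "G.orth C b" unfolding G.orth_def using fin b(1) bb by auto
  have nz: "cs \<in> C \<Longrightarrow> Re (\<gamma> (b cs) (b cs)) \<noteq> 0" for cs using bb h by simp
  have spn: "?S \<subseteq> hv.span (b ` C)"
  proof
    fix v assume "v \<in> ?S"
    then have "v = (\<Sum>c\<in>C. hscale (R v c) (b c))" by (rule b(3))
    also have "\<dots> \<in> hv.span (b ` C)" by (intro hv.span_sum hv.span_scale hv.span_base) blast
    finally show "v \<in> hv.span (b ` C)" .
  qed
  have nondeg: "nondegenerate ?S \<gamma>"
    unfolding nondegenerate_def using G.orth_nondegenerate[OF orth nz] spn b(1) by blast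
  have "\<gamma> (hecke_gen n q i v) v' = \<gamma> v (inv_into ?S (hecke_gen n q i) v')"
    if i: "i \<in> {1..<n}" and v: "v \<in> ?S" and v': "v' \<in> ?S" for i v v'
  proof -
    let ?H = "hecke_gen n q i"
    have k: "Suc (i - 1) < n" using i by auto
    have "R v' \<in> supported C" by (rule Rs[OF v'])
    then have "top_inv (i - 1) (R v') \<in> supported C"
      using top_supported[OF C k] by (auto simp: top_inv_def supported_def)
    then obtain w where w: "w \<in> ?S" "R w = top_inv (i - 1) (R v')"
      using bij_betw_imp_surj_on[OF R(4)] by (metis imageE)
    have "R (?H w) = R v'" unfolding R(3)[OF w(1) i] w(2) by (rule top_top_inv(1)[OF C k Rs[OF v']])
    then have Hw: "?H w = v'" using Rinj specht_closed(3)[OF i w(1)] v' by (simp add: inj_on_eq_iff)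
    have "inj_on ?H ?S"
    proof
      fix x y assume xy: "x \<in> ?S" "y \<in> ?S" "?H x = ?H y"
      then have "top_inv (i - 1) (top (i - 1) (R x)) = top_inv (i - 1) (top (i - 1) (R y))"
        using R(3)[OF _ i] by metis
      then have "R x = R y" using top_top_inv(2)[OF C k] Rs xy by simp
      then show "x = y" using Rinj xy by (simp add: inj_on_eq_iff)
    qed
    then have "inv_into ?S ?H v' = w" using Hw w(1) by (metis inv_into_f_f)
    moreover have "\<gamma> (?H v) v' = \<gamma> v w"
      unfolding \<gamma>_def R(3)[OF v i] w(2) by (rule seminormal_unitary[OF C k ratio[OF _ k]])
    ultimately show ?thesis by simp
  qed
  then have "hecke_form n q \<tau> \<gamma>" unfolding hecke_form_def using herm nondeg by blast
  moreover have "form_signature hscale ?S \<gamma> = (\<Sum>cs\<in>C. sg (Re (\<gamma> (b cs) (b cs))))"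
    unfolding sum_sg[OF fin] by (rule G.form_signature_orth[OF orth nz _ spn]) (use fin card_image_le in auto)
  moreover have "\<dots> = (\<Sum>cs\<in>C. sg (h cs))" by (intro sum.cong refl) (simp add: bb)
  ultimately show ?thesis by auto
qed

end

text \<open>A rational c with denominator m would give q^m = 1.\<close>

lemma irrational_exponent:
  assumes q: "q = exp (2 * of_real pi * \<i> * of_real c)" and root: "\<forall>k>0. q ^ k \<noteq> 1"
  shows "c \<notin> \<rat>" "q = cis (2 * pi * c)"
proof -
  show e: "q = cis (2 * pi * c)" unfolding q cis_conv_exp by (simp add: mult_ac)
  show "c \<notin> \<rat>"
  proof
    assume "c \<in> \<rat>"
    then obtain i :: int and m :: nat where m: "m \<noteq> 0" "c = of_int i / of_nat m"
      using Rats_eq_int_div_nat by blast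
    have "q ^ m = cis (2 * pi * of_int i)" unfolding e DeMoivre using m by simp
    also have "\<dots> = 1" by (simp add: cis_multiple_2pi)
    finally show False using root m(1) by simp
  qed
qed

theorem theorem1p4:
  fixes n :: nat and \<tau> :: "nat list" and c :: real and q :: complex
  assumes "n \<ge> 2"
    and "is_partition n \<tau>"
    and "\<not> (\<exists>r m :: int. coprime r m \<and> 2 \<le> m \<and> m \<le> int n \<and> c = of_int r / of_int m)"
    and "q = exp (2 * of_real pi * \<i> * of_real c)"
    and "\<forall>k>0. q ^ k \<noteq> 1"
  shows "\<exists>\<gamma>. hecke_form n q \<tau> \<gamma> \<and>
    asymptotic_character n c \<tau> = form_signature hscale (specht n q \<tau>) \<gamma>"
proof -
  note irr = irrational_exponent[OF assms(4,5)]
  interpret Q: unit_quantum c q by unfold_locales (rule irr)+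
  interpret M: standard_module n \<tau> c by unfold_locales (use assms(1,2) irr in auto)
  define C where "C = contents ` shape_words n (part_shape \<tau>)"
  define S where "S = (\<Union>cs\<in>C. set cs)"
  have C: "swap_closed n C" unfolding C_def by (rule swap_closed_shape)
  then have fC: "finite C" by (simp add: swap_closed_def)
  have fS: "finite S" using fC by (simp add: S_def)
  have CS: "length cs = n \<and> set cs \<subseteq> S" if "cs \<in> C" for cs
    using that swap_closed_length[OF C] by (auto simp: S_def)
  obtain K0 where K0: "\<And>K. K \<ge> K0 \<Longrightarrow> stable_from c S K" using stable_from_exists[OF fS] by blast
  \<comment> \<open>The arguments c(d + 1) and c(d - 1), with d a difference of contents, at which
    the reflection formula is used. K has to exceed these as well as the level from which the signs
    of the moves are stable.\<close>
  define W where "W = (\<lambda>(y, l, e). \<bar>c * of_int (y - l + e)\<bar>) ` (S \<times> S \<times> {1, - 1})"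
  have fW: "finite W" using fS by (simp add: W_def)
  define K where "K = max K0 (nat \<lceil>\<Sum>W\<rceil>)"
  have W: "w \<le> real K" if "w \<in> W" for w
  proof -
    have "w \<le> \<Sum>W" by (rule member_le_sum[of w W "\<lambda>x. x", OF that _ fW]) (auto simp: W_def)
    also have "\<dots> \<le> real K" unfolding K_def by linarith
    finally show ?thesis .
  qed
  have K: "stable_from c S K" by (rule K0) (simp add: K_def)
  \<comment> \<open>Using the Cherednik signs as diagonal of the Hecke form fixes its normalization,
    so the two signatures agree without a further sign.\<close>
  define h where "h = content_norm c K []"
  have sgh: "sg (h cs) = limit_sign c K [] cs" for cs unfolding h_def by (rule sg_content_norm[OF irr(1)])
  have pw: "pair_weight c K d \<noteq> 0" for d
    using sg_pair_weight[OF irr(1), of K d] pass_sign_nonzero[OF irr(1)] by (auto simp: sg_def)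
  have ratio: "root_sin c (axial cs k + 1) * h cs = root_sin c (axial cs k - 1) * h (swap_at k cs)"
    if cs: "cs \<in> C" and k: "Suc k < n" and d: "\<bar>axial cs k\<bar> \<ge> 2" for cs k
  proof -
    let ?d = "axial cs k"
    have "cs ! k \<in> S" "cs ! Suc k \<in> S" using CS[OF cs] k by (auto simp: subset_iff)
    then have "\<bar>c * of_int (?d + 1)\<bar> \<in> W" "\<bar>c * of_int (?d - 1)\<bar> \<in> W" by (force simp: W_def axial_def)+
    then have "pair_weight c K ?d * root_sin c (?d + 1) = pair_weight c K (- ?d) * root_sin c (?d - 1)"
      by (intro pair_weight_ratio[OF irr(1) d] W)
    moreover have "pair_weight c K (- ?d) * h cs = pair_weight c K ?d * h (swap_at k cs)"
      unfolding h_def using CS[OF cs] k by (intro content_norm_swap) simp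
    ultimately have "pair_weight c K ?d * (root_sin c (?d + 1) * h cs) = pair_weight c K ?d * (root_sin c (?d - 1) * h (swap_at k cs))"
      by (metis mult.assoc mult.commute)
    then show ?thesis using pw by simp
  qed
  have h0: "h cs \<noteq> 0" for cs
  proof
    assume "h cs = 0"
    have "content_norm c K pre xs \<noteq> 0" for pre xs
    proof (induction xs arbitrary: pre)
      case (Cons x xs)
      have "(\<Prod>l\<leftarrow>pre. pair_weight c K (x - l)) \<noteq> 0" using pw by (auto simp: prod_list_zero_iff)
      moreover have "cut_sign c K x \<noteq> 0" using cut_sign_square[OF irr(1), of K x] by auto
      ultimately show ?case using Cons by simp
    qed simp
    then show False using \<open>h cs = 0\<close> by (simp add: h_def)
  qed
  obtain \<gamma> where \<gamma>: "hecke_form n q \<tau> \<gamma>"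
    "form_signature hscale (specht n q \<tau>) \<gamma> = (\<Sum>cs\<in>C. limit_sign c K [] cs)"
    using Q.hecke_form_signature[OF assms(2), folded C_def, of h, OF h0 ratio] by (auto simp: sgh)
  obtain p where p: "fps_of_poly p = Abs_fps (\<lambda>d. \<Sum>a\<in>compositions n d. \<Sum>cs\<in>C. path_sign c [] cs a) * (1 - fps_X) ^ n"
    "poly p 1 = (\<Sum>cs\<in>C. limit_sign c K [] cs)"
    using signature_series[OF irr(1) K fC CS] by blast
  have "signature_character n c \<tau> = Abs_fps (\<lambda>d. \<Sum>a\<in>compositions n d. \<Sum>cs\<in>C. path_sign c [] cs a)"
    unfolding signature_character_def M.standard_signature C_def ..
  then have "fps_of_poly p = signature_character n c \<tau> * (1 - fps_X) ^ n" using p(1) by simp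
  then have "(THE p. fps_of_poly p = signature_character n c \<tau> * (1 - fps_X) ^ n) = p"
    by (intro the_equality) (simp_all only: fps_of_poly_eq_iff[symmetric])
  then have "asymptotic_character n c \<tau> = poly p 1" by (simp add: asymptotic_character_def)
  then show ?thesis using \<gamma> p(2) by auto
qed

end
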